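(* Let $M$ be a homogeneous nilpotent $\Delta_n$-representation, $X=\mathrm{Gr}_{\mathbf e}(M)$, and $\mathcal G=\mathcal G(X,T,\chi)$. Then the $\mathfrak S_{\underline k}$-representation $H_T^\bullet(X)$ is isomorphic, as a graded twisted $R$-module, to $$\bigoplus_{L\in X^T}\mathrm{Triv}^{\#\mathcal G_1^{\partial L}}.$$
   Context: $\Delta_n$ ($n\ge 1$) is the quiver with vertex set $\mathbb Z_n=\mathbb Z/n\mathbb Z$ and one arrow $i\to i+1$ for each $i$. A finite-dimensional $\Delta_n$-representation $M$ consists of finite-dimensional $\mathbb C$-vector spaces $M^{(i)}$ and linear maps $M_i:M^{(i)}\to M^{(i+1)}$; put $m_i=\dim M^{(i)}$. It is nilpotent if for some $N$ every composition of $N$ consecutive maps is zero. Every nilpotent $M$ is a direct sum of indecomposables $U_1,\dots,U_d$, where $U_j$ has a basis $b_{j,0},\dots,b_{j,\ell_j-1}$ of vectors at consecutive vertices, with the maps sending $b_{j,p}\mapsto b_{j,p+1}$ and $b_{j,\ell_j-1}\mapsto 0$. Let $B$ be the basis of $M$ formed by all $b_{j,p}$, and $B^{(i)}=B\cap M^{(i)}=\{v^{(i)}_1,\dots,v^{(i)}_{m_i}\}$ (an indexing of $B^{(i)}$). $\mathrm{Gr}_{\mathbf e}(M)$ is the projective variety of subrepresentations of $M$ of dimension vector $\mathbf e$ (assumed non-empty). The torus $T=(\mathbb C^* )^{d+1}\ni\gamma=(\gamma_0,\dots,\gamma_d)$ acts on $M$ by $\gamma.b_{j,p}=\gamma_0^p\gamma_j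 b_{j,p}$, inducing an action on $X=\mathrm{Gr}_{\mathbf e}(M)$ with finitely many fixed points (the subrepresentations spanned by subsets of $B$) and finitely many one-dimensional orbits; $X$ has vanishing odd rational cohomology. $M$ is homogeneous if $B$ and the indexings can be chosen such that: (H0) there is an attractive grading $\mathrm{wt}:B\to\mathbb Z$, i.e. $\mathrm{wt}(v^{(i)}_k)>\mathrm{wt}(v^{(i)}_\ell)$ whenever $k>\ell$, and for each $i$ there is $d(i)\in\mathbb Z$ with $\mathrm{wt}(v^{(i+1)}_\ell)=\mathrm{wt}(v^{(i)}_k)+d(i)$ whenever $M_iv^{(i)}_k=v^{(i+1)}_\ell$; (H1) alignment: if $M_iv^{(i)}_\ell=0$ and $M_iv^{(i)}_k\ne0$ then $\ell>k$, and if $M_iv^{(i)}_\ell=v^{(i+1)}_{\ell'}$, $M_iv^{(i)}_k=v^{(i+1)}_{k'}$ with $\ell>k$ then $\ell'>k'$; (H2) if $M_iv^{(i)}_k=v^{(i+1)}_{k'}$ and $m_{i+1}-k'>0$, then $M_iv^{(i)}_{k+r}=v^{(i+1)}_{k'+r}$ for all $1\le r\le m_{i+1}-k'$. Such choices are fixed. $\chi:\mathbb C^*\to T$ is a generic cocharacter (i.e. $X^{\chi(\mathbb C^* )}=X^T$) such that the $\mathbb C^*$-action on $X$ through $\chi$ is the one induced by $z\cdot b=z^{\mathrm{wt}(b)}b$, $b\in B$. The moment graph $\mathcal G=\mathcal G(X,T,\chi)$ has vertices $X^T$; its edges are the closures of one-dimensional $T$-orbits $E$ (each contains exactly two fixed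 points $x,y$), oriented $x\to y$ if $\lim_{\lambda\to0}\chi(\lambda).p=x$ for $p\in E$, and labelled by the character $\alpha_E$ (up to sign) of $T$ describing the action on $E$. $\mathcal G_1^{\partial L}$ is the set of edges starting at $L$. $R=H_T^\bullet(\mathrm{pt})=\mathbb Q[\delta,\epsilon_1,\dots,\epsilon_d]$ with $\delta(\gamma)=\gamma_0$, $\epsilon_j(\gamma)=\gamma_j$, all of degree $2$. $H_T^\bullet(X)$ (rational coefficients) is identified, by restriction to $X^T$, with $\{(f_x)\in\bigoplus_{x\in X^T}R: f_x-f_y\in\alpha_ER \text{ for every edge } E \text{ with endpoints } x,y\}$. Number the $U_j$ so that isomorphic summands are consecutive: $k_1,\dots,k_{d_0}$ are the multiplicities of the distinct isomorphism classes, $k_j'=k_1+\dots+k_j$, $k'_0=0$. $\mathfrak S_{\underline k}\subseteq\mathfrak S_d$ is the subgroup stabilising each block $\{k_{j-1}'+1,\dots,k_j'\}$; products are read left to right, $(\sigma\tau)(i)=\tau(\sigma(i))$. $\sigma\in\mathfrak S_{\underline k}$ acts on $M$ by $b_{i,p}\mapsto b_{\sigma^{-1}(i),p}$, hence on $X$; on $R$ by the algebra automorphism with $\sigma(\delta)=\delta$, $\sigma(\epsilon_i)=\epsilon_{\sigma^{-1}(i)}$; and on $H_T^\bullet(X)$ by $\sigma\cdot(f_L)_{L}=(\sigma(f_{\sigma^{-1}(L)}))_{L}$. A graded twisted $R$-module is a graded $R$-module $V$ with a degree-preserving additive $\mathfrak S_{\underline k}$-action satisfying $\sigma(av)=\sigma(a)\sigma(v)$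 for $a\in R$, $v\in V$; isomorphisms are graded $R$-linear $\mathfrak S_{\underline k}$-equivariant isomorphisms. $\mathrm{Triv}^{m}$ is the free graded $R$-module of rank one generated by an $\mathfrak S_{\underline k}$-invariant element of degree $2m$ (so $\sigma$ acts on it as on $R$, up to the degree shift). *)

theory Defs
  imports
    "HOL-Analysis.Analysis"
    "HOL-Algebra.Module"
    "HOL-Combinatorics.Permutations"
    "HOL-Library.Function_Algebras"
    "HOL-Library.Poly_Mapping"
begin

section \<open>The coefficient ring and its permutation action\<close>

text \<open>
  Polynomials in the variables \<open>x\<^sub>0, x\<^sub>1, \<dots>\<close> over the rationals, as finitely supported
  functions on finitely supported exponent vectors.  The variable \<open>x\<^sub>0\<close> plays the role of
  \<open>\<delta>\<close>, and \<open>x\<^sub>j\<close> for \<open>1 \<le> j \<le> d\<close> the role of \<open>\<epsilon>\<^sub>j\<close>.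
\<close>

type_synonym poly_R = "(nat \<Rightarrow>\<^sub>0 nat) \<Rightarrow>\<^sub>0 rat"

definition var :: "nat \<Rightarrow> poly_R" where
  "var i = Poly_Mapping.single (Poly_Mapping.single i 1) 1"

definition R_ring :: "nat \<Rightarrow> poly_R ring" where
  "R_ring d = \<lparr>carrier = {f. \<forall>m\<in>Poly_Mapping.keys f. Poly_Mapping.keys m \<subseteq> {0..d}},
     monoid.mult = (*), one = 1, zero = 0, add = (+)\<rparr>"

text \<open>Every variable has degree \<open>2\<close>; zero belongs to every component, and the components of
  negative or odd degree are zero.\<close>

definition R_grade :: "nat \<Rightarrow> int \<Rightarrow> poly_R set" where
  "R_grade d q = {f \<in> carrier (R_ring d).
     \<forall>m\<in>Poly_Mapping.keys f. int (2 * (\<Sum>i\<in>Poly_Mapping.keys m. Poly_Mapping.lookup m i)) = q}"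

text \<open>The algebra endomorphism with \<open>x\<^sub>i \<mapsto> x\<^bsub>\<sigma>\<^sup>-\<^sup>1(i)\<^esub>\<close>, by substitution.  Permutations are
  taken of \<open>{1..d}\<close>, hence fix the index \<open>0\<close>.\<close>

definition twist :: "(nat \<Rightarrow> nat) \<Rightarrow> poly_R \<Rightarrow> poly_R" where
  "twist \<sigma> f = (\<Sum>m\<in>Poly_Mapping.keys f. Poly_Mapping.single 0 (Poly_Mapping.lookup f m) *
     (\<Prod>i\<in>Poly_Mapping.keys m. var (inv_into UNIV \<sigma> i) ^ Poly_Mapping.lookup m i))"

definition block :: "nat list \<Rightarrow> nat \<Rightarrow> nat set" where
  "block ks r = {sum_list (take r ks) + 1 .. sum_list (take (Suc r) ks)}"

definition young_subgroup :: "nat list \<Rightarrow> (nat \<Rightarrow> nat) set" where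
  "young_subgroup ks = {\<sigma>. \<sigma> permutes {1..sum_list ks} \<and> (\<forall>r<length ks. \<sigma> ` block ks r = block ks r)}"


section \<open>Graded twisted modules\<close>

record 'v twisted_module = "(poly_R, 'v) module" +
  perm_action :: "(nat \<Rightarrow> nat) \<Rightarrow> 'v \<Rightarrow> 'v"
  grade :: "int \<Rightarrow> 'v set"

text \<open>Products of permutations are read from left to right, so \<open>\<sigma>\<tau>\<close> is the function
  \<open>\<tau> \<circ> \<sigma>\<close>.\<close>

definition graded_twisted_module :: "nat list \<Rightarrow> ('v, 'm) twisted_module_scheme \<Rightarrow> bool" where
  "graded_twisted_module ks W \<longleftrightarrow>
     (let d = sum_list ks; S = young_subgroup ks in
      Module.module (R_ring d) W \<and>
      (\<forall>\<sigma>\<in>S. \<forall>x\<in>carrier W. perm_action W \<sigma> x \<in> carrier W) \<and>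
      (\<forall>x\<in>carrier W. perm_action W id x = x) \<and>
      (\<forall>\<sigma>\<in>S. \<forall>\<tau>\<in>S. \<forall>x\<in>carrier W.
         perm_action W (\<tau> \<circ> \<sigma>) x = perm_action W \<sigma> (perm_action W \<tau> x)) \<and>
      (\<forall>\<sigma>\<in>S. \<forall>x\<in>carrier W. \<forall>y\<in>carrier W.
         perm_action W \<sigma> (x \<oplus>\<^bsub>W\<^esub> y) = perm_action W \<sigma> x \<oplus>\<^bsub>W\<^esub> perm_action W \<sigma> y) \<and>
      (\<forall>\<sigma>\<in>S. \<forall>a\<in>carrier (R_ring d). \<forall>x\<in>carrier W.
         perm_action W \<sigma> (a \<odot>\<^bsub>W\<^esub> x) = twist \<sigma> a \<odot>\<^bsub>W\<^esub> perm_action W \<sigma> x) \<and>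
      (\<forall>q. subgroup (grade W q) (add_monoid W)) \<and>
      (\<forall>x\<in>carrier W. \<exists>!c. (\<forall>q. c q \<in> grade W q) \<and> finite {q. c q \<noteq> \<zero>\<^bsub>W\<^esub>} \<and>
         x = finsum W c {q. c q \<noteq> \<zero>\<^bsub>W\<^esub>}) \<and>
      (\<forall>r q. \<forall>a\<in>R_grade d r. \<forall>x\<in>grade W q. a \<odot>\<^bsub>W\<^esub> x \<in> grade W (r + q)) \<and>
      (\<forall>\<sigma>\<in>S. \<forall>q. \<forall>x\<in>grade W q. perm_action W \<sigma> x \<in> grade W q))"

definition graded_twisted_iso ::
    "nat list \<Rightarrow> ('v, 'm) twisted_module_scheme \<Rightarrow> ('w, 'k) twisted_module_scheme \<Rightarrow> bool" where
  "graded_twisted_iso ks W W' \<longleftrightarrow>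
     graded_twisted_module ks W \<and> graded_twisted_module ks W' \<and>
     (\<exists>\<phi>. \<phi> \<in> iso (add_monoid W) (add_monoid W') \<and>
        (\<forall>a\<in>carrier (R_ring (sum_list ks)). \<forall>x\<in>carrier W. \<phi> (a \<odot>\<^bsub>W\<^esub> x) = a \<odot>\<^bsub>W'\<^esub> \<phi> x) \<and>
        (\<forall>\<sigma>\<in>young_subgroup ks. \<forall>x\<in>carrier W. \<phi> (perm_action W \<sigma> x) = perm_action W' \<sigma> (\<phi> x)) \<and>
        (\<forall>q. \<phi> ` grade W q = grade W' q))"

text \<open>The fields \<open>mult\<close> and \<open>one\<close> are inherited from the ring record underlying the library's
  modules and have no meaning for a module.\<close>

definition Triv :: "nat \<Rightarrow> nat \<Rightarrow> poly_R twisted_module" where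
  "Triv d m = \<lparr>carrier = carrier (R_ring d), monoid.mult = undefined, one = undefined,
     zero = 0, add = (+), smult = (*), perm_action = twist,
     grade = (\<lambda>q. R_grade d (q - 2 * int m))\<rparr>"

definition direct_sum :: "'i set \<Rightarrow> ('i \<Rightarrow> 'v twisted_module) \<Rightarrow> ('i \<Rightarrow> 'v) twisted_module" where
  "direct_sum I W = \<lparr>
     carrier = {f \<in> (\<Pi>\<^sub>E i\<in>I. carrier (W i)). finite {i\<in>I. f i \<noteq> \<zero>\<^bsub>W i\<^esub>}},
     monoid.mult = undefined, one = undefined,
     zero = (\<lambda>i\<in>I. \<zero>\<^bsub>W i\<^esub>),
     add = (\<lambda>f g. \<lambda>i\<in>I. f i \<oplus>\<^bsub>W i\<^esub> g i),
     smult = (\<lambda>a f. \<lambda>i\<in>I. a \<odot>\<^bsub>W i\<^esub> f i),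
     perm_action = (\<lambda>\<sigma> f. \<lambda>i\<in>I. perm_action (W i) \<sigma> (f i)),
     grade = (\<lambda>q. {f \<in> (\<Pi>\<^sub>E i\<in>I. grade (W i) q). finite {i\<in>I. f i \<noteq> \<zero>\<^bsub>W i\<^esub>}})\<rparr>"


section \<open>Representations of the cyclic quiver\<close>

text \<open>
  The vertices of the cyclic quiver are \<open>0, \<dots>, n - 1\<close>, with arrows \<open>i \<rightarrow> (i + 1) mod n\<close>.  The
  space \<open>V i\<close> at a vertex is a finite-dimensional subspace of an ambient complex vector space;
  the spaces at different vertices are unrelated and may overlap.  Families indexed by vertices
  are extensional on \<open>{..<n}\<close>.
\<close>

locale cyclic_quiver_rep = vector_space scale
  for scale :: "complex \<Rightarrow> 'v::ab_group_add \<Rightarrow> 'v" +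
  fixes n :: nat
    and V :: "nat \<Rightarrow> 'v set"
    and f :: "nat \<Rightarrow> 'v \<Rightarrow> 'v"
  assumes n_pos: "n \<ge> 1"
    and V_subspace: "i < n \<Longrightarrow> subspace (V i)"
    and V_finite_dim: "i < n \<Longrightarrow> \<exists>S. finite S \<and> V i \<subseteq> span S"
    and f_into: "i < n \<Longrightarrow> x \<in> V i \<Longrightarrow> f i x \<in> V ((i + 1) mod n)"
    and f_add: "i < n \<Longrightarrow> x \<in> V i \<Longrightarrow> y \<in> V i \<Longrightarrow> f i (x + y) = f i x + f i y"
    and f_scale: "i < n \<Longrightarrow> x \<in> V i \<Longrightarrow> f i (scale c x) = scale c (f i x)"
begin

primrec path_map :: "nat \<Rightarrow> nat \<Rightarrow> 'v \<Rightarrow> 'v" where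
  "path_map i 0 = id"
| "path_map i (Suc N) = f ((i + N) mod n) \<circ> path_map i N"

definition nilpotent_rep :: bool where
  "nilpotent_rep \<longleftrightarrow> (\<exists>N. \<forall>i<n. \<forall>x\<in>V i. path_map i N x = 0)"

definition subrep :: "(nat \<Rightarrow> 'v set) \<Rightarrow> bool" where
  "subrep N \<longleftrightarrow> N \<in> extensional {..<n} \<and>
     (\<forall>i<n. subspace (N i) \<and> N i \<subseteq> V i \<and> f i ` N i \<subseteq> N ((i + 1) mod n))"

definition isomorphic_subreps :: "(nat \<Rightarrow> 'v set) \<Rightarrow> (nat \<Rightarrow> 'v set) \<Rightarrow> bool" where
  "isomorphic_subreps N N' \<longleftrightarrow> (\<exists>\<phi> :: nat \<Rightarrow> 'v \<Rightarrow> 'v. \<forall>i<n.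
     bij_betw (\<phi> i) (N i) (N' i) \<and>
     (\<forall>x\<in>N i. \<forall>y\<in>N i. \<phi> i (x + y) = \<phi> i x + \<phi> i y) \<and>
     (\<forall>c. \<forall>x\<in>N i. \<phi> i (scale c x) = scale c (\<phi> i x)) \<and>
     (\<forall>x\<in>N i. \<phi> ((i + 1) mod n) (f i x) = f i (\<phi> i x)))"

definition Gr :: "(nat \<Rightarrow> nat) \<Rightarrow> (nat \<Rightarrow> 'v set) set" where
  "Gr e = {N. subrep N \<and> (\<forall>i<n. dim (N i) = e i)}"

end


section \<open>Nilpotent representations with a basis of indecomposable summands\<close>

text \<open>
  The basis vector \<open>b\<^bsub>j,p\<^esub>\<close> is \<open>bas (j, p)\<close>, with \<open>1 \<le> j \<le> d\<close> and \<open>p < len j\<close>, and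
  \<open>src j\<close> is the vertex of \<open>b\<^bsub>j,0\<^esub>\<close>.  The basis \<open>B\<close> is handled through the index pairs
  \<open>(j, p)\<close>.
\<close>

definition basis_at :: "nat \<Rightarrow> nat \<Rightarrow> (nat \<Rightarrow> nat) \<Rightarrow> (nat \<Rightarrow> nat) \<Rightarrow> nat \<Rightarrow> (nat \<times> nat) set" where
  "basis_at n d src len i = {(j, p). j \<in> {1..d} \<and> p < len j \<and> (src j + p) mod n = i}"

locale nilpotent_quiver_rep = cyclic_quiver_rep scale n V f
  for scale :: "complex \<Rightarrow> 'v::ab_group_add \<Rightarrow> 'v" and n V f +
  fixes d :: nat
    and src :: "nat \<Rightarrow> nat"
    and len :: "nat \<Rightarrow> nat"
    and bas :: "nat \<times> nat \<Rightarrow> 'v"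
  assumes nilpotent: nilpotent_rep
    and src_less: "j \<in> {1..d} \<Longrightarrow> src j < n"
    and len_pos: "j \<in> {1..d} \<Longrightarrow> len j \<ge> 1"
    and bas_inj: "i < n \<Longrightarrow> inj_on bas (basis_at n d src len i)"
    and bas_independent: "i < n \<Longrightarrow> independent (bas ` basis_at n d src len i)"
    and bas_span: "i < n \<Longrightarrow> span (bas ` basis_at n d src len i) = V i"
    and f_bas: "j \<in> {1..d} \<Longrightarrow> p < len j \<Longrightarrow>
      f ((src j + p) mod n) (bas (j, p)) = (if p + 1 < len j then bas (j, p + 1) else 0)"
begin

abbreviation B_at :: "nat \<Rightarrow> (nat \<times> nat) set" where
  "B_at \<equiv> basis_at n d src len"

definition coord :: "nat \<Rightarrow> (nat \<times> nat) \<Rightarrow> 'v \<Rightarrow> complex" where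
  "coord i \<beta> x = representation (bas ` B_at i) x (bas \<beta>)"

definition summand :: "nat \<Rightarrow> nat \<Rightarrow> 'v set" where
  "summand j = (\<lambda>i\<in>{..<n}. span {bas (j, p) | p. p < len j \<and> (src j + p) mod n = i})"

text \<open>The summands are numbered so that isomorphic ones are consecutive, \<open>ks\<close> being the list
  of multiplicities of the isomorphism classes.\<close>

definition numbered_by :: "nat list \<Rightarrow> bool" where
  "numbered_by ks \<longleftrightarrow> sum_list ks = d \<and> (\<forall>r<length ks. ks ! r > 0) \<and>
     (\<forall>j\<in>{1..d}. \<forall>j'\<in>{1..d}. isomorphic_subreps (summand j) (summand j') \<longleftrightarrow>
        (\<exists>r<length ks. j \<in> block ks r \<and> j' \<in> block ks r))"


subsection \<open>Homogeneity\<close>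

text \<open>An indexing \<open>v\<close> is given on index pairs, \<open>v i k\<close> being the index pair of
  \<open>v\<^sup>(\<^sup>i\<^sup>)\<^sub>k\<close>.\<close>

definition indexing :: "(nat \<Rightarrow> nat \<Rightarrow> nat \<times> nat) \<Rightarrow> bool" where
  "indexing v \<longleftrightarrow> (\<forall>i<n. bij_betw (v i) {1..dim (V i)} (B_at i))"

definition attractive_grading ::
    "(nat \<Rightarrow> nat \<Rightarrow> nat \<times> nat) \<Rightarrow> (nat \<times> nat \<Rightarrow> int) \<Rightarrow> bool" where
  "attractive_grading v wt \<longleftrightarrow>
     (\<forall>i<n. \<forall>k\<in>{1..dim (V i)}. \<forall>l\<in>{1..dim (V i)}. k > l \<longrightarrow> wt (v i k) > wt (v i l)) \<and>
     (\<forall>i<n. \<exists>c. \<forall>k\<in>{1..dim (V i)}. \<forall>l\<in>{1..dim (V ((i + 1) mod n))}.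
        f i (bas (v i k)) = bas (v ((i + 1) mod n) l) \<longrightarrow>
        wt (v ((i + 1) mod n) l) = wt (v i k) + c)"

definition aligned :: "(nat \<Rightarrow> nat \<Rightarrow> nat \<times> nat) \<Rightarrow> bool" where
  "aligned v \<longleftrightarrow> (\<forall>i<n. \<forall>k\<in>{1..dim (V i)}. \<forall>l\<in>{1..dim (V i)}.
     (f i (bas (v i l)) = 0 \<and> f i (bas (v i k)) \<noteq> 0 \<longrightarrow> l > k) \<and>
     (\<forall>k'\<in>{1..dim (V ((i + 1) mod n))}. \<forall>l'\<in>{1..dim (V ((i + 1) mod n))}.
        f i (bas (v i l)) = bas (v ((i + 1) mod n) l') \<and>
        f i (bas (v i k)) = bas (v ((i + 1) mod n) k') \<and> l > k \<longrightarrow> l' > k'))"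

text \<open>The equation \<open>M\<^sub>i v\<^sup>(\<^sup>i\<^sup>)\<^bsub>k+r\<^esub> = v\<^sup>(\<^sup>i\<^sup>+\<^sup>1\<^sup>)\<^bsub>k'+r\<^esub>\<close> includes the existence of the left-hand vector,
  that is, \<open>k + r \<le> m\<^sub>i\<close>.\<close>

definition gap_free :: "(nat \<Rightarrow> nat \<Rightarrow> nat \<times> nat) \<Rightarrow> bool" where
  "gap_free v \<longleftrightarrow> (\<forall>i<n. \<forall>k\<in>{1..dim (V i)}. \<forall>k'\<in>{1..dim (V ((i + 1) mod n))}.
     f i (bas (v i k)) = bas (v ((i + 1) mod n) k') \<and> dim (V ((i + 1) mod n)) - k' > 0 \<longrightarrow>
     (\<forall>r\<in>{1..dim (V ((i + 1) mod n)) - k'}.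
        k + r \<le> dim (V i) \<and> f i (bas (v i (k + r))) = bas (v ((i + 1) mod n) (k' + r))))"

definition homogeneous :: "(nat \<Rightarrow> nat \<Rightarrow> nat \<times> nat) \<Rightarrow> (nat \<times> nat \<Rightarrow> int) \<Rightarrow> bool" where
  "homogeneous v wt \<longleftrightarrow> indexing v \<and> attractive_grading v wt \<and> aligned v \<and> gap_free v"


subsection \<open>The torus action\<close>

definition diag :: "(nat \<times> nat \<Rightarrow> complex) \<Rightarrow> nat \<Rightarrow> 'v \<Rightarrow> 'v" where
  "diag w i x = (\<Sum>\<beta>\<in>B_at i. scale (w \<beta> * coord i \<beta> x) (bas \<beta>))"

definition diag_act :: "(nat \<times> nat \<Rightarrow> complex) \<Rightarrow> (nat \<Rightarrow> 'v set) \<Rightarrow> nat \<Rightarrow> 'v set" where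
  "diag_act w N = (\<lambda>i\<in>{..<n}. diag w i ` N i)"

definition torus :: "(nat \<Rightarrow> complex) set" where
  "torus = (\<Pi>\<^sub>E i\<in>{0..d}. UNIV - {0})"

definition torus_act :: "(nat \<Rightarrow> complex) \<Rightarrow> (nat \<Rightarrow> 'v set) \<Rightarrow> nat \<Rightarrow> 'v set" where
  "torus_act \<gamma> = diag_act (\<lambda>(j, p). \<gamma> 0 ^ p * \<gamma> j)"

definition fixed_points :: "(nat \<Rightarrow> nat) \<Rightarrow> (nat \<Rightarrow> 'v set) set" where
  "fixed_points e = {N \<in> Gr e. \<forall>\<gamma>\<in>torus. torus_act \<gamma> N = N}"

text \<open>Cocharacters and characters of the torus are given by their integral exponents.\<close>

definition cochar :: "(nat \<Rightarrow> int) \<Rightarrow> complex \<Rightarrow> nat \<Rightarrow> complex" where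
  "cochar \<kappa> z = (\<lambda>i\<in>{0..d}. z powi \<kappa> i)"

definition torus_char :: "(nat \<Rightarrow> int) \<Rightarrow> (nat \<Rightarrow> complex) \<Rightarrow> complex" where
  "torus_char \<alpha> \<gamma> = (\<Prod>i\<in>{0..d}. \<gamma> i powi \<alpha> i)"

definition char_class :: "(nat \<Rightarrow> int) \<Rightarrow> poly_R" where
  "char_class \<alpha> = (\<Sum>i\<in>{0..d}. of_int (\<alpha> i) * var i)"

definition generic_cochar :: "(nat \<Rightarrow> nat) \<Rightarrow> (nat \<Rightarrow> int) \<Rightarrow> bool" where
  "generic_cochar e \<kappa> \<longleftrightarrow>
     {N \<in> Gr e. \<forall>z. z \<noteq> 0 \<longrightarrow> torus_act (cochar \<kappa> z) N = N} = fixed_points e"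

definition induces_grading ::
    "(nat \<Rightarrow> nat) \<Rightarrow> (nat \<Rightarrow> int) \<Rightarrow> (nat \<times> nat \<Rightarrow> int) \<Rightarrow> bool" where
  "induces_grading e \<kappa> wt \<longleftrightarrow>
     (\<forall>N\<in>Gr e. \<forall>z. z \<noteq> 0 \<longrightarrow> torus_act (cochar \<kappa> z) N = diag_act (\<lambda>\<beta>. z powi wt \<beta>) N)"


subsection \<open>The topology of the quiver Grassmannian\<close>

text \<open>
  The Grassmannian carries its usual analytic topology: a subspace is identified with the
  matrix of the orthogonal projection onto it, for the Hermitian inner product which makes the
  basis orthonormal.  For orbits and limits along algebraic torus actions this gives the same
  closures and limits as the Zariski topology.
\<close>

definition herm :: "nat \<Rightarrow> 'v \<Rightarrow> 'v \<Rightarrow> complex" where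
  "herm i x y = (\<Sum>\<beta>\<in>B_at i. coord i \<beta> x * cnj (coord i \<beta> y))"

definition orth_proj :: "nat \<Rightarrow> 'v set \<Rightarrow> 'v \<Rightarrow> 'v" where
  "orth_proj i U x = (THE u. u \<in> U \<and> (\<forall>y\<in>U. herm i (x - u) y = 0))"

definition proj_matrix ::
    "(nat \<Rightarrow> 'v set) \<Rightarrow> nat \<Rightarrow> nat \<times> nat \<Rightarrow> nat \<times> nat \<Rightarrow> complex" where
  "proj_matrix N i \<beta> \<beta>' = (if i < n \<and> \<beta> \<in> B_at i \<and> \<beta>' \<in> B_at i
     then coord i \<beta> (orth_proj i (N i) (bas \<beta>')) else 0)"

definition Gr_top :: "(nat \<Rightarrow> nat) \<Rightarrow> (nat \<Rightarrow> 'v set) topology" where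
  "Gr_top e = pullback_topology (Gr e) proj_matrix euclidean"


subsection \<open>The moment graph\<close>

definition orbit :: "(nat \<Rightarrow> 'v set) \<Rightarrow> (nat \<Rightarrow> 'v set) set" where
  "orbit N = {torus_act \<gamma> N | \<gamma>. \<gamma> \<in> torus}"

text \<open>The Lie algebra of the stabiliser of \<open>N\<close>, as a subspace of the Lie algebra
  \<open>\<complex>\<^sup>d\<^sup>+\<^sup>1\<close> of the torus; the dimension of the orbit is the dimension of the torus minus that
  of the stabiliser.\<close>

definition stabiliser_lie :: "(nat \<Rightarrow> 'v set) \<Rightarrow> (nat \<Rightarrow> complex) set" where
  "stabiliser_lie N = {\<xi>. (\<forall>i>d. \<xi> i = 0) \<and>
     (\<forall>s::complex. torus_act (\<lambda>i\<in>{0..d}. exp (s * \<xi> i)) N = N)}"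

definition orbit_dim :: "(nat \<Rightarrow> 'v set) \<Rightarrow> nat" where
  "orbit_dim N =
     (d + 1) - vector_space.dim (\<lambda>(c::complex) (\<xi>::nat \<Rightarrow> complex) i. c * \<xi> i) (stabiliser_lie N)"

definition one_dim_orbits :: "(nat \<Rightarrow> nat) \<Rightarrow> (nat \<Rightarrow> 'v set) set set" where
  "one_dim_orbits e = {orbit N | N. N \<in> Gr e \<and> orbit_dim N = 1}"

text \<open>The torus acts on a one-dimensional orbit \<open>E\<close>, a copy of the multiplicative group,
  through the character \<open>\<alpha>\<close>.  This determines \<open>\<alpha>\<close> up to sign.\<close>

definition edge_label :: "(nat \<Rightarrow> 'v set) set \<Rightarrow> (nat \<Rightarrow> int) \<Rightarrow> bool" where
  "edge_label E \<alpha> \<longleftrightarrow> (\<exists>\<phi> :: (nat \<Rightarrow> 'v set) \<Rightarrow> complex. bij_betw \<phi> E (UNIV - {0}) \<and>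
     (\<forall>\<gamma>\<in>torus. \<forall>N\<in>E. \<phi> (torus_act \<gamma> N) = torus_char \<alpha> \<gamma> * \<phi> N))"

definition edge_endpoints ::
    "(nat \<Rightarrow> nat) \<Rightarrow> (nat \<Rightarrow> 'v set) set \<Rightarrow> (nat \<Rightarrow> 'v set) set" where
  "edge_endpoints e E = fixed_points e \<inter> (Gr_top e closure_of E)"

definition edge_starts_at ::
    "(nat \<Rightarrow> nat) \<Rightarrow> (nat \<Rightarrow> int) \<Rightarrow> (nat \<Rightarrow> 'v set) set \<Rightarrow> (nat \<Rightarrow> 'v set) \<Rightarrow> bool" where
  "edge_starts_at e \<kappa> E L \<longleftrightarrow> L \<in> edge_endpoints e E \<and>
     (\<forall>N\<in>E. limitin (Gr_top e) (\<lambda>z. torus_act (cochar \<kappa> z) N) L (at 0))"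

definition out_edges ::
    "(nat \<Rightarrow> nat) \<Rightarrow> (nat \<Rightarrow> int) \<Rightarrow> (nat \<Rightarrow> 'v set) \<Rightarrow> (nat \<Rightarrow> 'v set) set set" where
  "out_edges e \<kappa> L =
     {Gr_top e closure_of E | E. E \<in> one_dim_orbits e \<and> edge_starts_at e \<kappa> E L}"


subsection \<open>Equivariant cohomology\<close>

definition sym_act :: "(nat \<Rightarrow> nat) \<Rightarrow> (nat \<Rightarrow> 'v set) \<Rightarrow> nat \<Rightarrow> 'v set" where
  "sym_act \<sigma> N = (\<lambda>i\<in>{..<n}.
     (\<lambda>x. \<Sum>(j, p)\<in>B_at i. scale (coord i (j, p) x) (bas (inv_into UNIV \<sigma> j, p))) ` N i)"

text \<open>The equivariant cohomology is identified with its image under restriction to the fixed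
  points, that is, with the structure algebra of the moment graph.\<close>

definition HT_carrier :: "(nat \<Rightarrow> nat) \<Rightarrow> ((nat \<Rightarrow> 'v set) \<Rightarrow> poly_R) set" where
  "HT_carrier e = {g \<in> carrier (direct_sum (fixed_points e) (\<lambda>_. Triv d 0)).
     \<forall>E\<in>one_dim_orbits e. \<forall>\<alpha>. edge_label E \<alpha> \<longrightarrow>
       (\<forall>x\<in>edge_endpoints e E. \<forall>y\<in>edge_endpoints e E.
          \<exists>r\<in>carrier (R_ring d). g x - g y = char_class \<alpha> * r)}"

definition HT :: "(nat \<Rightarrow> nat) \<Rightarrow> ((nat \<Rightarrow> 'v set) \<Rightarrow> poly_R) twisted_module" where
  "HT e = (direct_sum (fixed_points e) (\<lambda>_. Triv d 0))
     \<lparr>carrier := HT_carrier e,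
      perm_action := (\<lambda>\<sigma> g. \<lambda>L\<in>fixed_points e. twist \<sigma> (g (sym_act (inv_into UNIV \<sigma>) L))),
      grade := (\<lambda>q. grade (direct_sum (fixed_points e) (\<lambda>_. Triv d 0)) q \<inter> HT_carrier e)\<rparr>"

end

end

theory Submission
  imports Defs
begin

text \<open>
  Unrolling the cyclic quiver, homogeneity puts every basis vector at a level \<open>z\<close> and a position
  \<open>k\<close>, both integers, in such a way that the maps of \<open>M\<close> raise the level and preserve the
  position.  A torus fixed point \<open>L\<close> becomes the function \<open>\<nu>\<close> assigning to a position the level
  at which it enters \<open>L\<close>; it satisfies \<open>\<nu> (k + C) = \<nu> k - n\<close>.  The edges starting at \<open>L\<close>
  exchange two positions \<open>a < b\<close> with \<open>\<nu> a < \<nu> b\<close>, and their labels are the roots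
  \<open>\<omega> a - \<omega> b\<close> of an affine symmetric group.  Thus the moment graph is the restriction of an
  affine Bruhat graph to a finite set which is closed downwards in the Bruhat order.

  Divided differences provide an integration functional on every lower set, and by duality every
  section on a lower set extends.  Hence each fixed point has a homogeneous class which is supported
  above it and whose value there is the product of the labels of the edges starting there; these
  classes form a basis over \<open>R\<close>.  A transposition in the Young subgroup acts as an affine
  reflection, so it changes a section by a multiple of a root.  Therefore the Young subgroup acts
  trivially modulo the span of the classes of smaller degree, and averaging the basis over the
  group yields an invariant basis in the same degrees.
\<close>


section \<open>Substitution in polynomials\<close>

text \<open>The lifting property supplies a substitute, since the part below a single
  \<open>\<nu>\<close> is stable under the simple reflection at any ascent of \<open>\<nu>\<close>.
  Integration is therefore built on principal lower sets, by induction on the number of inversions,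
  and it prescribes the missing value when one maximal point is added to the domain of a section.
  The reflections belonging to two isomorphic summands are special: they do preserve the set of all
  fixed points, which is why divided differences apply to the action of the Young subgroup. A second
  difficulty is that a residue class of positions modulo \<open>C\<close> need not contain a
  summand. Such classes receive auxiliary variables with index above \<open>d\<close>, so that all
  affine reflections act on one polynomial ring. Labels of edges between actual fixed points involve
  none of these variables, so setting them to zero (\<open>truncate\<close>) returns every
  construction to R.\<close>

definition psubst :: "(nat => poly_R) => poly_R => poly_R" where
  "psubst h f = (\<Sum>m\<in>Poly_Mapping.keys f. Poly_Mapping.single 0 (Poly_Mapping.lookup f m) *
     (\<Prod>i\<in>Poly_Mapping.keys m. h i ^ Poly_Mapping.lookup m i))"

definition mono_subst :: "(nat => poly_R) => (nat \<Rightarrow>\<^sub>0 nat) => poly_R" where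
  "mono_subst h m = (\<Prod>i\<in>Poly_Mapping.keys m. h i ^ Poly_Mapping.lookup m i)"

lemma mono_subst_superset:
  assumes "finite I" "Poly_Mapping.keys m \<subseteq> I"
  shows "mono_subst h m = (\<Prod>i\<in>I. h i ^ Poly_Mapping.lookup m i)"
  unfolding mono_subst_def
  by (rule prod.mono_neutral_left) (use assms in \<open>auto simp: in_keys_iff\<close>)

lemma mono_subst_add: "mono_subst h (m + m') = mono_subst h m * mono_subst h m'"
proof -
  let ?I = "Poly_Mapping.keys m \<union> Poly_Mapping.keys m'"
  have "mono_subst h (m + m') = (\<Prod>i\<in>?I. h i ^ Poly_Mapping.lookup (m + m') i)"
    by (rule mono_subst_superset) (auto dest: set_mp[OF keys_add])
  also have "\<dots> = (\<Prod>i\<in>?I. h i ^ Poly_Mapping.lookup m i) * (\<Prod>i\<in>?I. h i ^ Poly_Mapping.lookup m' i)"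
    by (simp add: lookup_add power_add prod.distrib)
  also have "\<dots> = mono_subst h m * mono_subst h m'"
    by (subst (1 2) mono_subst_superset[of ?I]) auto
  finally show ?thesis .
qed

lemma mono_subst_0 [simp]: "mono_subst h 0 = 1"
  by (simp add: mono_subst_def)

lemma psubst_superset:
  assumes "finite I" "Poly_Mapping.keys f \<subseteq> I"
  shows "psubst h f = (\<Sum>m\<in>I. Poly_Mapping.single 0 (Poly_Mapping.lookup f m) * mono_subst h m)"
  unfolding psubst_def mono_subst_def
  by (rule sum.mono_neutral_left) (use assms in \<open>auto simp: in_keys_iff\<close>)

lemma psubst_0 [simp]: "psubst h 0 = 0"
  by (simp add: psubst_def)

lemma psubst_single: "psubst h (Poly_Mapping.single m c) = Poly_Mapping.single 0 c * mono_subst h m"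
  by (subst psubst_superset[of "{m}"]) (auto simp: lookup_single)

lemma psubst_add: "psubst h (f + g) = psubst h f + psubst h g"
proof -
  let ?I = "Poly_Mapping.keys f \<union> Poly_Mapping.keys g"
  have "psubst h (f + g) = (\<Sum>m\<in>?I. Poly_Mapping.single 0 (Poly_Mapping.lookup (f + g) m) * mono_subst h m)"
    by (rule psubst_superset) (auto dest: set_mp[OF keys_add])
  also have "\<dots> = (\<Sum>m\<in>?I. Poly_Mapping.single 0 (Poly_Mapping.lookup f m) * mono_subst h m)
      + (\<Sum>m\<in>?I. Poly_Mapping.single 0 (Poly_Mapping.lookup g m) * mono_subst h m)"
    by (simp add: lookup_add single_add algebra_simps sum.distrib)
  also have "\<dots> = psubst h f + psubst h g"
    by (subst (1 2) psubst_superset[of ?I]) auto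
  finally show ?thesis .
qed

lemma psubst_sum: "psubst h (\<Sum>i\<in>I. f i) = (\<Sum>i\<in>I. psubst h (f i))"
  by (induction I rule: infinite_finite_induct) (auto simp: psubst_add)

lemma poly_expand: "(f :: poly_R) = (\<Sum>m\<in>Poly_Mapping.keys f. Poly_Mapping.single m (Poly_Mapping.lookup f m))"
proof (rule poly_mapping_eqI)
  fix k
  show "Poly_Mapping.lookup f k =
    Poly_Mapping.lookup (\<Sum>m\<in>Poly_Mapping.keys f. Poly_Mapping.single m (Poly_Mapping.lookup f m)) k"
    by (auto simp: lookup_sum lookup_single when_def in_keys_iff)
qed

lemma psubst_mult: "psubst h (f * g) = psubst h f * psubst h g"
proof -
  have single: "psubst h (Poly_Mapping.single m a * Poly_Mapping.single m' b) =
      psubst h (Poly_Mapping.single m a) * psubst h (Poly_Mapping.single m' b)" for m m' a b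
    by (simp add: mult_single psubst_single mono_subst_add)
  have "psubst h (f * g) = psubst h ((\<Sum>m\<in>Poly_Mapping.keys f. Poly_Mapping.single m (Poly_Mapping.lookup f m)) *
      (\<Sum>m\<in>Poly_Mapping.keys g. Poly_Mapping.single m (Poly_Mapping.lookup g m)))"
    using poly_expand[of f] poly_expand[of g] by simp
  also have "\<dots> = psubst h (\<Sum>m\<in>Poly_Mapping.keys f. Poly_Mapping.single m (Poly_Mapping.lookup f m)) *
      psubst h (\<Sum>m\<in>Poly_Mapping.keys g. Poly_Mapping.single m (Poly_Mapping.lookup g m))"
    by (simp add: sum_product psubst_sum single)
  also have "\<dots> = psubst h f * psubst h g"
    using poly_expand[of f] poly_expand[of g] by simp
  finally show ?thesis .
qed

lemma psubst_1 [simp]: "psubst h 1 = 1"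
  using psubst_single[of h 0 1] by simp

lemma psubst_const [simp]: "psubst h (Poly_Mapping.single 0 c) = Poly_Mapping.single 0 c"
  by (simp add: psubst_single)

lemma psubst_uminus: "psubst h (- f) = - psubst h f"
  by (metis add.right_inverse add_eq_0_iff psubst_0 psubst_add)

lemma psubst_diff: "psubst h (f - g) = psubst h f - psubst h g"
  using psubst_add[of h f "- g"] by (simp add: psubst_uminus)

lemma psubst_of_int [simp]: "psubst h (of_int z) = of_int z"
  by (metis psubst_const single_of_int)

lemma psubst_prod: "psubst h (\<Prod>i\<in>I. f i) = (\<Prod>i\<in>I. psubst h (f i))"
  by (induction I rule: infinite_finite_induct) (auto simp: psubst_mult)

lemma psubst_power: "psubst h (f ^ k) = psubst h f ^ k"
  by (induction k) (auto simp: psubst_mult)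

lemma psubst_var [simp]: "psubst h (var i) = h i"
  by (simp add: var_def psubst_single mono_subst_def)

lemma single_as_vars: "Poly_Mapping.single m c = Poly_Mapping.single 0 c * mono_subst var m"
proof -
  have pw: "var i ^ k = Poly_Mapping.single (Poly_Mapping.single i k) 1" for i k
    by (induction k) (auto simp: var_def mult_single single_add[symmetric])
  have pr: "(\<Prod>i\<in>I. Poly_Mapping.single (g i) (1::rat)) = Poly_Mapping.single (\<Sum>i\<in>I. g i) 1"
    if "finite I" for I and g :: "nat => nat \<Rightarrow>\<^sub>0 nat"
    using that by (induction I) (auto simp: mult_single)
  have "(\<Sum>i\<in>Poly_Mapping.keys m. Poly_Mapping.single i (Poly_Mapping.lookup m i)) = m"
    by (rule poly_mapping_eqI) (auto simp: lookup_sum lookup_single when_def in_keys_iff)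
  then show ?thesis by (simp add: mono_subst_def pw pr mult_single)
qed

lemma psubst_id [simp]: "psubst var f = f"
proof -
  have "psubst var f = (\<Sum>m\<in>Poly_Mapping.keys f. Poly_Mapping.single m (Poly_Mapping.lookup f m))"
    by (simp add: psubst_superset[OF finite_keys order_refl] single_as_vars[symmetric])
  then show ?thesis using poly_expand[of f] by simp
qed

lemma psubst_psubst: "psubst h (psubst g f) = psubst (\<lambda>i. psubst h (g i)) f"
  by (subst (2 3) psubst_superset[OF finite_keys order_refl])
     (simp add: psubst_sum psubst_mult mono_subst_def psubst_prod psubst_power)

lemma psubst_cong:
  assumes "\<And>m i. m \<in> Poly_Mapping.keys f ==> i \<in> Poly_Mapping.keys m ==> g i = h i"
  shows "psubst g f = psubst h f"
  unfolding psubst_def by (intro sum.cong prod.cong arg_cong2[where f="(*)"] arg_cong2[where f=power]) (use assms in auto)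

lemma poly_induct [case_names const var add mult]:
  fixes f :: poly_R
  assumes const: "\<And>c. P (Poly_Mapping.single 0 c)" and v: "\<And>i. P (var i)"
    and add: "\<And>f g. P f ==> P g ==> P (f + g)" and mult: "\<And>f g. P f ==> P g ==> P (f * g)"
  shows "P f"
proof -
  have P0: "P 0" and P1: "P 1" using const[of 0] const[of 1] by auto
  have pw: "P (var i ^ k)" for i k by (induction k) (auto intro: mult v P1)
  have pr: "P (\<Prod>i\<in>I. var i ^ e i)" for I e
    by (induction I rule: infinite_finite_induct) (auto intro: mult pw P1)
  have "P (\<Sum>m\<in>I. Poly_Mapping.single m (g m))" for I and g :: "(nat \<Rightarrow>\<^sub>0 nat) => rat"
  proof (induction I rule: infinite_finite_induct)
    case (insert m I)
    have "P (Poly_Mapping.single m (g m))"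
      by (subst single_as_vars) (auto simp: mono_subst_def intro: mult const pr)
    with insert show ?case by (auto intro: add)
  qed (auto intro: P0)
  then show ?thesis using poly_expand[of f] by metis
qed

text \<open>Both substitutions are ring homomorphisms, so agreement modulo \<alpha> on the variables
  propagates to all polynomials. This is the source of the congruence between a polynomial and its
  reflection modulo the root.\<close>

lemma psubst_congruent:
  assumes "\<And>i. \<alpha> dvd g i - h i"
  shows "\<alpha> dvd psubst g f - psubst h f"
proof (induction f rule: poly_induct)
  case (mult f k)
  have "psubst g (f * k) - psubst h (f * k) =
     psubst g f * (psubst g k - psubst h k) + psubst h k * (psubst g f - psubst h f)"
    by (simp add: psubst_mult algebra_simps)
  then show ?case using mult by (metis dvd_add dvd_mult)
next
  case (add f k)
  have "psubst g (f + k) - psubst h (f + k) = (psubst g f - psubst h f) + (psubst g k - psubst h k)"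
    by (simp add: psubst_add algebra_simps)
  then show ?case using add by (metis dvd_add)
qed (use assms in auto)

text \<open>Eliminating the variable \<open>i\<close> is the quotient map modulo the linear form
  \<beta>. Divisibility by \<beta> becomes vanishing in an integral domain, which is how roots are
  seen to be prime.\<close>

lemma dvd_by_elimination:
  assumes "\<beta> - var i = r \<or> \<beta> + var i = r" "psubst (var(i := q)) \<beta> = 0" "\<beta> dvd var i - q"
  shows "\<beta> dvd f \<longleftrightarrow> psubst (var(i := q)) f = 0"
proof
  assume "\<beta> dvd f"
  then obtain k where "f = \<beta> * k" ..
  then show "psubst (var(i := q)) f = 0" using assms by (simp add: psubst_mult)
next
  assume "psubst (var(i := q)) f = 0"
  moreover have "\<beta> dvd psubst var f - psubst (var(i := q)) f"
    by (rule psubst_congruent) (use assms in auto)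
  ultimately show "\<beta> dvd f" by simp
qed

lemma twist_eq_psubst: "twist \<sigma> = psubst (\<lambda>i. var (inv_into UNIV \<sigma> i))"
  by (rule ext) (simp add: twist_def psubst_def)

section \<open>Periodic functions on the integers and affine reflections\<close>

locale affine_refl =
  fixes C n :: int
  assumes C_pos: "C > 0" and n_pos': "n > 0"
begin

text \<open>For \<open>a\<close> and \<open>b\<close> in different classes modulo \<open>C\<close>
  this is the reflection of the affine symmetric group exchanging \<open>a + t * C\<close> with
  \<open>b + t * C\<close> for all \<open>t\<close>. For congruent \<open>a\<close> and
  \<open>b\<close> it is set to the identity, so that it is always an involution commuting with the
  shift by \<open>C\<close>.\<close>

definition refl :: "int => int => int => int" where
  "refl a b k = (if a mod C = b mod C then k else if k mod C = a mod C then k + (b - a) else if k mod C = b mod C then k + (a - b) else k)"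

text \<open>One turn around the quiver raises the level by \<open>n\<close> and corresponds to
  moving the position by \<open>C\<close>; the level at which a position enters a subrepresentation
  therefore drops by \<open>n\<close> under this move.\<close>

definition periodic :: "(int => int) => bool" where
  "periodic \<nu> \<longleftrightarrow> (\<forall>k. \<nu> (k + C) = \<nu> k - n)"

lemma cong_iff: "k mod C = a mod C \<longleftrightarrow> (\<exists>t. k = a + t * C)"
proof
  assume "k mod C = a mod C"
  then have "C dvd k - a" by (simp add: mod_eq_dvd_iff)
  then obtain t where "k - a = C * t" ..
  then have "k = a + t * C" by (simp add: algebra_simps)
  then show "\<exists>t. k = a + t * C" ..
qed auto

lemma mod_window:
  assumes "i \<le> a" "a < i + C" "a mod C = i mod C" shows "a = i"
proof -
  obtain t where t: "a = i + t * C" using assms(3) unfolding cong_iff ..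
  have "0 \<le> t * C" "t * C < 1 * C" using t assms by auto
  then have "0 \<le> t" "t < 1" using C_pos by (simp_all only: zero_le_mult_iff mult_less_cancel_right) auto
  then show ?thesis using t by simp
qed

lemma refl_shift: "refl a b (k + t * C) = refl a b k + t * C"
  by (simp add: refl_def)

lemma refl_left [simp]: "a mod C ~= b mod C ==> refl a b a = b"
  by (simp add: refl_def)

lemma refl_right [simp]: "a mod C ~= b mod C ==> refl a b b = a"
  by (auto simp: refl_def)

lemma refl_mod: "refl a b k mod C =
   (if k mod C = a mod C then b mod C else if k mod C = b mod C then a mod C else k mod C)"
proof -
  have sh: "(k + (b - a)) mod C = b mod C" if "k mod C = a mod C" for k a b
    using that by (metis add.commute diff_add_cancel mod_add_right_eq mod_diff_right_eq add_diff_eq)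
  show ?thesis using sh[of k a b] sh[of k b a] by (simp add: refl_def)
qed

lemma refl_refl [simp]: "refl a b (refl a b k) = k"
  using refl_mod[of a b k] by (auto simp: refl_def)

lemma refl_o_refl [simp]: "refl a b \<circ> refl a b = id"
  by (rule ext) simp

lemma refl_mod_eq_iff: "refl a b k mod C = refl a b l mod C \<longleftrightarrow> k mod C = l mod C"
  by (auto simp: refl_mod split: if_splits)

lemma refl_commute: "refl b a = refl a b"
  by (rule ext) (auto simp: refl_def)

lemma refl_translate: "refl (a + t * C) (b + t * C) = refl a b"
  by (rule ext) (simp add: refl_def)

text \<open>Conjugation carries an edge at a point to an edge at its mirror image; this is what
  \<open>gkm_twist\<close> rests on. The cases follow the residue class of the reflected
  argument.\<close>

lemma refl_conj:
  assumes "c mod C ~= e mod C"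
  shows "refl a b \<circ> refl c e \<circ> refl a b = refl (refl a b c) (refl a b e)"
proof
  fix k
  let ?s = "refl a b"
  consider "?s k mod C = c mod C" | "?s k mod C = e mod C" | "?s k mod C ~= c mod C" "?s k mod C ~= e mod C"
    by blast
  then show "(?s \<circ> refl c e \<circ> ?s) k = refl (?s c) (?s e) k"
  proof cases
    case 1
    then obtain t where t: "?s k = c + t * C" unfolding cong_iff ..
    have "k = ?s c + t * C" using t refl_refl[of a b k] by (metis refl_shift)
    moreover have "refl c e (?s k) = e + t * C" using t refl_shift[of c e c t] assms by simp
    moreover have "?s c mod C ~= ?s e mod C" using assms refl_mod_eq_iff by simp
    ultimately show ?thesis using refl_shift[of "?s c" "?s e" "?s c" t] by (simp add: refl_shift)
  next
    case 2
    then obtain t where t: "?s k = e + t * C" unfolding cong_iff ..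
    have ne: "?s c mod C ~= ?s e mod C" using assms refl_mod_eq_iff by simp
    have "k = ?s e + t * C" using t refl_refl[of a b k] by (metis refl_shift)
    moreover have "refl c e (?s k) = c + t * C" using t refl_shift[of c e e t] assms by simp
    ultimately show ?thesis using refl_shift[of "?s c" "?s e" "?s e" t] ne by (simp add: refl_shift)
  next
    case 3
    then have "k mod C ~= ?s c mod C" "k mod C ~= ?s e mod C"
      by (metis refl_mod_eq_iff refl_refl)+
    with 3 show ?thesis by (simp add: refl_def[of c e] refl_def[of "?s c"])
  qed
qed

lemma periodic_shift:
  assumes "periodic \<nu>" shows "\<nu> (k + t * C) = \<nu> k - t * n"
proof -
  have nat: "\<nu> (k + int m * C) = \<nu> k - int m * n" for m k
  proof (induction m)
    case (Suc m)
    have "\<nu> (k + int (Suc m) * C) = \<nu> ((k + int m * C) + C)" by (simp add: algebra_simps)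
    also have "\<dots> = \<nu> k - int m * n - n" using assms Suc by (simp add: periodic_def)
    finally show ?case by (simp add: algebra_simps)
  qed simp
  show ?thesis
  proof (cases "t \<ge> 0")
    case True then show ?thesis using nat[of k "nat t"] by simp
  next
    case False
    then show ?thesis using nat[of "k + t * C" "nat (- t)"] by (simp add: algebra_simps)
  qed
qed

lemma periodic_comp_refl [simp]: "periodic \<nu> ==> periodic (\<nu> \<circ> refl a b)"
  using refl_shift[of a b _ 1] by (auto simp: periodic_def)

lemma periodic_comp_refl' [simp]: "periodic \<nu> ==> periodic (\<lambda>k. \<nu> (refl a b k))"
  using periodic_comp_refl[of \<nu> a b] by (simp add: comp_def)

lemma periodic_eq: "periodic \<nu> ==> \<nu> k = \<nu> (k mod C) - (k div C) * n"
  by (metis mult.commute mult_div_mod_eq periodic_shift add.commute)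

text \<open>The sum \<open>\<nu> k + (k div C) * n\<close> depends only on the residue of
  \<open>k\<close>, so it takes finitely many values.\<close>

lemma periodic_bounds:
  assumes "periodic \<nu>"
  shows "\<exists>l h. (\<forall>k. l - (k div C) * n \<le> \<nu> k) \<and> (\<forall>k. \<nu> k \<le> h - (k div C) * n)"
proof -
  have fin: "finite (\<nu> ` {0..<C})" by simp
  have "\<nu> (k mod C) \<in> \<nu> ` {0..<C}" for k using C_pos by auto
  then have "Min (\<nu> ` {0..<C}) - (k div C) * n \<le> \<nu> k" "\<nu> k \<le> Max (\<nu> ` {0..<C}) - (k div C) * n" for k
    using periodic_eq[OF assms, of k] fin by auto
  then show ?thesis by blast
qed

lemma finite_div_bounded: "finite {k :: int. l \<le> k div C \<and> k \<le> A}"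
proof -
  have "{k :: int. l \<le> k div C \<and> k \<le> A} \<subseteq> {l * C .. A}"
  proof safe
    fix k :: int assume "l \<le> k div C" "k \<le> A"
    then have "l * C \<le> (k div C) * C" using C_pos by simp
    also have "\<dots> \<le> k" using C_pos by (simp add: minus_mod_eq_div_mult[symmetric])
    finally show "k \<in> {l * C .. A}" using \<open>k \<le> A\<close> by simp
  qed
  then show ?thesis by (rule finite_subset) simp
qed

text \<open>Periodicity makes \<open>\<nu>\<close> tend to infinity as the position tends to minus
  infinity, so a bound on the value bounds the position from below. Without this the counting
  function of the order would be meaningless.\<close>

lemma finite_below:
  assumes "periodic \<nu>" shows "finite {k. k \<le> A \<and> \<nu> k \<le> v}"
proof -
  obtain l h where lh: "\<And>k. l - (k div C) * n \<le> \<nu> k" "\<And>k. \<nu> k \<le> h - (k div C) * n"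
    using periodic_bounds[OF assms] by blast
  have "{k. k \<le> A \<and> \<nu> k \<le> v} \<subseteq> {k. - \<bar>l - v\<bar> \<le> k div C \<and> k \<le> A}"
  proof safe
    fix k assume "\<nu> k \<le> v"
    then have "l - v \<le> (k div C) * n" using lh(1)[of k] by simp
    show "- \<bar>l - v\<bar> \<le> k div C"
    proof (rule ccontr)
      assume neg: "\<not> ?thesis"
      then have "k div C \<le> - \<bar>l - v\<bar> - 1" by simp
      then have "(k div C) * n \<le> (k div C) * 1" using n_pos' by (intro mult_left_mono_neg) auto
      then show False using \<open>l - v \<le> (k div C) * n\<close> neg by linarith
    qed
  qed
  then show ?thesis by (rule finite_subset) (rule finite_div_bounded)
qed

lemma eventually_le:
  assumes "periodic \<nu>" shows "\<exists>A0. \<forall>k\<ge>A0. \<nu> k \<le> v"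
proof -
  obtain l h where lh: "\<And>k. l - (k div C) * n \<le> \<nu> k" "\<And>k. \<nu> k \<le> h - (k div C) * n"
    using periodic_bounds[OF assms] by blast
  have "\<nu> k \<le> v" if "k \<ge> \<bar>h - v\<bar> * C" for k
  proof -
    have "(\<bar>h - v\<bar> * C) div C \<le> k div C" using that C_pos by (rule zdiv_mono1)
    then have 1: "\<bar>h - v\<bar> \<le> k div C" using C_pos by simp
    then have "(k div C) * 1 \<le> (k div C) * n" using n_pos' by (intro mult_left_mono) auto
    with 1 have "\<bar>h - v\<bar> \<le> (k div C) * n" by simp
    then show ?thesis using lh(2)[of k] by linarith
  qed
  then show ?thesis by blast
qed

section \<open>Inversions of periodic functions\<close>

definition inv_pairs :: "(int => int) => (int \<times> int) set" where
  "inv_pairs \<nu> = {(a, b). 0 \<le> a \<and> a < C \<and> a < b \<and> \<nu> a < \<nu> b}"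

text \<open>Each translation class of inversions is represented once, by the pair whose first entry
  lies in a window of length \<open>C\<close>. The window is movable because the simple reflection
  at \<open>i\<close> preserves the one starting at \<open>i\<close> but may leave the one starting
  at 0.\<close>

definition inv_pairs_from :: "int => (int => int) => (int \<times> int) set" where
  "inv_pairs_from r \<nu> = {(a, b). r \<le> a \<and> a < r + C \<and> a < b \<and> \<nu> a < \<nu> b}"

text \<open>Within one residue class a periodic function is strictly decreasing.\<close>

lemma inv_pairs_mod:
  assumes "periodic \<nu>" "a < b" "\<nu> a < \<nu> b" shows "a mod C ~= b mod C"
proof
  assume "a mod C = b mod C"
  then obtain t where t: "b = a + t * C" using cong_iff[of b a] by auto
  have "t > 0" using t assms(2) C_pos by (simp add: zero_less_mult_iff)
  then have "t * n > 0" using n_pos' by simp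
  then show False using t assms(1,3) periodic_shift[of \<nu> a t] by simp
qed

lemma finite_inv_pairs_from:
  assumes "periodic \<nu>" shows "finite (inv_pairs_from r \<nu>)"
proof -
  have "inv_pairs_from r \<nu> \<subseteq> (SIGMA a:{r..<r+C}. {a<..<(SOME A0. \<forall>k\<ge>A0. \<nu> k \<le> \<nu> a)})"
  proof clarify
    fix a b assume ab: "(a, b) \<in> inv_pairs_from r \<nu>"
    have "\<forall>k\<ge>(SOME A0. \<forall>k\<ge>A0. \<nu> k \<le> \<nu> a). \<nu> k \<le> \<nu> a"
      by (rule someI_ex) (rule eventually_le[OF assms])
    then show "a \<in> {r..<r+C} \<and> b \<in> {a<..<(SOME A0. \<forall>k\<ge>A0. \<nu> k \<le> \<nu> a)}"
      using ab by (fastforce simp: inv_pairs_from_def not_le[symmetric])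
  qed
  then show ?thesis by (rule finite_subset) simp
qed

lemma inv_pairs_eq: "inv_pairs \<nu> = inv_pairs_from 0 \<nu>"
  by (simp add: inv_pairs_def inv_pairs_from_def)

lemma finite_inv_pairs: "periodic \<nu> ==> finite (inv_pairs \<nu>)"
  by (simp add: inv_pairs_eq finite_inv_pairs_from)

lemma bij_inv_pairs_from:
  assumes "periodic \<nu>"
  shows "bij_betw (\<lambda>(a, b). (a - ((a - r') div C) * C, b - ((a - r') div C) * C))
    (inv_pairs_from r \<nu>) (inv_pairs_from r' \<nu>)"
proof (rule bij_betw_byWitness[where
      f' = "\<lambda>(a, b). (a - ((a - r) div C) * C, b - ((a - r) div C) * C)"])
  have sh: "\<nu> (k - t * C) = \<nu> k + t * n" for k t
    using periodic_shift[OF assms, of k "- t"] by simp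
  have rng: "r \<le> a - ((a - r) div C) * C \<and> a - ((a - r) div C) * C < r + C" for a r
  proof -
    have "a - ((a - r) div C) * C = r + (a - r) mod C" by (simp add: minus_div_mult_eq_mod[symmetric] algebra_simps)
    then show ?thesis using C_pos by simp
  qed
  have bk: "(a - t * C - r) div C = - t" if "r \<le> a" "a < r + C" for a t r
  proof -
    have "(a - t * C - r) div C = ((a - r) + (- t) * C) div C" by (simp add: algebra_simps)
    also have "\<dots> = - t + (a - r) div C" using C_pos by (subst div_mult_self1) auto
    also have "(a - r) div C = 0" using that by (intro div_pos_pos_trivial) auto
    finally show ?thesis by simp
  qed
  show "\<forall>x\<in>inv_pairs_from r \<nu>. (\<lambda>(a, b). (a - ((a - r) div C) * C, b - ((a - r) div C) * C))
     ((\<lambda>(a, b). (a - ((a - r') div C) * C, b - ((a - r') div C) * C)) x) = x"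
    by (auto simp: inv_pairs_from_def bk)
  show "\<forall>x\<in>inv_pairs_from r' \<nu>. (\<lambda>(a, b). (a - ((a - r') div C) * C, b - ((a - r') div C) * C))
     ((\<lambda>(a, b). (a - ((a - r) div C) * C, b - ((a - r) div C) * C)) x) = x"
    by (auto simp: inv_pairs_from_def bk)
  show "(\<lambda>(a, b). (a - ((a - r') div C) * C, b - ((a - r') div C) * C)) ` inv_pairs_from r \<nu> \<subseteq> inv_pairs_from r' \<nu>"
    using rng by (auto simp: inv_pairs_from_def sh)
  show "(\<lambda>(a, b). (a - ((a - r) div C) * C, b - ((a - r) div C) * C)) ` inv_pairs_from r' \<nu> \<subseteq> inv_pairs_from r \<nu>"
    using rng by (auto simp: inv_pairs_from_def sh)
qed

text \<open>A simple reflection reverses the order of a pair only if the pair is a translate of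
  \<open>(i, i + 1)\<close>. Composing with it therefore removes exactly this inversion and permutes
  the translation classes of all others.\<close>

lemma bij_inv_pairs_simple:
  assumes per: "periodic \<nu>" and lt: "\<nu> i < \<nu> (i + 1)"
  defines "s \<equiv> refl i (i + 1)"
  shows "bij_betw (\<lambda>(a, b). (s a, s b)) (inv_pairs_from i (\<nu> \<circ> s)) (inv_pairs_from i \<nu> - {(i, i + 1)})"
proof -
  have ne: "i mod C ~= (i + 1) mod C" by (rule inv_pairs_mod[OF per _ lt]) simp
  then have C2: "C \<ge> 2" using C_pos by (cases "C = 1") auto
  have s_eq: "s k = (if k mod C = i mod C then k + 1 else if k mod C = (i + 1) mod C then k - 1 else k)" for k
    using ne by (simp add: s_def refl_def)
  have dom: "i \<le> s a \<and> s a < i + C" if "i \<le> a" "a < i + C" for a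
  proof -
    have "a = i" if "a mod C = i mod C"
      using mod_window[OF \<open>i \<le> a\<close> \<open>a < i + C\<close> that] .
    moreover have "a ~= i" if "a mod C = (i + 1) mod C" using that ne by auto
    ultimately show ?thesis using that C2 by (auto simp: s_eq)
  qed
  have lts: "s a < s b" if "a < b" "\<not> (a mod C = i mod C \<and> b = a + 1)" for a b
  proof -
    have False if "a mod C = i mod C" "b mod C = (i + 1) mod C" "b = a + 1"
      using that \<open>\<not> (a mod C = i mod C \<and> b = a + 1)\<close> by auto
    \<comment> \<open>Here \<open>s\<close> moves \<open>a\<close> up and \<open>b\<close> down by
      one, so their images would coincide at distance two; that distance would make neighbouring
      residues equal, against \<open>C \<ge> 2\<close>.\<close>
    moreover have "b ~= a + 2" if "a mod C = i mod C" "b mod C = (i + 1) mod C"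
    proof
      assume "b = a + 2"
      then have "(a + 2) mod C = (i + 1) mod C" using that by simp
      then have "(i + 2) mod C = (i + 1) mod C" using that(1) by (metis mod_add_left_eq)
      then have "C dvd 1" by (simp add: mod_eq_dvd_iff)
      then show False using C2 by auto
    qed
    moreover have "a ~= b - 1" if "b mod C = (i + 1) mod C" "a mod C ~= i mod C"
      using that by (metis add_diff_cancel_right' mod_diff_left_eq)
    ultimately show ?thesis using \<open>a < b\<close> \<open>\<not> (a mod C = i mod C \<and> b = a + 1)\<close> by (auto simp: s_eq)
  qed
  have sinv [simp]: "s (s k) = k" for k by (simp add: s_def)
  have si: "s i = i + 1" "s (i + 1) = i" using ne by (auto simp: s_def)
  have key: "(s a, s b) \<in> inv_pairs_from i \<mu>"
    if "(a, b) \<in> inv_pairs_from i (\<mu> \<circ> s)" "(a, b) ~= (i, i + 1)" for \<mu> a b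
  proof -
    have "a = i" if "a mod C = i mod C"
      using mod_window[OF _ _ that] \<open>(a, b) \<in> inv_pairs_from i (\<mu> \<circ> s)\<close> by (auto simp: inv_pairs_from_def)
    then have "s a < s b" using that by (intro lts) (auto simp: inv_pairs_from_def)
    then show ?thesis using that dom by (auto simp: inv_pairs_from_def)
  qed
  show ?thesis
  proof (rule bij_betw_byWitness[where f' = "\<lambda>(a, b). (s a, s b)"])
    have no: "(i, i + 1) \<notin> inv_pairs_from i (\<nu> \<circ> s)" using lt si by (simp add: inv_pairs_from_def)
    have "(s a, s b) \<in> inv_pairs_from i \<nu> - {(i, i+1)}" if "(a, b) \<in> inv_pairs_from i (\<nu> \<circ> s)" for a b
    proof -
      have "(s a, s b) \<in> inv_pairs_from i \<nu>" by (rule key[OF that]) (use no that in auto)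
      moreover have "(s a, s b) ~= (i, i + 1)"
      proof
        assume "(s a, s b) = (i, i + 1)"
        then have "a = i + 1" "b = i" using si by (metis sinv prod.inject)+
        then show False using that by (auto simp: inv_pairs_from_def)
      qed
      ultimately show ?thesis by simp
    qed
    then show "(\<lambda>(a, b). (s a, s b)) ` inv_pairs_from i (\<nu> \<circ> s) \<subseteq> inv_pairs_from i \<nu> - {(i, i + 1)}" by auto
    have "\<nu> \<circ> s \<circ> s = \<nu>" by auto
    then have "(s a, s b) \<in> inv_pairs_from i (\<nu> \<circ> s)" if "(a, b) \<in> inv_pairs_from i \<nu> - {(i, i+1)}" for a b
      using key[of a b "\<nu> \<circ> s"] that by simp
    then show "(\<lambda>(a, b). (s a, s b)) ` (inv_pairs_from i \<nu> - {(i, i + 1)}) \<subseteq> inv_pairs_from i (\<nu> \<circ> s)" by auto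
  qed auto
qed

lemma card_inv_pairs_from: "periodic \<nu> ==> card (inv_pairs_from r \<nu>) = card (inv_pairs \<nu>)"
  unfolding inv_pairs_eq using bij_betw_same_card[OF bij_inv_pairs_from] by blast

lemma card_inv_pairs_simple:
  assumes "periodic \<nu>" "\<nu> i < \<nu> (i + 1)"
  shows "card (inv_pairs \<nu>) = Suc (card (inv_pairs (\<nu> \<circ> refl i (i + 1))))"
proof -
  have "(i, i + 1) \<in> inv_pairs_from i \<nu>" using assms C_pos by (simp add: inv_pairs_from_def)
  then have "card (inv_pairs_from i \<nu>) = Suc (card (inv_pairs_from i \<nu> - {(i, i + 1)}))"
    using finite_inv_pairs_from[OF assms(1), of i] by (metis card.remove)
  then show ?thesis using bij_betw_same_card[OF bij_inv_pairs_simple[OF assms]] assms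
    by (simp add: card_inv_pairs_from)
qed

lemma ex_ascent:
  assumes "inv_pairs \<nu> ~= {}" shows "\<exists>i. \<nu> i < \<nu> (i + 1)"
proof (rule ccontr)
  assume "\<not> ?thesis"
  then have step: "\<nu> (i + 1) \<le> \<nu> i" for i by (meson not_le)
  have "\<nu> (a + int m) \<le> \<nu> a" for a m
  proof (induction m)
    case (Suc m) then show ?case using step[of "a + int m"] by (simp add: algebra_simps)
  qed simp
  then have "\<nu> b \<le> \<nu> a" if "a < b" for a b using that by (metis zle_iff_zadd less_imp_le)
  then show False using assms by (auto simp: inv_pairs_def) (meson not_le)
qed

subsection \<open>The counting order\<close>

definition cnt :: "(int => int) => int => int => nat" where
  "cnt \<nu> v A = card {k. k \<le> A \<and> \<nu> k \<le> v}"

text \<open>The Bruhat order in its rank-matrix form. Since all values are eventually at most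
  \<open>v\<close>, the second condition compares only functions with equal total counts; it is what
  keeps the dimension vector constant on lower sets.\<close>

definition below :: "(int => int) => (int => int) => bool" where
  "below \<mu> \<nu> \<longleftrightarrow> periodic \<mu> \<and> periodic \<nu> \<and> (\<forall>v A. cnt \<mu> v A \<le> cnt \<nu> v A) \<and>
     (\<forall>v. \<exists>A0. \<forall>A\<ge>A0. cnt \<mu> v A = cnt \<nu> v A)"

lemma below_refl [simp]: "below \<nu> \<nu> \<longleftrightarrow> periodic \<nu>"
  by (auto simp: below_def)

lemma below_trans: assumes "below \<mu> \<nu>" "below \<nu> \<rho>" shows "below \<mu> \<rho>"
proof -
  have "\<exists>A0. \<forall>A\<ge>A0. cnt \<mu> v A = cnt \<rho> v A" for v
  proof -
    obtain A B where "\<forall>k\<ge>A. cnt \<mu> v k = cnt \<nu> v k" "\<forall>k\<ge>B. cnt \<nu> v k = cnt \<rho> v k"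
      using assms unfolding below_def by meson
    then show ?thesis by (intro exI[of _ "max A B"]) simp
  qed
  then show ?thesis using assms unfolding below_def by (meson order_trans)
qed

lemma cnt_step:
  assumes "periodic \<nu>" shows "cnt \<nu> v A = cnt \<nu> v (A - 1) + (if \<nu> A \<le> v then 1 else 0)"
proof -
  have "{k. k \<le> A \<and> \<nu> k \<le> v} = (if \<nu> A \<le> v then insert A {k. k \<le> A - 1 \<and> \<nu> k \<le> v} else {k. k \<le> A - 1 \<and> \<nu> k \<le> v})"
    by auto (metis eq_iff linorder_not_le zle_diff1_eq)+
  then show ?thesis using finite_below[OF assms, of "A - 1" v] by (simp add: cnt_def)
qed

text \<open>The increment of the counting function at a position records whether the value there is
  at most \<open>v\<close>, so the counts determine the function.\<close>

lemma below_antisym: assumes "below \<mu> \<nu>" "below \<nu> \<mu>" shows "\<mu> = \<nu>"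
proof
  fix k
  have "cnt \<mu> v A = cnt \<nu> v A" for v A using assms unfolding below_def by (meson order_antisym)
  then have "\<mu> k \<le> v \<longleftrightarrow> \<nu> k \<le> v" for v
    using cnt_step[of \<mu> v k] cnt_step[of \<nu> v k] assms unfolding below_def by (auto split: if_splits)
  then show "\<mu> k = \<nu> k" by (meson order_antisym order_refl)
qed

text \<open>An injection between the counted sets: a position stays where it is if its mirror image
  also has value at most \<open>v\<close>, and is otherwise replaced by the mirror image, which the
  hypothesis keeps at or below \<open>A\<close>.\<close>

lemma cnt_le_comp_refl:
  assumes "periodic \<nu>"
    and "\<And>k. k \<le> A ==> \<nu> k \<le> v ==> v < \<nu> (refl a b k) ==> refl a b k \<le> A"
  shows "cnt \<nu> v A \<le> cnt (\<nu> \<circ> refl a b) v A"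
proof -
  let ?s = "refl a b"
  let ?\<phi> = "\<lambda>k. if \<nu> (?s k) \<le> v then k else ?s k"
  have "inj_on ?\<phi> {k. k \<le> A \<and> \<nu> k \<le> v}"
    by (rule inj_onI) (auto split: if_splits, metis refl_refl)
  moreover have "?\<phi> ` {k. k \<le> A \<and> \<nu> k \<le> v} \<subseteq> {k. k \<le> A \<and> (\<nu> \<circ> ?s) k \<le> v}"
    using assms(2) by (auto simp: not_le)
  ultimately show ?thesis unfolding cnt_def
    by (rule card_inj_on_le) (rule finite_below, simp add: assms)
qed

text \<open>Beyond the place from which all values are at most \<open>v\<close>, the critical mirror
  images automatically lie below \<open>A\<close>. As the reflection is an involution, the
  inequality holds in both directions.\<close>

lemma cnt_eventually_comp_refl:
  assumes "periodic \<nu>"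
  shows "\<exists>A0. \<forall>A\<ge>A0. cnt \<nu> v A = cnt (\<nu> \<circ> refl a b) v A"
proof -
  have le: "\<exists>A0. \<forall>A\<ge>A0. cnt \<mu> v A \<le> cnt (\<mu> \<circ> refl a b) v A" if per: "periodic \<mu>" for \<mu>
  proof -
    obtain A0 where A0: "\<forall>k\<ge>A0. \<mu> k \<le> v" using eventually_le[OF per] by blast
    have "refl a b k \<le> A" if "A \<ge> A0" "v < \<mu> (refl a b k)" for A k
      using A0 that by (meson dual_order.trans linorder_not_le nle_le)
    then show ?thesis using cnt_le_comp_refl[OF per] by (metis (no_types))
  qed
  have eq: "\<nu> \<circ> refl a b \<circ> refl a b = \<nu>" by auto
  obtain A B where "\<forall>k\<ge>A. cnt \<nu> v k \<le> cnt (\<nu> \<circ> refl a b) v k" "\<forall>k\<ge>B. cnt (\<nu> \<circ> refl a b) v k \<le> cnt \<nu> v k"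
    using le[OF assms] le[OF periodic_comp_refl[OF assms, of a b]] unfolding eq by blast
  then show ?thesis by (intro exI[of _ "max A B"]) (auto intro: order_antisym)
qed

text \<open>The injection is applied to the reflected function. A critical position in the class of
  \<open>a\<close> would need a value larger than that of its partner in the class of
  \<open>b\<close>, against \<open>\<nu> a < \<nu> b\<close>; a critical position in the class of
  \<open>b\<close> moves downwards.\<close>

lemma below_comp_refl:
  assumes per: "periodic \<nu>" and ab: "a < b" "\<nu> a < \<nu> b"
  shows "below (\<nu> \<circ> refl a b) \<nu>"
proof -
  let ?s = "refl a b"
  have ne: "a mod C ~= b mod C" by (rule inv_pairs_mod[OF per ab])
  have "cnt (\<nu> \<circ> ?s) v A \<le> cnt \<nu> v A" for v A
  proof -
    have "cnt (\<nu> \<circ> ?s) v A \<le> cnt (\<nu> \<circ> ?s \<circ> ?s) v A"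
    proof (rule cnt_le_comp_refl)
      fix k assume k: "k \<le> A" "(\<nu> \<circ> ?s) k \<le> v" "v < (\<nu> \<circ> ?s) (?s k)"
      show "?s k \<le> A"
      proof (cases "k mod C = a mod C")
        case True
        then obtain t where t: "k = a + t * C" unfolding cong_iff ..
        have "?s k = b + t * C" using t refl_shift[of a b a t] ne by simp
        moreover have "v < \<nu> k" "\<nu> (?s k) \<le> v" using k by simp_all
        ultimately show ?thesis using k(1) t ab periodic_shift[OF per] by simp
      next
        case False
        then show ?thesis using k ab by (auto simp: refl_def)
      qed
    qed (simp add: per)
    moreover have "\<nu> \<circ> ?s \<circ> ?s = \<nu>" by auto
    ultimately show ?thesis by simp
  qed
  then show ?thesis using per cnt_eventually_comp_refl[OF per, of _ a b] unfolding below_def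
    by (metis periodic_comp_refl)
qed

text \<open>The lifting property of the Bruhat order.\<close>

lemma below_lift:
  assumes "below \<mu> \<nu>" and lt: "\<nu> i < \<nu> (i + 1)"
  shows "below (\<mu> \<circ> refl i (i + 1)) \<nu>"
proof -
  let ?s = "refl i (i + 1)"
  have per: "periodic \<mu>" "periodic \<nu>" and le: "\<And>v A. cnt \<mu> v A \<le> cnt \<nu> v A"
    using assms(1) by (auto simp: below_def)
  have ne: "i mod C ~= (i + 1) mod C" by (rule inv_pairs_mod[OF per(2) _ lt]) simp
  \<comment> \<open>The reflection maps the positions up to \<open>A\<close> to themselves unless it
    exchanges \<open>A\<close> with \<open>A + 1\<close>.\<close>
  have same: "cnt (\<mu> \<circ> ?s) v A = cnt \<mu> v A" if "A mod C ~= i mod C" for v A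
  proof -
    have sA: "?s k \<le> A" if "k \<le> A" for k
      using that \<open>A mod C ~= i mod C\<close> by (cases "k = A") (auto simp: refl_def)
    have eq: "\<mu> \<circ> ?s \<circ> ?s = \<mu>" by auto
    have "cnt (\<mu> \<circ> ?s) v A \<le> cnt (\<mu> \<circ> ?s \<circ> ?s) v A"
      by (rule cnt_le_comp_refl) (use sA per in auto)
    moreover have "cnt \<mu> v A \<le> cnt (\<mu> \<circ> ?s) v A"
      by (rule cnt_le_comp_refl) (use sA per in auto)
    ultimately show ?thesis using eq by simp
  qed
  have "cnt (\<mu> \<circ> ?s) v A \<le> cnt \<nu> v A" for v A
  proof (cases "A mod C = i mod C")
    case True
    then obtain t where t: "A = i + t * C" unfolding cong_iff ..
    have sA: "?s A = A + 1" using t refl_shift[of i "i + 1" i t] ne by simp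
    have ltA: "\<nu> A < \<nu> (A + 1)" using lt periodic_shift[OF per(2), of i t] periodic_shift[OF per(2), of "i + 1" t] t
      by (simp add: algebra_simps)
    have "(A - 1) mod C ~= i mod C"
    proof
      assume "(A - 1) mod C = i mod C"
      then have "A mod C = (i + 1) mod C" by (metis diff_add_cancel mod_add_left_eq)
      then show False using True ne by simp
    qed
    then have "cnt (\<mu> \<circ> ?s) v A = cnt \<mu> v (A - 1) + (if \<mu> (A + 1) \<le> v then 1 else 0)"
      using cnt_step[OF periodic_comp_refl[OF per(1)], of i "i + 1" v A] sA same[of "A - 1" v] by simp
    moreover have "cnt \<mu> v (A + 1) = cnt \<mu> v A + (if \<mu> (A + 1) \<le> v then 1 else 0)"
      "cnt \<mu> v A = cnt \<mu> v (A - 1) + (if \<mu> A \<le> v then 1 else 0)"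
      "cnt \<nu> v (A + 1) = cnt \<nu> v A + (if \<nu> (A + 1) \<le> v then 1 else 0)"
      "cnt \<nu> v A = cnt \<nu> v (A - 1) + (if \<nu> A \<le> v then 1 else 0)"
      using cnt_step[OF per(1), of v "A + 1"] cnt_step[OF per(1), of v A]
        cnt_step[OF per(2), of v "A + 1"] cnt_step[OF per(2), of v A] by simp_all
    \<comment> \<open>As \<open>\<nu> A < \<nu> (A + 1)\<close>, the counting function of \<nu>
      cannot stay constant at \<open>A\<close> and jump at \<open>A + 1\<close>. If it jumps at
      \<open>A\<close>, the comparison at \<open>A - 1\<close> suffices; if it jumps at neither
      place, the comparison at \<open>A + 1\<close> does.\<close>
    ultimately show ?thesis using le[of v "A + 1"] le[of v "A - 1"] ltA by (auto split: if_splits)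
  qed (simp add: same le)
  moreover have "\<exists>A0. \<forall>A\<ge>A0. cnt (\<mu> \<circ> ?s) v A = cnt \<nu> v A" for v
  proof -
    obtain A B where "\<forall>k\<ge>A. cnt \<mu> v k = cnt \<nu> v k" "\<forall>k\<ge>B. cnt \<mu> v k = cnt (\<mu> \<circ> ?s) v k"
      using assms(1) cnt_eventually_comp_refl[OF per(1)] unfolding below_def by meson
    then show ?thesis by (intro exI[of _ "max A B"]) (metis max.bounded_iff)
  qed
  ultimately show ?thesis using per unfolding below_def by simp
qed

end

section \<open>The structure algebra of the affine moment graph\<close>

text \<open>The reflection representation over an integral domain, reduced to what the structure
  algebra needs: \<open>\<omega> k\<close> is the weight of position \<open>k\<close>, the
  differences \<open>\<omega> a - \<omega> b\<close> are the roots, and \<open>\<sigma> a b\<close>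
  is the ring automorphism attached to a reflection. The last assumption is coprimality of roots of
  different reflections in cancellation form.\<close>

locale affine_weights = affine_refl C n for C n :: int +
  fixes \<omega> :: "int => 'r::idom" and \<sigma> :: "int => int => 'r => 'r" and \<tau> :: 'r
  assumes \<omega>_shift: "\<omega> (k + C) = \<omega> k + \<tau>"
    and \<omega>_ne: "a mod C ~= b mod C ==> \<omega> a ~= \<omega> b"
    and \<sigma>_add: "\<sigma> a b (x + y) = \<sigma> a b x + \<sigma> a b y"
    and \<sigma>_mult: "\<sigma> a b (x * y) = \<sigma> a b x * \<sigma> a b y"
    and \<sigma>_1: "\<sigma> a b 1 = 1"
    and \<sigma>_\<sigma>: "a mod C ~= b mod C ==> \<sigma> a b (\<sigma> a b x) = x"
    and \<sigma>_\<omega>: "a mod C ~= b mod C ==> \<sigma> a b (\<omega> k) = \<omega> (refl a b k)"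
    and \<sigma>_cong: "a mod C ~= b mod C ==> \<omega> a - \<omega> b dvd x - \<sigma> a b x"
    and coprime_roots: "a mod C ~= b mod C ==> c mod C ~= e mod C ==>
      \<not> (\<exists>t. (c, e) = (a + t * C, b + t * C) \<or> (c, e) = (b + t * C, a + t * C)) ==>
      \<omega> c - \<omega> e dvd (\<omega> a - \<omega> b) * x ==> \<omega> c - \<omega> e dvd x"
begin

lemma \<omega>_shift': "\<omega> (k + t * C) = \<omega> k + of_int t * \<tau>"
proof -
  have nat: "\<omega> (k + int m * C) = \<omega> k + of_nat m * \<tau>" for m k
  proof (induction m)
    case (Suc m)
    have "\<omega> (k + int (Suc m) * C) = \<omega> ((k + int m * C) + C)" by (simp add: algebra_simps)
    then show ?case using Suc by (simp only: \<omega>_shift) (simp add: algebra_simps)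
  qed simp
  show ?thesis
  proof (cases "t \<ge> 0")
    case True then show ?thesis using nat[of k "nat t"] by simp
  next
    case False
    then show ?thesis using nat[of "k + t * C" "nat (- t)"] by (simp add: algebra_simps)
  qed
qed

lemma \<omega>_diff_translate: "\<omega> (a + t * C) - \<omega> (b + t * C) = \<omega> a - \<omega> b"
  by (simp add: \<omega>_shift')

lemma \<sigma>_0 [simp]: "\<sigma> a b 0 = 0"
  using \<sigma>_add[of a b 0 0] by (metis add.right_neutral add_cancel_right_right)

lemma \<sigma>_diff: "\<sigma> a b (x - y) = \<sigma> a b x - \<sigma> a b y"
  using \<sigma>_add[of a b "x - y" y] by simp

lemma \<sigma>_uminus: "\<sigma> a b (- x) = - \<sigma> a b x"
  using \<sigma>_diff[of a b 0 x] by simp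

lemma \<sigma>_prod: "\<sigma> a b (\<Prod>i\<in>I. f i) = (\<Prod>i\<in>I. \<sigma> a b (f i))"
  by (induction I rule: infinite_finite_induct) (auto simp: \<sigma>_1 \<sigma>_mult)

text \<open>Sections of the structure sheaf of the affine moment graph over \<open>D\<close>.
  Congruences are required only along edges with both ends in \<open>D\<close>; values outside
  \<open>D\<close> are immaterial.\<close>

definition gkm :: "(int => int) set => ((int => int) => 'r) => bool" where
  "gkm D f \<longleftrightarrow> (\<forall>x\<in>D. \<forall>a b. a mod C ~= b mod C \<longrightarrow> x \<circ> refl a b \<in> D \<longrightarrow>
     \<omega> a - \<omega> b dvd f x - f (x \<circ> refl a b))"

lemma gkmD: "gkm D f ==> x \<in> D ==> a mod C ~= b mod C ==> x \<circ> refl a b \<in> D ==>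
    \<omega> a - \<omega> b dvd f x - f (x \<circ> refl a b)"
  by (auto simp: gkm_def)

lemma gkm_mono: "gkm D f ==> D' \<subseteq> D ==> gkm D' f"
  by (auto simp: gkm_def)

lemma gkm_cong: "gkm D f ==> (\<And>x. x \<in> D ==> g x = f x) ==> gkm D g"
  by (auto simp: gkm_def)

lemma gkm_add: "gkm D f ==> gkm D g ==> gkm D (\<lambda>x. f x + g x)"
  unfolding gkm_def by (metis add_diff_add dvd_add)

lemma gkm_scale: "gkm D f ==> gkm D (\<lambda>x. r * f x)"
  unfolding gkm_def by (metis dvd_mult right_diff_distrib)

text \<open>The reflection takes the edge \<open>(c, e)\<close> at \<open>x\<close> to the edge
  \<open>(refl a b c, refl a b e)\<close> at the mirror image of \<open>x\<close>, and the ring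
  automorphism takes the label of the latter back to \<open>\<omega> c - \<omega> e\<close>.\<close>

lemma gkm_twist:
  assumes "gkm D f" and ab: "a mod C ~= b mod C" and stable: "\<And>x. x \<in> D ==> x \<circ> refl a b \<in> D"
  shows "gkm D (\<lambda>x. \<sigma> a b (f (x \<circ> refl a b)))"
  unfolding gkm_def
proof (intro ballI allI impI)
  fix x c e assume x: "x \<in> D" and ce: "c mod C ~= e mod C" and y: "x \<circ> refl c e \<in> D"
  let ?s = "refl a b"
  have "x \<circ> refl c e \<circ> ?s = x \<circ> ?s \<circ> (?s \<circ> refl c e \<circ> ?s)" by (auto simp: fun_eq_iff)
  also have "\<dots> = x \<circ> ?s \<circ> refl (?s c) (?s e)" by (simp only: refl_conj[OF ce])
  finally have eq: "x \<circ> refl c e \<circ> ?s = x \<circ> ?s \<circ> refl (?s c) (?s e)" .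
  have "\<omega> (?s c) - \<omega> (?s e) dvd f (x \<circ> ?s) - f (x \<circ> ?s \<circ> refl (?s c) (?s e))"
    by (rule gkmD[OF assms(1) stable[OF x]]) (use ce stable[OF y] in \<open>simp_all only: refl_mod_eq_iff eq, auto\<close>)
  then obtain q where "f (x \<circ> ?s) - f (x \<circ> ?s \<circ> refl (?s c) (?s e)) = (\<omega> (?s c) - \<omega> (?s e)) * q" ..
  then have "\<sigma> a b (f (x \<circ> ?s)) - \<sigma> a b (f (x \<circ> ?s \<circ> refl (?s c) (?s e))) = (\<omega> c - \<omega> e) * \<sigma> a b q"
    by (metis \<sigma>_\<omega>[OF ab] \<sigma>_diff \<sigma>_mult refl_refl)
  then show "\<omega> c - \<omega> e dvd \<sigma> a b (f (x \<circ> ?s)) - \<sigma> a b (f (x \<circ> refl c e \<circ> ?s))"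
    by (simp only: eq) simp
qed

text \<open>The quotient exists pointwise because \<open>f x\<close>,
  \<open>f (x \<circ> refl a b)\<close> and the twist of the latter are congruent modulo the root.
  What needs an argument is that the quotients again form a section.\<close>

lemma divided_difference:
  assumes f: "gkm D f" and ab: "a mod C ~= b mod C" and stable: "\<And>x. x \<in> D ==> x \<circ> refl a b \<in> D"
  shows "\<exists>g. gkm D g \<and> (\<forall>x\<in>D. (\<omega> a - \<omega> b) * g x = f x - \<sigma> a b (f (x \<circ> refl a b)))"
proof -
  let ?s = "refl a b" and ?\<alpha> = "\<omega> a - \<omega> b"
  have "\<exists>q. x \<in> D \<longrightarrow> ?\<alpha> * q = f x - \<sigma> a b (f (x \<circ> ?s))" for x
  proof (cases "x \<in> D")
    case True
    have "?\<alpha> dvd (f x - f (x \<circ> ?s)) + (f (x \<circ> ?s) - \<sigma> a b (f (x \<circ> ?s)))"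
      by (rule dvd_add[OF gkmD[OF f True ab stable[OF True]] \<sigma>_cong[OF ab]])
    then show ?thesis by (simp add: dvd_def) metis
  qed auto
  then obtain g where g: "\<And>x. x \<in> D ==> ?\<alpha> * g x = f x - \<sigma> a b (f (x \<circ> ?s))" by metis
  have \<alpha>0: "?\<alpha> ~= 0" using \<omega>_ne[OF ab] by simp
  have ss: "x \<circ> ?s \<circ> ?s = x" for x by (auto simp: fun_eq_iff)
  have "\<omega> c - \<omega> e dvd g x - g (x \<circ> refl c e)"
    if x: "x \<in> D" and ce: "c mod C ~= e mod C" and y: "x \<circ> refl c e \<in> D" for x c e
  proof (cases "\<exists>t. (c, e) = (a + t * C, b + t * C) \<or> (c, e) = (b + t * C, a + t * C)")
    case True
    then obtain t where t: "(c, e) = (a + t * C, b + t * C) \<or> (c, e) = (b + t * C, a + t * C)" ..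
    then have r: "refl c e = ?s" by (auto simp: refl_translate) (metis refl_commute)
    \<comment> \<open>On the edge of the reflection itself the root is anti-invariant; applying
      \<open>\<sigma> a b\<close> to the defining equation shows that \<open>g\<close> takes the
      twisted value at the mirror image.\<close>
    have \<sigma>\<alpha>: "\<sigma> a b ?\<alpha> = - ?\<alpha>" using ab by (simp add: \<sigma>_diff \<sigma>_\<omega>)
    have "\<sigma> a b (?\<alpha> * g x) = - ?\<alpha> * \<sigma> a b (g x)" by (simp only: \<sigma>_mult \<sigma>\<alpha>)
    then have "?\<alpha> * \<sigma> a b (g x) = - \<sigma> a b (?\<alpha> * g x)" by (metis minus_mult_left minus_minus)
    also have "\<dots> = ?\<alpha> * g (x \<circ> ?s)"
      using g[OF x] g[OF stable[OF x]] by (simp only: ss \<sigma>_diff \<sigma>_\<sigma>[OF ab]) simp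
    finally have "g (x \<circ> refl c e) = \<sigma> a b (g x)" using \<alpha>0 r by simp
    moreover have "\<omega> c - \<omega> e = ?\<alpha> \<or> \<omega> c - \<omega> e = - ?\<alpha>" using t \<omega>_diff_translate by auto
    moreover have "?\<alpha> dvd g x - \<sigma> a b (g x)" by (rule \<sigma>_cong[OF ab])
    ultimately show ?thesis by (metis minus_dvd_iff)
  next
    case False
    \<comment> \<open>On any other edge both numerators satisfy the congruence, and the root of the
      reflection cancels by coprimality.\<close>
    have "?\<alpha> * (g x - g (x \<circ> refl c e)) =
        (f x - f (x \<circ> refl c e)) - (\<sigma> a b (f (x \<circ> ?s)) - \<sigma> a b (f (x \<circ> refl c e \<circ> ?s)))"
      using g[OF x] g[OF y] by (simp add: right_diff_distrib)
    moreover have "\<omega> c - \<omega> e dvd \<dots>"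
      by (intro dvd_diff gkmD[OF f x ce y] gkmD[OF gkm_twist[OF f ab stable] x ce y])
    ultimately have "\<omega> c - \<omega> e dvd ?\<alpha> * (g x - g (x \<circ> refl c e))" by simp
    then show ?thesis by (rule coprime_roots[OF ab ce False])
  qed
  then show ?thesis using g unfolding gkm_def by blast
qed

section \<open>Euler classes and patching at a maximal point\<close>

definition euler :: "(int => int) => 'r" where
  "euler \<nu> = (\<Prod>(a, b)\<in>inv_pairs \<nu>. \<omega> a - \<omega> b)"

lemma euler_from: assumes "periodic \<nu>" shows "euler \<nu> = (\<Prod>(a, b)\<in>inv_pairs_from r \<nu>. \<omega> a - \<omega> b)"
proof -
  have "\<omega> (a - t * C) - \<omega> (b - t * C) = \<omega> a - \<omega> b" for a b t
    using \<omega>_diff_translate[of a "- t" b] by simp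
  then have "(\<Prod>(a, b)\<in>inv_pairs_from r \<nu>. \<omega> a - \<omega> b) = (\<Prod>x\<in>inv_pairs_from r \<nu>.
      (\<lambda>(a, b). \<omega> a - \<omega> b) ((\<lambda>(a, b). (a - ((a - 0) div C) * C, b - ((a - 0) div C) * C)) x))"
    by (intro prod.cong) auto
  also have "\<dots> = (\<Prod>(a, b)\<in>inv_pairs_from 0 \<nu>. \<omega> a - \<omega> b)"
    by (rule prod.reindex_bij_betw[OF bij_inv_pairs_from[OF assms]])
  finally show ?thesis by (simp add: euler_def inv_pairs_eq)
qed

text \<open>The inversions of \<open>\<nu>\<close> other than \<open>(i, i + 1)\<close> are the
  reflected inversions of \<open>\<nu> \<circ> refl i (i + 1)\<close>, and the automorphism acts on
  their roots in the same way.\<close>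

lemma euler_simple:
  assumes per: "periodic \<nu>" and lt: "\<nu> i < \<nu> (i + 1)"
  shows "euler \<nu> = (\<omega> i - \<omega> (i + 1)) * \<sigma> i (i + 1) (euler (\<nu> \<circ> refl i (i + 1)))"
proof -
  let ?s = "refl i (i + 1)"
  have ne: "i mod C ~= (i + 1) mod C" by (rule inv_pairs_mod[OF per _ lt]) simp
  have mem: "(i, i + 1) \<in> inv_pairs_from i \<nu>" using lt C_pos by (simp add: inv_pairs_from_def)
  have "\<sigma> i (i + 1) (euler (\<nu> \<circ> ?s)) =
      (\<Prod>x\<in>inv_pairs_from i (\<nu> \<circ> ?s). (\<lambda>(a, b). \<omega> a - \<omega> b) ((\<lambda>(a, b). (?s a, ?s b)) x))"
    using per by (simp add: euler_from[of _ i] \<sigma>_prod case_prod_unfold \<sigma>_diff \<sigma>_\<omega>[OF ne])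
  also have "\<dots> = (\<Prod>(a, b)\<in>inv_pairs_from i \<nu> - {(i, i + 1)}. \<omega> a - \<omega> b)"
    by (rule prod.reindex_bij_betw[OF bij_inv_pairs_simple[OF assms]])
  finally show ?thesis
    using prod.remove[OF finite_inv_pairs_from[OF per] mem, of "\<lambda>(a, b). \<omega> a - \<omega> b"] per
    by (simp add: euler_from[of _ i])
qed

lemma root_dvd_euler:
  assumes per: "periodic \<nu>" and ab: "a < b" "\<nu> a < \<nu> b" shows "\<omega> a - \<omega> b dvd euler \<nu>"
proof -
  have "(a, b) \<in> inv_pairs_from a \<nu>" using ab C_pos by (simp add: inv_pairs_from_def)
  then show ?thesis unfolding euler_from[OF per, of a]
    using dvd_prodI[OF finite_inv_pairs_from[OF per], of "(a, b)" a "\<lambda>(a, b). \<omega> a - \<omega> b"] by simp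
qed

lemma euler_nonzero: assumes "periodic \<nu>" shows "euler \<nu> ~= 0"
  using finite_inv_pairs[OF assms] \<omega>_ne inv_pairs_mod[OF assms]
  by (force simp: euler_def inv_pairs_def prod_zero_iff)

definition down :: "(int => int) => (int => int) set" where
  "down \<nu> = {\<mu>. below \<mu> \<nu>}"

definition delta :: "(int => int) => 'r => (int => int) => 'r" where
  "delta \<nu> r x = (if x = \<nu> then r else 0)"

text \<open>Equal values at \<open>a\<close> and \<open>b\<close> would make the edge a loop, and an
  edge in the ascending direction would lead to a point strictly above the maximal one.\<close>

lemma edge_at_maximal:
  assumes per: "periodic \<nu>" and max: "\<And>x. x \<in> D ==> below \<nu> x ==> x = \<nu>"
    and ab: "a mod C ~= b mod C" and D: "\<nu> \<circ> refl a b \<in> D" and ne: "\<nu> \<circ> refl a b ~= \<nu>"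
  shows "(a < b \<and> \<nu> a < \<nu> b) \<or> (b < a \<and> \<nu> b < \<nu> a)"
proof -
  have "\<nu> a ~= \<nu> b"
  proof
    assume eq: "\<nu> a = \<nu> b"
    have "\<nu> (refl a b k) = \<nu> k" for k
    proof -
      consider t where "k = a + t * C" | t where "k = b + t * C" | "k mod C ~= a mod C" "k mod C ~= b mod C"
        using cong_iff by blast
      then show ?thesis
      proof cases
        case 1 then show ?thesis
          using eq refl_shift[of a b a] ab by (simp only: refl_left periodic_shift[OF per] not_False_eq_True)
      next
        case 2 then show ?thesis
          using eq refl_shift[of a b b] ab by (simp only: refl_right periodic_shift[OF per] not_False_eq_True)
      qed (simp add: refl_def)
    qed
    then show False using ne by (auto simp: fun_eq_iff)
  qed
  moreover have False if cd: "c < d" "\<nu> d < \<nu> c" and "refl c d = refl a b" "c mod C ~= d mod C" for c d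
  proof -
    have "refl c d c = d" "refl c d d = c" using \<open>c mod C ~= d mod C\<close> by auto
    then have "below (\<nu> \<circ> refl c d \<circ> refl c d) (\<nu> \<circ> refl c d)"
      by (intro below_comp_refl) (simp_all add: cd per)
    moreover have "\<nu> \<circ> refl c d \<circ> refl c d = \<nu>" by (auto simp: fun_eq_iff)
    ultimately show False using max[OF D] ne that by simp
  qed
  moreover have "a ~= b" using ab by auto
  ultimately show ?thesis using ab refl_commute[of a b] by (smt (verit))
qed

text \<open>All edges from a maximal point inside \<open>D\<close> descend, so a new value there has
  to be tested only against the inversions of \<open>\<nu>\<close>.\<close>

lemma gkm_patch:
  assumes f: "gkm (D - {\<nu>}) f" and per: "periodic \<nu>"
    and max: "\<And>x. x \<in> D ==> below \<nu> x ==> x = \<nu>"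
    and out: "\<And>a b. a < b ==> \<nu> a < \<nu> b ==> \<nu> \<circ> refl a b \<in> D ==> \<omega> a - \<omega> b dvd r - f (\<nu> \<circ> refl a b)"
  shows "gkm D (f(\<nu> := r))"
proof -
  have key: "\<omega> a - \<omega> b dvd r - f (\<nu> \<circ> refl a b)"
    if neab: "a mod C ~= b mod C" "\<nu> \<circ> refl a b \<in> D" "\<nu> \<circ> refl a b ~= \<nu>" for a b
  proof -
    consider "a < b \<and> \<nu> a < \<nu> b" | "b < a \<and> \<nu> b < \<nu> a"
      using edge_at_maximal[OF per max neab] by blast
    then show ?thesis
    proof cases
      case 2
      then have "\<omega> b - \<omega> a dvd r - f (\<nu> \<circ> refl b a)" using neab refl_commute[of a b] by (intro out) auto
      then show ?thesis using refl_commute[of a b] by (metis minus_diff_eq minus_dvd_iff)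
    qed (use neab out in auto)
  qed
  show ?thesis
    unfolding gkm_def
  proof (intro ballI allI impI)
    fix x a b assume x: "x \<in> D" and ab: "a mod C ~= b mod C" and y: "x \<circ> refl a b \<in> D"
    have xx: "x \<circ> refl a b \<circ> refl a b = x" by (auto simp: fun_eq_iff)
    consider "x = \<nu>" "x \<circ> refl a b = \<nu>" | "x = \<nu>" "x \<circ> refl a b ~= \<nu>" | "x ~= \<nu>" "x \<circ> refl a b = \<nu>"
      | "x ~= \<nu>" "x \<circ> refl a b ~= \<nu>" by blast
    then show "\<omega> a - \<omega> b dvd (f(\<nu> := r)) x - (f(\<nu> := r)) (x \<circ> refl a b)"
    proof cases
      case 3
      then have "x = \<nu> \<circ> refl a b" using xx by simp
      then have "\<omega> a - \<omega> b dvd r - f x" using key[OF ab] x 3 by simp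
      then have "\<omega> a - \<omega> b dvd f x - r" by (metis minus_diff_eq dvd_minus_iff)
      then show ?thesis using 3 by simp
    next
      case 4
      then show ?thesis using gkmD[OF f _ ab] x y by simp
    qed (use key[OF ab] y in auto)
  qed
qed

lemma gkm_delta:
  assumes "periodic \<nu>" "\<And>x. x \<in> D ==> below \<nu> x ==> x = \<nu>"
  shows "gkm D (delta \<nu> (euler \<nu> * r))"
proof -
  have "gkm D ((\<lambda>_. 0)(\<nu> := euler \<nu> * r))"
    by (rule gkm_patch) (use assms root_dvd_euler in \<open>auto simp: gkm_def\<close>)
  moreover have "(\<lambda>_. 0)(\<nu> := euler \<nu> * r) = delta \<nu> (euler \<nu> * r)"
    by (auto simp: delta_def)
  ultimately show ?thesis by simp
qed

lemma down_max: "x \<in> down \<nu> ==> below \<nu> x ==> x = \<nu>"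
  by (auto simp: down_def intro: below_antisym)

text \<open>\<open>J\<close> plays the role of integration over a Bott--Samelson resolution of the closure of the cell
  of \<open>\<nu>\<close>.\<close>

definition integration :: "(int => int) => (((int => int) => 'r) => 'r) => bool" where
  "integration \<nu> J \<longleftrightarrow>
     (\<forall>f g. (\<forall>x\<in>down \<nu>. f x = g x) \<longrightarrow> J f = J g) \<and>
     (\<forall>f g. gkm (down \<nu>) f \<longrightarrow> gkm (down \<nu>) g \<longrightarrow> J (\<lambda>x. f x + g x) = J f + J g) \<and>
     (\<forall>r f. gkm (down \<nu>) f \<longrightarrow> J (\<lambda>x. r * f x) = r * J f) \<and>
     J (delta \<nu> (euler \<nu>)) = 1"

text \<open>The inductive step is integration along a projective line bundle. For an ascent
  \<open>i\<close> of \<open>\<nu>\<close>, the integral \<open>J'\<close> below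
  \<open>\<nu> \<circ> refl i (i + 1)\<close> is applied to a section and to its twist, and the
  difference is divided by the simple root. The lifting property makes the twist meaningful on
  \<open>down \<nu>\<close>.\<close>

lemma integration_exists:
  assumes "periodic \<nu>" shows "\<exists>J. integration \<nu> J"
  using assms
proof (induction "card (inv_pairs \<nu>)" arbitrary: \<nu>)
  case 0
  then have "inv_pairs \<nu> = {}" using finite_inv_pairs by auto
  then have "integration \<nu> (\<lambda>f. f \<nu>)" using 0 by (auto simp: integration_def delta_def euler_def down_def)
  then show ?case by blast
next
  case (Suc m)
  then have "inv_pairs \<nu> ~= {}" by auto
  then obtain i where lt: "\<nu> i < \<nu> (i + 1)" using ex_ascent by blast
  let ?s = "refl i (i + 1)" and ?\<alpha> = "\<omega> i - \<omega> (i + 1)" and ?\<sigma> = "\<sigma> i (i + 1)"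
  let ?\<nu>' = "\<nu> \<circ> ?s"
  have per: "periodic \<nu>" "periodic ?\<nu>'" using Suc.prems by auto
  have ne: "i mod C ~= (i + 1) mod C" by (rule inv_pairs_mod[OF per(1) _ lt]) simp
  have \<alpha>0: "?\<alpha> ~= 0" using \<omega>_ne[OF ne] by simp
  have \<sigma>\<alpha>: "?\<sigma> ?\<alpha> = - ?\<alpha>" using ne by (simp add: \<sigma>_diff \<sigma>_\<omega>)
  have "m = card (inv_pairs ?\<nu>')" using card_inv_pairs_simple[of \<nu> i] per lt Suc.hyps(2) by simp
  then obtain J' where J': "integration ?\<nu>' J'" using Suc.hyps(1) per by blast
  have ext': "J' f = J' g" if "\<And>x. x \<in> down ?\<nu>' ==> f x = g x" for f g
    using J' that unfolding integration_def by blast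
  have add': "J' (\<lambda>x. f x + g x) = J' f + J' g" if "gkm (down ?\<nu>') f" "gkm (down ?\<nu>') g" for f g
    using J' that unfolding integration_def by blast
  have scale': "J' (\<lambda>x. r * f x) = r * J' f" if "gkm (down ?\<nu>') f" for f r
    using J' that unfolding integration_def by blast
  have one': "J' (delta ?\<nu>' (euler ?\<nu>')) = 1" using J' unfolding integration_def by blast
  have stable: "x \<circ> ?s \<in> down \<nu>" if "x \<in> down \<nu>" for x
    using that below_lift[OF _ lt] by (auto simp: down_def)
  have sub: "down ?\<nu>' \<subseteq> down \<nu>"
    using below_trans below_comp_refl[OF per(1) _ lt] by (force simp: down_def)
  let ?t = "\<lambda>f x. ?\<sigma> (f (x \<circ> ?s))"
  have tw: "gkm (down \<nu>) (?t f)" if "gkm (down \<nu>) f" for f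
    by (rule gkm_twist[OF that ne stable])
  \<comment> \<open>A section differs from its twist by the root times its divided difference;
    \<open>J'\<close> is linear over the ring, and \<open>\<sigma>_cong\<close> accounts for the
    outer automorphism.\<close>
  have dvd: "?\<alpha> dvd J' f - ?\<sigma> (J' (?t f))" if f: "gkm (down \<nu>) f" for f
  proof -
    obtain g where g: "gkm (down \<nu>) g" "\<And>x. x \<in> down \<nu> ==> ?\<alpha> * g x = f x - ?t f x"
      using divided_difference[OF f ne stable] by blast
    have gd: "gkm (down ?\<nu>') g" using g(1) gkm_mono sub by blast
    have "J' f = J' (\<lambda>x. ?\<alpha> * g x + ?t f x)"
      by (rule ext') (use g(2) sub in auto)
    also have "\<dots> = J' (\<lambda>x. ?\<alpha> * g x) + J' (?t f)"
      by (rule add') (use gkm_scale[OF gd] tw[OF f] gkm_mono sub in blast)+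
    also have "\<dots> = ?\<alpha> * J' g + J' (?t f)" by (simp only: scale'[OF gd])
    finally have "J' f - ?\<sigma> (J' (?t f)) = ?\<alpha> * J' g + (J' (?t f) - ?\<sigma> (J' (?t f)))" by simp
    then show ?thesis using \<sigma>_cong[OF ne] by (metis dvd_add dvd_triv_left)
  qed
  \<comment> \<open>The choice refers only to the right-hand side of the equation. Hence even for
    functions that are not sections \<open>J f\<close> depends only on the values of
    \<open>f\<close> on \<open>down \<nu>\<close>.\<close>
  define J where "J f = (SOME q. ?\<alpha> * q = ?\<sigma> (J' (?t f)) - J' f)" for f
  have J: "?\<alpha> * J f = ?\<sigma> (J' (?t f)) - J' f" if ff: "gkm (down \<nu>) f" for f
  proof -
    have "\<exists>q. ?\<alpha> * q = ?\<sigma> (J' (?t f)) - J' f" proof -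
      obtain k where "J' f - ?\<sigma> (J' (?t f)) = ?\<alpha> * k" using dvd[OF ff] ..
      then have "?\<alpha> * (- k) = ?\<sigma> (J' (?t f)) - J' f" by (metis mult_minus_right minus_diff_eq)
      then show ?thesis by (rule exI)
    qed
    then show ?thesis unfolding J_def by (rule someI_ex)
  qed
  have "J f = J g" if "\<forall>x\<in>down \<nu>. f x = g x" for f g
  proof -
    have "J' f = J' g" by (rule ext') (use that sub in auto)
    moreover have "J' (?t f) = J' (?t g)" by (rule ext') (use that sub stable in auto)
    ultimately show ?thesis by (simp add: J_def)
  qed
  moreover have "J (\<lambda>x. f x + g x) = J f + J g" if f: "gkm (down \<nu>) f" and g: "gkm (down \<nu>) g" for f g
  proof -
    have "J' (\<lambda>x. f x + g x) = J' f + J' g"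
      by (rule add') (use f g gkm_mono sub in blast)+
    moreover have "J' (?t (\<lambda>x. f x + g x)) = J' (?t f) + J' (?t g)"
      using add'[OF gkm_mono[OF tw[OF f] sub] gkm_mono[OF tw[OF g] sub]] by (simp only: \<sigma>_add)
    ultimately have "?\<alpha> * J (\<lambda>x. f x + g x) = ?\<sigma> (J' (?t f) + J' (?t g)) - (J' f + J' g)"
      using J[OF gkm_add[OF f g]] by (simp only:)
    also have "\<dots> = ?\<alpha> * J f + ?\<alpha> * J g" by (simp only: J[OF f] J[OF g] \<sigma>_add) simp
    also have "\<dots> = ?\<alpha> * (J f + J g)" by (simp only: distrib_left)
    finally have "?\<alpha> * J (\<lambda>x. f x + g x) = ?\<alpha> * (J f + J g)" .
    then show ?thesis using \<alpha>0 by simp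
  qed
  moreover have "J (\<lambda>x. r * f x) = r * J f" if f: "gkm (down \<nu>) f" for f r
  proof -
    have "J' (\<lambda>x. r * f x) = r * J' f"
      by (rule scale') (use f gkm_mono sub in blast)
    moreover have "J' (?t (\<lambda>x. r * f x)) = ?\<sigma> r * J' (?t f)"
      using scale'[OF gkm_mono[OF tw[OF f] sub]] by (simp only: \<sigma>_mult)
    ultimately have "?\<alpha> * J (\<lambda>x. r * f x) = ?\<sigma> (?\<sigma> r * J' (?t f)) - r * J' f"
      using J[OF gkm_scale[OF f, of r]] by (simp only:)
    also have "\<dots> = r * (?\<alpha> * J f)" by (simp only: J[OF f] \<sigma>_mult \<sigma>_\<sigma>[OF ne] right_diff_distrib)
    also have "\<dots> = ?\<alpha> * (r * J f)" by (rule mult.left_commute)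
    finally have "?\<alpha> * J (\<lambda>x. r * f x) = ?\<alpha> * (r * J f)" .
    then show ?thesis using \<alpha>0 by simp
  qed
  moreover have "J (delta \<nu> (euler \<nu>)) = 1"
  proof -
    have gd: "gkm (down \<nu>) (delta \<nu> (euler \<nu>))"
      using gkm_delta[OF per(1) down_max, where r = 1] by simp
    have gd': "gkm (down ?\<nu>') (delta ?\<nu>' (euler ?\<nu>'))"
      using gkm_delta[OF per(2) down_max, where r = 1] by simp
    have nn: "?\<nu>' ~= \<nu>" using lt ne by (metis comp_apply less_irrefl refl_left)
    have "\<nu> \<notin> down ?\<nu>'"
      using below_antisym below_comp_refl[OF per(1) _ lt] nn by (force simp: down_def)
    \<comment> \<open>The class at \<nu> vanishes on the smaller lower set. As \<open>J'\<close> is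
      known to be linear on sections only, the zero function is written as a multiple of
      one.\<close>
    then have "J' (delta \<nu> (euler \<nu>)) = J' (\<lambda>x. 0 * delta ?\<nu>' (euler ?\<nu>') x)"
      by (intro ext') (auto simp: delta_def)
    then have 1: "J' (delta \<nu> (euler \<nu>)) = 0" using scale'[OF gd', of 0] by simp
    have eqv: "x \<circ> ?s = \<nu> \<longleftrightarrow> x = ?\<nu>'" for x by (auto simp: fun_eq_iff) (metis refl_refl)
    \<comment> \<open>The twisted class is supported at the reflected point and is there minus the
      root times the Euler class of that point, so its integral is known by induction.\<close>
    have "?\<sigma> (euler \<nu>) = (- ?\<alpha>) * euler ?\<nu>'"
      using euler_simple[OF per(1) lt] by (simp add: \<sigma>_mult \<sigma>\<alpha> \<sigma>_\<sigma>[OF ne])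
    then have "?t (delta \<nu> (euler \<nu>)) = (\<lambda>x. (- ?\<alpha>) * delta ?\<nu>' (euler ?\<nu>') x)"
      by (auto simp: delta_def eqv)
    then have "J' (?t (delta \<nu> (euler \<nu>))) = - ?\<alpha>" using scale'[OF gd', of "- ?\<alpha>"] one' by simp
    then have "?\<alpha> * J (delta \<nu> (euler \<nu>)) = ?\<alpha> * 1" using J[OF gd]
      by (simp only: 1 \<sigma>_uminus \<sigma>\<alpha> mult_1_right) simp
    then show ?thesis using \<alpha>0 by simp
  qed
  ultimately have "integration \<nu> J" unfolding integration_def by blast
  then show ?case by blast
qed

text \<open>Duality for the integral. For each descending edge the Euler class is divided by the
  label of the edge; the quotient times \<open>f\<close>, completed at \<nu> by its value at the
  other end, is a section, and its integral exhibits the required divisibility.\<close>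

lemma gkm_extend_max:
  assumes f: "gkm (D - {\<nu>}) f" and per: "periodic \<nu>"
    and max: "\<And>x. x \<in> D ==> below \<nu> x ==> x = \<nu>" and down: "down \<nu> \<subseteq> D"
  shows "\<exists>r. gkm D (f(\<nu> := r))"
proof -
  obtain J where J: "integration \<nu> J" using integration_exists[OF per] by blast
  let ?\<pi> = "euler \<nu>"
  have J_add: "J (\<lambda>x. f x + g x) = J f + J g" if "gkm (down \<nu>) f" "gkm (down \<nu>) g" for f g
    using J that unfolding integration_def by blast
  have J_scale: "J (\<lambda>x. r * f x) = r * J f" if "gkm (down \<nu>) f" for f r
    using J that unfolding integration_def by blast
  have J_one: "J (delta \<nu> ?\<pi>) = 1" using J unfolding integration_def by blast
  have sub: "down \<nu> - {\<nu>} \<subseteq> D - {\<nu>}" using down by auto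
  have fd: "gkm (down \<nu> - {\<nu>}) f" by (rule gkm_mono[OF f sub])
  have g0: "gkm (down \<nu>) ((\<lambda>x. ?\<pi> * f x)(\<nu> := 0))"
    by (rule gkm_patch[OF gkm_scale[OF fd] per down_max]) (use root_dvd_euler[OF per] in auto)
  \<comment> \<open>If \<open>F\<close> is the extension with value \<open>r\<close> at \<nu>, then
    the Euler class times \<open>F\<close> is the extension by zero plus \<open>r\<close> times a
    class of integral one. The value chosen here makes the integral of \<open>F\<close> vanish;
    other admissible values differ by multiples of the Euler class.\<close>
  define r where "r = - J ((\<lambda>x. ?\<pi> * f x)(\<nu> := 0))"
  have "gkm D (f(\<nu> := r))"
  proof (rule gkm_patch[OF f per max])
    fix a b assume ab: "a < b" "\<nu> a < \<nu> b" and D: "\<nu> \<circ> refl a b \<in> D"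
    let ?y = "\<nu> \<circ> refl a b"
    have neab: "a mod C ~= b mod C" by (rule inv_pairs_mod[OF per ab])
    have "(a, b) \<in> inv_pairs_from a \<nu>" using ab C_pos by (simp add: inv_pairs_from_def)
    then have \<pi>: "?\<pi> = (\<omega> a - \<omega> b) * (\<Prod>(c, e)\<in>inv_pairs_from a \<nu> - {(a, b)}. \<omega> c - \<omega> e)"
      (is "_ = _ * ?h")
      using prod.remove[OF finite_inv_pairs_from[OF per], of "(a, b)" a "\<lambda>(a, b). \<omega> a - \<omega> b"]
      by (simp add: euler_from[OF per, of a])
    \<comment> \<open>Along the edge of \<open>(a, b)\<close> both values agree; along any other
      edge the label divides the factor \<open>?h\<close>, from which only the root of
      \<open>(a, b)\<close> was removed.\<close>
    have g1: "gkm (down \<nu>) ((\<lambda>x. ?h * f x)(\<nu> := ?h * f ?y))"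
    proof (rule gkm_patch[OF gkm_scale[OF fd] per down_max])
      fix c e assume ce: "c < e" "\<nu> c < \<nu> e" and "\<nu> \<circ> refl c e \<in> down \<nu>"
      have nece: "c mod C ~= e mod C" by (rule inv_pairs_mod[OF per ce])
      show "\<omega> c - \<omega> e dvd ?h * f ?y - ?h * f (\<nu> \<circ> refl c e)"
      proof (cases "\<exists>t. c = a + t * C \<and> e = b + t * C")
        case True
        then have "refl c e = refl a b" using refl_translate by auto
        then show ?thesis by simp
      next
        case False
        have "\<omega> c - \<omega> e dvd ?h"
        proof -
          have "(c, e) \<in> inv_pairs_from c \<nu>" using ce C_pos by (simp add: inv_pairs_from_def)
          from bij_betw_apply[OF bij_inv_pairs_from[OF per, where r = c and r' = a] this]
          obtain t where "(c - t * C, e - t * C) \<in> inv_pairs_from a \<nu>" by auto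
          moreover have "(c - t * C, e - t * C) ~= (a, b)" using False by (metis diff_add_cancel prod.inject)
          ultimately have "\<omega> (c - t * C) - \<omega> (e - t * C) dvd ?h"
            using dvd_prodI[of "inv_pairs_from a \<nu> - {(a, b)}" "(c - t * C, e - t * C)" "\<lambda>(a, b). \<omega> a - \<omega> b"]
              finite_inv_pairs_from[OF per] by simp
          then show ?thesis using \<omega>_diff_translate[of c "- t" e] by simp
        qed
        then show ?thesis by (simp add: right_diff_distrib[symmetric])
      qed
    qed auto
    have gd: "gkm (down \<nu>) (delta \<nu> ?\<pi>)" using gkm_delta[OF per down_max, where r = 1] by simp
    have yn: "?y ~= \<nu>" using ab neab by (metis comp_apply less_irrefl refl_left)
    \<comment> \<open>Restoring the removed root gives the extension by zero plus
      \<open>f ?y\<close> times the class of integral one. The resulting equation says that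
      \<open>r - f ?y\<close> is a multiple of the root.\<close>
    have "(\<omega> a - \<omega> b) * J ((\<lambda>x. ?h * f x)(\<nu> := ?h * f ?y)) =
        J (\<lambda>x. (\<omega> a - \<omega> b) * ((\<lambda>x. ?h * f x)(\<nu> := ?h * f ?y)) x)"
      by (rule J_scale[OF g1, symmetric])
    also have "(\<lambda>x. (\<omega> a - \<omega> b) * ((\<lambda>x. ?h * f x)(\<nu> := ?h * f ?y)) x) =
        (\<lambda>x. ((\<lambda>x. ?\<pi> * f x)(\<nu> := 0)) x + f ?y * delta \<nu> ?\<pi> x)"
      by (rule ext) (simp add: delta_def \<pi> algebra_simps)
    also have "J \<dots> = J ((\<lambda>x. ?\<pi> * f x)(\<nu> := 0)) + J (\<lambda>x. f ?y * delta \<nu> ?\<pi> x)"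
      by (rule J_add[OF g0 gkm_scale[OF gd]])
    also have "J (\<lambda>x. f ?y * delta \<nu> ?\<pi> x) = f ?y * 1"
      by (simp only: J_scale[OF gd] J_one)
    finally have eq: "(\<omega> a - \<omega> b) * J ((\<lambda>x. ?h * f x)(\<nu> := ?h * f ?y)) =
        J ((\<lambda>x. ?\<pi> * f x)(\<nu> := 0)) + f ?y * 1" .
    have "r - f ?y = - (J ((\<lambda>x. ?\<pi> * f x)(\<nu> := 0)) + f ?y * 1)"
      by (simp only: r_def mult_1_right minus_add_distrib diff_conv_add_uminus)
    then have "r - f ?y = (\<omega> a - \<omega> b) * (- J ((\<lambda>x. ?h * f x)(\<nu> := ?h * f ?y)))"
      by (simp only: eq[symmetric] mult_minus_right)
    then show "\<omega> a - \<omega> b dvd r - f ?y" by (metis dvd_triv_left)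
  qed
  then show ?thesis ..
qed

text \<open>Points are added one at a time, each maximal in the enlarged lower set, so that
  \<open>gkm_extend_max\<close> applies.\<close>

lemma gkm_extend:
  assumes "finite D" and per: "\<And>x. x \<in> D ==> periodic x"
    and D: "\<And>x. x \<in> D ==> down x \<subseteq> D" and D': "\<And>x. x \<in> D' ==> down x \<subseteq> D'" "D' \<subseteq> D" and f: "gkm D' f"
  shows "\<exists>g. gkm D g \<and> (\<forall>x\<in>D'. g x = f x)"
  using D' f
proof (induction "card (D - D')" arbitrary: D' f)
  case 0
  then show ?case using assms(1) by auto
next
  case (Suc m)
  have "finite (D - D')" "D - D' ~= {}" using Suc.hyps(2) assms(1) by (simp, metis card.empty nat.distinct(1))
  then obtain \<nu>0 where "\<nu>0 \<in> D - D'" by auto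
  \<comment> \<open>A point of the complement with fewest points of \<open>D\<close> below it is
    minimal there, so everything strictly below it already belongs to \<open>D'\<close>.\<close>
  then obtain \<nu> where \<nu>: "\<nu> \<in> D - D'"
    and least: "\<forall>y. y \<in> D - D' \<longrightarrow> card (down \<nu> \<inter> D) \<le> card (down y \<inter> D)"
    using ex_has_least_nat[of "\<lambda>x. x \<in> D - D'" _ "\<lambda>x. card (down x \<inter> D)"] by blast
  have min: "y = \<nu>" if y: "y \<in> D - D'" and le: "below y \<nu>" for y
  proof (rule ccontr)
    assume "y ~= \<nu>"
    then have "\<not> below \<nu> y" using below_antisym[OF le] by blast
    moreover have "below \<nu> \<nu>" using per \<nu> by simp
    ultimately have "down y \<inter> D \<subset> down \<nu> \<inter> D"
      using le \<nu> by (auto simp: down_def intro: below_trans)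
    then have "card (down y \<inter> D) < card (down \<nu> \<inter> D)" using assms(1) by (intro psubset_card_mono) auto
    then show False using least y by (metis linorder_not_le)
  qed
  have dn: "down \<nu> \<subseteq> insert \<nu> D'"
  proof
    fix y assume "y \<in> down \<nu>"
    then have "below y \<nu>" "y \<in> D" using D[of \<nu>] \<nu> by (auto simp: down_def)
    then show "y \<in> insert \<nu> D'" using min by blast
  qed
  have down': "down x \<subseteq> insert \<nu> D'" if "x \<in> insert \<nu> D'" for x
    using that dn Suc.prems(1) by auto
  have "gkm (insert \<nu> D' - {\<nu>}) f" using Suc.prems(3) by (rule gkm_mono) auto
  moreover have "x = \<nu>" if "x \<in> insert \<nu> D'" "below \<nu> x" for x
    using that Suc.prems(1)[of x] \<nu> by (auto simp: down_def)
  ultimately obtain r where r: "gkm (insert \<nu> D') (f(\<nu> := r))"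
    using gkm_extend_max[of "insert \<nu> D'" \<nu> f] per \<nu> dn by auto
  have "m = card (D - insert \<nu> D')"
  proof -
    have "D - insert \<nu> D' = (D - D') - {\<nu>}" by auto
    then show ?thesis using Suc.hyps(2) \<nu> assms(1) by (simp add: card_Diff_singleton)
  qed
  then obtain g where "gkm D g" "\<forall>x\<in>insert \<nu> D'. g x = (f(\<nu> := r)) x"
    using Suc.hyps(1)[of "insert \<nu> D'" "f(\<nu> := r)"] down' Suc.prems(2) \<nu> r by (metis Diff_iff insert_subset)
  then show ?case using \<nu> by (intro exI[of _ g]) auto
qed

text \<open>The points not strictly above \<open>\<nu>\<close> form a lower set in which
  \<open>\<nu>\<close> is maximal. The class concentrated at \<open>\<nu>\<close> with the Euler
  class as value is a section there and extends.\<close>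

lemma gkm_class_exists:
  assumes "finite D" and per: "\<And>x. x \<in> D ==> periodic x" and D: "\<And>x. x \<in> D ==> down x \<subseteq> D" and \<nu>: "\<nu> \<in> D"
  shows "\<exists>p. gkm D p \<and> p \<nu> = euler \<nu> \<and> (\<forall>x\<in>D. \<not> below \<nu> x \<longrightarrow> p x = 0)"
proof -
  define D' where "D' = {x \<in> D. below \<nu> x \<longrightarrow> x = \<nu>}"
  have "gkm D' (delta \<nu> (euler \<nu>))"
    using gkm_delta[of \<nu> D' 1] per \<nu> by (auto simp: D'_def)
  moreover have "down x \<subseteq> D'" if "x \<in> D'" for x
    using that D by (auto simp: D'_def down_def intro: below_trans below_antisym)
  moreover have "D' \<subseteq> D" by (auto simp: D'_def)
  ultimately obtain p where p: "gkm D p" "\<forall>x\<in>D'. p x = delta \<nu> (euler \<nu>) x"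
    using gkm_extend[OF assms(1) per D, of D' "delta \<nu> (euler \<nu>)"] by metis
  then show ?thesis using \<nu> per by (intro exI[of _ p]) (auto simp: D'_def delta_def)
qed

text \<open>The lower ends of all descending edges carry the value zero, so each label divides
  \<open>f x\<close>; by coprimality their product does. Together with the existence of classes this
  gives triangular bases.\<close>

lemma euler_dvd:
  assumes f: "gkm D f" and x: "x \<in> D" "periodic x" and D: "down x \<subseteq> D"
    and zero: "\<And>y. y \<in> D ==> below y x ==> y ~= x ==> f y = 0"
  shows "euler x dvd f x"
proof -
  have "(\<Prod>(a, b)\<in>I. \<omega> a - \<omega> b) dvd f x" if "finite I" "I \<subseteq> inv_pairs x" for I
    using that
  proof (induction I)
    case (insert p I)
    obtain a b where p: "p = (a, b)" by fastforce
    have ab: "a < b" "x a < x b" "0 \<le> a" "a < C" using insert.prems p by (auto simp: inv_pairs_def)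
    have neab: "a mod C ~= b mod C" by (rule inv_pairs_mod[OF x(2) ab(1,2)])
    have bl: "below (x \<circ> refl a b) x" by (rule below_comp_refl[OF x(2) ab(1,2)])
    have yD: "x \<circ> refl a b \<in> D" using bl D by (auto simp: down_def)
    have "x \<circ> refl a b ~= x" using ab neab by (metis comp_apply less_irrefl refl_left)
    then have "\<omega> a - \<omega> b dvd f x" using gkmD[OF f x(1) neab yD] zero[OF yD bl] by simp
    moreover obtain q where q: "f x = (\<Prod>(a, b)\<in>I. \<omega> a - \<omega> b) * q" using insert by auto
    \<comment> \<open>The new root divides the product of the earlier roots with \<open>q\<close>;
      it is moved past these roots one by one. The normalisation of first entries to
      \<open>[0, C)\<close> excludes translates of the same pair.\<close>
    moreover have "\<omega> a - \<omega> b dvd q" if "finite K" "K \<subseteq> I" "\<omega> a - \<omega> b dvd (\<Prod>(a, b)\<in>K. \<omega> a - \<omega> b) * q" for K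
      using that
    proof (induction K)
      case (insert k K)
      obtain c e where k: "k = (c, e)" by fastforce
      have "(c, e) \<in> inv_pairs x" "(c, e) ~= (a, b)"
        using \<open>insert p I \<subseteq> inv_pairs x\<close> \<open>p \<notin> I\<close> insert.prems k p by auto
      then have ce: "c < e" "x c < x e" "0 \<le> c" "c < C" and ne2: "(c, e) ~= (a, b)"
        by (auto simp: inv_pairs_def)
      have nece: "c mod C ~= e mod C" by (rule inv_pairs_mod[OF x(2) ce(1,2)])
      have "\<not> (\<exists>t. (a, b) = (c + t * C, e + t * C) \<or> (a, b) = (e + t * C, c + t * C))"
      proof
        assume "\<exists>t. (a, b) = (c + t * C, e + t * C) \<or> (a, b) = (e + t * C, c + t * C)"
        then obtain t where "(a, b) = (c + t * C, e + t * C) \<or> (a, b) = (e + t * C, c + t * C)" ..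
        then show False
        proof
          assume t: "(a, b) = (c + t * C, e + t * C)"
          then have "a mod C = c mod C" by auto
          then have "a = c" using ab ce by simp
          then show False using t ne2 C_pos by auto
        qed (use ab ce in auto)
      qed
      moreover have "\<omega> a - \<omega> b dvd (\<omega> c - \<omega> e) * ((\<Prod>(a, b)\<in>K. \<omega> a - \<omega> b) * q)"
        using insert.prems(2) insert.hyps k by (simp add: mult.assoc)
      ultimately have "\<omega> a - \<omega> b dvd (\<Prod>(a, b)\<in>K. \<omega> a - \<omega> b) * q"
        using coprime_roots[OF nece neab] by blast
      then show ?case using insert by auto
    qed simp
    ultimately have "\<omega> a - \<omega> b dvd q" using insert.hyps(1) by auto
    then show ?case using insert.hyps p q by (auto simp: mult_ac dvd_def)
  qed simp
  then show ?thesis unfolding euler_def using finite_inv_pairs[OF x(2)] by blast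
qed

end

section \<open>Linear forms as weights\<close>

lemma lookup_var: "Poly_Mapping.lookup (var i) m = (if m = Poly_Mapping.single i 1 then 1 else 0)"
  by (auto simp: var_def lookup_single when_def)

lemma lookup_of_int_var:
  "Poly_Mapping.lookup (of_int z * var i) m = (if m = Poly_Mapping.single i 1 then of_int z else 0)"
proof -
  have "of_int z * var i = Poly_Mapping.single (Poly_Mapping.single i 1) (of_int z)"
    unfolding single_of_int[symmetric] var_def mult_single by simp
  then show ?thesis by (auto simp: lookup_single when_def)
qed

lemma single_1_eq [simp]: "Poly_Mapping.single i (1::nat) = Poly_Mapping.single j 1 \<longleftrightarrow> i = j"
proof
  assume "Poly_Mapping.single i (1::nat) = Poly_Mapping.single j 1"
  then have "Poly_Mapping.lookup (Poly_Mapping.single i (1::nat)) i = Poly_Mapping.lookup (Poly_Mapping.single j 1) i" by simp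
  then show "i = j" by (auto simp: lookup_single when_def split: if_splits)
qed simp

lemma single_Suc_0_eq [simp]: "Poly_Mapping.single i (Suc 0) = Poly_Mapping.single j (Suc 0) \<longleftrightarrow> i = j"
  using single_1_eq by simp

lemma linear_form_eq_0_iff:
  assumes "i \<ge> 1" "j \<ge> 1"
  shows "var i - var j + of_int z * var 0 = 0 \<longleftrightarrow> i = j \<and> z = 0"
proof
  assume eq: "var i - var j + of_int z * var 0 = 0"
  have "Poly_Mapping.lookup (var i - var j + of_int z * var 0) (Poly_Mapping.single k 1) = 0" for k
    using eq by simp
  from this[of i] this[of 0] assms show "i = j \<and> z = 0"
    unfolding lookup_add lookup_minus lookup_var lookup_of_int_var by (auto split: if_splits)
qed auto

text \<open>\<open>cls\<close> assigns a variable to each residue class of positions and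
  \<open>off\<close> the coefficient of the loop variable. Index 0 is kept for that loop variable,
  whence \<open>cls k \<ge> 1\<close>.\<close>

locale affine_poly = affine_refl C n for C n :: int +
  fixes cls :: "int => nat" and off :: "int => int"
  assumes cls_pos: "cls k \<ge> 1"
    and cls_eq_iff: "cls k = cls l \<longleftrightarrow> k mod C = l mod C"
    and off_shift: "off (k + C) = off k + n"
begin

definition \<omega> :: "int => poly_R" where
  "\<omega> k = var (cls k) + of_int (off k) * var 0"

text \<open>The substitution is forced by exchanging \<open>\<omega> a\<close> and
  \<open>\<omega> b\<close> and fixing \<open>var 0\<close>, because \<open>var (cls a)\<close>
  equals \<open>\<omega> a\<close> minus \<open>off a\<close> times \<open>var 0\<close>.\<close>

definition \<sigma> :: "int => int => poly_R => poly_R" where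
  "\<sigma> a b = psubst (\<lambda>i. if i = cls a then \<omega> b - of_int (off a) * var 0
     else if i = cls b then \<omega> a - of_int (off b) * var 0 else var i)"

lemma off_shift': "off (k + t * C) = off k + t * n"
proof -
  have nat: "off (k + int m * C) = off k + int m * n" for m k
  proof (induction m)
    case (Suc m)
    have "off (k + int (Suc m) * C) = off ((k + int m * C) + C)" by (simp add: algebra_simps)
    then show ?case using Suc by (simp only: off_shift) (simp add: algebra_simps)
  qed simp
  show ?thesis
  proof (cases "t \<ge> 0")
    case True then show ?thesis using nat[of k "nat t"] by simp
  next
    case False
    then show ?thesis using nat[of "k + t * C" "nat (- t)"] by (simp add: algebra_simps)
  qed
qed

lemma cls_shift [simp]: "cls (k + t * C) = cls k"
  by (simp add: cls_eq_iff)

lemma \<omega>_translate: "\<omega> (k + t * C) = \<omega> k + of_int (t * n) * var 0"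
  by (simp add: \<omega>_def off_shift' distrib_right)

lemma \<omega>_diff: "\<omega> a - \<omega> b = var (cls a) - var (cls b) + of_int (off a - off b) * var 0"
  by (simp add: \<omega>_def algebra_simps)

lemma \<omega>_eq_iff: "\<omega> a = \<omega> b \<longleftrightarrow> a = b"
proof
  assume "\<omega> a = \<omega> b"
  then have "cls a = cls b" "off a = off b"
    using linear_form_eq_0_iff[OF cls_pos cls_pos, of a b "off a - off b"] \<omega>_diff[of a b] by simp_all
  then obtain t where "a = b + t * C" "off a = off b" unfolding cls_eq_iff cong_iff by blast
  then show "a = b" using n_pos' by (simp add: off_shift')
qed simp

lemma cls_0 [simp]: "cls a ~= 0" "0 ~= cls a"
  using cls_pos[of a] by auto

lemma \<sigma>_\<omega>_eq: assumes ne: "a mod C ~= b mod C" shows "\<sigma> a b (\<omega> k) = \<omega> (refl a b k)"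
proof -
  have ab: "cls a ~= cls b" "cls b ~= cls a" using ne cls_eq_iff by metis+
  consider t where "k = a + t * C" | t where "k = b + t * C" | "k mod C ~= a mod C" "k mod C ~= b mod C"
    using cong_iff by blast
  then show ?thesis
  proof cases
    case 1
    then have "refl a b k = b + t * C" using refl_shift[of a b a t] ne by simp
    moreover have "\<sigma> a b (\<omega> k) = \<omega> b - of_int (off a) * var 0 + of_int (off a + t * n) * var 0"
      unfolding 1 \<omega>_def[of "a + t * C"] by (simp add: \<sigma>_def psubst_add psubst_mult off_shift')
    ultimately show ?thesis by (simp add: \<omega>_translate distrib_right)
  next
    case 2
    then have "refl a b k = a + t * C" using refl_shift[of a b b t] ne by simp
    moreover have "\<sigma> a b (\<omega> k) = \<omega> a - of_int (off b) * var 0 + of_int (off b + t * n) * var 0"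
      unfolding 2 \<omega>_def[of "b + t * C"] using ab by (simp add: \<sigma>_def psubst_add psubst_mult off_shift')
    ultimately show ?thesis by (simp add: \<omega>_translate distrib_right)
  next
    case 3
    then have "cls k ~= cls a" "cls k ~= cls b" by (simp_all add: cls_eq_iff)
    then show ?thesis using 3 by (simp add: refl_def \<sigma>_def \<omega>_def psubst_add psubst_mult)
  qed
qed

text \<open>Modulo the root of \<open>(c, e)\<close> the variable \<open>cls c\<close> can be
  eliminated. The other root survives as a nonzero linear form unless it is proportional, which
  happens only for translates of the same pair in either order.\<close>

lemma root_nondivisor:
  assumes ab: "a mod C ~= b mod C" and ce: "c mod C ~= e mod C"
    and ne: "\<not> (\<exists>t. (c, e) = (a + t * C, b + t * C) \<or> (c, e) = (b + t * C, a + t * C))"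
    and dvd: "\<omega> c - \<omega> e dvd (\<omega> a - \<omega> b) * x"
  shows "\<omega> c - \<omega> e dvd x"
proof -
  let ?q = "\<omega> e - of_int (off c) * var 0" and ?\<beta> = "\<omega> c - \<omega> e"
  let ?S = "psubst (var(cls c := ?q))"
  have ce': "cls e ~= cls c" and ab': "cls a ~= cls b" using ce ab cls_eq_iff by metis+
  have var_q: "var (cls c) - ?q = ?\<beta>" by (simp add: \<omega>_def)
  have S\<beta>: "?S ?\<beta> = 0"
    using ce' by (simp add: \<omega>_def psubst_add psubst_mult psubst_diff)
  have dvd_iff: "?\<beta> dvd f \<longleftrightarrow> ?S f = 0" for f
    by (rule dvd_by_elimination[OF disjI1[OF refl] S\<beta>]) (simp add: var_q)
  have "?S (\<omega> a - \<omega> b) ~= 0"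
  proof
    assume z: "?S (\<omega> a - \<omega> b) = 0"
    \<comment> \<open>If the eliminated variable occurs in the other root, vanishing compares both
      the classes and the offsets, and equality of offsets forces one common translation.\<close>
    consider "cls c = cls a" | "cls c = cls b" | "cls c ~= cls a" "cls c ~= cls b" by blast
    then show False
    proof cases
      case 1
      then have "?S (\<omega> a - \<omega> b) = var (cls e) - var (cls b) + of_int (off e - off c + off a - off b) * var 0"
        using ab' by (simp add: \<omega>_def psubst_add psubst_mult psubst_diff algebra_simps)
      then have eq: "cls e = cls b" "off e - off c + off a - off b = 0"
        using z linear_form_eq_0_iff[OF cls_pos cls_pos] by metis+
      obtain t s where "c = a + t * C" "e = b + s * C" using 1 eq(1) unfolding cls_eq_iff cong_iff by blast
      with eq(2) have "s * n = t * n" by (simp add: off_shift')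
      then show False using ne \<open>c = _\<close> \<open>e = _\<close> n_pos' by auto
    next
      case 2
      then have "?S (\<omega> a - \<omega> b) = var (cls a) - var (cls e) + of_int (off a - off e + off c - off b) * var 0"
        using ab' by (simp add: \<omega>_def psubst_add psubst_mult psubst_diff algebra_simps)
      then have eq: "cls a = cls e" "off a - off e + off c - off b = 0"
        using z linear_form_eq_0_iff[OF cls_pos cls_pos] by metis+
      obtain t s where "c = b + t * C" "e = a + s * C" using 2 eq(1)[symmetric] unfolding cls_eq_iff cong_iff by blast
      with eq(2) have "t * n = s * n" by (simp add: off_shift')
      then show False using ne \<open>c = _\<close> \<open>e = _\<close> n_pos' by auto
    next
      case 3
      then have "?S (\<omega> a - \<omega> b) = \<omega> a - \<omega> b" by (simp add: \<omega>_def psubst_add psubst_mult psubst_diff)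
      then show False using z ab by (simp add: \<omega>_eq_iff)
    qed
  qed
  then show ?thesis using dvd by (simp add: dvd_iff psubst_mult)
qed

sublocale affine_weights C n \<omega> \<sigma> "of_int n * var 0"
proof
  fix k show "\<omega> (k + C) = \<omega> k + of_int n * var 0"
    using \<omega>_translate[of k 1] by simp
next
  fix a b :: int assume "a mod C ~= b mod C" then show "\<omega> a ~= \<omega> b" by (auto simp: \<omega>_eq_iff)
next
  fix a b x y show "\<sigma> a b (x + y) = \<sigma> a b x + \<sigma> a b y" by (simp add: \<sigma>_def psubst_add)
next
  fix a b x y show "\<sigma> a b (x * y) = \<sigma> a b x * \<sigma> a b y" by (simp add: \<sigma>_def psubst_mult)
next
  fix a b show "\<sigma> a b 1 = 1" by (simp add: \<sigma>_def)
next
  fix a b x assume ab: "a mod C ~= b mod C"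
  then have ab': "cls a ~= cls b" using cls_eq_iff by metis
  have 0: "\<sigma> a b (of_int z * var 0) = of_int z * var 0" for z
    by (simp add: \<sigma>_def psubst_mult)
  have d: "\<sigma> a b (p - q) = \<sigma> a b p - \<sigma> a b q" for p q by (simp add: \<sigma>_def psubst_diff)
  have "\<sigma> a b (\<sigma> a b (var i)) = var i" for i
  proof -
    consider "i = cls a" | "i = cls b" | "i ~= cls a" "i ~= cls b" by blast
    then show ?thesis
    proof cases
      case 1
      then have "\<sigma> a b (var i) = \<omega> b - of_int (off a) * var 0" by (simp add: \<sigma>_def)
      then have "\<sigma> a b (\<sigma> a b (var i)) = \<omega> a - of_int (off a) * var 0"
        using ab by (simp only: d 0 \<sigma>_\<omega>_eq[OF ab]) simp
      then show ?thesis using 1 by (simp add: \<omega>_def)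
    next
      case 2
      then have "\<sigma> a b (var i) = \<omega> a - of_int (off b) * var 0" using ab' by (simp add: \<sigma>_def)
      then have "\<sigma> a b (\<sigma> a b (var i)) = \<omega> b - of_int (off b) * var 0"
        using ab by (simp only: d 0 \<sigma>_\<omega>_eq[OF ab]) simp
      then show ?thesis using 2 by (simp add: \<omega>_def)
    qed (simp add: \<sigma>_def)
  qed
  then have "psubst (\<lambda>i. \<sigma> a b (\<sigma> a b (var i))) x = x" by simp
  then show "\<sigma> a b (\<sigma> a b x) = x" unfolding \<sigma>_def psubst_psubst psubst_var .
next
  fix a b k :: int assume "a mod C ~= b mod C" then show "\<sigma> a b (\<omega> k) = \<omega> (refl a b k)" by (rule \<sigma>_\<omega>_eq)
next
  fix a b :: int and x assume ab: "a mod C ~= b mod C"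
  have "\<omega> a - \<omega> b dvd psubst var x - \<sigma> a b x"
    unfolding \<sigma>_def
  proof (rule psubst_congruent)
    fix i
    have va: "var (cls a) - (\<omega> b - of_int (off a) * var 0) = \<omega> a - \<omega> b"
      and vb: "var (cls b) - (\<omega> a - of_int (off b) * var 0) = - (\<omega> a - \<omega> b)" by (simp_all add: \<omega>_def)
    then have va': "\<omega> a - \<omega> b dvd var (cls a) - (\<omega> b - of_int (off a) * var 0)"
      and vb': "\<omega> a - \<omega> b dvd var (cls b) - (\<omega> a - of_int (off b) * var 0)"
      by (simp_all only: va vb dvd_minus_iff dvd_refl)
    consider "i = cls a" | "i ~= cls a" "i = cls b" | "i ~= cls a" "i ~= cls b" by blast
    then show "\<omega> a - \<omega> b dvd var i - (if i = cls a then \<omega> b - of_int (off a) * var 0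
       else if i = cls b then \<omega> a - of_int (off b) * var 0 else var i)"
    proof cases
      case 1 show ?thesis by (simp only: 1 if_True simp_thms va')
    next
      case 2 then show ?thesis by (simp only: if_True if_False simp_thms vb')
    next
      case 3 then show ?thesis by (simp only: if_False diff_self dvd_0_right)
    qed
  qed
  then show "\<omega> a - \<omega> b dvd x - \<sigma> a b x" by simp
qed (fact root_nondivisor)

end

section \<open>The graded coefficient ring\<close>

definition vars_le :: "nat => poly_R => bool" where
  "vars_le d f \<longleftrightarrow> (\<forall>m\<in>Poly_Mapping.keys f. Poly_Mapping.keys m \<subseteq> {0..d})"

lemma carrier_R_ring: "carrier (R_ring d) = {f. vars_le d f}"
  by (simp add: R_ring_def vars_le_def)

lemma vars_le_0 [simp]: "vars_le d 0" and vars_le_1 [simp]: "vars_le d 1"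
  and vars_le_const [simp]: "vars_le d (Poly_Mapping.single 0 c)"
  by (auto simp: vars_le_def)

lemma vars_le_var [simp]: "vars_le d (var i) \<longleftrightarrow> i \<le> d"
  by (simp add: vars_le_def var_def)

lemma vars_le_add: "vars_le d f ==> vars_le d g ==> vars_le d (f + g)"
  using keys_add[of f g] by (auto simp: vars_le_def)

lemma vars_le_uminus [simp]: "vars_le d (- f) \<longleftrightarrow> vars_le d f"
  by (simp add: vars_le_def in_keys_iff)

lemma vars_le_diff: "vars_le d f ==> vars_le d g ==> vars_le d (f - g)"
  using vars_le_add[of d f "- g"] by simp

lemma vars_le_mult: assumes "vars_le d f" "vars_le d g" shows "vars_le d (f * g)"
  unfolding vars_le_def
proof
  fix m assume "m \<in> Poly_Mapping.keys (f * g)"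
  then obtain a b where ab: "m = a + b" "a \<in> Poly_Mapping.keys f" "b \<in> Poly_Mapping.keys g"
    using keys_mult[of f g] by blast
  then show "Poly_Mapping.keys m \<subseteq> {0..d}" using assms keys_add[of a b] unfolding vars_le_def by blast
qed

lemma vars_le_sum: "(\<And>i. i \<in> I ==> vars_le d (f i)) ==> vars_le d (\<Sum>i\<in>I. f i)"
  by (induction I rule: infinite_finite_induct) (auto intro: vars_le_add)

lemma vars_le_prod: "(\<And>i. i \<in> I ==> vars_le d (f i)) ==> vars_le d (\<Prod>i\<in>I. f i)"
  by (induction I rule: infinite_finite_induct) (auto intro: vars_le_mult)

lemma vars_le_of_int [simp]: "vars_le d (of_int z)"
  by (metis vars_le_const single_of_int)

lemma vars_le_psubst: "(\<And>i. vars_le d (h i)) ==> vars_le d (psubst h f)"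
  by (induction f rule: poly_induct) (auto simp: psubst_add psubst_mult intro: vars_le_add vars_le_mult)

lemma vars_le_psubst': assumes "vars_le d f" "\<And>i. i \<le> d ==> vars_le d (h i)" shows "vars_le d (psubst h f)"
proof -
  have "psubst h f = psubst (\<lambda>i. if i \<le> d then h i else 0) f"
    by (rule psubst_cong) (use assms(1) in \<open>force simp: vars_le_def\<close>)
  also have "vars_le d \<dots>" by (rule vars_le_psubst) (use assms in auto)
  finally show ?thesis .
qed

text \<open>A retraction of the big polynomial ring onto R that kills the auxiliary
  variables.\<close>

definition truncate :: "nat => poly_R => poly_R" where
  "truncate d = psubst (\<lambda>i. if i \<le> d then var i else 0)"

lemma vars_le_truncate [simp]: "vars_le d (truncate d f)"
  unfolding truncate_def by (rule vars_le_psubst) auto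

lemma truncate_id [simp]: assumes "vars_le d f" shows "truncate d f = f"
proof -
  have "truncate d f = psubst var f" unfolding truncate_def
    by (rule psubst_cong) (use assms in \<open>force simp: vars_le_def\<close>)
  then show ?thesis by simp
qed

lemma truncate_mult: "truncate d (f * g) = truncate d f * truncate d g"
  and truncate_diff: "truncate d (f - g) = truncate d f - truncate d g"
  and truncate_0 [simp]: "truncate d 0 = 0"
  by (simp_all add: truncate_def psubst_mult psubst_diff)

text \<open>Truncation is multiplicative and fixes both \<open>a\<close> and the product, so
  cancelling \<open>a\<close> shows that it fixes \<open>f\<close>.\<close>

lemma vars_le_cancel:
  assumes "vars_le d a" "vars_le d (a * f)" "a ~= 0" shows "vars_le d f"
proof -
  have "a * truncate d f = a * f" using assms truncate_mult[of d a f] by simp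
  then have "truncate d f = f" using assms by simp
  then show ?thesis by (metis vars_le_truncate)
qed

section \<open>Homogeneous polynomials and their components\<close>

definition mdeg :: "(nat \<Rightarrow>\<^sub>0 nat) => nat" where
  "mdeg m = (\<Sum>i\<in>Poly_Mapping.keys m. Poly_Mapping.lookup m i)"

lemma mdeg_add: "mdeg (a + b) = mdeg a + mdeg b"
proof -
  let ?I = "Poly_Mapping.keys a \<union> Poly_Mapping.keys b"
  have sup: "mdeg m = (\<Sum>i\<in>?I. Poly_Mapping.lookup m i)" if "Poly_Mapping.keys m \<subseteq> ?I" for m
    unfolding mdeg_def by (rule sum.mono_neutral_left) (use that in \<open>auto simp: in_keys_iff\<close>)
  show ?thesis using sup[of "a + b"] sup[of a] sup[of b] keys_add[of a b]
    by (auto simp: lookup_add sum.distrib)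
qed

lemma mdeg_0 [simp]: "mdeg 0 = 0" by (simp add: mdeg_def)

definition homog :: "nat => poly_R => bool" where
  "homog k f \<longleftrightarrow> (\<forall>m\<in>Poly_Mapping.keys f. mdeg m = k)"

lemma homog_0 [simp]: "homog k 0" by (simp add: homog_def)

lemma homog_const [simp]: "homog 0 (Poly_Mapping.single 0 c)"
  by (auto simp: homog_def)

lemma homog_1 [simp]: "homog 0 1" by (simp add: homog_def)

lemma homog_var [simp]: "homog 1 (var i)"
  by (auto simp: homog_def var_def mdeg_def)

lemma homog_add: "homog k f ==> homog k g ==> homog k (f + g)"
  using keys_add[of f g] by (auto simp: homog_def)

lemma homog_uminus [simp]: "homog k (- f) \<longleftrightarrow> homog k f"
  by (simp add: homog_def in_keys_iff)

lemma homog_diff: "homog k f ==> homog k g ==> homog k (f - g)"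
  using homog_add[of k f "- g"] by simp

lemma homog_mult: assumes "homog k f" "homog l g" shows "homog (k + l) (f * g)"
  unfolding homog_def
proof
  fix m assume "m \<in> Poly_Mapping.keys (f * g)"
  then obtain a b where ab: "m = a + b" "a \<in> Poly_Mapping.keys f" "b \<in> Poly_Mapping.keys g"
    using keys_mult[of f g] by blast
  then show "mdeg m = k + l" using assms by (simp add: homog_def mdeg_add)
qed

lemma homog_sum: "(\<And>i. i \<in> I ==> homog k (f i)) ==> homog k (\<Sum>i\<in>I. f i)"
  by (induction I rule: infinite_finite_induct) (auto intro: homog_add)

lemma homog_prod: "finite I ==> (\<And>i. i \<in> I ==> homog (k i) (f i)) ==> homog (\<Sum>i\<in>I. k i) (\<Prod>i\<in>I. f i)"
  by (induction I rule: finite_induct) (auto intro: homog_mult)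

lemma homog_power: "homog k f ==> homog (m * k) (f ^ m)"
  by (induction m) (auto intro: homog_mult)

lemma homog_psubst: assumes "homog k f" "\<And>i. homog 1 (h i)" shows "homog k (psubst h f)"
proof -
  have "homog (mdeg m) (mono_subst h m)" for m
    using homog_prod[of "Poly_Mapping.keys m" "\<lambda>i. Poly_Mapping.lookup m i" "\<lambda>i. h i ^ Poly_Mapping.lookup m i"]
      homog_power[OF assms(2)] by (simp add: mono_subst_def mdeg_def)
  then have "homog (0 + k) (Poly_Mapping.single 0 (Poly_Mapping.lookup f m) * mono_subst h m)"
    if "m \<in> Poly_Mapping.keys f" for m
    using assms(1) that by (intro homog_mult homog_const) (auto simp: homog_def)
  then show ?thesis
    by (subst psubst_superset[OF finite_keys order_refl]) (auto intro: homog_sum)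
qed

lemma homog_unique: "homog k f ==> homog l f ==> f ~= 0 ==> k = l"
  by (metis homog_def keys_eq_empty ex_in_conv)

definition hcomp :: "nat => poly_R => poly_R" where
  "hcomp k f = (\<Sum>m\<in>{m \<in> Poly_Mapping.keys f. mdeg m = k}. Poly_Mapping.single m (Poly_Mapping.lookup f m))"

lemma lookup_hcomp: "Poly_Mapping.lookup (hcomp k f) m = (if mdeg m = k then Poly_Mapping.lookup f m else 0)"
  by (auto simp: hcomp_def lookup_sum lookup_single when_def in_keys_iff)

lemma hcomp_add: "hcomp k (f + g) = hcomp k f + hcomp k g"
  by (rule poly_mapping_eqI) (simp add: lookup_hcomp lookup_add)

lemma hcomp_diff: "hcomp k (f - g) = hcomp k f - hcomp k g"
  by (rule poly_mapping_eqI) (simp add: lookup_hcomp lookup_minus)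

lemma hcomp_0 [simp]: "hcomp k 0 = 0"
  by (rule poly_mapping_eqI) (simp add: lookup_hcomp)

lemma hcomp_sum: "hcomp k (\<Sum>i\<in>I. f i) = (\<Sum>i\<in>I. hcomp k (f i))"
  by (induction I rule: infinite_finite_induct) (auto simp: hcomp_add)

lemma homog_hcomp [simp]: "homog k (hcomp k f)"
  by (auto simp: homog_def in_keys_iff lookup_hcomp split: if_splits)

lemma vars_le_hcomp: "vars_le d f ==> vars_le d (hcomp k f)"
  by (auto simp: vars_le_def in_keys_iff lookup_hcomp split: if_splits)

lemma hcomp_homog: "homog l f ==> hcomp k f = (if k = l then f else 0)"
  by (rule poly_mapping_eqI) (auto simp: homog_def lookup_hcomp in_keys_iff)

lemma hcomp_decomp: "f = (\<Sum>k\<in>mdeg ` Poly_Mapping.keys f. hcomp k f)"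
  by (rule poly_mapping_eqI) (auto simp: lookup_sum lookup_hcomp in_keys_iff)

lemma hcomp_mult: assumes "homog k a" shows "hcomp (k + l) (a * f) = a * hcomp l f"
proof -
  let ?I = "mdeg ` Poly_Mapping.keys f"
  have "hcomp (k + l) (a * f) = hcomp (k + l) (\<Sum>j\<in>?I. a * hcomp j f)"
    using hcomp_decomp[of f] by (simp add: sum_distrib_left[symmetric])
  also have "\<dots> = (\<Sum>j\<in>?I. if k + l = k + j then a * hcomp j f else 0)"
    by (simp only: hcomp_sum hcomp_homog[OF homog_mult[OF assms homog_hcomp]])
  also have "\<dots> = (if l \<in> ?I then a * hcomp l f else 0)" by (simp add: sum.delta)
  also have "\<dots> = a * hcomp l f"
  proof -
    have "hcomp l f = 0" if "l \<notin> ?I" using that by (intro poly_mapping_eqI) (auto simp: lookup_hcomp in_keys_iff)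
    then show ?thesis by auto
  qed
  finally show ?thesis .
qed

lemma hcomp_mult_low: assumes "homog k a" "l < k" shows "hcomp l (a * f) = 0"
proof -
  let ?I = "mdeg ` Poly_Mapping.keys f"
  have "hcomp l (a * f) = hcomp l (\<Sum>j\<in>?I. a * hcomp j f)"
    using hcomp_decomp[of f] by (simp add: sum_distrib_left[symmetric])
  also have "\<dots> = (\<Sum>j\<in>?I. if l = k + j then a * hcomp j f else 0)"
    by (simp only: hcomp_sum hcomp_homog[OF homog_mult[OF assms(1) homog_hcomp]])
  also have "\<dots> = 0" using assms(2) by (intro sum.neutral) auto
  finally show ?thesis .
qed

lemma homog_cancel: assumes "homog k a" "homog l (a * f)" "a ~= 0" "k \<le> l" shows "homog (l - k) f"
proof -
  have "hcomp l (a * f) = a * hcomp (l - k) f"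
    using hcomp_mult[OF assms(1), of "l - k" f] assms(4) by simp
  moreover have "hcomp l (a * f) = a * f" using hcomp_homog[OF assms(2), of l] by simp
  ultimately have "a * hcomp (l - k) f = a * f" by metis
  then have "hcomp (l - k) f = f" using assms(3) by simp
  then show ?thesis by (metis homog_hcomp)
qed

lemma homog_low: assumes "homog k a" "homog l (a * f)" "l < k" shows "a * f = 0"
  using hcomp_mult_low[OF assms(1,3), of f] hcomp_homog[OF assms(2)] by simp

lemma R_grade_iff: "f \<in> R_grade d q \<longleftrightarrow> vars_le d f \<and> (if q \<ge> 0 \<and> even q then homog (nat (q div 2)) f else f = 0)"
proof (cases "q \<ge> 0 \<and> even q")
  case True
  then obtain k where k: "q = 2 * k" "k \<ge> 0" by (auto elim: evenE)
  have "int (2 * mdeg m) = q \<longleftrightarrow> mdeg m = nat (q div 2)" for m using k by auto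
  then show ?thesis using True by (simp add: R_grade_def carrier_R_ring homog_def mdeg_def)
next
  case False
  have "int (2 * s) ~= q" for s using False by auto
  then show ?thesis using False by (auto simp: R_grade_def carrier_R_ring simp del: of_nat_mult)
qed

section \<open>Graded twisted modules of functions\<close>

lemma cring_R_ring: "cring (R_ring d)"
proof (rule cringI)
  show "abelian_group (R_ring d)"
  proof (rule abelian_groupI)
    fix x assume "x \<in> carrier (R_ring d)"
    then show "\<exists>y\<in>carrier (R_ring d). y \<oplus>\<^bsub>R_ring d\<^esub> x = \<zero>\<^bsub>R_ring d\<^esub>"
      by (intro bexI[of _ "- x"]) (auto simp: carrier_R_ring, simp add: R_ring_def)
  qed (auto simp: carrier_R_ring vars_le_add, auto simp: R_ring_def vars_le_add algebra_simps)
  show "Group.comm_monoid (R_ring d)"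
    by (rule comm_monoidI) (auto simp: carrier_R_ring, auto simp: R_ring_def vars_le_mult algebra_simps)
qed (auto simp: R_ring_def algebra_simps)

lemma R_ring_simps: "add (R_ring d) = (+)" "monoid.mult (R_ring d) = (*)" "one (R_ring d) = 1" "zero (R_ring d) = 0"
  by (simp_all add: R_ring_def)

text \<open>The component in cohomological degree \<open>q\<close>, where variables have degree 2;
  odd and negative degrees contribute zero.\<close>

definition gcomp :: "int => poly_R => poly_R" where
  "gcomp q f = (if q \<ge> 0 \<and> even q then hcomp (nat (q div 2)) f else 0)"

lemma gcomp_R_grade: "vars_le d f ==> gcomp q f \<in> R_grade d q"
  by (auto simp: gcomp_def R_grade_iff vars_le_hcomp)

lemma gcomp_of_R_grade: "f \<in> R_grade d r ==> gcomp q f = (if q = r then f else 0)"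
proof -
  assume f: "f \<in> R_grade d r"
  show ?thesis
  proof (cases "r \<ge> 0 \<and> even r")
    case True
    then have h: "homog (nat (r div 2)) f" using f by (simp add: R_grade_iff)
    have "q = r" if "nat (q div 2) = nat (r div 2)" "q \<ge> 0" "even q"
      using that True by (metis div_mult_self1_is_m dvd_div_mult_self nat_eq_iff2 pos_imp_zdiv_nonneg_iff zero_less_numeral)
    then show ?thesis using h True by (auto simp: gcomp_def hcomp_homog[OF h])
  next
    case False
    then have "f = 0" using f by (simp add: R_grade_iff split: if_splits)
    then show ?thesis by (simp add: gcomp_def)
  qed
qed

lemma gcomp_sum: "gcomp q (\<Sum>i\<in>I. f i) = (\<Sum>i\<in>I. gcomp q (f i))"
  by (cases "q \<ge> 0 \<and> even q") (simp_all only: gcomp_def hcomp_sum if_True if_False sum.neutral_const simp_thms)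

lemma gcomp_0 [simp]: "gcomp q 0 = 0"
  by (simp add: gcomp_def)

lemma gcomp_mult: assumes "homog k b" shows "gcomp q (f * b) = gcomp (q - 2 * int k) f * b"
proof (cases "q \<ge> 0 \<and> even q")
  case True
  then obtain l where l: "q = 2 * int l" by (metis evenE nonneg_int_cases zero_le_mult_iff zero_less_numeral not_less)
  show ?thesis
  proof (cases "k \<le> l")
    case True
    then have "nat ((q - 2 * int k) div 2) = l - k" "q - 2 * int k \<ge> 0" using l by auto
    then show ?thesis using l True hcomp_mult[OF assms, of "l - k" f] by (simp add: gcomp_def mult.commute)
  next
    case False
    then show ?thesis using l hcomp_mult_low[OF assms, of l f] by (simp add: gcomp_def mult.commute)
  qed
next
  case False
  then have "\<not> (q - 2 * int k \<ge> 0 \<and> even (q - 2 * int k))" by auto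
  then have "gcomp (q - 2 * int k) f = 0" by (simp only: gcomp_def if_False)
  moreover have "gcomp q (f * b) = 0" using False by (simp only: gcomp_def if_False)
  ultimately show ?thesis by simp
qed

lemma gcomp_decomp:
  assumes "finite Q" "(\<lambda>k. 2 * int k) ` mdeg ` Poly_Mapping.keys f \<subseteq> Q"
  shows "(\<Sum>q\<in>Q. gcomp q f) = f"
proof -
  have "(\<Sum>q\<in>Q. gcomp q f) = (\<Sum>q\<in>(\<lambda>k. 2 * int k) ` mdeg ` Poly_Mapping.keys f. gcomp q f)"
  proof (rule sum.mono_neutral_right[OF assms], rule ballI)
    fix q assume q: "q \<in> Q - (\<lambda>k. 2 * int k) ` mdeg ` Poly_Mapping.keys f"
    show "gcomp q f = 0"
    proof (cases "q \<ge> 0 \<and> even q")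
      case True
      then have "q = 2 * int (nat (q div 2))" by auto
      then have "nat (q div 2) \<notin> mdeg ` Poly_Mapping.keys f" using q by (metis DiffD2 imageI)
      then have "hcomp (nat (q div 2)) f = 0"
        by (intro poly_mapping_eqI) (simp add: lookup_hcomp, metis in_keys_iff imageI)
      then show ?thesis by (simp add: gcomp_def)
    qed (auto simp: gcomp_def)
  qed
  also have "\<dots> = (\<Sum>k\<in>mdeg ` Poly_Mapping.keys f. hcomp k f)"
    by (subst sum.reindex) (auto simp: inj_on_def gcomp_def)
  finally show ?thesis using hcomp_decomp[of f] by simp
qed

lemma R_grade_zero [simp]: "0 \<in> R_grade d q"
  by (simp add: R_grade_iff)

lemma R_grade_add: "f \<in> R_grade d q ==> g \<in> R_grade d q ==> f + g \<in> R_grade d q"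
  by (auto simp: R_grade_iff vars_le_add homog_add split: if_splits)

lemma R_grade_uminus: "f \<in> R_grade d q ==> - f \<in> R_grade d q"
  by (auto simp: R_grade_iff split: if_splits)

lemma R_grade_mult: assumes "f \<in> R_grade d q" "g \<in> R_grade d r" shows "f * g \<in> R_grade d (q + r)"
proof (cases "(q \<ge> 0 \<and> even q) \<and> (r \<ge> 0 \<and> even r)")
  case True
  then have "nat ((q + r) div 2) = nat (q div 2) + nat (r div 2)" by (auto elim!: evenE)
  then show ?thesis using True assms homog_mult by (auto simp: R_grade_iff vars_le_mult)
next
  case False
  then have "f = 0 \<or> g = 0" using assms by (auto simp: R_grade_iff split: if_splits)
  then show ?thesis using assms by auto
qed

lemma R_grade_vars_le: "f \<in> R_grade d q ==> vars_le d f"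
  by (simp add: R_grade_iff)

text \<open>A common criterion for the cohomology (with \<open>s\<close> zero) and for the sum of
  trivial modules (with \<open>s\<close> the generator degrees). For coordinatewise operations the
  substantial requirements are closure under homogeneous components and the properties of the group
  action.\<close>

lemma graded_twisted_moduleI:
  fixes W :: "('a => poly_R) twisted_module"
  assumes F: "finite F"
    and carrier: "carrier W = A"
    and zero: "zero W = (\<lambda>L\<in>F. 0)"
    and add: "add W = (\<lambda>f g. \<lambda>L\<in>F. f L + g L)"
    and smult: "smult W = (\<lambda>a f. \<lambda>L\<in>F. a * f L)"
    and act: "perm_action W = act"
    and grade: "\<And>q. grade W q = {f \<in> A. \<forall>L\<in>F. f L \<in> R_grade (sum_list ks) (q - 2 * int (s L))}"
    and A_ext: "\<And>x. x \<in> A ==> x \<in> extensional F" and A_vars: "\<And>x L. x \<in> A ==> L \<in> F ==> vars_le (sum_list ks) (x L)"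
    and A_zero: "(\<lambda>L\<in>F. 0) \<in> A"
    and A_add: "\<And>x y. x \<in> A ==> y \<in> A ==> (\<lambda>L\<in>F. x L + y L) \<in> A"
    and A_scale: "\<And>a x. vars_le (sum_list ks) a ==> x \<in> A ==> (\<lambda>L\<in>F. a * x L) \<in> A"
    and A_gcomp: "\<And>x q. x \<in> A ==> (\<lambda>L\<in>F. gcomp (q - 2 * int (s L)) (x L)) \<in> A"
    and act_closed: "\<And>\<sigma> x. \<sigma> \<in> young_subgroup ks ==> x \<in> A ==> act \<sigma> x \<in> A"
    and act_id: "\<And>x. x \<in> A ==> act id x = x"
    and act_comp: "\<And>\<sigma> \<tau> x. \<sigma> \<in> young_subgroup ks ==> \<tau> \<in> young_subgroup ks ==> x \<in> A ==>
      act (\<tau> \<circ> \<sigma>) x = act \<sigma> (act \<tau> x)"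
    and act_add: "\<And>\<sigma> x y. \<sigma> \<in> young_subgroup ks ==> x \<in> A ==> y \<in> A ==>
      act \<sigma> (\<lambda>L\<in>F. x L + y L) = (\<lambda>L\<in>F. act \<sigma> x L + act \<sigma> y L)"
    and act_scale: "\<And>\<sigma> a x. \<sigma> \<in> young_subgroup ks ==> vars_le (sum_list ks) a ==> x \<in> A ==>
      act \<sigma> (\<lambda>L\<in>F. a * x L) = (\<lambda>L\<in>F. twist \<sigma> a * act \<sigma> x L)"
    and act_grade: "\<And>\<sigma> x q. \<sigma> \<in> young_subgroup ks ==> x \<in> grade W q ==> act \<sigma> x \<in> grade W q"
  shows "graded_twisted_module ks W"
proof -
  let ?d = "sum_list ks" and ?S = "young_subgroup ks"
  have ext_eq: "x = y" if "x \<in> A" "y \<in> extensional F" "\<And>L. L \<in> F ==> x L = y L" for x y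
    using A_ext that by (intro extensionalityI[of _ F]) auto
  have A_neg: "(\<lambda>L\<in>F. - x L) \<in> A" if "x \<in> A" for x
    using A_scale[of "- 1" x] that by simp
  have abel: "abelian_group W"
  proof (rule abelian_groupI)
    fix x assume "x \<in> carrier W"
    then show "\<exists>y\<in>carrier W. y \<oplus>\<^bsub>W\<^esub> x = \<zero>\<^bsub>W\<^esub>"
      by (intro bexI[of _ "\<lambda>L\<in>F. - x L"]) (auto simp: carrier add zero A_neg)
  next
    fix x assume "x \<in> carrier W"
    then show "\<zero>\<^bsub>W\<^esub> \<oplus>\<^bsub>W\<^esub> x = x"
      by (intro ext_eq[symmetric]) (auto simp: carrier add zero A_zero)
  qed (auto simp: carrier add zero A_zero A_add algebra_simps)
  interpret ab: abelian_group W by (rule abel)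
  have cr: "cring (R_ring ?d)" by (rule cring_R_ring)
  have mod: "Module.module (R_ring ?d) W"
  proof (rule module.intro[OF cr abel], unfold_locales)
    fix x assume "x \<in> carrier W"
    then show "\<one>\<^bsub>R_ring ?d\<^esub> \<odot>\<^bsub>W\<^esub> x = x"
      by (intro ext_eq[symmetric]) (auto simp: carrier smult R_ring_simps)
  qed (auto simp: carrier smult add carrier_R_ring R_ring_simps A_scale algebra_simps)
  have sub: "subgroup (grade W q) (add_monoid W)" for q
  proof (rule group.subgroupI)
    show "group (add_monoid W)" by (rule ab.a_group)
    show "grade W q \<subseteq> carrier (add_monoid W)" by (auto simp: grade carrier)
    have "(\<lambda>L\<in>F. 0) \<in> grade W q" by (simp add: grade A_zero)
    then show "grade W q ~= {}" by blast
    fix x assume x: "x \<in> grade W q"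
    then have xA: "x \<in> A" by (simp add: grade)
    have neg: "(\<lambda>L\<in>F. - x L) \<in> grade W q" using x by (auto simp: grade A_neg R_grade_uminus)
    have "inv\<^bsub>add_monoid W\<^esub> x = (\<lambda>L\<in>F. - x L)"
    proof (rule group.inv_equality[OF ab.a_group])
      show "(\<lambda>L\<in>F. - x L) \<otimes>\<^bsub>add_monoid W\<^esub> x = \<one>\<^bsub>add_monoid W\<^esub>" by (auto simp: add zero)
    qed (auto simp: carrier xA A_neg)
    then show "inv\<^bsub>add_monoid W\<^esub> x \<in> grade W q" using neg by simp
    fix y assume "y \<in> grade W q"
    then show "x \<otimes>\<^bsub>add_monoid W\<^esub> y \<in> grade W q" using x by (auto simp: grade add A_add R_grade_add)
  qed
  have fs: "finsum W c Q = (\<lambda>L\<in>F. \<Sum>q\<in>Q. c q L)" if "finite Q" "\<And>q. q \<in> Q ==> c q \<in> A" for c :: "int => 'a => poly_R" and Q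
    using that by (induction Q) (auto simp: carrier zero add Pi_def)
  have uniq: "\<exists>!c. (\<forall>q. c q \<in> grade W q) \<and> finite {q. c q ~= \<zero>\<^bsub>W\<^esub>} \<and> x = finsum W c {q. c q ~= \<zero>\<^bsub>W\<^esub>}"
    if x: "x \<in> carrier W" for x
  proof (rule ex1I)
    let ?c = "\<lambda>q. \<lambda>L\<in>F. gcomp (q - 2 * int (s L)) (x L)"
    have xA: "x \<in> A" using x carrier by simp
    \<comment> \<open>The finitely many degrees in which some coordinate, shifted by the degree of
      its generator, has a nonzero component.\<close>
    define Q where "Q = (\<Union>L\<in>F. (\<lambda>r. r + 2 * int (s L)) ` (\<lambda>k. 2 * int k) ` mdeg ` Poly_Mapping.keys (x L))"
    have Q: "finite Q" using F by (simp add: Q_def)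
    have z: "?c q = \<zero>\<^bsub>W\<^esub>" if "q \<notin> Q" for q
    proof -
      have "gcomp (q - 2 * int (s L)) (x L) = 0" if "L \<in> F" for L
      proof -
        have "q - 2 * int (s L) \<notin> (\<lambda>k. 2 * int k) ` mdeg ` Poly_Mapping.keys (x L)"
        proof
          assume "q - 2 * int (s L) \<in> (\<lambda>k. 2 * int k) ` mdeg ` Poly_Mapping.keys (x L)"
          then have "(\<lambda>r. r + 2 * int (s L)) (q - 2 * int (s L)) \<in> Q"
            unfolding Q_def using that by blast
          then show False using \<open>q \<notin> Q\<close> by simp
        qed
        \<comment> \<open>The decomposition of \<open>x L\<close> holds with and without the
          additional degree, so the component in that degree is zero.\<close>
        then have "(\<Sum>r\<in>insert (q - 2 * int (s L)) ((\<lambda>k. 2 * int k) ` mdeg ` Poly_Mapping.keys (x L)). gcomp r (x L)) =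
          gcomp (q - 2 * int (s L)) (x L) + (\<Sum>r\<in>((\<lambda>k. 2 * int k) ` mdeg ` Poly_Mapping.keys (x L)). gcomp r (x L))"
          by (intro sum.insert) auto
        then show ?thesis
          using gcomp_decomp[of "insert (q - 2 * int (s L)) ((\<lambda>k. 2 * int k) ` mdeg ` Poly_Mapping.keys (x L))" "x L"]
            gcomp_decomp[of "((\<lambda>k. 2 * int k) ` mdeg ` Poly_Mapping.keys (x L))" "x L"] by auto
      qed
      then show ?thesis by (auto simp: zero)
    qed
    have sQ: "{q. ?c q ~= \<zero>\<^bsub>W\<^esub>} \<subseteq> Q" using z by blast
    then have fin: "finite {q. ?c q ~= \<zero>\<^bsub>W\<^esub>}" using Q finite_subset by blast
    have sum_c: "(\<Sum>q\<in>{q. ?c q ~= \<zero>\<^bsub>W\<^esub>}. ?c q L) = x L" if "L \<in> F" for L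
    proof -
      have "(\<Sum>q\<in>{q. ?c q ~= \<zero>\<^bsub>W\<^esub>}. ?c q L) = (\<Sum>q\<in>Q. ?c q L)"
        by (rule sum.mono_neutral_left[OF Q sQ]) (use that in \<open>auto simp: zero fun_eq_iff\<close>)
      also have "\<dots> = (\<Sum>q\<in>(\<lambda>q. q - 2 * int (s L)) ` Q. gcomp q (x L))"
        using that by (subst sum.reindex) (auto simp: inj_on_def)
      also have "\<dots> = x L"
        by (rule gcomp_decomp) (use Q that in \<open>force simp: Q_def\<close>)+
      finally show ?thesis .
    qed
    have gr: "?c q \<in> grade W q" for q
      using A_gcomp[OF xA, of q] A_vars[OF xA] by (simp add: grade gcomp_R_grade)
    show "(\<forall>q. ?c q \<in> grade W q) \<and> finite {q. ?c q ~= \<zero>\<^bsub>W\<^esub>} \<and> x = finsum W ?c {q. ?c q ~= \<zero>\<^bsub>W\<^esub>}"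
    proof (intro conjI allI gr fin)
      have "finsum W ?c {q. ?c q ~= \<zero>\<^bsub>W\<^esub>} = (\<lambda>L\<in>F. \<Sum>q\<in>{q. ?c q ~= \<zero>\<^bsub>W\<^esub>}. ?c q L)"
        by (rule fs[OF fin]) (rule A_gcomp[OF xA])
      also have "\<dots> = (\<lambda>L\<in>F. x L)" using sum_c by (intro restrict_ext) blast
      also have "\<dots> = x" using A_ext[OF xA] by (rule extensional_restrict)
      finally show "x = finsum W ?c {q. ?c q ~= \<zero>\<^bsub>W\<^esub>}" ..
    qed
    fix c assume c: "(\<forall>q. c q \<in> grade W q) \<and> finite {q. c q ~= \<zero>\<^bsub>W\<^esub>} \<and> x = finsum W c {q. c q ~= \<zero>\<^bsub>W\<^esub>}"
    let ?P = "{q. c q ~= \<zero>\<^bsub>W\<^esub>}"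
    have cA: "c q \<in> A" and cg: "L \<in> F ==> c q L \<in> R_grade ?d (q - 2 * int (s L))" for q L using c by (auto simp: grade)
    have xs: "x = (\<lambda>L\<in>F. \<Sum>q\<in>?P. c q L)" using fs[of ?P c] c cA by simp
    show "c = ?c"
    proof
      fix q
      have "c q L = gcomp (q - 2 * int (s L)) (x L)" if L: "L \<in> F" for L
      proof -
        have "gcomp (q - 2 * int (s L)) (x L) = (\<Sum>r\<in>?P. gcomp (q - 2 * int (s L)) (c r L))"
          using L by (subst xs) (simp add: gcomp_sum)
        also have "\<dots> = (\<Sum>r\<in>?P. if q = r then c r L else 0)"
          by (intro sum.cong refl) (simp add: gcomp_of_R_grade[OF cg[OF L]])
        also have "\<dots> = c q L" using c L by (auto simp: zero)
        finally show ?thesis ..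
      qed
      then show "c q = ?c q" using A_ext[OF cA] by (intro ext_eq[OF cA]) auto
    qed
  qed
  have gm: "a \<odot>\<^bsub>W\<^esub> x \<in> grade W (r + q)" if "a \<in> R_grade ?d r" "x \<in> grade W q" for a x r q
  proof -
    have "a * x L \<in> R_grade ?d (r + q - 2 * int (s L))" if "L \<in> F" for L
      using R_grade_mult[of a ?d r "x L" "q - 2 * int (s L)"] \<open>a \<in> R_grade ?d r\<close> \<open>x \<in> grade W q\<close> that
      by (simp add: grade algebra_simps)
    then show ?thesis using that A_scale[of a x] by (auto simp: grade smult R_grade_vars_le)
  qed
  show ?thesis
    unfolding graded_twisted_module_def Let_def act
  proof (intro conjI ballI allI)
  qed (use mod act_closed act_id act_comp act_add act_scale sub uniq gm act_grade in
      \<open>auto simp: carrier add smult carrier_R_ring\<close>)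
qed

section \<open>Invariant bases from triangular classes\<close>

lemma block_cover:
  assumes "a \<in> {1..sum_list ks}" shows "\<exists>r<length ks. a \<in> block ks r"
proof -
  define r where "r = (LEAST r. a \<le> sum_list (take (Suc r) ks))"
  have ex: "a \<le> sum_list (take (Suc (length ks)) ks)" using assms by simp
  then have le: "a \<le> sum_list (take (Suc r) ks)" unfolding r_def by (rule LeastI)
  have lt: "sum_list (take r ks) < a"
  proof (cases r)
    case 0 then show ?thesis using assms by simp
  next
    case (Suc m)
    then have "\<not> a \<le> sum_list (take (Suc m) ks)" using not_less_Least[of m "\<lambda>r. a \<le> sum_list (take (Suc r) ks)"]
      by (simp add: r_def)
    then show ?thesis using Suc by simp
  qed
  have "r < length ks"
  proof (rule ccontr)
    assume "\<not> r < length ks"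
    then have "take r ks = take (Suc r) ks" by simp
    then show False using le lt by simp
  qed
  then show ?thesis using le lt by (auto simp: block_def)
qed

section \<open>The Young subgroup and its transpositions\<close>

lemma young_subgroup_id: "id \<in> young_subgroup ks"
  by (simp add: young_subgroup_def permutes_id)

lemma young_subgroup_comp: "\<sigma> \<in> young_subgroup ks ==> \<tau> \<in> young_subgroup ks ==> \<sigma> \<circ> \<tau> \<in> young_subgroup ks"
  unfolding young_subgroup_def mem_Collect_eq
proof (elim conjE, intro conjI allI impI)
  fix r assume "\<forall>r<length ks. \<sigma> ` block ks r = block ks r" "\<forall>r<length ks. \<tau> ` block ks r = block ks r" "r < length ks"
  then have "\<sigma> ` \<tau> ` block ks r = block ks r" by (simp only:)
  then show "(\<sigma> \<circ> \<tau>) ` block ks r = block ks r" by (simp only: image_comp)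
qed (rule permutes_compose)

lemma finite_young_subgroup: "finite (young_subgroup ks)"
  by (rule finite_subset[of _ "{\<sigma>. \<sigma> permutes {1..sum_list ks}}"]) (auto simp: young_subgroup_def finite_permutations)

lemma block_subset: "block ks r \<subseteq> {1..sum_list ks}"
proof -
  have "sum_list ks = sum_list (take (Suc r) ks) + sum_list (drop (Suc r) ks)"
    by (metis append_take_drop_id sum_list_append)
  then show ?thesis by (auto simp: block_def)
qed

lemma block_unique:
  assumes "a \<in> block ks r" "a \<in> block ks r'" shows "r = r'"
proof -
  have mono: "sum_list (take i ks) \<le> sum_list (take j ks)" if "i \<le> j" for i j
  proof -
    have "take i ks = take i (take j ks)" using that by (simp add: min_def)
    then have "take j ks = take i ks @ drop i (take j ks)" by (metis append_take_drop_id)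
    then have "sum_list (take j ks) = sum_list (take i ks) + sum_list (drop i (take j ks))"
      by (metis sum_list_append)
    then show ?thesis by simp
  qed
  have False if "i < j" "a \<in> block ks i" "a \<in> block ks j" for i j
    using mono[of "Suc i" j] that by (auto simp: block_def)
  then show ?thesis using assms by (meson linorder_neqE_nat)
qed

lemma transpose_in_young_subgroup:
  assumes "r < length ks" "a \<in> block ks r" "b \<in> block ks r"
  shows "Transposition.transpose a b \<in> young_subgroup ks"
proof -
  have "Transposition.transpose a b permutes {1..sum_list ks}"
    using assms block_subset[of ks r] by (intro permutes_swap_id) auto
  moreover have "Transposition.transpose a b ` block ks r' = block ks r'" for r'
  proof (cases "r' = r")
    case True then show ?thesis using assms by simp
  next
    case False
    then have "a \<notin> block ks r'" "b \<notin> block ks r'" using assms block_unique by metis+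
    then show ?thesis by (force simp: image_iff Transposition.transpose_def)
  qed
  ultimately show ?thesis by (simp add: young_subgroup_def)
qed

text \<open>Transpositions within blocks generate. If \<open>\<sigma>\<close> moves
  \<open>a\<close>, then composing with the transposition of \<open>a\<close> and
  \<open>\<sigma> a\<close> fixes \<open>a\<close> and keeps every point fixed by
  \<open>\<sigma>\<close>, so the number of moved points decreases.\<close>

lemma young_subgroup_induct [consumes 1, case_names id swap]:
  assumes "\<sigma> \<in> young_subgroup ks" and "P id"
    and step: "\<And>a b r \<sigma>. r < length ks ==> a \<in> block ks r ==> b \<in> block ks r ==> a ~= b ==>
      \<sigma> \<in> young_subgroup ks ==> P \<sigma> ==> P (Transposition.transpose a b \<circ> \<sigma>)"
  shows "P \<sigma>"
  using assms(1)
proof (induction "card {i. \<sigma> i ~= i}" arbitrary: \<sigma> rule: less_induct)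
  case less
  have perm: "\<sigma> permutes {1..sum_list ks}" using less.prems by (simp add: young_subgroup_def)
  show ?case
  proof (cases "\<sigma> = id")
    case False
    then obtain a where a: "\<sigma> a ~= a" by (auto simp: fun_eq_iff)
    then have "a \<in> {1..sum_list ks}" using perm by (metis permutes_not_in)
    then obtain r where r: "r < length ks" "a \<in> block ks r" using block_cover by blast
    let ?b = "\<sigma> a" let ?t = "Transposition.transpose a ?b"
    have b: "?b \<in> block ks r" using less.prems r by (auto simp: young_subgroup_def)
    have t: "?t \<in> young_subgroup ks" by (rule transpose_in_young_subgroup[OF r b])
    have inj: "inj \<sigma>" using perm by (rule permutes_inj)
    have "{i. (?t \<circ> \<sigma>) i ~= i} \<subset> {i. \<sigma> i ~= i}"
    proof
      show "{i. (?t \<circ> \<sigma>) i ~= i} \<subseteq> {i. \<sigma> i ~= i}"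
      proof clarify
        fix i assume i: "(?t \<circ> \<sigma>) i ~= i" "\<sigma> i = i"
        then have "i ~= a" "i ~= ?b" using a inj by (auto simp: inj_def)
        then show False using i by (simp add: Transposition.transpose_def)
      qed
      have "a \<notin> {i. (?t \<circ> \<sigma>) i ~= i}" "a \<in> {i. \<sigma> i ~= i}" using a by auto
      then show "{i. (?t \<circ> \<sigma>) i ~= i} ~= {i. \<sigma> i ~= i}" by blast
    qed
    moreover have "finite {i. \<sigma> i ~= i}"
      by (rule finite_subset[of _ "{1..sum_list ks}"]) (use perm permutes_not_in in fastforce)+
    ultimately have "card {i. (?t \<circ> \<sigma>) i ~= i} < card {i. \<sigma> i ~= i}" by (intro psubset_card_mono)
    then have "P (?t \<circ> \<sigma>)" using less.hyps young_subgroup_comp[OF t less.prems] by blast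
    then have "P (?t \<circ> (?t \<circ> \<sigma>))"
      using step[OF r b _ young_subgroup_comp[OF t less.prems]] a by metis
    moreover have "?t \<circ> (?t \<circ> \<sigma>) = \<sigma>" by (simp add: fun_eq_iff)
    ultimately show ?thesis by simp
  qed (simp add: assms(2))
qed

lemma young_subgroup_inv: assumes "\<sigma> \<in> young_subgroup ks" shows "inv_into UNIV \<sigma> \<in> young_subgroup ks"
proof -
  have perm: "\<sigma> permutes {1..sum_list ks}" using assms by (simp add: young_subgroup_def)
  have "inv_into UNIV \<sigma> ` block ks r = block ks r" if "r < length ks" for r
  proof -
    have "\<sigma> ` block ks r = block ks r" using assms that by (simp add: young_subgroup_def)
    then have "inv_into UNIV \<sigma> ` block ks r = inv_into UNIV \<sigma> ` \<sigma> ` block ks r" by simp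
    also have "\<dots> = block ks r" using permutes_inj[OF perm] by (simp add: image_comp)
    finally show ?thesis .
  qed
  then show ?thesis using permutes_inv[OF perm] by (simp add: young_subgroup_def)
qed

section \<open>The permutation action on the coefficient ring\<close>

lemma twist_vars_le:
  assumes "\<sigma> \<in> young_subgroup ks" "vars_le (sum_list ks) f" shows "vars_le (sum_list ks) (twist \<sigma> f)"
  unfolding twist_eq_psubst
proof (rule vars_le_psubst'[OF assms(2)])
  fix i assume "i \<le> sum_list ks"
  have "inv_into UNIV \<sigma> permutes {1..sum_list ks}"
    using young_subgroup_inv[OF assms(1)] by (simp add: young_subgroup_def)
  then have "inv_into UNIV \<sigma> i \<le> sum_list ks"
    using \<open>i \<le> sum_list ks\<close> permutes_in_image[of "inv_into UNIV \<sigma>" "{1..sum_list ks}" i] permutes_not_in[of "inv_into UNIV \<sigma>" "{1..sum_list ks}" i]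
    by (cases "i \<in> {1..sum_list ks}") auto
  then show "vars_le (sum_list ks) (var (inv_into UNIV \<sigma> i))" by simp
qed

lemma twist_homog: "homog k f ==> homog k (twist \<sigma> f)"
  unfolding twist_eq_psubst by (erule homog_psubst) (rule homog_var)

lemma twist_add: "twist \<sigma> (f + g) = twist \<sigma> f + twist \<sigma> g"
  and twist_mult: "twist \<sigma> (f * g) = twist \<sigma> f * twist \<sigma> g"
  and twist_diff: "twist \<sigma> (f - g) = twist \<sigma> f - twist \<sigma> g"
  and twist_const [simp]: "twist \<sigma> (Poly_Mapping.single 0 c) = Poly_Mapping.single 0 c"
  and twist_0 [simp]: "twist \<sigma> 0 = 0"
  and twist_var: "twist \<sigma> (var i) = var (inv_into UNIV \<sigma> i)"
  by (simp_all add: twist_eq_psubst psubst_add psubst_mult psubst_diff)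

lemma twist_id [simp]: "twist id f = f"
proof -
  have "inv_into UNIV id = (id :: nat => nat)" by (metis inv_id)
  then show ?thesis by (simp add: twist_eq_psubst)
qed

text \<open>With products read from left to right, \<open>\<tau> \<circ> \<sigma>\<close> is the
  product of \<open>\<sigma>\<close> and \<open>\<tau>\<close>, so this is the rule of a left
  action.\<close>

lemma twist_comp:
  assumes "bij \<sigma>" "bij \<tau>" shows "twist (\<tau> \<circ> \<sigma>) f = twist \<sigma> (twist \<tau> f)"
  using assms by (simp add: twist_eq_psubst psubst_psubst o_inv_distrib)

lemma twist_R_grade:
  assumes "\<sigma> \<in> young_subgroup ks" "f \<in> R_grade (sum_list ks) q" shows "twist \<sigma> f \<in> R_grade (sum_list ks) q"
  using assms by (auto simp: R_grade_iff twist_vars_le twist_homog split: if_splits)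

lemma young_subgroup_bij: "\<sigma> \<in> young_subgroup ks ==> bij \<sigma>"
  by (auto simp: young_subgroup_def permutes_bij)

lemma sum_triv_module:
  assumes F: "finite F"
  shows "graded_twisted_module ks (direct_sum F (\<lambda>L. Triv (sum_list ks) (deg L)))"
proof (rule graded_twisted_moduleI[OF F, where s = deg and
      A = "(\<Pi>\<^sub>E L\<in>F. carrier (R_ring (sum_list ks)))" and act = "\<lambda>\<sigma> f. \<lambda>L\<in>F. twist \<sigma> (f L)"])
  let ?W = "direct_sum F (\<lambda>L. Triv (sum_list ks) (deg L))"
  show c: "carrier ?W = (\<Pi>\<^sub>E L\<in>F. carrier (R_ring (sum_list ks)))"
    using F by (auto simp: direct_sum_def Triv_def)
  show g: "grade ?W q = {f \<in> \<Pi>\<^sub>E L\<in>F. carrier (R_ring (sum_list ks)).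
        \<forall>L\<in>F. f L \<in> R_grade (sum_list ks) (q - 2 * int (deg L))}" for q
    using F by (auto simp: direct_sum_def Triv_def PiE_iff carrier_R_ring R_grade_vars_le)
  show "(\<lambda>L\<in>F. twist \<sigma> (x L)) \<in> grade ?W q" if "\<sigma> \<in> young_subgroup ks" "x \<in> grade ?W q" for \<sigma> x q
    using that unfolding g by (auto simp: PiE_iff carrier_R_ring twist_vars_le twist_R_grade)
  show "(\<lambda>L\<in>F. twist \<sigma> (x L)) \<in> (\<Pi>\<^sub>E L\<in>F. carrier (R_ring (sum_list ks)))"
    if "\<sigma> \<in> young_subgroup ks" "x \<in> (\<Pi>\<^sub>E L\<in>F. carrier (R_ring (sum_list ks)))" for \<sigma> x
    using that by (auto simp: PiE_iff carrier_R_ring twist_vars_le)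
  show "(\<lambda>L\<in>F. twist (\<tau> \<circ> \<sigma>) (x L)) = (\<lambda>L\<in>F. twist \<sigma> ((\<lambda>L\<in>F. twist \<tau> (x L)) L))"
    if "\<sigma> \<in> young_subgroup ks" "\<tau> \<in> young_subgroup ks" for \<sigma> \<tau> and x :: "'a => poly_R"
    using that by (auto simp: twist_comp young_subgroup_bij)
  show "(\<lambda>L\<in>F. twist id (x L)) = x" if "x \<in> (\<Pi>\<^sub>E L\<in>F. carrier (R_ring (sum_list ks)))" for x
    using that by (auto simp: PiE_iff intro!: extensionalityI)
  show "(\<lambda>L\<in>F. gcomp (q - 2 * int (deg L)) (x L)) \<in> (\<Pi>\<^sub>E L\<in>F. carrier (R_ring (sum_list ks)))"
    if "x \<in> (\<Pi>\<^sub>E L\<in>F. carrier (R_ring (sum_list ks)))" for x q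
    using that by (auto simp: PiE_iff carrier_R_ring intro: R_grade_vars_le gcomp_R_grade)
qed (auto simp: direct_sum_def Triv_def PiE_iff carrier_R_ring vars_le_add vars_le_mult twist_add twist_mult)

text \<open>The algebraic input of the final argument: homogeneous classes \<open>p\<close>,
  triangular for a height function \<open>\<mu>\<close> with diagonal entries dividing every
  possible leading value, and a group action for which a transposition changes a section by a
  multiple of a linear form.\<close>

locale twisted_class_basis =
  fixes ks :: "nat list" and F :: "'a set" and A :: "('a => poly_R) set"
    and act :: "(nat => nat) => ('a => poly_R) => 'a => poly_R"
    and deg :: "'a => nat" and \<mu> :: "'a => nat" and p :: "'a => 'a => poly_R"
  assumes finite_F: "finite F"
    and A_ext: "x \<in> A ==> x \<in> extensional F"
    and A_vars: "x \<in> A ==> L \<in> F ==> vars_le (sum_list ks) (x L)"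
    and A_zero: "(\<lambda>L\<in>F. 0) \<in> A"
    and A_add: "x \<in> A ==> y \<in> A ==> (\<lambda>L\<in>F. x L + y L) \<in> A"
    and A_scale: "vars_le (sum_list ks) a ==> x \<in> A ==> (\<lambda>L\<in>F. a * x L) \<in> A"
    and A_hcomp: "x \<in> A ==> (\<lambda>L\<in>F. hcomp k (x L)) \<in> A"
    and act_closed: "\<sigma> \<in> young_subgroup ks ==> x \<in> A ==> act \<sigma> x \<in> A"
    and act_id: "x \<in> A ==> act id x = x"
    and act_comp: "\<sigma> \<in> young_subgroup ks ==> \<tau> \<in> young_subgroup ks ==> x \<in> A ==>
      act (\<tau> \<circ> \<sigma>) x = act \<sigma> (act \<tau> x)"
    and act_add: "\<sigma> \<in> young_subgroup ks ==> x \<in> A ==> y \<in> A ==>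
      act \<sigma> (\<lambda>L\<in>F. x L + y L) = (\<lambda>L\<in>F. act \<sigma> x L + act \<sigma> y L)"
    and act_scale: "\<sigma> \<in> young_subgroup ks ==> vars_le (sum_list ks) a ==> x \<in> A ==>
      act \<sigma> (\<lambda>L\<in>F. a * x L) = (\<lambda>L\<in>F. twist \<sigma> a * act \<sigma> x L)"
    and act_homog: "\<sigma> \<in> young_subgroup ks ==> x \<in> A ==> \<forall>L\<in>F. homog k (x L) ==> L \<in> F ==> homog k (act \<sigma> x L)"
    and act_swap: "r < length ks ==> i \<in> block ks r ==> j \<in> block ks r ==> i ~= j ==> x \<in> A ==>
      \<exists>g\<in>A. \<exists>\<alpha>. vars_le (sum_list ks) \<alpha> \<and> homog 1 \<alpha> \<and> \<alpha> ~= 0 \<and>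
        (\<forall>L\<in>F. x L - act (Transposition.transpose i j) x L = \<alpha> * g L)"
    and p_A: "L \<in> F ==> p L \<in> A"
    and p_homog: "L \<in> F ==> K \<in> F ==> homog (deg L) (p L K)"
    and p_diag: "L \<in> F ==> p L L ~= 0"
    and p_tri: "L \<in> F ==> K \<in> F ==> p L K ~= 0 ==> K = L \<or> \<mu> L < \<mu> K"
    and p_dvd: "x \<in> A ==> L \<in> F ==> (\<forall>K\<in>F. \<mu> K < \<mu> L \<longrightarrow> x K = 0) ==> p L L dvd x L"
begin

abbreviation "d \<equiv> sum_list ks"
abbreviation "S \<equiv> young_subgroup ks"

section \<open>Sections as combinations of the triangular classes\<close>

definition lin :: "('a => 'a => poly_R) => ('a => poly_R) => 'a => poly_R" where
  "lin b c = (\<lambda>K\<in>F. \<Sum>L\<in>F. c L * b L K)"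

definition coeffs :: "('a => poly_R) set" where
  "coeffs = (\<Pi>\<^sub>E L\<in>F. carrier (R_ring d))"

lemma A_eqI: "x \<in> A ==> y \<in> A ==> (\<And>L. L \<in> F ==> x L = y L) ==> x = y"
  using A_ext by (blast intro: extensionalityI)

lemma A_sum: "finite I ==> (\<And>i. i \<in> I ==> x i \<in> A) ==> (\<lambda>L\<in>F. \<Sum>i\<in>I. x i L) \<in> A"
proof (induction I rule: finite_induct)
  case (insert j I)
  then have "(\<lambda>L\<in>F. x j L + (\<lambda>L\<in>F. \<Sum>i\<in>I. x i L) L) \<in> A" by (intro A_add) auto
  moreover have "(\<lambda>L\<in>F. x j L + (\<lambda>L\<in>F. \<Sum>i\<in>I. x i L) L) = (\<lambda>L\<in>F. \<Sum>i\<in>insert j I. x i L)"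
    using insert.hyps by (intro restrict_ext) simp
  ultimately show ?case by (simp only:)
qed (simp add: A_zero)

lemma A_diff: "x \<in> A ==> y \<in> A ==> (\<lambda>L\<in>F. x L - y L) \<in> A"
proof -
  assume x: "x \<in> A" and y: "y \<in> A"
  have "(\<lambda>L\<in>F. x L + (\<lambda>L\<in>F. - 1 * y L) L) \<in> A" by (intro A_add A_scale x y) simp
  moreover have "(\<lambda>L\<in>F. x L + (\<lambda>L\<in>F. - 1 * y L) L) = (\<lambda>L\<in>F. x L - y L)" by (intro restrict_ext) simp
  ultimately show ?thesis by (simp only:)
qed

lemma lin_A: assumes "\<And>L. L \<in> F ==> b L \<in> A" "c \<in> coeffs" shows "lin b c \<in> A"
proof -
  have "(\<lambda>K\<in>F. \<Sum>L\<in>F. (\<lambda>L. \<lambda>K\<in>F. c L * b L K) L K) \<in> A"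
    using assms by (intro A_sum finite_F A_scale) (auto simp: coeffs_def PiE_iff carrier_R_ring)
  moreover have "(\<lambda>K\<in>F. \<Sum>L\<in>F. (\<lambda>L. \<lambda>K\<in>F. c L * b L K) L K) = lin b c"
    unfolding lin_def by (intro restrict_ext) simp
  ultimately show ?thesis by (simp only:)
qed

text \<open>Leading values are removed height by height. If \<open>x\<close> vanishes at all heights
  below \<open>m\<close>, then \<open>p_dvd\<close> provides coefficients for the classes of height
  \<open>m\<close>, and subtracting them leaves a section vanishing up to height
  \<open>m\<close>.\<close>

lemma span_p:
  assumes "x \<in> A" shows "\<exists>c\<in>coeffs. x = lin p c"
proof -
  obtain N where N: "\<And>K. K \<in> F ==> \<mu> K < N"
    using finite_F by (metis finite_imageI finite_nat_set_iff_bounded imageI)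
  have "\<exists>c\<in>coeffs. x = lin p c" if "x \<in> A" "\<forall>K\<in>F. \<mu> K < m \<longrightarrow> x K = 0" "m \<le> N" for m x
    using \<open>m \<le> N\<close> that(1,2)
  proof (induction arbitrary: x rule: inc_induct)
    case base
    then have "x K = 0" if "K \<in> F" for K using that N by blast
    then have "x = lin p (\<lambda>L\<in>F. 0)"
      using A_ext[OF base(1)] by (intro extensionalityI[of _ F]) (auto simp: lin_def)
    moreover have "(\<lambda>L\<in>F. 0) \<in> coeffs" by (simp add: coeffs_def carrier_R_ring)
    ultimately show ?case by blast
  next
    case (step m)
    define a where "a L = (if \<mu> L = m then SOME a. x L = p L L * a else 0)" for L
    have a: "x L = p L L * a L" if "L \<in> F" "\<mu> L = m" for L
    proof -
      have "p L L dvd x L" by (rule p_dvd[OF step.prems(1)]) (use step.prems(2) that in auto)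
      then have "\<exists>a. x L = p L L * a" by (simp add: dvd_def)
      then have "x L = p L L * (SOME a. x L = p L L * a)" by (rule someI_ex)
      then show ?thesis using that by (simp add: a_def)
    qed
    have av: "vars_le d (a L)" if "L \<in> F" for L
    proof (cases "\<mu> L = m")
      case True
      show ?thesis
        by (rule vars_le_cancel[of d "p L L"])
          (use a[OF that True] A_vars[OF step.prems(1) that] A_vars[OF p_A[OF that] that] p_diag[OF that] in auto)
    qed (simp add: a_def)
    have aC: "restrict a F \<in> coeffs" using av by (simp add: coeffs_def carrier_R_ring)
    let ?y = "lin p (restrict a F)"
    have yA: "?y \<in> A" by (rule lin_A[OF p_A aC])
    have yK: "?y K = (\<Sum>L\<in>F. a L * p L K)" if "K \<in> F" for K using that by (simp add: lin_def)
    have z: "(\<lambda>L\<in>F. x L - ?y L) K = 0" if K: "K \<in> F" "\<mu> K < Suc m" for K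
    proof -
      have t: "a L * p L K = 0" if "L \<in> F" "L ~= K" for L
        using p_tri[OF \<open>L \<in> F\<close> K(1)] that K(2) by (cases "p L K = 0") (auto simp: a_def)
      have "?y K = (\<Sum>L\<in>{K}. a L * p L K)"
        unfolding yK[OF K(1)] by (rule sum.mono_neutral_right[OF finite_F]) (use K t in auto)
      then have "?y K = a K * p K K" by simp
      then have y: "(\<lambda>L\<in>F. x L - ?y L) K = x K - a K * p K K" using K(1) by simp
      show ?thesis
      proof (cases "\<mu> K = m")
        case True then show ?thesis unfolding y using a[OF K(1)] by (simp add: mult.commute)
      next
        case False
        then have "x K = 0" "a K = 0" using K step.prems(2) by (auto simp: a_def)
        then show ?thesis unfolding y by simp
      qed
    qed
    obtain c where c: "c \<in> coeffs" "(\<lambda>L\<in>F. x L - ?y L) = lin p c"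
      using step.IH[of "\<lambda>L\<in>F. x L - ?y L"] A_diff[OF step.prems(1) yA] z by blast
    let ?c = "\<lambda>L\<in>F. a L + c L"
    have cC: "?c \<in> coeffs" using c(1) av by (auto simp: coeffs_def carrier_R_ring PiE_iff vars_le_add)
    have "x K = lin p ?c K" if "K \<in> F" for K
    proof -
      have "x K - ?y K = lin p c K" using fun_cong[OF c(2), of K] that by simp
      then show ?thesis using that by (simp add: lin_def distrib_right sum.distrib algebra_simps)
    qed
    then have "x = lin p ?c" by (intro A_eqI[OF step.prems(1) lin_A[OF p_A cC]]) auto
    then show ?case using cC by blast
  qed
  from this[OF assms, of 0] show ?thesis by simp
qed

text \<open>At a point of least height with nonzero coefficient only its own class
  contributes.\<close>

lemma indep_p:
  assumes "\<forall>K\<in>F. (\<Sum>L\<in>F. c L * p L K) = 0" "L \<in> F" shows "c L = 0"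
proof (rule ccontr)
  assume "c L ~= 0"
  then obtain M where M: "M \<in> F" "c M ~= 0" and min: "\<And>K. K \<in> F ==> c K ~= 0 ==> \<mu> M \<le> \<mu> K"
    using ex_has_least_nat[of "\<lambda>L. L \<in> F \<and> c L ~= 0" L \<mu>] assms(2) by blast
  have "c K * p K M = 0" if "K \<in> F" "K ~= M" for K
    using p_tri[OF that(1) M(1)] min[OF that(1)] that by (cases "c K = 0") auto
  then have "(\<Sum>L\<in>F. c L * p L M) = (\<Sum>L\<in>{M}. c L * p L M)"
    by (intro sum.mono_neutral_right finite_F) (use M in auto)
  then show False using assms(1) M p_diag by auto
qed

text \<open>Coefficients range over all polynomials, so uniqueness can be used before it is known
  that they lie in R.\<close>

definition indep :: "('a => 'a => poly_R) => bool" where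
  "indep b \<longleftrightarrow> (\<forall>c. (\<forall>K\<in>F. (\<Sum>L\<in>F. c L * b L K) = 0) \<longrightarrow> (\<forall>L\<in>F. c L = 0))"

lemma indepD: "indep b ==> (\<And>K. K \<in> F ==> (\<Sum>L\<in>F. c L * b L K) = 0) ==> L \<in> F ==> c L = 0"
  by (auto simp: indep_def)

lemma unique_coeffs:
  assumes ind: "indep b"
    and c: "c \<in> extensional F" "c' \<in> extensional F" and eq: "lin b c = lin b c'"
  shows "c = c'"
proof (rule extensionalityI[OF c])
  fix L assume "L \<in> F"
  have "(\<Sum>L\<in>F. (c L - c' L) * b L K) = 0" if "K \<in> F" for K
    using fun_cong[OF eq, of K] that by (simp add: lin_def left_diff_distrib sum_subtractf)
  from indepD[OF ind this \<open>L \<in> F\<close>] show "c L = c' L" by simp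
qed

text \<open>Replacing each coefficient by its component of the complementary degree does not change
  a combination that is homogeneous of degree \<open>q\<close>; uniqueness then identifies the
  coefficients with these components.\<close>

lemma coeffs_gcomp:
  assumes ind: "indep b"
    and b: "\<And>L K. L \<in> F ==> K \<in> F ==> homog (deg L) (b L K)"
    and x: "\<And>K. K \<in> F ==> lin b c K \<in> R_grade d q" and c: "c \<in> coeffs" and L: "L \<in> F"
  shows "c L \<in> R_grade d (q - 2 * int (deg L))"
proof -
  let ?c = "\<lambda>L\<in>F. gcomp (q - 2 * int (deg L)) (c L)"
  have cv: "vars_le d (c L)" if "L \<in> F" for L using c that by (auto simp: coeffs_def carrier_R_ring PiE_iff)
  have "lin b c K = lin b ?c K" if K: "K \<in> F" for K
  proof -
    have "lin b c K = gcomp q (lin b c K)" using gcomp_of_R_grade[OF x[OF K], of q] by simp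
    also have "\<dots> = (\<Sum>L\<in>F. gcomp q (c L * b L K))" using K by (simp add: lin_def gcomp_sum)
    also have "\<dots> = (\<Sum>L\<in>F. gcomp (q - 2 * int (deg L)) (c L) * b L K)"
      by (intro sum.cong refl gcomp_mult b K)
    finally show ?thesis using K by (simp add: lin_def)
  qed
  then have leq: "lin b c = lin b ?c"
    by (intro extensionalityI[of "lin b c" F "lin b ?c"]) (simp_all only: lin_def restrict_extensional)
  have "c \<in> extensional F" using c by (simp add: coeffs_def PiE_iff)
  from unique_coeffs[OF ind this restrict_extensional leq] have "c = ?c" .
  from fun_cong[OF this, of L] have eq: "c L = gcomp (q - 2 * int (deg L)) (c L)"
    unfolding restrict_apply'[OF L] .
  show ?thesis by (subst eq) (rule gcomp_R_grade[OF cv[OF L]])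
qed

lemma indep_p': "indep p"
  using indep_p by (auto simp: indep_def)

text \<open>The filtration by generator degree. The group acts trivially on sections of degree
  \<open>k\<close> modulo \<open>low k\<close>, which is the content of
  \<open>act_minus_id\<close>.\<close>

definition low :: "nat => ('a => poly_R) set" where
  "low k = {lin p c | c. c \<in> coeffs \<and> (\<forall>L\<in>F. c L ~= 0 \<longrightarrow> deg L < k)}"

lemma low_add: assumes "x \<in> low k" "y \<in> low k" shows "(\<lambda>K\<in>F. x K + y K) \<in> low k"
proof -
  obtain b c where b: "x = lin p b" "b \<in> coeffs" "\<forall>L\<in>F. b L ~= 0 \<longrightarrow> deg L < k"
    and c: "y = lin p c" "c \<in> coeffs" "\<forall>L\<in>F. c L ~= 0 \<longrightarrow> deg L < k"
    using assms by (auto simp: low_def)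
  let ?c = "\<lambda>L\<in>F. b L + c L"
  have "?c \<in> coeffs" using b c by (auto simp: coeffs_def carrier_R_ring PiE_iff vars_le_add)
  moreover have "\<forall>L\<in>F. ?c L ~= 0 \<longrightarrow> deg L < k" using b(3) c(3) by force
  moreover have "(\<lambda>K\<in>F. x K + y K) = lin p ?c"
    by (auto simp: b(1) c(1) lin_def distrib_right sum.distrib fun_eq_iff)
  ultimately show ?thesis by (auto simp: low_def)
qed

lemma low_scale: assumes "x \<in> low k" "vars_le d a" shows "(\<lambda>K\<in>F. a * x K) \<in> low k"
proof -
  obtain c where c: "x = lin p c" "c \<in> coeffs" "\<forall>L\<in>F. c L ~= 0 \<longrightarrow> deg L < k"
    using assms by (auto simp: low_def)
  let ?c = "\<lambda>L\<in>F. a * c L"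
  have "?c \<in> coeffs" using assms(2) c by (auto simp: coeffs_def carrier_R_ring PiE_iff vars_le_mult)
  moreover have "\<forall>L\<in>F. ?c L ~= 0 \<longrightarrow> deg L < k" using c(3) by force
  moreover have "(\<lambda>K\<in>F. a * x K) = lin p ?c"
    by (auto simp: c(1) lin_def sum_distrib_left mult.assoc fun_eq_iff)
  ultimately show ?thesis by (auto simp: low_def)
qed

lemma low_zero: "(\<lambda>K\<in>F. 0) \<in> low k"
proof -
  have "(\<lambda>K\<in>F. 0) = lin p (\<lambda>L\<in>F. 0)" by (auto simp: lin_def fun_eq_iff)
  then show ?thesis unfolding low_def by (auto simp: coeffs_def carrier_R_ring)
qed

lemma low_sum: "finite I ==> (\<And>i. i \<in> I ==> x i \<in> low k) ==> (\<lambda>L\<in>F. \<Sum>i\<in>I. x i L) \<in> low k"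
proof (induction I rule: finite_induct)
  case (insert j I)
  then have "(\<lambda>L\<in>F. x j L + (\<lambda>L\<in>F. \<Sum>i\<in>I. x i L) L) \<in> low k" by (intro low_add) auto
  moreover have "(\<lambda>L\<in>F. x j L + (\<lambda>L\<in>F. \<Sum>i\<in>I. x i L) L) = (\<lambda>L\<in>F. \<Sum>i\<in>insert j I. x i L)"
    using insert.hyps by (intro restrict_ext) simp
  ultimately show ?case by (simp only:)
qed (simp add: low_zero)

lemma homog_grade: "vars_le d f ==> homog k f ==> f \<in> R_grade d (2 * int k)"
  by (simp add: R_grade_iff)

text \<open>In a homogeneous section of degree \<open>k\<close> a class of larger degree would need
  a coefficient of negative degree.\<close>

lemma homog_low: assumes x: "x \<in> A" "\<forall>K\<in>F. homog k (x K)" shows "x \<in> low (Suc k)"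
proof -
  obtain c where c: "c \<in> coeffs" "x = lin p c" using span_p[OF x(1)] by blast
  have "c L \<in> R_grade d (2 * int k - 2 * int (deg L))" if "L \<in> F" for L
    by (rule coeffs_gcomp[OF indep_p' p_homog _ c(1) that])
      (use x A_vars c(2) homog_grade in auto)
  then have "deg L < Suc k" if "L \<in> F" "c L ~= 0" for L
    using that by (force simp: R_grade_iff split: if_splits)
  then show ?thesis using c by (auto simp: low_def)
qed

text \<open>For a transposition the difference is a linear form times a section of degree
  \<open>k - 1\<close>, which involves only classes of degree below \<open>k\<close>. A product of
  transpositions is handled by telescoping.\<close>

lemma act_minus_id:
  assumes "\<sigma> \<in> S" "x \<in> A" "\<forall>K\<in>F. homog k (x K)" shows "(\<lambda>K\<in>F. act \<sigma> x K - x K) \<in> low k"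
  using assms
proof (induction arbitrary: x rule: young_subgroup_induct)
  case id
  have "(\<lambda>K\<in>F. act id x K - x K) = (\<lambda>K\<in>F. 0)"
    by (intro restrict_ext) (simp only: act_id[OF id(1)] diff_self)
  then show ?case using low_zero by (simp only:)
next
  case (swap a b r \<sigma>)
  let ?t = "Transposition.transpose a b"
  have t: "?t \<in> S" by (rule transpose_in_young_subgroup[OF swap(1-3)])
  let ?y = "act ?t x"
  have yA: "?y \<in> A" by (rule act_closed[OF t swap(7)])
  have yh: "\<forall>K\<in>F. homog k (?y K)" using act_homog[OF t swap(7,8)] by blast
  have "(\<lambda>K\<in>F. act \<sigma> ?y K - ?y K) \<in> low k" by (rule swap.IH[OF yA yh])
  moreover have "(\<lambda>K\<in>F. ?y K - x K) \<in> low k"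
  proof -
    obtain g \<alpha> where g: "g \<in> A" "vars_le d \<alpha>" "homog 1 \<alpha>" "\<alpha> ~= 0" "\<And>K. K \<in> F ==> x K - ?y K = \<alpha> * g K"
      using act_swap[OF swap(1-4,7)] by blast
    have h: "homog k (\<alpha> * g K)" if "K \<in> F" for K
      using g(5)[OF that, symmetric] swap(8) yh that by (auto intro: homog_diff)
    show ?thesis
    proof (cases "k = 0")
      case True
      \<comment> \<open>In degree zero a multiple of a linear form vanishes. The qualified name
        refers to the statement about polynomials, which the one about sections hides.\<close>
      have "\<alpha> * g K = 0" if "K \<in> F" for K using Submission.homog_low[OF g(3) h[OF that]] True by simp
      then have "(\<lambda>K\<in>F. ?y K - x K) = (\<lambda>K\<in>F. 0)" using g(5) by (intro restrict_ext) (metis eq_iff_diff_eq_0 diff_0 minus_diff_eq neg_equal_0_iff_equal)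
      then show ?thesis using low_zero by simp
    next
      case False
      have "homog (k - 1) (g K)" if "K \<in> F" for K
        by (rule homog_cancel[OF g(3) h[OF that] g(4)]) (use False in simp)
      then have "g \<in> low k" using homog_low[OF g(1), of "k - 1"] False by simp
      then have "(\<lambda>K\<in>F. (- \<alpha>) * g K) \<in> low k" using g(2) by (intro low_scale) auto
      moreover have "(\<lambda>K\<in>F. (- \<alpha>) * g K) = (\<lambda>K\<in>F. ?y K - x K)"
        using g(5) by (intro restrict_ext) (metis minus_diff_eq mult_minus_left)
      ultimately show ?thesis by simp
    qed
  qed
  ultimately have "(\<lambda>K\<in>F. (\<lambda>K\<in>F. act \<sigma> ?y K - ?y K) K + (\<lambda>K\<in>F. ?y K - x K) K) \<in> low k" by (rule low_add)
  moreover have "(\<lambda>K\<in>F. (\<lambda>K\<in>F. act \<sigma> ?y K - ?y K) K + (\<lambda>K\<in>F. ?y K - x K) K) =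
      (\<lambda>K\<in>F. act (?t \<circ> \<sigma>) x K - x K)"
    using act_comp[OF swap(5) t swap(7)] by (intro restrict_ext) simp
  ultimately show ?case by (simp only:)
qed

section \<open>Averaging over the Young subgroup\<close>

definition avg :: "'a => 'a => poly_R" where
  "avg L = (\<lambda>K\<in>F. Poly_Mapping.single 0 (1 / of_nat (card S)) * (\<Sum>\<sigma>\<in>S. act \<sigma> (p L) K))"

lemma card_S: "card S > 0"
  using finite_young_subgroup young_subgroup_id by (metis card_gt_0_iff empty_iff)

lemma sum_act_A: assumes "x \<in> A" shows "(\<lambda>K\<in>F. \<Sum>\<sigma>\<in>S. act \<sigma> x K) \<in> A"
  by (rule A_sum[OF finite_young_subgroup act_closed[OF _ assms]])

lemma avg_eq: "avg L = (\<lambda>K\<in>F. Poly_Mapping.single 0 (1 / of_nat (card S)) * (\<lambda>K\<in>F. \<Sum>\<sigma>\<in>S. act \<sigma> (p L) K) K)"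
  unfolding avg_def by (intro restrict_ext) simp

lemma avg_A: "L \<in> F ==> avg L \<in> A"
  unfolding avg_eq by (intro A_scale sum_act_A p_A) auto

lemma avg_homog: assumes "L \<in> F" "K \<in> F" shows "homog (deg L) (avg L K)"
proof -
  have "homog (0 + deg L) (Poly_Mapping.single 0 (1 / of_nat (card S)) * (\<Sum>\<sigma>\<in>S. act \<sigma> (p L) K))"
    using assms p_homog by (intro homog_mult homog_const homog_sum act_homog p_A) auto
  then show ?thesis using assms by (simp add: avg_def)
qed

lemma act_sum:
  assumes "\<tau> \<in> S" "finite I" "\<And>i. i \<in> I ==> x i \<in> A"
  shows "act \<tau> (\<lambda>K\<in>F. \<Sum>i\<in>I. x i K) = (\<lambda>K\<in>F. \<Sum>i\<in>I. act \<tau> (x i) K)"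
  using assms(2,3)
proof (induction I rule: finite_induct)
  case empty
  have "act \<tau> (\<lambda>L\<in>F. 0 * (\<lambda>L\<in>F. 0) L) = (\<lambda>L\<in>F. twist \<tau> 0 * act \<tau> (\<lambda>L\<in>F. 0) L)"
    by (rule act_scale[OF assms(1) _ A_zero]) simp
  moreover have "(\<lambda>L\<in>F. 0 * (\<lambda>L\<in>F. 0) L) = (\<lambda>L\<in>F. 0 :: poly_R)" by (intro restrict_ext) simp
  ultimately have "act \<tau> (\<lambda>L\<in>F. 0) = (\<lambda>L\<in>F. 0)" by (simp only: twist_0 mult_zero_left)
  then show ?case by (simp only: sum.empty)
next
  case (insert j I)
  have "(\<lambda>L\<in>F. \<Sum>i\<in>insert j I. x i L) = (\<lambda>L\<in>F. x j L + (\<lambda>L\<in>F. \<Sum>i\<in>I. x i L) L)"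
    using insert.hyps by (intro restrict_ext) simp
  then have "act \<tau> (\<lambda>L\<in>F. \<Sum>i\<in>insert j I. x i L) = act \<tau> (\<lambda>L\<in>F. x j L + (\<lambda>L\<in>F. \<Sum>i\<in>I. x i L) L)" by simp
  also have "\<dots> = (\<lambda>L\<in>F. act \<tau> (x j) L + act \<tau> (\<lambda>L\<in>F. \<Sum>i\<in>I. x i L) L)"
    using insert.prems insert.hyps by (intro act_add assms(1) A_sum) auto
  also have "\<dots> = (\<lambda>K\<in>F. \<Sum>i\<in>insert j I. act \<tau> (x i) K)"
  proof (intro restrict_ext)
    fix L assume L: "L \<in> F"
    have "act \<tau> (\<lambda>L\<in>F. \<Sum>i\<in>I. x i L) = (\<lambda>K\<in>F. \<Sum>i\<in>I. act \<tau> (x i) K)"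
      by (rule insert.IH) (use insert.prems in auto)
    then show "act \<tau> (x j) L + act \<tau> (\<lambda>L\<in>F. \<Sum>i\<in>I. x i L) L = (\<Sum>i\<in>insert j I. act \<tau> (x i) L)"
      using insert.hyps by (simp only: restrict_apply'[OF L] sum.insert not_False_eq_True)
  qed
  finally show ?case .
qed

lemma avg_invariant: assumes "\<tau> \<in> S" "L \<in> F" shows "act \<tau> (avg L) = avg L"
proof -
  let ?x = "\<lambda>K\<in>F. \<Sum>\<sigma>\<in>S. act \<sigma> (p L) K"
  have "act \<tau> ?x = (\<lambda>K\<in>F. \<Sum>\<sigma>\<in>S. act \<tau> (act \<sigma> (p L)) K)"
    by (rule act_sum[OF assms(1) finite_young_subgroup]) (use act_closed p_A assms in auto)
  also have "\<dots> = (\<lambda>K\<in>F. \<Sum>\<sigma>\<in>S. act (\<sigma> \<circ> \<tau>) (p L) K)"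
    using act_comp[OF assms(1) _ p_A[OF assms(2)]] by (intro restrict_ext sum.cong) auto
  also have "\<dots> = ?x"
  proof (intro restrict_ext)
    fix K
    have "bij_betw (\<lambda>\<sigma>. \<sigma> \<circ> \<tau>) S S"
    proof (rule bij_betw_byWitness[where f' = "\<lambda>\<sigma>. \<sigma> \<circ> inv_into UNIV \<tau>"])
      have b: "bij \<tau>" using young_subgroup_bij[OF assms(1)] .
      show "\<forall>a\<in>S. a \<circ> \<tau> \<circ> inv_into UNIV \<tau> = a" using bij_is_surj[OF b] by (simp add: fun_eq_iff surj_f_inv_f)
      show "\<forall>a\<in>S. a \<circ> inv_into UNIV \<tau> \<circ> \<tau> = a" using bij_is_inj[OF b] by (simp add: fun_eq_iff)
    qed (use young_subgroup_comp young_subgroup_inv assms(1) in auto)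
    from sum.reindex_bij_betw[OF this, of "\<lambda>\<sigma>. act \<sigma> (p L) K"]
    show "(\<Sum>\<sigma>\<in>S. act (\<sigma> \<circ> \<tau>) (p L) K) = (\<Sum>\<sigma>\<in>S. act \<sigma> (p L) K)" .
  qed
  finally have inv: "act \<tau> ?x = ?x" .
  show ?thesis
    unfolding avg_eq by (subst act_scale[OF assms(1) _ sum_act_A[OF p_A[OF assms(2)]]]) (simp_all only: inv twist_const vars_le_const)
qed

text \<open>Averaging the differences of \<open>act_minus_id\<close> stays in
  \<open>low (deg L)\<close>, so passing from \<open>p\<close> to \<open>avg\<close> is
  unitriangular with respect to the degree.\<close>

lemma avg_low: assumes L: "L \<in> F" shows "\<exists>r\<in>coeffs. (\<forall>M\<in>F. r M ~= 0 \<longrightarrow> deg M < deg L) \<and>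
    (\<forall>K\<in>F. avg L K = p L K + (\<Sum>M\<in>F. r M * p M K))"
proof -
  let ?c = "Poly_Mapping.single 0 (1 / of_nat (card S)) :: poly_R"
  have "(\<lambda>K\<in>F. ?c * (\<lambda>K\<in>F. \<Sum>\<sigma>\<in>S. (\<lambda>K\<in>F. act \<sigma> (p L) K - p L K) K) K) \<in> low (deg L)"
    by (intro low_scale low_sum finite_young_subgroup act_minus_id p_A L vars_le_const) (use p_homog L in auto)
  then obtain r where r: "r \<in> coeffs" "\<forall>M\<in>F. r M ~= 0 \<longrightarrow> deg M < deg L"
    "(\<lambda>K\<in>F. ?c * (\<lambda>K\<in>F. \<Sum>\<sigma>\<in>S. (\<lambda>K\<in>F. act \<sigma> (p L) K - p L K) K) K) = lin p r"
    by (auto simp: low_def)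
  have "avg L K = p L K + (\<Sum>M\<in>F. r M * p M K)" if K: "K \<in> F" for K
  proof -
    \<comment> \<open>Here the rational coefficients are essential: the order of the group is
      inverted.\<close>
    have "?c * of_nat (card S) = ?c * Poly_Mapping.single 0 (of_nat (card S))" by (simp only: single_of_nat)
    also have "\<dots> = Poly_Mapping.single (0 + 0) (1 / of_nat (card S) * of_nat (card S))" by (rule mult_single)
    also have "\<dots> = 1" using card_S by simp
    finally have one: "?c * of_nat (card S) = 1" .
    have "(\<Sum>M\<in>F. r M * p M K) = ?c * ((\<Sum>\<sigma>\<in>S. act \<sigma> (p L) K) - of_nat (card S) * p L K)"
      using fun_cong[OF r(3), of K] K by (simp add: lin_def sum_subtractf)
    also have "\<dots> = avg L K - (?c * of_nat (card S)) * p L K" using K by (simp add: avg_def algebra_simps)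
    finally show ?thesis unfolding one by simp
  qed
  then show ?thesis using r by blast
qed

definition rel :: "'a => 'a => poly_R" where
  "rel L = (SOME r. r \<in> coeffs \<and> (\<forall>M\<in>F. r M ~= 0 \<longrightarrow> deg M < deg L) \<and>
    (\<forall>K\<in>F. avg L K = p L K + (\<Sum>M\<in>F. r M * p M K)))"

lemma rel:
  assumes "L \<in> F"
  shows "rel L \<in> coeffs" "M \<in> F ==> rel L M ~= 0 ==> deg M < deg L"
    "K \<in> F ==> avg L K = p L K + (\<Sum>M\<in>F. rel L M * p M K)"
proof -
  have "\<exists>r. r \<in> coeffs \<and> (\<forall>M\<in>F. r M ~= 0 \<longrightarrow> deg M < deg L) \<and>
    (\<forall>K\<in>F. avg L K = p L K + (\<Sum>M\<in>F. r M * p M K))" using avg_low[OF assms] by blast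
  then have "rel L \<in> coeffs \<and> (\<forall>M\<in>F. rel L M ~= 0 \<longrightarrow> deg M < deg L) \<and>
    (\<forall>K\<in>F. avg L K = p L K + (\<Sum>M\<in>F. rel L M * p M K))"
    unfolding rel_def by (rule someI_ex)
  then show "rel L \<in> coeffs" "M \<in> F ==> rel L M ~= 0 ==> deg M < deg L"
    "K \<in> F ==> avg L K = p L K + (\<Sum>M\<in>F. rel L M * p M K)" by blast+
qed

lemma lin_avg:
  assumes "K \<in> F" shows "(\<Sum>L\<in>F. c L * avg L K) = (\<Sum>M\<in>F. (c M + (\<Sum>L\<in>F. c L * rel L M)) * p M K)"
proof -
  have "(\<Sum>L\<in>F. c L * avg L K) = (\<Sum>L\<in>F. c L * p L K) + (\<Sum>L\<in>F. \<Sum>M\<in>F. c L * rel L M * p M K)"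
    using rel(3) assms by (simp add: algebra_simps sum.distrib sum_distrib_left)
  also have "(\<Sum>L\<in>F. \<Sum>M\<in>F. c L * rel L M * p M K) = (\<Sum>M\<in>F. (\<Sum>L\<in>F. c L * rel L M) * p M K)"
    by (subst sum.swap) (simp add: sum_distrib_right)
  finally show ?thesis by (simp add: distrib_right sum.distrib)
qed

text \<open>Among the indices with nonzero coefficient one of largest degree is taken. The
  transition terms go to strictly smaller degrees, so the coefficient of its class \<open>p\<close>
  is unchanged and must vanish.\<close>

lemma indep_avg:
  assumes "\<forall>K\<in>F. (\<Sum>L\<in>F. c L * avg L K) = 0" "L \<in> F" shows "c L = 0"
proof (rule ccontr)
  assume "c L ~= 0"
  define D where "D = {L \<in> F. c L ~= 0}"
  have D: "finite D" "D ~= {}" using \<open>c L ~= 0\<close> assms(2) finite_F by (auto simp: D_def)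
  then have "Max (deg ` D) \<in> deg ` D" by (intro Max_in) auto
  then obtain M where M: "M \<in> D" "deg M = Max (deg ` D)" by auto
  have z: "c L * rel L M = 0" if "L \<in> F" for L
  proof (cases "c L = 0")
    case False
    then have "deg L \<le> deg M" using that D M by (auto simp: D_def intro!: Max_ge)
    then show ?thesis using rel(2)[OF that, of M] M by (auto simp: D_def)
  qed simp
  have "c M + (\<Sum>L\<in>F. c L * rel L M) = 0"
    by (rule indep_p[of "\<lambda>M. c M + (\<Sum>L\<in>F. c L * rel L M)"]) (use assms(1) lin_avg M in \<open>auto simp: D_def\<close>)
  then show False using M z by (simp add: D_def)
qed

lemma indep_avg': "indep avg"
  using indep_avg by (auto simp: indep_def)

text \<open>Replacing \<open>p\<close> by \<open>avg\<close> produces an error whose coefficients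
  sit in strictly smaller degrees; induction on a bound for the degree absorbs it.\<close>

lemma span_avg:
  assumes "x \<in> A" shows "\<exists>c\<in>coeffs. x = lin avg c"
proof -
  have "\<exists>c'\<in>coeffs. lin p c = lin avg c'" if "c \<in> coeffs" "\<forall>L\<in>F. c L ~= 0 \<longrightarrow> deg L < m" for c m
    using that
  proof (induction m arbitrary: c)
    case 0
    then have "lin p c = lin avg c" by (auto simp: lin_def fun_eq_iff intro!: sum.cong)
    then show ?case using 0 by blast
  next
    case (Suc m)
    let ?c = "\<lambda>M\<in>F. - (\<Sum>L\<in>F. c L * rel L M)"
    have cC: "?c \<in> coeffs" using Suc.prems(1) rel(1)
      by (auto simp: coeffs_def carrier_R_ring PiE_iff intro!: vars_le_sum vars_le_mult)
    have "deg M < m" if "M \<in> F" "?c M ~= 0" for M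
    proof -
      have "(\<Sum>L\<in>F. c L * rel L M) ~= 0" using that by simp
      then obtain L where "L \<in> F" "c L * rel L M ~= 0" by (meson sum.neutral)
      then show ?thesis using Suc.prems(2) rel(2)[of L M] that by force
    qed
    then obtain c1 where c1: "c1 \<in> coeffs" "lin p ?c = lin avg c1" using Suc.IH[OF cC] by blast
    let ?c2 = "\<lambda>L\<in>F. c L + c1 L"
    have "?c2 \<in> coeffs" using Suc.prems(1) c1(1) by (auto simp: coeffs_def carrier_R_ring PiE_iff vars_le_add)
    moreover have "lin p c = lin avg ?c2"
    proof (rule extensionalityI[of _ F])
      fix K assume K: "K \<in> F"
      have "lin avg c1 K = (\<Sum>M\<in>F. - (\<Sum>L\<in>F. c L * rel L M) * p M K)"
        using fun_cong[OF c1(2), of K] K by (simp add: lin_def)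
      moreover have "lin avg ?c2 K = (\<Sum>L\<in>F. c L * avg L K) + lin avg c1 K"
        using K by (simp add: lin_def distrib_right sum.distrib)
      ultimately show "lin p c K = lin avg ?c2 K"
        using K by (simp add: lin_avg) (simp add: lin_def distrib_right sum.distrib sum_negf)
    qed (auto simp: lin_def)
    ultimately show ?case by blast
  qed
  moreover obtain c where c: "c \<in> coeffs" "x = lin p c" using span_p[OF assms] by blast
  moreover obtain N where "\<And>L. L \<in> F ==> deg L < N"
    using finite_F by (metis finite_imageI finite_nat_set_iff_bounded imageI)
  ultimately show ?thesis by blast
qed

text \<open>The isomorphism takes a section to its coefficients in the averaged basis. Since the
  basis elements are invariant, a permutation acts on the coefficients by \<open>twist\<close>
  alone, which is the action on the trivial modules.\<close>

theorem twisted_iso: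
  fixes W :: "('a => poly_R) twisted_module"
  assumes W: "carrier W = A" "zero W = (\<lambda>L\<in>F. 0)" "add W = (\<lambda>f g. \<lambda>L\<in>F. f L + g L)"
    "smult W = (\<lambda>a f. \<lambda>L\<in>F. a * f L)" "perm_action W = act"
    and grade: "\<And>q. grade W q = {f \<in> A. \<forall>L\<in>F. f L \<in> R_grade d q}"
  shows "graded_twisted_iso ks W (direct_sum F (\<lambda>L. Triv d (deg L)))"
proof -
  let ?D = "direct_sum F (\<lambda>L. Triv d (deg L))"
  have cD: "carrier ?D = coeffs"
    using finite_F by (auto simp: direct_sum_def Triv_def coeffs_def)
  have addD: "add ?D = (\<lambda>f g. \<lambda>L\<in>F. f L + g L)" and smultD: "smult ?D = (\<lambda>a f. \<lambda>L\<in>F. a * f L)"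
    and actD: "perm_action ?D = (\<lambda>\<sigma> f. \<lambda>L\<in>F. twist \<sigma> (f L))"
    by (simp_all add: direct_sum_def Triv_def)
  have gD: "grade ?D q = {f \<in> coeffs. \<forall>L\<in>F. f L \<in> R_grade d (q - 2 * int (deg L))}" for q
    using finite_F by (auto simp: direct_sum_def Triv_def PiE_iff carrier_R_ring R_grade_vars_le coeffs_def)
  have A_gcomp: "(\<lambda>L\<in>F. gcomp q (x L)) \<in> A" if "x \<in> A" for x q
  proof (cases "q \<ge> 0 \<and> even q")
    case True then show ?thesis using A_hcomp[OF that] by (simp add: gcomp_def)
  next
    case False
    then have "(\<lambda>L\<in>F. gcomp q (x L)) = (\<lambda>L\<in>F. 0)" by (intro restrict_ext) (simp only: gcomp_def if_False)
    then show ?thesis using A_zero by simp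
  qed
  have mod: "graded_twisted_module ks W"
  proof (rule graded_twisted_moduleI[OF finite_F W, where s = "\<lambda>_. 0"])
    fix \<sigma> x q assume s: "\<sigma> \<in> S" and x: "x \<in> grade W q"
    then have xA: "x \<in> A" by (simp add: grade)
    have yA: "act \<sigma> x \<in> A" by (rule act_closed[OF s xA])
    show "act \<sigma> x \<in> grade W q"
    proof (cases "q \<ge> 0 \<and> even q")
      case True
      then have "\<forall>L\<in>F. homog (nat (q div 2)) (x L)" using x by (simp add: grade R_grade_iff)
      then show ?thesis using act_homog[OF s xA] yA A_vars[OF yA] True by (simp add: grade R_grade_iff)
    next
      case False
      then have "\<forall>L\<in>F. x L = 0" using x by (simp add: grade R_grade_iff split: if_splits)
      then have "\<forall>L\<in>F. homog k (x L)" for k by simp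
      then have "homog k (act \<sigma> x L)" if "L \<in> F" for k L using act_homog[OF s xA] that by blast
      then have "act \<sigma> x L = 0" if "L \<in> F" for L using homog_unique[of 0 _ 1] that by (metis zero_neq_one)
      then show ?thesis using yA by (simp add: grade)
    qed
  qed (use A_ext A_vars A_zero A_add A_scale A_gcomp act_closed act_id act_comp act_add act_scale in
      \<open>auto simp: grade\<close>)
  have bij: "bij_betw (lin avg) coeffs A"
    unfolding bij_betw_def
  proof
    show "inj_on (lin avg) coeffs"
      by (rule inj_onI) (rule unique_coeffs[OF indep_avg'], auto simp: coeffs_def PiE_def)
    have "lin avg c \<in> A" if "c \<in> coeffs" for c by (rule lin_A[OF avg_A that])
    then show "lin avg ` coeffs = A" using span_avg by blast
  qed
  define \<phi> where "\<phi> = inv_into coeffs (lin avg)"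
  have \<phi>_bij: "bij_betw \<phi> A coeffs" unfolding \<phi>_def by (rule bij_betw_inv_into[OF bij])
  have \<phi>_eq: "\<phi> (lin avg c) = c" if "c \<in> coeffs" for c
    unfolding \<phi>_def by (rule bij_betw_inv_into_left[OF bij that])
  have \<phi>_lin: "lin avg (\<phi> x) = x" if "x \<in> A" for x
    unfolding \<phi>_def by (rule bij_betw_inv_into_right[OF bij that])
  have \<phi>_C: "\<phi> x \<in> coeffs" if "x \<in> A" for x using bij_betw_apply[OF \<phi>_bij that] .
  have C_add: "(\<lambda>L\<in>F. a L + b L) \<in> coeffs" if "a \<in> coeffs" "b \<in> coeffs" for a b
    using that by (auto simp: coeffs_def carrier_R_ring PiE_iff vars_le_add)
  have C_scale: "(\<lambda>L\<in>F. a * b L) \<in> coeffs" if "vars_le d a" "b \<in> coeffs" for a b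
    using that by (auto simp: coeffs_def carrier_R_ring PiE_iff vars_le_mult)
  have C_twist: "(\<lambda>L\<in>F. twist \<sigma> (b L)) \<in> coeffs" if "\<sigma> \<in> S" "b \<in> coeffs" for \<sigma> b
    using that by (auto simp: coeffs_def carrier_R_ring PiE_iff twist_vars_le)
  have \<phi>_add: "\<phi> (\<lambda>L\<in>F. x L + y L) = (\<lambda>L\<in>F. \<phi> x L + \<phi> y L)" if x: "x \<in> A" and y: "y \<in> A" for x y
  proof -
    have "lin avg (\<lambda>L\<in>F. \<phi> x L + \<phi> y L) = (\<lambda>K\<in>F. lin avg (\<phi> x) K + lin avg (\<phi> y) K)"
      unfolding lin_def by (intro restrict_ext) (simp add: distrib_right sum.distrib)
    also have "\<dots> = (\<lambda>L\<in>F. x L + y L)" using \<phi>_lin x y by simp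
    finally show ?thesis using \<phi>_eq[OF C_add[OF \<phi>_C[OF x] \<phi>_C[OF y]]] by simp
  qed
  have \<phi>_scale: "\<phi> (\<lambda>L\<in>F. a * x L) = (\<lambda>L\<in>F. a * \<phi> x L)" if a: "vars_le d a" and x: "x \<in> A" for a x
  proof -
    have "lin avg (\<lambda>L\<in>F. a * \<phi> x L) = (\<lambda>K\<in>F. a * lin avg (\<phi> x) K)"
      unfolding lin_def by (intro restrict_ext) (simp add: sum_distrib_left mult.assoc)
    also have "\<dots> = (\<lambda>L\<in>F. a * x L)" using \<phi>_lin x by simp
    finally show ?thesis using \<phi>_eq[OF C_scale[OF a \<phi>_C[OF x]]] by simp
  qed
  have \<phi>_act: "\<phi> (act \<sigma> x) = (\<lambda>L\<in>F. twist \<sigma> (\<phi> x L))" if s: "\<sigma> \<in> S" and x: "x \<in> A" for \<sigma> x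
  proof -
    let ?c = "\<phi> x"
    have cv: "vars_le d (?c L)" if "L \<in> F" for L using \<phi>_C[OF x] that by (auto simp: coeffs_def carrier_R_ring PiE_iff)
    have "act \<sigma> x = act \<sigma> (lin avg ?c)" using \<phi>_lin[OF x] by simp
    also have "lin avg ?c = (\<lambda>K\<in>F. \<Sum>L\<in>F. (\<lambda>K\<in>F. ?c L * avg L K) K)"
      unfolding lin_def by (intro restrict_ext) simp
    also have "act \<sigma> \<dots> = (\<lambda>K\<in>F. \<Sum>L\<in>F. act \<sigma> (\<lambda>K\<in>F. ?c L * avg L K) K)"
      by (rule act_sum[OF s finite_F]) (rule A_scale[OF cv avg_A])
    also have "\<dots> = (\<lambda>K\<in>F. \<Sum>L\<in>F. twist \<sigma> (?c L) * avg L K)"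
    proof (intro restrict_ext sum.cong refl)
      fix K L assume "K \<in> F" "L \<in> F"
      then show "act \<sigma> (\<lambda>K\<in>F. ?c L * avg L K) K = twist \<sigma> (?c L) * avg L K"
        using act_scale[OF s cv avg_A, of L L] avg_invariant[OF s] by simp
    qed
    also have "\<dots> = lin avg (\<lambda>L\<in>F. twist \<sigma> (?c L))" unfolding lin_def by (intro restrict_ext) simp
    finally show ?thesis using \<phi>_eq[OF C_twist[OF s \<phi>_C[OF x]]] by simp
  qed
  have \<phi>_grade: "\<phi> ` grade W q = grade ?D q" for q
  proof
    show "\<phi> ` grade W q \<subseteq> grade ?D q"
    proof clarify
      fix x assume "x \<in> grade W q"
      then have x: "x \<in> A" "\<And>K. K \<in> F ==> x K \<in> R_grade d q" by (auto simp: grade)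
      have "\<phi> x L \<in> R_grade d (q - 2 * int (deg L))" if "L \<in> F" for L
        by (rule coeffs_gcomp[OF indep_avg' avg_homog _ \<phi>_C[OF x(1)] that]) (use \<phi>_lin x in auto)
      then show "\<phi> x \<in> grade ?D q" using \<phi>_C[OF x(1)] by (simp add: gD)
    qed
    show "grade ?D q \<subseteq> \<phi> ` grade W q"
    proof
      fix c assume "c \<in> grade ?D q"
      then have c: "c \<in> coeffs" "\<And>L. L \<in> F ==> c L \<in> R_grade d (q - 2 * int (deg L))" by (auto simp: gD)
      have trm: "c L * avg L K \<in> R_grade d q" if "L \<in> F" "K \<in> F" for L K
        using R_grade_mult[OF c(2)[OF that(1)] homog_grade[OF A_vars[OF avg_A[OF that(1)] that(2)] avg_homog[OF that]]]
        by simp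
      have "(\<Sum>L\<in>I. c L * avg L K) \<in> R_grade d q" if "finite I" "I \<subseteq> F" "K \<in> F" for I K
        using that by (induction I rule: finite_induct) (auto intro!: R_grade_add trm)
      from this[OF finite_F order_refl] have "lin avg c K \<in> R_grade d q" if "K \<in> F" for K
        using that by (simp add: lin_def)
      then have "lin avg c \<in> grade W q" using lin_A[OF avg_A c(1)] by (simp add: grade)
      then show "c \<in> \<phi> ` grade W q" using \<phi>_eq[OF c(1)] by (metis imageI)
    qed
  qed
  have "\<phi> \<in> iso (add_monoid W) (add_monoid ?D)"
    using \<phi>_bij \<phi>_C \<phi>_add by (auto simp: iso_def hom_def W cD addD)
  then show ?thesis
    unfolding graded_twisted_iso_def
    using mod sum_triv_module[OF finite_F] \<phi>_grade \<phi>_scale \<phi>_act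
    by (intro conjI exI[of _ \<phi>]) (auto simp: W smultD actD carrier_R_ring)
qed

end

section \<open>Coordinates and echelon forms of subrepresentations\<close>

lemma Suc_mod_cancel:
  assumes "i < n" "(a + 1) mod n = (i + 1) mod n" shows "a mod n = (i::nat)"
proof -
  have "(a mod n + 1) mod n = (i + 1) mod n" using assms by (simp add: mod_simps)
  moreover have "a mod n < n" using assms(1) by simp
  ultimately show ?thesis using assms(1) by (cases "a mod n + 1 = n"; cases "i + 1 = n") auto
qed

text \<open>Defined without regard to the length of the summand: \<open>succ \<beta>\<close> may
  leave the index set, and this happens exactly when the basis vector is sent to zero.\<close>

definition succ :: "nat \<times> nat => nat \<times> nat" where
  "succ \<beta> = (fst \<beta>, snd \<beta> + 1)"

lemma succ_Pair [simp]: "succ (j, p) = (j, Suc p)"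
  by (simp add: succ_def)

lemma inj_succ: "succ \<beta> = succ \<beta>' \<longleftrightarrow> \<beta> = \<beta>'"
  by (auto simp: succ_def prod_eq_iff)

context nilpotent_quiver_rep
begin

section \<open>Coordinates with respect to the basis\<close>

definition B :: "(nat \<times> nat) set" where
  "B = {(j, p). j \<in> {1..d} \<and> p < len j}"

definition vtx :: "nat \<times> nat => nat" where
  "vtx \<beta> = (src (fst \<beta>) + snd \<beta>) mod n"

lemma B_at_iff: "\<beta> \<in> B_at i \<longleftrightarrow> \<beta> \<in> B \<and> vtx \<beta> = i"
  by (auto simp: basis_at_def B_def vtx_def)

lemma finite_B [simp]: "finite B"
proof -
  have "B \<subseteq> (SIGMA j:{1..d}. {..<len j})" by (auto simp: B_def)
  then show ?thesis by (rule finite_subset) simp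
qed

lemma finite_B_at [simp]: "finite (B_at i)"
  by (rule finite_subset[OF _ finite_B]) (auto simp: B_at_iff)

lemma vtx_less [simp]: "vtx \<beta> < n"
  using n_pos by (simp add: vtx_def)

lemma vtx_succ: "vtx (succ \<beta>) = (vtx \<beta> + 1) mod n"
  by (simp add: vtx_def succ_def mod_simps)

lemma next_less [simp]: "(i + 1) mod n < n" "Suc i mod n < n"
  using n_pos by auto

lemma succ_B_D: "succ \<beta> \<in> B ==> \<beta> \<in> B"
  by (auto simp: B_def succ_def)

definition vec :: "nat => (nat \<times> nat => complex) => 'v" where
  "vec i c = (\<Sum>\<beta>\<in>B_at i. scale (c \<beta>) (bas \<beta>))"

lemma bas_V: "i < n ==> \<beta> \<in> B_at i ==> bas \<beta> \<in> V i"
  using bas_span[of i] span_base by auto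

lemma vec_V [simp]: "i < n ==> vec i c \<in> V i"
  unfolding vec_def by (intro subspace_sum V_subspace subspace_scale bas_V) auto

lemma coord_bas:
  assumes "i < n" "\<beta> \<in> B_at i" "\<beta>' \<in> B_at i"
  shows "coord i \<beta> (bas \<beta>') = (if \<beta> = \<beta>' then 1 else 0)"
  using representation_basis[OF bas_independent[OF assms(1)], of "bas \<beta>'"] assms bas_inj[OF assms(1)]
  by (auto simp: coord_def inj_on_def)

lemma coord_add: "i < n ==> x \<in> V i ==> y \<in> V i ==> coord i \<beta> (x + y) = coord i \<beta> x + coord i \<beta> y"
  by (simp add: coord_def representation_add bas_independent bas_span)

lemma coord_scale: "i < n ==> x \<in> V i ==> coord i \<beta> (scale c x) = c * coord i \<beta> x"
  by (simp add: coord_def representation_scale bas_independent bas_span)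

lemma coord_diff: "i < n ==> x \<in> V i ==> y \<in> V i ==> coord i \<beta> (x - y) = coord i \<beta> x - coord i \<beta> y"
  by (simp add: coord_def representation_diff bas_independent bas_span)

lemma coord_0 [simp]: "coord i \<beta> 0 = 0"
  by (simp add: coord_def representation_zero)

lemma coord_sum:
  "i < n ==> (\<And>k. k \<in> I ==> x k \<in> V i) ==> coord i \<beta> (\<Sum>k\<in>I. x k) = (\<Sum>k\<in>I. coord i \<beta> (x k))"
  by (induction I rule: infinite_finite_induct) (auto simp: coord_add subspace_sum V_subspace)

lemma coord_vec [simp]:
  assumes "i < n" "\<beta> \<in> B_at i" shows "coord i \<beta> (vec i c) = c \<beta>"
proof -
  have "coord i \<beta> (vec i c) = (\<Sum>\<beta>'\<in>B_at i. c \<beta>' * coord i \<beta> (bas \<beta>'))"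
    unfolding vec_def using assms
    by (subst coord_sum) (auto simp: coord_scale bas_V intro!: subspace_scale V_subspace)
  also have "\<dots> = (\<Sum>\<beta>'\<in>B_at i. if \<beta> = \<beta>' then c \<beta>' else 0)"
    using assms by (intro sum.cong) (auto simp: coord_bas)
  finally show ?thesis using assms by simp
qed

lemma vec_coord:
  assumes "i < n" "x \<in> V i" shows "vec i (\<lambda>\<beta>. coord i \<beta> x) = x"
proof -
  have "(\<Sum>b\<in>bas ` B_at i. scale (representation (bas ` B_at i) x b) b) = x"
    using assms by (intro sum_representation_eq bas_independent) (auto simp: bas_span)
  then show ?thesis
    by (simp add: vec_def coord_def sum.reindex[OF bas_inj[OF assms(1)]])
qed

lemma coord_eqI:
  assumes "i < n" "x \<in> V i" "y \<in> V i" "\<And>\<beta>. \<beta> \<in> B_at i ==> coord i \<beta> x = coord i \<beta> y"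
  shows "x = y"
proof -
  have "vec i (\<lambda>\<beta>. coord i \<beta> x) = vec i (\<lambda>\<beta>. coord i \<beta> y)"
    unfolding vec_def by (intro sum.cong refl) (simp add: assms(4))
  then show ?thesis using vec_coord assms by simp
qed

lemma bas_nonzero: "i < n ==> \<beta> \<in> B_at i ==> bas \<beta> ~= 0"
  using coord_bas[of i \<beta> \<beta>] by auto

lemma f_bas_succ: "\<beta> \<in> B ==> f (vtx \<beta>) (bas \<beta>) = (if succ \<beta> \<in> B then bas (succ \<beta>) else 0)"
  using f_bas[of "fst \<beta>" "snd \<beta>"] by (auto simp: B_def vtx_def succ_def)

lemma f_0: assumes "i < n" shows "f i 0 = 0"
  using f_scale[OF assms subspace_0[OF V_subspace[OF assms]], of 0] by simp

lemma f_sum: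
  "i < n ==> (\<And>k. k \<in> I ==> x k \<in> V i) ==> f i (\<Sum>k\<in>I. x k) = (\<Sum>k\<in>I. f i (x k))"
  by (induction I rule: infinite_finite_induct) (auto simp: f_0 f_add subspace_sum V_subspace)

lemma f_vec: assumes "i < n" shows "f i (vec i c) = (\<Sum>\<beta>\<in>B_at i. scale (c \<beta>) (if succ \<beta> \<in> B then bas (succ \<beta>) else 0))"
proof -
  have "f i (vec i c) = (\<Sum>\<beta>\<in>B_at i. f i (scale (c \<beta>) (bas \<beta>)))"
    unfolding vec_def using assms by (intro f_sum subspace_scale V_subspace bas_V)
  also have "\<dots> = (\<Sum>\<beta>\<in>B_at i. scale (c \<beta>) (if succ \<beta> \<in> B then bas (succ \<beta>) else 0))"
  proof (intro sum.cong refl)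
    fix \<beta> assume "\<beta> \<in> B_at i"
    then show "f i (scale (c \<beta>) (bas \<beta>)) = scale (c \<beta>) (if succ \<beta> \<in> B then bas (succ \<beta>) else 0)"
      using f_bas_succ[of \<beta>] assms by (subst f_scale) (auto simp: B_at_iff intro!: bas_V)
  qed
  finally show ?thesis .
qed

lemma coord_f_succ:
  assumes i: "i < n" and x: "x \<in> V i" and \<beta>: "\<beta> \<in> B_at i" "succ \<beta> \<in> B"
  shows "coord ((i + 1) mod n) (succ \<beta>) (f i x) = coord i \<beta> x"
proof -
  let ?i = "(i + 1) mod n"
  have \<beta>': "succ \<gamma> \<in> B_at ?i" if "\<gamma> \<in> B_at i" "succ \<gamma> \<in> B" for \<gamma>
    using that by (auto simp: B_at_iff vtx_succ)
  have "coord ?i (succ \<beta>) (f i x) = coord ?i (succ \<beta>) (f i (vec i (\<lambda>\<gamma>. coord i \<gamma> x)))"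
    using vec_coord[OF i x] by simp
  also have "\<dots> = (\<Sum>\<gamma>\<in>B_at i. coord ?i (succ \<beta>) (scale (coord i \<gamma> x) (if succ \<gamma> \<in> B then bas (succ \<gamma>) else 0)))"
    unfolding f_vec[OF i]
  proof (rule coord_sum)
    fix \<gamma> assume "\<gamma> \<in> B_at i"
    then show "scale (coord i \<gamma> x) (if succ \<gamma> \<in> B then bas (succ \<gamma>) else 0) \<in> V ?i"
      using \<beta>'[of \<gamma>] by (cases "succ \<gamma> \<in> B") (simp_all add: subspace_scale V_subspace bas_V subspace_0)
  qed simp
  also have "\<dots> = (\<Sum>\<gamma>\<in>B_at i. if \<gamma> = \<beta> then coord i \<gamma> x else 0)"
  proof (intro sum.cong refl)
    fix \<gamma> assume \<gamma>: "\<gamma> \<in> B_at i"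
    show "coord ?i (succ \<beta>) (scale (coord i \<gamma> x) (if succ \<gamma> \<in> B then bas (succ \<gamma>) else 0)) =
        (if \<gamma> = \<beta> then coord i \<gamma> x else 0)"
    proof (cases "succ \<gamma> \<in> B")
      case True
      have "succ \<gamma> \<in> B_at ?i" "succ \<beta> \<in> B_at ?i" using \<beta>'[OF \<gamma> True] \<beta>'[OF \<beta>] .
      then show ?thesis using True coord_bas[of ?i "succ \<beta>" "succ \<gamma>"]
        by (simp add: coord_scale bas_V inj_succ)
    qed (use \<beta> in auto)
  qed
  finally show ?thesis using \<beta> by simp
qed

text \<open>The first vector of a summand is not the image of any basis vector.\<close>

lemma coord_f_start:
  assumes i: "i < n" and x: "x \<in> V i" and \<beta>: "(j, 0) \<in> B_at ((i + 1) mod n)"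
  shows "coord ((i + 1) mod n) (j, 0) (f i x) = 0"
proof -
  let ?i = "(i + 1) mod n"
  have \<beta>': "succ \<gamma> \<in> B_at ?i" if "\<gamma> \<in> B_at i" "succ \<gamma> \<in> B" for \<gamma>
    using that by (auto simp: B_at_iff vtx_succ)
  have "coord ?i (j, 0) (f i x) = coord ?i (j, 0) (f i (vec i (\<lambda>\<gamma>. coord i \<gamma> x)))"
    using vec_coord[OF i x] by simp
  also have "\<dots> = (\<Sum>\<gamma>\<in>B_at i. coord ?i (j, 0) (scale (coord i \<gamma> x) (if succ \<gamma> \<in> B then bas (succ \<gamma>) else 0)))"
    unfolding f_vec[OF i]
  proof (rule coord_sum)
    fix \<gamma> assume "\<gamma> \<in> B_at i"
    then show "scale (coord i \<gamma> x) (if succ \<gamma> \<in> B then bas (succ \<gamma>) else 0) \<in> V ?i"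
      using \<beta>'[of \<gamma>] by (cases "succ \<gamma> \<in> B") (simp_all add: subspace_scale V_subspace bas_V subspace_0)
  qed simp
  also have "\<dots> = 0"
  proof (intro sum.neutral ballI)
    fix \<gamma> assume \<gamma>: "\<gamma> \<in> B_at i"
    show "coord ?i (j, 0) (scale (coord i \<gamma> x) (if succ \<gamma> \<in> B then bas (succ \<gamma>) else 0)) = 0"
      using \<gamma> \<beta> \<beta>' coord_bas[of ?i "(j, 0)" "succ \<gamma>"] by (auto simp: coord_scale bas_V succ_def)
  qed
  finally show ?thesis .
qed

text \<open>The subspaces that are graphs of linear maps from the span of \<open>L\<close> to the span of the remaining
  basis vectors.\<close>

definition mk :: "(nat \<times> nat) set => (nat \<times> nat => nat \<times> nat => complex) => nat => 'v set" where
  "mk L A = (\<lambda>i\<in>{..<n}. {x \<in> V i. \<forall>l\<in>B_at i - L. coord i l x = (\<Sum>h\<in>B_at i \<inter> L. A h l * coord i h x)})"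

lemma mk_iff: "i < n ==> x \<in> mk L A i \<longleftrightarrow>
    x \<in> V i \<and> (\<forall>l\<in>B_at i - L. coord i l x = (\<Sum>h\<in>B_at i \<inter> L. A h l * coord i h x))"
  by (simp add: mk_def)

lemma mk_extensional: "mk L A \<in> extensional {..<n}"
  by (simp add: mk_def)

lemma mk_subspace: assumes i: "i < n" shows "subspace (mk L A i)"
proof (rule subspaceI)
  show "0 \<in> mk L A i" using i subspace_0[OF V_subspace[OF i]] by (simp add: mk_iff)
next
  fix x y assume "x \<in> mk L A i" "y \<in> mk L A i"
  then show "x + y \<in> mk L A i" using i subspace_add[OF V_subspace[OF i]]
    by (simp add: mk_iff coord_add distrib_left sum.distrib)
next
  fix c x assume "x \<in> mk L A i"
  then show "scale c x \<in> mk L A i" using i subspace_scale[OF V_subspace[OF i]]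
    by (simp add: mk_iff coord_scale sum_distrib_left mult.left_commute)
qed

text \<open>The point of the graph over the basis vector \<open>h\<close>, that is, a row of the
  reduced echelon matrix with pivot \<open>h\<close>.\<close>

definition ech :: "(nat \<times> nat) set => (nat \<times> nat => nat \<times> nat => complex) => nat => nat \<times> nat => 'v" where
  "ech L A i h = vec i (\<lambda>\<beta>. if \<beta> = h then 1 else if \<beta> \<in> L then 0 else A h \<beta>)"

lemma sum_L_delta:
  assumes "h \<in> B_at i \<inter> L"
  shows "(\<Sum>h'\<in>B_at i \<inter> L. a h' * (if h' = h then 1 else if h' \<in> L then 0 else b h')) = (a h :: complex)"
proof -
  have "(\<Sum>h'\<in>B_at i \<inter> L. a h' * (if h' = h then 1 else if h' \<in> L then 0 else b h')) =
      (\<Sum>h'\<in>B_at i \<inter> L. if h' = h then a h' else 0)"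
    by (intro sum.cong) auto
  also have "\<dots> = a h" using assms by (simp add: sum.delta)
  finally show ?thesis .
qed

lemma ech_mk: assumes i: "i < n" and h: "h \<in> B_at i \<inter> L" shows "ech L A i h \<in> mk L A i"
proof -
  have "coord i l (ech L A i h) = (\<Sum>h'\<in>B_at i \<inter> L. A h' l * coord i h' (ech L A i h))" if l: "l \<in> B_at i - L" for l
  proof -
    have "(\<Sum>h'\<in>B_at i \<inter> L. A h' l * coord i h' (ech L A i h)) =
       (\<Sum>h'\<in>B_at i \<inter> L. A h' l * (if h' = h then 1 else if h' \<in> L then 0 else A h h'))"
      using i by (intro sum.cong) (auto simp: ech_def)
    also have "\<dots> = A h l" by (rule sum_L_delta[OF h])
    also have "\<dots> = coord i l (ech L A i h)" using i l h by (auto simp: ech_def)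
    finally show ?thesis ..
  qed
  then show ?thesis using i by (simp add: mk_iff ech_def)
qed

lemma mk_expand:
  assumes i: "i < n" and x: "x \<in> mk L A i"
  shows "x = (\<Sum>h\<in>B_at i \<inter> L. scale (coord i h x) (ech L A i h))"
proof (rule coord_eqI[OF i])
  have e: "ech L A i h \<in> V i" for h using i by (simp add: ech_def)
  show "x \<in> V i" using x i by (simp add: mk_iff)
  show "(\<Sum>h\<in>B_at i \<inter> L. scale (coord i h x) (ech L A i h)) \<in> V i"
    using i e by (intro subspace_sum V_subspace subspace_scale)
  fix \<beta> assume \<beta>: "\<beta> \<in> B_at i"
  have "coord i \<beta> (\<Sum>h\<in>B_at i \<inter> L. scale (coord i h x) (ech L A i h)) =
      (\<Sum>h\<in>B_at i \<inter> L. coord i h x * (if \<beta> = h then 1 else if \<beta> \<in> L then 0 else A h \<beta>))"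
    using i e \<beta> by (subst coord_sum) (auto simp: coord_scale ech_def intro!: subspace_scale V_subspace sum.cong)
  also have "\<dots> = coord i \<beta> x"
  proof (cases "\<beta> \<in> L")
    case True
    have "(\<Sum>h\<in>B_at i \<inter> L. coord i h x * (if \<beta> = h then 1 else if \<beta> \<in> L then 0 else A h \<beta>)) =
      (\<Sum>h\<in>B_at i \<inter> L. if \<beta> = h then coord i h x else 0)" using True by (intro sum.cong) auto
    then show ?thesis using True \<beta> by simp
  next
    case False
    have "(\<Sum>h\<in>B_at i \<inter> L. coord i h x * (if \<beta> = h then 1 else if \<beta> \<in> L then 0 else A h \<beta>)) =
      (\<Sum>h\<in>B_at i \<inter> L. A h \<beta> * coord i h x)" using False by (intro sum.cong) auto
    then show ?thesis using x \<beta> False i by (simp add: mk_iff)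
  qed
  finally show "coord i \<beta> x = coord i \<beta> (\<Sum>h\<in>B_at i \<inter> L. scale (coord i h x) (ech L A i h))" ..
qed

lemma dim_mk: assumes i: "i < n" shows "dim (mk L A i) = card (B_at i \<inter> L)"
proof (rule dim_unique)
  let ?E = "ech L A i ` (B_at i \<inter> L)"
  have ce: "coord i h' (ech L A i h) = (if h' = h then 1 else 0)" if "h \<in> B_at i \<inter> L" "h' \<in> B_at i \<inter> L" for h h'
    using that i by (auto simp: ech_def)
  have inj: "inj_on (ech L A i) (B_at i \<inter> L)"
    by (rule inj_onI) (metis ce zero_neq_one)
  have e: "ech L A i h \<in> V i" for h using i by (simp add: ech_def)
  show "?E \<subseteq> mk L A i" using ech_mk[OF i] by blast
  show "mk L A i \<subseteq> span ?E"
  proof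
    fix x assume "x \<in> mk L A i"
    then have "x = (\<Sum>h\<in>B_at i \<inter> L. scale (coord i h x) (ech L A i h))" by (rule mk_expand[OF i])
    also have "\<dots> \<in> span ?E" by (intro span_sum span_scale span_base) auto
    finally show "x \<in> span ?E" .
  qed
  show "card ?E = card (B_at i \<inter> L)" by (rule card_image[OF inj])
  show "independent ?E"
  proof (rule independent_if_scalars_zero)
    fix u x assume z: "(\<Sum>x\<in>?E. scale (u x) x) = 0" and "x \<in> ?E"
    then obtain h where h: "h \<in> B_at i \<inter> L" "x = ech L A i h" by auto
    have "0 = coord i h (\<Sum>h'\<in>B_at i \<inter> L. scale (u (ech L A i h')) (ech L A i h'))"
      using z by (simp add: sum.reindex[OF inj])
    also have "\<dots> = (\<Sum>h'\<in>B_at i \<inter> L. u (ech L A i h') * coord i h (ech L A i h'))"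
      using i e by (subst coord_sum) (auto simp: coord_scale intro!: subspace_scale V_subspace)
    also have "\<dots> = (\<Sum>h'\<in>B_at i \<inter> L. if h' = h then u (ech L A i h') else 0)"
      using h by (intro sum.cong) (auto simp: ce)
    also have "\<dots> = u x" using h by simp
    finally show "u x = 0" ..
  qed simp
qed

text \<open>A graph determines its linear map; the entries of the matrix outside \<open>L\<close>
  times its complement, or between different vertices, carry no information.\<close>

lemma mk_eq_iff:
  "mk L A = mk L A' \<longleftrightarrow> (\<forall>i<n. \<forall>h\<in>B_at i \<inter> L. \<forall>l\<in>B_at i - L. A h l = A' h l)"
proof
  assume eq: "mk L A = mk L A'"
  show "\<forall>i<n. \<forall>h\<in>B_at i \<inter> L. \<forall>l\<in>B_at i - L. A h l = A' h l"
  proof (intro allI impI ballI)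
    fix i h l assume i: "i < n" and h: "h \<in> B_at i \<inter> L" and l: "l \<in> B_at i - L"
    have "ech L A i h \<in> mk L A' i" using ech_mk[OF i h, of A] eq by simp
    then have "coord i l (ech L A i h) = (\<Sum>h'\<in>B_at i \<inter> L. A' h' l * coord i h' (ech L A i h))"
      using i l by (simp add: mk_iff)
    also have "\<dots> = (\<Sum>h'\<in>B_at i \<inter> L. A' h' l * (if h' = h then 1 else if h' \<in> L then 0 else A h h'))"
      using i by (intro sum.cong) (auto simp: ech_def)
    also have "\<dots> = A' h l" by (rule sum_L_delta[OF h])
    finally show "A h l = A' h l" using i l h by (auto simp: ech_def split: if_splits)
  qed
next
  assume "\<forall>i<n. \<forall>h\<in>B_at i \<inter> L. \<forall>l\<in>B_at i - L. A h l = A' h l"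
  then show "mk L A = mk L A'"
    unfolding mk_def by (intro restrict_ext Collect_cong conj_cong refl ball_cong arg_cong2[where f = "(=)"] sum.cong) auto
qed

lemma bas_mk_0: "i < n ==> \<beta> \<in> B_at i ==> bas \<beta> \<in> mk L (\<lambda>_ _. 0) i \<longleftrightarrow> \<beta> \<in> L"
  by (auto simp: mk_iff bas_V coord_bas)

lemma mk_0_eq_iff: assumes "L \<subseteq> B" "L' \<subseteq> B" shows "mk L (\<lambda>_ _. 0) = mk L' (\<lambda>_ _. 0) \<longleftrightarrow> L = L'"
proof
  assume eq: "mk L (\<lambda>_ _. 0) = mk L' (\<lambda>_ _. 0)"
  have "\<beta> \<in> L \<longleftrightarrow> \<beta> \<in> L'" if "\<beta> \<in> B" for \<beta>
    using bas_mk_0[of "vtx \<beta>" \<beta> L] bas_mk_0[of "vtx \<beta>" \<beta> L'] that eq by (simp add: B_at_iff)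
  then show "L = L'" using assms by blast
qed simp

lemma diag_V [simp]: "i < n ==> diag w i x \<in> V i"
  unfolding diag_def by (intro subspace_sum V_subspace subspace_scale bas_V)

lemma coord_diag: "i < n ==> \<beta> \<in> B_at i ==> coord i \<beta> (diag w i x) = w \<beta> * coord i \<beta> x"
  using coord_vec[of i \<beta> "\<lambda>\<beta>. w \<beta> * coord i \<beta> x"] by (simp add: diag_def vec_def)

lemma diag_act_mk:
  assumes w: "\<And>\<beta>. \<beta> \<in> B ==> w \<beta> ~= 0"
  shows "diag_act w (mk L A) = mk L (\<lambda>h l. A h l * (w l / w h))"
  unfolding diag_act_def
proof (rule extensionalityI[of _ "{..<n}"])
  fix i assume "i \<in> {..<n}"
  then have i: "i < n" by simp
  have w': "w \<beta> ~= 0" if "\<beta> \<in> B_at i" for \<beta> using w that by (simp add: B_at_iff)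
  have "diag w i ` mk L A i = mk L (\<lambda>h l. A h l * (w l / w h)) i"
  proof
    show "diag w i ` mk L A i \<subseteq> mk L (\<lambda>h l. A h l * (w l / w h)) i"
    proof clarify
      fix x assume x: "x \<in> mk L A i"
      have "w l * coord i l x = (\<Sum>h\<in>B_at i \<inter> L. A h l * (w l / w h) * (w h * coord i h x))" if "l \<in> B_at i - L" for l
        using x i that w' by (simp add: mk_iff sum_distrib_left) (intro sum.cong, auto)
      then show "diag w i x \<in> mk L (\<lambda>h l. A h l * (w l / w h)) i"
        using i by (auto simp: mk_iff coord_diag)
    qed
    show "mk L (\<lambda>h l. A h l * (w l / w h)) i \<subseteq> diag w i ` mk L A i"
    proof
      fix y assume y: "y \<in> mk L (\<lambda>h l. A h l * (w l / w h)) i"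
      let ?x = "diag (\<lambda>\<beta>. 1 / w \<beta>) i y"
      have yV: "y \<in> V i" using y i by (simp add: mk_iff)
      have "coord i l ?x = (\<Sum>h\<in>B_at i \<inter> L. A h l * coord i h ?x)" if l: "l \<in> B_at i - L" for l
      proof -
        have "coord i l ?x = (1 / w l) * (\<Sum>h\<in>B_at i \<inter> L. A h l * (w l / w h) * coord i h y)"
          using l y i by (simp add: coord_diag mk_iff)
        also have "\<dots> = (\<Sum>h\<in>B_at i \<inter> L. A h l * (1 / w h * coord i h y))"
          using w' l unfolding sum_distrib_left by (intro sum.cong) auto
        also have "\<dots> = (\<Sum>h\<in>B_at i \<inter> L. A h l * coord i h ?x)"
          using i by (intro sum.cong) (auto simp: coord_diag)
        finally show ?thesis .
      qed
      then have "?x \<in> mk L A i" using i by (simp add: mk_iff)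
      moreover have "diag w i ?x = y"
        by (rule coord_eqI[OF i]) (use i yV w' in \<open>auto simp: coord_diag\<close>)
      ultimately show "y \<in> diag w i ` mk L A i" by (metis imageI)
    qed
  qed
  then show "(\<lambda>i\<in>{..<n}. diag w i ` mk L A i) i = mk L (\<lambda>h l. A h l * (w l / w h)) i" using i by simp
qed (auto simp: mk_extensional)

text \<open>Gaussian elimination. The set \<open>L\<close> consists of the indices at which some
  vector of \<open>U\<close> has its first nonzero coordinate; clearing the coordinates at all other
  pivots yields reduced vectors, and these exhibit \<open>U\<close> as a graph.\<close>

lemma echelon_exists:
  assumes i: "i < n" and U: "subspace U" "U \<subseteq> V i" and inj: "inj_on ord (B_at i)"
  defines "L \<equiv> {h \<in> B_at i. \<exists>x\<in>U. coord i h x ~= 0 \<and> (\<forall>l\<in>B_at i. ord l < (ord h :: nat) \<longrightarrow> coord i l x = 0)}"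
  shows "\<exists>A. U = mk L A i \<and> (\<forall>h l. A h l ~= 0 \<longrightarrow> h \<in> L \<and> l \<in> B_at i - L \<and> ord h < ord l)"
proof -
  have UV: "x \<in> V i" if "x \<in> U" for x using U(2) that by blast
  have LB: "L \<subseteq> B_at i" by (auto simp: L_def)
  have norm: "\<exists>x\<in>U. coord i h x = 1 \<and> (\<forall>l\<in>B_at i. ord l < ord h \<longrightarrow> coord i l x = 0)" if h: "h \<in> L" for h
  proof -
    obtain x where x: "x \<in> U" "coord i h x ~= 0" "\<forall>l\<in>B_at i. ord l < ord h \<longrightarrow> coord i l x = 0"
      using h by (auto simp: L_def)
    then show ?thesis using U(1) i UV
      by (intro bexI[of _ "scale (1 / coord i h x) x"]) (auto simp: coord_scale intro: subspace_scale)
  qed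
  \<comment> \<open>The induction on \<open>m\<close> clears the pivots of order less than
    \<open>m\<close> one after the other; subtracting a vector with pivot of order \<open>m\<close>
    does not disturb the earlier coordinates.\<close>
  have red: "\<exists>x\<in>U. coord i h x = 1 \<and> (\<forall>l\<in>B_at i. ord l < ord h \<longrightarrow> coord i l x = 0) \<and>
      (\<forall>l\<in>L. l ~= h \<longrightarrow> ord l < m \<longrightarrow> coord i l x = 0)" if h: "h \<in> L" for h m
  proof (induction m)
    case 0
    then show ?case using norm[OF h] by auto
  next
    case (Suc m)
    then obtain x where x: "x \<in> U" "coord i h x = 1" "\<forall>l\<in>B_at i. ord l < ord h \<longrightarrow> coord i l x = 0"
      "\<forall>l\<in>L. l ~= h \<longrightarrow> ord l < m \<longrightarrow> coord i l x = 0" by blast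
    show ?case
    proof (cases "\<exists>l\<in>L. l ~= h \<and> ord l = m \<and> ord h < m")
      case False
      have "coord i l x = 0" if "l \<in> L" "l ~= h" "ord l < Suc m" for l
      proof (cases "ord l = m")
        case True
        then have "\<not> ord h < m" using False that by blast
        moreover have "ord h ~= m" using that True inj h LB by (metis inj_onD subsetD)
        ultimately show ?thesis using x(3) True that LB by auto
      qed (use x(4) that in auto)
      then show ?thesis using x by blast
    next
      case True
      then obtain l where l: "l \<in> L" "l ~= h" "ord l = m" "ord h < m" by blast
      then obtain z where z: "z \<in> U" "coord i l z = 1" "\<forall>k\<in>B_at i. ord k < ord l \<longrightarrow> coord i k z = 0"
        using norm by blast
      let ?y = "x - scale (coord i l x) z"
      have c: "coord i k ?y = coord i k x - coord i l x * coord i k z" for k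
        using i x(1) z(1) UV by (simp add: coord_diff coord_scale subspace_scale V_subspace)
      have "?y \<in> U" using x(1) z(1) U(1) by (intro subspace_diff subspace_scale)
      moreover have "coord i h ?y = 1" using x z l h LB c by auto
      moreover have "\<forall>k\<in>B_at i. ord k < ord h \<longrightarrow> coord i k ?y = 0" using x z l c by auto
      moreover have "coord i k ?y = 0" if "k \<in> L" "k ~= h" "ord k < Suc m" for k
      proof (cases "ord k = m")
        case True
        then have "k = l" using l that inj LB by (metis inj_onD subsetD)
        then show ?thesis using c z by simp
      next
        case False
        then show ?thesis using c x(4) z(3) l that LB by auto
      qed
      ultimately show ?thesis by blast
    qed
  qed
  obtain N where N: "\<And>l. l \<in> B_at i ==> ord l < N"
    using finite_nat_set_iff_bounded[of "ord ` B_at i"] by auto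
  have "\<exists>x. x \<in> U \<and> coord i h x = 1 \<and> (\<forall>l\<in>B_at i. ord l < ord h \<longrightarrow> coord i l x = 0) \<and>
      (\<forall>l\<in>L. l ~= h \<longrightarrow> coord i l x = 0)" if "h \<in> L" for h
    using red[OF that, of N] N LB by blast
  then obtain e where e: "\<And>h. h \<in> L ==> e h \<in> U \<and> coord i h (e h) = 1 \<and>
      (\<forall>l\<in>B_at i. ord l < ord h \<longrightarrow> coord i l (e h) = 0) \<and> (\<forall>l\<in>L. l ~= h \<longrightarrow> coord i l (e h) = 0)"
    by metis
  define A where "A h l = (if h \<in> L \<and> l \<in> B_at i - L then coord i l (e h) else 0)" for h l
  have BL: "B_at i \<inter> L = L" using LB by blast
  have fL: "finite L" using LB by (rule finite_subset) simp
  have lincomb: "coord i l (\<Sum>h\<in>L. scale (c h) (e h)) = (\<Sum>h\<in>L. c h * coord i l (e h))" for l c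
    using i e UV by (subst coord_sum) (auto simp: coord_scale intro!: subspace_scale V_subspace)
  have lead: "coord i l (\<Sum>h\<in>L. scale (c h) (e h)) = c l" if "l \<in> L" for l c
  proof -
    have "(\<Sum>h\<in>L. c h * coord i l (e h)) = (\<Sum>h\<in>L. if h = l then c h else 0)"
      using e that by (intro sum.cong) auto
    then show ?thesis using that fL by (simp add: lincomb)
  qed
  have inU: "(\<Sum>h\<in>L. scale (c h) (e h)) \<in> U" for c
    using e U(1) by (intro subspace_sum subspace_scale) auto
  have "U = mk L A i"
  proof
    show "mk L A i \<subseteq> U"
    proof
      fix x assume x: "x \<in> mk L A i"
      have "x = (\<Sum>h\<in>L. scale (coord i h x) (e h))"
      proof (rule coord_eqI[OF i])
        fix l assume l: "l \<in> B_at i"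
        show "coord i l x = coord i l (\<Sum>h\<in>L. scale (coord i h x) (e h))"
        proof (cases "l \<in> L")
          case False
          then show ?thesis using x i l by (simp add: mk_iff lincomb BL A_def mult.commute)
        qed (simp add: lead)
      qed (use x i UV inU in \<open>auto simp: mk_iff\<close>)
      then show "x \<in> U" using inU by metis
    qed
    show "U \<subseteq> mk L A i"
    proof
      fix x assume x: "x \<in> U"
      let ?y = "x - (\<Sum>h\<in>L. scale (coord i h x) (e h))"
      have yU: "?y \<in> U" using x inU U(1) by (intro subspace_diff)
      have yc: "coord i l ?y = coord i l x - coord i l (\<Sum>h\<in>L. scale (coord i h x) (e h))" for l
        using i x inU UV by (simp add: coord_diff)
      \<comment> \<open>The remainder has zero coordinates at all pivots, whereas its first nonzero
        coordinate would itself be a pivot.\<close>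
      have "coord i l ?y = 0" if lB: "l \<in> B_at i" for l
      proof (rule ccontr)
        assume "coord i l ?y ~= 0"
        then obtain k where k: "k \<in> B_at i" "coord i k ?y ~= 0"
          and min: "\<And>l. l \<in> B_at i ==> coord i l ?y ~= 0 ==> ord k \<le> ord l"
          using ex_has_least_nat[of "\<lambda>l. l \<in> B_at i \<and> coord i l ?y ~= 0" l ord] lB by blast
        then have "k \<in> L" using yU by (force simp: L_def)
        then show False using k yc lead by simp
      qed
      then have "coord i l x = (\<Sum>h\<in>L. coord i h x * coord i l (e h))" if "l \<in> B_at i" for l
        using yc that lincomb by simp
      then show "x \<in> mk L A i" using i x UV by (simp add: mk_iff BL A_def mult.commute)
    qed
  qed
  moreover have "h \<in> L \<and> l \<in> B_at i - L \<and> ord h < ord l" if nz: "A h l ~= 0" for h l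
  proof -
    have hl: "h \<in> L" "l \<in> B_at i - L" "coord i l (e h) ~= 0" using nz by (auto simp: A_def split: if_splits)
    then have "\<not> ord l < ord h" using e by blast
    moreover have "ord l ~= ord h" using hl inj LB by (metis DiffD1 DiffD2 inj_onD subsetD)
    ultimately show ?thesis using hl by simp
  qed
  ultimately show ?thesis by blast
qed

subsection \<open>Orthogonal projections\<close>

lemma herm_diff_left: "i < n ==> x \<in> V i ==> u \<in> V i ==>
    herm i (x - u) y = (\<Sum>\<beta>\<in>B_at i. (coord i \<beta> x - coord i \<beta> u) * cnj (coord i \<beta> y))"
  by (simp add: herm_def coord_diff)

text \<open>Uniqueness, which the definite description requires: the difference of two candidates
  lies in \<open>U\<close> and is orthogonal to \<open>U\<close>, so its Hermitian norm
  vanishes.\<close>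

lemma orth_proj_eqI:
  assumes i: "i < n" and U: "subspace U" "U \<subseteq> V i" and x: "x \<in> V i" and u: "u \<in> U"
    and orth: "\<And>y. y \<in> U ==> herm i (x - u) y = 0"
  shows "orth_proj i U x = u"
  unfolding orth_proj_def
proof (rule the_equality)
  show "u \<in> U \<and> (\<forall>y\<in>U. herm i (x - u) y = 0)" using u orth by blast
  fix u' assume u': "u' \<in> U \<and> (\<forall>y\<in>U. herm i (x - u') y = 0)"
  have mem: "u \<in> V i" "u' \<in> V i" using u u' U(2) by auto
  let ?y = "u' - u"
  have yU: "?y \<in> U" using u u' U(1) by (intro subspace_diff) auto
  have "herm i (x - u) ?y - herm i (x - u') ?y = (\<Sum>\<beta>\<in>B_at i. coord i \<beta> ?y * cnj (coord i \<beta> ?y))"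
    unfolding herm_diff_left[OF i x mem(1)] herm_diff_left[OF i x mem(2)] sum_subtractf[symmetric]
    using i mem by (intro sum.cong refl) (simp add: coord_diff algebra_simps)
  then have "(\<Sum>\<beta>\<in>B_at i. coord i \<beta> ?y * cnj (coord i \<beta> ?y)) = 0" using orth u' yU by simp
  then have "complex_of_real (\<Sum>\<beta>\<in>B_at i. (cmod (coord i \<beta> ?y))\<^sup>2) = 0"
    by (simp add: complex_norm_square del: of_real_power)
  then have "(\<Sum>\<beta>\<in>B_at i. (cmod (coord i \<beta> ?y))\<^sup>2) = 0" by (simp only: of_real_eq_0_iff)
  then have "coord i \<beta> ?y = 0" if "\<beta> \<in> B_at i" for \<beta>
    using that by (subst (asm) sum_nonneg_eq_0_iff) auto
  then show "u' = u" using i mem by (intro coord_eqI[OF i]) (auto simp: coord_diff)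
qed

end

section \<open>Dimensions of stabilisers\<close>

text \<open>The scaling used by \<open>orbit_dim\<close>, named so that the vector space theory can
  be interpreted for it.\<close>

definition fscale :: "complex => (nat => complex) => nat => complex" where
  "fscale c \<xi> = (\<lambda>i. c * \<xi> i)"

lemma fscale_apply [simp]: "fscale c \<xi> i = c * \<xi> i"
  by (simp add: fscale_def)

interpretation fs: vector_space fscale
proof
  fix a b :: complex and x y :: "nat => complex"
  show "fscale a (x + y) = fscale a x + fscale a y" by (simp add: fun_eq_iff distrib_left)
  show "fscale (a + b) x = fscale a x + fscale b x" by (simp add: fun_eq_iff distrib_right)
  show "fscale a (fscale b x) = fscale (a * b) x" by (simp add: fun_eq_iff mult.assoc)
  show "fscale 1 x = x" by (simp add: fun_eq_iff)
qed

lemma sum_apply: "(\<Sum>k\<in>I. g k) i = (\<Sum>k\<in>I. g k i)" for g :: "'a => nat => complex"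
  by (induction I rule: infinite_finite_induct) auto

lemma fs_dim_le_coords:
  assumes S: "fs.subspace S" and I: "finite I" and inj: "\<And>\<xi>. \<xi> \<in> S ==> (\<And>i. i \<in> I ==> \<xi> i = 0) ==> \<xi> = 0"
  shows "fs.dim S \<le> card I"
proof -
  define \<pi> :: "(nat => complex) => nat => complex" where "\<pi> \<xi> = (\<lambda>i. if i \<in> I then \<xi> i else 0)" for \<xi>
  interpret \<pi>: Vector_Spaces.linear fscale fscale \<pi>
    by unfold_locales (auto simp: \<pi>_def fun_eq_iff)
  obtain Bs where Bs: "Bs \<subseteq> S" "fs.independent Bs" "S \<subseteq> fs.span Bs" "card Bs = fs.dim S"
    by (rule fs.basis_exists)
  have sp: "fs.span Bs \<subseteq> S" using fs.span_minimal[OF Bs(1) S] .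
  have injS: "inj_on \<pi> S"
  proof (rule inj_onI)
    fix x y assume "x \<in> S" "y \<in> S" "\<pi> x = \<pi> y"
    then have "x - y \<in> S" "\<And>i. i \<in> I ==> (x - y) i = 0"
      using fs.subspace_diff[OF S] by (auto simp: \<pi>_def fun_eq_iff) (metis eq_iff_diff_eq_0)
    then show "x = y" using inj[of "x - y"] by simp
  qed
  have ind: "fs.independent (\<pi> ` Bs)"
    by (rule \<pi>.independent_injective_image[OF Bs(2)]) (rule inj_on_subset[OF injS sp])
  define e :: "nat => nat => complex" where "e k = (\<lambda>i. if i = k then 1 else 0)" for k
  have "\<pi> \<xi> \<in> fs.span (e ` I)" for \<xi>
  proof -
    have "\<pi> \<xi> = (\<Sum>k\<in>I. fscale (\<xi> k) (e k))"
    proof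
      fix i
      have "(\<Sum>k\<in>I. fscale (\<xi> k) (e k)) i = (\<Sum>k\<in>I. if i = k then \<xi> k else 0)"
        by (simp add: sum_apply e_def) (intro sum.cong, auto)
      then show "\<pi> \<xi> i = (\<Sum>k\<in>I. fscale (\<xi> k) (e k)) i" using I by (simp add: \<pi>_def)
    qed
    also have "\<dots> \<in> fs.span (e ` I)" by (intro fs.span_sum fs.span_scale fs.span_base) auto
    finally show ?thesis .
  qed
  then have "card (\<pi> ` Bs) \<le> card (e ` I)"
    using fs.independent_span_bound[of "e ` I" "\<pi> ` Bs"] I ind by auto
  also have "\<dots> \<le> card I" by (rule card_image_le[OF I])
  also have "card (\<pi> ` Bs) = card Bs" using injS Bs(1) by (metis card_image inj_on_subset)
  finally show ?thesis using Bs(4) by simp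
qed

lemma fs_dim_eq_coords:
  assumes S: "fs.subspace S" and I: "finite I" and inj: "\<And>\<xi>. \<xi> \<in> S ==> (\<And>i. i \<in> I ==> \<xi> i = 0) ==> \<xi> = 0"
    and v: "\<And>k. k \<in> I ==> v k \<in> S" "\<And>k i. k \<in> I ==> i \<in> I ==> v k i = (if i = k then 1 else 0)"
  shows "fs.dim S = card I"
proof (rule fs.dim_unique[of "v ` I"])
  have injv: "inj_on v I" by (rule inj_onI) (metis v(2) zero_neq_one)
  show "card (v ` I) = card I" by (rule card_image[OF injv])
  show "v ` I \<subseteq> S" using v(1) by blast
  have co: "(\<Sum>k\<in>I. fscale (u k) (v k)) i = u i" if "i \<in> I" for u :: "nat => complex" and i
  proof -
    have "(\<Sum>k\<in>I. fscale (u k) (v k)) i = (\<Sum>k\<in>I. if i = k then u k else 0)"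
      using that v(2) by (simp add: sum_apply) (intro sum.cong, auto)
    then show ?thesis using that I by simp
  qed
  show "fs.independent (v ` I)"
  proof (rule fs.independent_if_scalars_zero)
    fix u x assume z: "(\<Sum>x\<in>v ` I. fscale (u x) x) = 0" and "x \<in> v ` I"
    then obtain k where k: "k \<in> I" "x = v k" by auto
    have "(\<Sum>k\<in>I. fscale (u (v k)) (v k)) = 0" using z by (simp add: sum.reindex[OF injv])
    then have "(\<Sum>k\<in>I. fscale (u (v k)) (v k)) k = 0" by simp
    then show "u x = 0" using co[OF k(1), of "\<lambda>k. u (v k)"] k by simp
  qed (simp add: I)
  show "S \<subseteq> fs.span (v ` I)"
  proof
    fix \<xi> assume \<xi>: "\<xi> \<in> S"
    let ?y = "\<Sum>k\<in>I. fscale (\<xi> k) (v k)"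
    have "?y \<in> S" by (intro fs.subspace_sum[OF S] fs.subspace_scale[OF S] v(1))
    then have "\<xi> - ?y = 0" using \<xi> co[of _ \<xi>] by (intro inj fs.subspace_diff[OF S]) simp_all
    then have "\<xi> = ?y" by simp
    also have "\<dots> \<in> fs.span (v ` I)" by (intro fs.span_sum fs.span_scale fs.span_base) auto
    finally show "\<xi> \<in> fs.span (v ` I)" .
  qed
qed

text \<open>The differential of the character by which the torus acts on the basis vector
  \<open>\<beta>\<close>.\<close>

definition wt_form :: "(nat => complex) => nat \<times> nat => complex" where
  "wt_form \<xi> \<beta> = of_nat (snd \<beta>) * \<xi> 0 + \<xi> (fst \<beta>)"

text \<open>The Lie algebra of the stabiliser of a graph whose nonzero entries are the pairs in
  \<open>P\<close>; see \<open>stabiliser_lie_mk\<close>.\<close>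

definition stab_of :: "nat => ((nat \<times> nat) \<times> nat \<times> nat) set => (nat => complex) set" where
  "stab_of d P = {\<xi>. (\<forall>i>d. \<xi> i = 0) \<and> (\<forall>(h, l)\<in>P. wt_form \<xi> h = wt_form \<xi> l)}"

lemma wt_form_add: "wt_form (x + y) \<beta> = wt_form x \<beta> + wt_form y \<beta>"
  by (simp add: wt_form_def algebra_simps)

lemma wt_form_fscale: "wt_form (fscale c x) \<beta> = c * wt_form x \<beta>"
  by (simp add: wt_form_def algebra_simps)

lemma ball_pair_iff: "(\<forall>(h, l)\<in>P. Q h l) \<longleftrightarrow> (\<forall>h l. (h, l) \<in> P \<longrightarrow> Q h l)"
  by auto

lemma subspace_stab_of: "fs.subspace (stab_of d P)"
proof (rule fs.subspaceI)
  show "0 \<in> stab_of d P" by (auto simp: stab_of_def wt_form_def)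
  show "x + y \<in> stab_of d P" if "x \<in> stab_of d P" "y \<in> stab_of d P" for x y
    using that unfolding stab_of_def ball_pair_iff by (simp add: wt_form_add)
  show "fscale c x \<in> stab_of d P" if "x \<in> stab_of d P" for c x
    using that unfolding stab_of_def ball_pair_iff by (simp add: wt_form_fscale)
qed

definition shift_of :: "(nat \<times> nat) \<times> nat \<times> nat => int" where
  "shift_of = (\<lambda>(h, l). int (snd l) - int (snd h))"

lemma wt_form_eq_iff:
  "wt_form \<xi> h = wt_form \<xi> l \<longleftrightarrow> \<xi> (fst l) = \<xi> (fst h) - of_int (shift_of (h, l)) * \<xi> 0"
  by (auto simp: wt_form_def shift_of_def algebra_simps)

lemma dim_stab_empty: "fs.dim (stab_of d {}) = d + 1"
proof -
  have "fs.dim (stab_of d {}) = card {0..d}"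
    by (rule fs_dim_eq_coords[where v = "\<lambda>k i. if i = k then 1 else 0"])
      (auto simp: subspace_stab_of, auto simp: stab_of_def fun_eq_iff, metis not_le)
  then show ?thesis by simp
qed

text \<open>All pairs impose the same linear equation, which expresses the coordinate
  \<open>j'\<close> through the others.\<close>

lemma dim_stab_one:
  assumes P: "P ~= {}" and jj: "j \<in> {1..d}" "j' \<in> {1..d}" "j ~= j'"
    and par: "\<And>h l. (h, l) \<in> P ==> fst h = j \<and> fst l = j' \<and> shift_of (h, l) = u"
  shows "fs.dim (stab_of d P) = d"
proof -
  have iff: "\<xi> \<in> stab_of d P \<longleftrightarrow> (\<forall>i>d. \<xi> i = 0) \<and> \<xi> j' = \<xi> j - of_int u * \<xi> 0" for \<xi>
  proof -
    have "wt_form \<xi> h = wt_form \<xi> l \<longleftrightarrow> \<xi> j' = \<xi> j - of_int u * \<xi> 0" if "(h, l) \<in> P" for h l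
      using par[OF that] by (simp add: wt_form_eq_iff)
    moreover obtain h l where "(h, l) \<in> P" using P by auto
    ultimately show ?thesis unfolding stab_of_def ball_pair_iff by blast
  qed
  \<comment> \<open>The witnesses are the unit vectors for the free coordinates, corrected at
    \<open>j'\<close> so that they satisfy the equation.\<close>
  have "fs.dim (stab_of d P) = card ({0..d} - {j'})"
  proof (rule fs_dim_eq_coords[OF subspace_stab_of,
        where v = "\<lambda>k i. if i = k then 1 else if i = j' then (if k = j then 1 else if k = 0 then - of_int u else 0) else 0"])
    fix \<xi> assume \<xi>: "\<xi> \<in> stab_of d P" "\<And>i. i \<in> {0..d} - {j'} ==> \<xi> i = 0"
    then have "\<xi> j = 0" "\<xi> 0 = 0" using jj by auto
    then have "\<xi> j' = 0" using \<xi>(1) iff by auto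
    then have "\<xi> i = 0" for i using \<xi> iff by (cases "i \<le> d"; cases "i = j'") auto
    then show "\<xi> = 0" by (simp add: fun_eq_iff)
  qed (use jj in \<open>auto simp: iff\<close>)
  then show ?thesis using jj by simp
qed

text \<open>Two equations are proportional only if they come from the same summands with the same
  shift, or from the reversed pair with the opposite shift. Otherwise two coordinates are determined
  by the remaining ones.\<close>

lemma dim_stab_two:
  assumes PQ: "(h, l) \<in> P" "(h1, l1) \<in> P"
    and b: "fst h \<in> {1..d}" "fst l \<in> {1..d}" "fst h ~= fst l"
    and b1: "fst h1 \<in> {1..d}" "fst l1 \<in> {1..d}" "fst h1 ~= fst l1"
    and ne: "\<not> (fst h1 = fst h \<and> fst l1 = fst l \<and> shift_of (h1, l1) = shift_of (h, l))"
      "\<not> (fst h1 = fst l \<and> fst l1 = fst h \<and> shift_of (h1, l1) = - shift_of (h, l))"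
  shows "fs.dim (stab_of d P) + 1 \<le> d"
proof -
  define a where "a = fst h" define c where "c = fst l" define u where "u = shift_of (h, l)"
  define a1 where "a1 = fst h1" define c1 where "c1 = fst l1" define u1 where "u1 = shift_of (h1, l1)"
  have eqs: "\<xi> c = \<xi> a - of_int u * \<xi> 0" "\<xi> c1 = \<xi> a1 - of_int u1 * \<xi> 0" "\<And>i. i > d ==> \<xi> i = 0"
    if "\<xi> \<in> stab_of d P" for \<xi>
  proof -
    have "wt_form \<xi> h = wt_form \<xi> l" "wt_form \<xi> h1 = wt_form \<xi> l1" using that PQ by (auto simp: stab_of_def)
    then show "\<xi> c = \<xi> a - of_int u * \<xi> 0" "\<xi> c1 = \<xi> a1 - of_int u1 * \<xi> 0"
      by (simp_all add: wt_form_eq_iff a_def c_def u_def a1_def c1_def u1_def)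
    show "\<And>i. i > d ==> \<xi> i = 0" using that by (simp add: stab_of_def)
  qed
  have "\<exists>q r. q \<in> {0..d} \<and> r \<in> {0..d} \<and> q ~= r \<and>
    (\<forall>\<xi>\<in>stab_of d P. (\<forall>i\<in>{0..d} - {q, r}. \<xi> i = 0) \<longrightarrow> \<xi> q = 0 \<and> \<xi> r = 0)"
  proof (cases "{a1, c1} = {a, c}")
    case True
    \<comment> \<open>The equations involve the same two summands, so combining them leaves a
      nonzero multiple of the coordinate 0; afterwards the first equation determines the coordinate
      \<open>c\<close>.\<close>
    then consider "a1 = a" "c1 = c" "u1 ~= u" | "a1 = c" "c1 = a" "u1 ~= - u"
      using ne b(3) b1(3) by (auto simp: doubleton_eq_iff a_def c_def a1_def c1_def u_def u1_def)
    then have z0: "\<xi> 0 = 0" if "\<xi> \<in> stab_of d P" for \<xi>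
    proof cases
      case 1
      have "\<xi> c = \<xi> a - of_int u * \<xi> 0" "\<xi> c = \<xi> a - of_int u1 * \<xi> 0"
        using eqs(1)[OF that] eqs(2)[OF that, unfolded 1(1,2)] .
      then have "of_int u * \<xi> 0 = of_int u1 * \<xi> 0" by auto
      then show ?thesis using 1(3) by auto
    next
      case 2
      have A: "\<xi> c = \<xi> a - of_int u * \<xi> 0" "\<xi> a = \<xi> c - of_int u1 * \<xi> 0"
        using eqs(1)[OF that] eqs(2)[OF that, unfolded 2(1,2)] .
      have p: "of_int u * \<xi> 0 = \<xi> a - \<xi> c" by (subst A(1)) simp
      have q: "of_int u1 * \<xi> 0 = \<xi> c - \<xi> a" by (subst A(2)) simp
      have "(of_int u + of_int u1) * \<xi> 0 = 0" unfolding distrib_right p q by simp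
      then have "of_int (u + u1) = (0::complex) \<or> \<xi> 0 = 0" by simp
      then show ?thesis using 2 unfolding of_int_eq_0_iff by auto
    qed
    have "\<xi> 0 = 0 \<and> \<xi> c = 0" if \<xi>: "\<xi> \<in> stab_of d P" "\<forall>i\<in>{0..d} - {0, c}. \<xi> i = 0" for \<xi>
    proof -
      have "a \<in> {0..d} - {0, c}" using b by (auto simp: a_def c_def)
      then have "\<xi> a = 0" using \<xi>(2) by blast
      then show ?thesis using z0[OF \<xi>(1)] eqs(1)[OF \<xi>(1)] by simp
    qed
    moreover have "c \<in> {0..d}" "0 ~= c" using b by (auto simp: c_def)
    ultimately show ?thesis by (intro exI[of _ 0] exI[of _ c]) simp
  next
    case False
    \<comment> \<open>One of the summands of the second equation does not occur in the first, and
      the second equation solves for its coordinate.\<close>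
    then consider q r where "q \<notin> {a, c}" "q \<in> {1..d}" "r \<in> {1..d}" "r ~= q"
       "\<And>\<xi>. \<xi> \<in> stab_of d P ==> \<xi> r = 0 ==> \<xi> 0 = 0 ==> \<xi> q = 0"
    proof -
      have e1: "\<xi> c1 = 0" if "\<xi> \<in> stab_of d P" "\<xi> a1 = 0" "\<xi> 0 = 0" for \<xi>
        using eqs(2)[OF that(1)] that(2,3) by simp
      have e2: "\<xi> a1 = 0" if "\<xi> \<in> stab_of d P" "\<xi> c1 = 0" "\<xi> 0 = 0" for \<xi>
        using eqs(2)[OF that(1)] that(2,3) by simp
      have m: "a1 \<in> {1..d}" "c1 \<in> {1..d}" "a1 ~= c1" using b1 by (simp_all add: a1_def c1_def)
      have "c1 \<notin> {a, c} \<or> a1 \<notin> {a, c}" using False b1(3) b(3) by (auto simp: a1_def c1_def)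
      then show ?thesis
      proof
        assume "c1 \<notin> {a, c}"
        then show ?thesis using that[of c1 a1] m e1 by metis
      next
        assume "a1 \<notin> {a, c}"
        then show ?thesis using that[of a1 c1] m e2 by metis
      qed
    qed
    then show ?thesis
    proof cases
      case (1 q r)
      have "\<xi> q = 0 \<and> \<xi> c = 0" if \<xi>: "\<xi> \<in> stab_of d P" "\<forall>i\<in>{0..d} - {q, c}. \<xi> i = 0" for \<xi>
      proof -
        have "\<xi> 0 = 0" "\<xi> a = 0" using \<xi>(2) 1 b by (auto simp: a_def c_def)
        then have c0: "\<xi> c = 0" using eqs(1)[OF \<xi>(1)] by simp
        then have "\<xi> r = 0" using \<xi>(2) 1 by (cases "r = c") auto
        then show ?thesis using 1(5)[OF \<xi>(1)] \<open>\<xi> 0 = 0\<close> c0 by simp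
      qed
      then show ?thesis using 1 b by (intro exI[of _ q] exI[of _ c]) (auto simp: c_def)
    qed
  qed
  then obtain q r where qr: "q \<in> {0..d}" "r \<in> {0..d}" "q ~= r"
    "\<And>\<xi>. \<xi> \<in> stab_of d P ==> (\<forall>i\<in>{0..d} - {q, r}. \<xi> i = 0) ==> \<xi> q = 0 \<and> \<xi> r = 0" by blast
  have "fs.dim (stab_of d P) \<le> card ({0..d} - {q, r})"
  proof (rule fs_dim_le_coords[OF subspace_stab_of])
    fix \<xi> assume \<xi>: "\<xi> \<in> stab_of d P" "\<And>i. i \<in> {0..d} - {q, r} ==> \<xi> i = 0"
    then have "\<xi> q = 0" "\<xi> r = 0" using qr(4) by blast+
    then have "\<xi> i = 0" for i using \<xi> eqs(3)[OF \<xi>(1)] by (cases "i \<le> d"; cases "i = q"; cases "i = r") auto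
    then show "\<xi> = 0" by (simp add: fun_eq_iff)
  qed simp
  also have "card ({0..d} - {q, r}) = d + 1 - 2" using qr by (subst card_Diff_subset) auto
  finally show ?thesis using b by (auto simp: a_def)
qed

section \<open>Torus orbits\<close>

lemma torus_char_two:
  fixes d :: nat
  assumes "i \<in> {0..d}" "j \<in> {0..d}" "i ~= j"
  shows "(\<Prod>k\<in>{0..d}. (if k = i then x else if k = j then y else 1) powi \<alpha> k) = x powi \<alpha> i * (y powi \<alpha> j :: complex)"
proof -
  have "(\<Prod>k\<in>{0..d}. (if k = i then x else if k = j then y else 1) powi \<alpha> k) =
     (\<Prod>k\<in>{i, j}. (if k = i then x else if k = j then y else 1) powi \<alpha> k)"
    by (rule prod.mono_neutral_right) (use assms in auto)
  then show ?thesis using assms by simp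
qed

lemma two_powi_eq_1: "(2::complex) powi z = 1 \<longleftrightarrow> z = 0"
proof
  assume "(2::complex) powi z = 1"
  then have "cmod (2 powi z) = 1" by simp
  then have 1: "(2::real) powi z = 1" by (simp add: norm_power_int)
  have pow: "m = 0" if "(2::real) ^ m = 1" for m
    using that power_inject_exp[of "2::real" m 0] by simp
  show "z = 0"
  proof (cases "z \<ge> 0")
    case True
    then obtain m where "z = int m" by (metis nonneg_int_cases)
    then show ?thesis using 1 pow[of m] by simp
  next
    case False
    then obtain m where "z = - int m" by (metis int_cases2 nle_le of_nat_0_le_iff)
    then show ?thesis using 1 pow[of m] by (simp add: power_int_minus)
  qed
qed simp

context nilpotent_quiver_rep
begin

section \<open>Torus weights and stabilisers of graphs\<close>

definition tw :: "(nat => complex) => nat \<times> nat => complex" where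
  "tw \<gamma> = (\<lambda>(j, p). \<gamma> 0 ^ p * \<gamma> j)"

lemma tw_nonzero: "\<gamma> \<in> torus ==> \<beta> \<in> B ==> tw \<gamma> \<beta> ~= 0"
  by (auto simp: tw_def torus_def B_def PiE_iff)

lemma torus_act_mk: "\<gamma> \<in> torus ==> torus_act \<gamma> (mk L A) = mk L (\<lambda>h l. A h l * (tw \<gamma> l / tw \<gamma> h))"
  unfolding torus_act_def tw_def[symmetric] by (rule diag_act_mk) (rule tw_nonzero)

lemma exp_torus: "(\<lambda>i\<in>{0..d}. exp (s * \<xi> i)) \<in> torus"
  by (simp add: torus_def)

lemma tw_exp: "\<beta> \<in> B ==> tw (\<lambda>i\<in>{0..d}. exp (s * \<xi> i)) \<beta> = exp (s * wt_form \<xi> \<beta>)"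
  by (auto simp: tw_def B_def wt_form_def exp_add[symmetric] exp_of_nat_mult[symmetric] algebra_simps)

text \<open>The nonzero entries at the places where the matrix influences the graph.\<close>

definition ent :: "(nat \<times> nat) set => (nat \<times> nat => nat \<times> nat => complex) => ((nat \<times> nat) \<times> nat \<times> nat) set" where
  "ent L A = {(h, l). h \<in> B \<inter> L \<and> l \<in> B - L \<and> vtx h = vtx l \<and> A h l ~= 0}"

lemma mk_eq_iff': "mk L A = mk L A' \<longleftrightarrow>
    (\<forall>h l. h \<in> B \<inter> L \<longrightarrow> l \<in> B - L \<longrightarrow> vtx h = vtx l \<longrightarrow> A h l = A' h l)"
  unfolding mk_eq_iff by (simp add: B_at_iff Ball_def) (metis vtx_less)

lemma ball_ent: "(\<forall>(h, l)\<in>ent L A. Q h l) \<longleftrightarrow>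
    (\<forall>h l. h \<in> B \<inter> L \<longrightarrow> l \<in> B - L \<longrightarrow> vtx h = vtx l \<longrightarrow> A h l ~= 0 \<longrightarrow> Q h l)"
  unfolding ball_pair_iff ent_def by blast

lemma torus_fix_iff:
  assumes "\<gamma> \<in> torus"
  shows "torus_act \<gamma> (mk L A) = mk L A \<longleftrightarrow> (\<forall>(h, l)\<in>ent L A. tw \<gamma> h = tw \<gamma> l)"
proof -
  have "A h l * (tw \<gamma> l / tw \<gamma> h) = A h l \<longleftrightarrow> A h l = 0 \<or> tw \<gamma> h = tw \<gamma> l" if "h \<in> B" for h l
    using tw_nonzero[OF assms that] by (auto simp: field_simps)
  then show ?thesis unfolding torus_act_mk[OF assms] mk_eq_iff' ball_ent by blast
qed

lemma stabiliser_lie_mk: "stabiliser_lie (mk L A) = stab_of d (ent L A)"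
proof -
  have "(\<forall>s. torus_act (\<lambda>i\<in>{0..d}. exp (s * \<xi> i)) (mk L A) = mk L A) \<longleftrightarrow>
     (\<forall>(h, l)\<in>ent L A. wt_form \<xi> h = wt_form \<xi> l)" for \<xi>
  proof
    assume fx: "\<forall>s. torus_act (\<lambda>i\<in>{0..d}. exp (s * \<xi> i)) (mk L A) = mk L A"
    show "\<forall>(h, l)\<in>ent L A. wt_form \<xi> h = wt_form \<xi> l"
    proof clarify
      fix h1 h2 l1 l2 assume hl: "((h1, h2), (l1, l2)) \<in> ent L A"
      let ?h = "(h1, h2)" and ?l = "(l1, l2)"
      have eq: "exp (s * wt_form \<xi> ?h) = exp (s * wt_form \<xi> ?l)" for s
      proof -
        have "torus_act (\<lambda>i\<in>{0..d}. exp (s * \<xi> i)) (mk L A) = mk L A" using fx by blast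
        then have "tw (\<lambda>i\<in>{0..d}. exp (s * \<xi> i)) ?h = tw (\<lambda>i\<in>{0..d}. exp (s * \<xi> i)) ?l"
          using hl unfolding torus_fix_iff[OF exp_torus] by blast
        then show ?thesis using hl by (simp add: tw_exp ent_def)
      qed
      show "wt_form \<xi> ?h = wt_form \<xi> ?l"
      proof (rule ccontr)
        assume "wt_form \<xi> ?h ~= wt_form \<xi> ?l"
        define D where "D = wt_form \<xi> ?h - wt_form \<xi> ?l"
        have "D ~= 0" using \<open>wt_form \<xi> ?h ~= wt_form \<xi> ?l\<close> by (simp add: D_def)
        \<comment> \<open>In place of differentiation, the parameter \<open>1 / D\<close> turns the
          equality of exponentials into \<open>exp 1 = 1\<close>.\<close>
        have "exp (1 / D * wt_form \<xi> ?h) = exp (1 / D * wt_form \<xi> ?l) * exp 1"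
          using \<open>D ~= 0\<close> by (simp add: exp_add[symmetric]) (simp add: D_def field_simps)
        then have "exp (1::complex) = 1" using eq[of "1 / D"] by simp
        then have "cmod (exp 1) = 1" by simp
        then show False by (simp add: norm_exp_eq_Re)
      qed
    qed
  next
    assume W: "\<forall>(h, l)\<in>ent L A. wt_form \<xi> h = wt_form \<xi> l"
    show "\<forall>s. torus_act (\<lambda>i\<in>{0..d}. exp (s * \<xi> i)) (mk L A) = mk L A"
      unfolding torus_fix_iff[OF exp_torus] using W by (auto simp: ent_def tw_exp)
  qed
  then show ?thesis unfolding stabiliser_lie_def stab_of_def by simp
qed

lemma orbit_dim_mk: "orbit_dim (mk L A) = (d + 1) - fs.dim (stab_of d (ent L A))"
proof -
  have "fscale = (\<lambda>c \<xi> i. c * \<xi> i)" by (simp add: fun_eq_iff)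
  then show ?thesis by (simp add: orbit_dim_def stabiliser_lie_mk)
qed

text \<open>The exponents of the ratio of torus weights of an exchanged pair: one at
  \<open>j'\<close>, minus one at \<open>j\<close>, and the shift \<open>u\<close> at 0.\<close>

definition lab :: "nat => nat => int => nat => int" where
  "lab j j' u = (\<lambda>i. (if i = j' then 1 else 0) - (if i = j then 1 else 0) + (if i = 0 then u else 0))"

lemma torus_char_lab:
  assumes "\<gamma> \<in> torus" "j \<in> {1..d}" "j' \<in> {1..d}" "j ~= j'"
  shows "torus_char (lab j j' u) \<gamma> = \<gamma> 0 powi u * (\<gamma> j' / \<gamma> j)"
proof -
  have nz: "\<gamma> i ~= 0" if "i \<le> d" for i using assms(1) that by (auto simp: torus_def PiE_iff)
  have "torus_char (lab j j' u) \<gamma> = (\<Prod>i\<in>{0, j, j'}. \<gamma> i powi lab j j' u i)"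
    unfolding torus_char_def by (rule prod.mono_neutral_right) (use assms in \<open>auto simp: lab_def\<close>)
  also have "\<dots> = \<gamma> 0 powi u * (\<gamma> j' / \<gamma> j)"
    using assms nz by (simp add: lab_def power_int_minus field_simps)
  finally show ?thesis .
qed

lemma tw_ratio:
  assumes "\<gamma> \<in> torus" "h \<in> B" "l \<in> B" "fst h ~= fst l"
  shows "tw \<gamma> l / tw \<gamma> h = torus_char (lab (fst h) (fst l) (shift_of (h, l))) \<gamma>"
proof -
  have nz: "\<gamma> 0 ~= 0" using assms(1) by (auto simp: torus_def PiE_iff)
  have "tw \<gamma> l / tw \<gamma> h = (\<gamma> 0 ^ snd l / \<gamma> 0 ^ snd h) * (\<gamma> (fst l) / \<gamma> (fst h))"
    by (simp add: tw_def case_prod_unfold)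
  also have "\<gamma> 0 ^ snd l / \<gamma> 0 ^ snd h = \<gamma> 0 powi shift_of (h, l)"
    using nz by (simp add: shift_of_def power_int_diff)
  finally show ?thesis using assms by (subst torus_char_lab) (auto simp: B_def)
qed

text \<open>The coordinate subrepresentations, described by the basis vectors they contain;
  \<open>fixed_points_eq\<close> identifies them with the torus fixed points.\<close>

definition fixed_index :: "(nat => nat) => (nat \<times> nat) set set" where
  "fixed_index e = {L. L \<subseteq> B \<and> (\<forall>h\<in>L. succ h \<in> B \<longrightarrow> succ h \<in> L) \<and> (\<forall>i<n. card (B_at i \<inter> L) = e i)}"

lemma mk_0_subrep:
  assumes L: "\<forall>h\<in>L. succ h \<in> B \<longrightarrow> succ h \<in> L" "L \<subseteq> B" shows "subrep (mk L (\<lambda>_ _. 0))"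
  unfolding subrep_def
proof (intro conjI allI impI mk_extensional)
  fix i assume i: "i < n"
  show "subspace (mk L (\<lambda>_ _. 0) i)" by (rule mk_subspace[OF i])
  show "mk L (\<lambda>_ _. 0) i \<subseteq> V i" using i by (auto simp: mk_iff)
  show "f i ` mk L (\<lambda>_ _. 0) i \<subseteq> mk L (\<lambda>_ _. 0) ((i + 1) mod n)"
  proof clarify
    fix x assume x: "x \<in> mk L (\<lambda>_ _. 0) i"
    then have xV: "x \<in> V i" using i by (simp add: mk_iff)
    have "coord ((i + 1) mod n) l (f i x) = 0" if l: "l \<in> B_at ((i + 1) mod n) - L" for l
    proof (cases "snd l")
      case 0
      then show ?thesis using coord_f_start[OF i xV, of "fst l"] l by (metis DiffD1 prod.collapse)
    next
      case (Suc p)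
      define k where "k = (fst l, p)"
      have lk: "l = succ k" using Suc by (simp add: k_def prod_eq_iff)
      have kB: "k \<in> B" using l succ_B_D[of k] by (simp add: lk B_at_iff)
      have "vtx k = i" using l vtx_succ[of k] Suc_mod_cancel[OF i, of "vtx k"] vtx_less[of k]
        by (simp add: lk B_at_iff)
      then have kat: "k \<in> B_at i" using kB by (simp add: B_at_iff)
      have "k \<notin> L" using L l by (auto simp: lk B_at_iff)
      then have "coord i k x = 0" using x kat i by (simp add: mk_iff)
      then show ?thesis using coord_f_succ[OF i xV kat] l by (simp add: lk B_at_iff)
    qed
    then show "f i x \<in> mk L (\<lambda>_ _. 0) ((i + 1) mod n)"
      using f_into[OF i xV] by (simp add: mk_iff)
  qed
qed

lemma mk_0_fixed: assumes "L \<in> fixed_index e" shows "mk L (\<lambda>_ _. 0) \<in> fixed_points e"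
proof -
  have "mk L (\<lambda>_ _. 0) \<in> Gr e"
    using assms mk_0_subrep[of L] by (auto simp: Gr_def fixed_index_def dim_mk)
  moreover have "ent L (\<lambda>_ _. 0) = {}" by (simp add: ent_def)
  ultimately show ?thesis by (simp add: fixed_points_def torus_fix_iff)
qed

subsection \<open>Matchings and one-parameter families\<close>

text \<open>All exchanged pairs carry the same entry \<open>y\<close>: compatibility with the maps
  of the representation leaves one parameter.\<close>

definition AP :: "((nat \<times> nat) \<times> nat \<times> nat) set => complex => nat \<times> nat => nat \<times> nat => complex" where
  "AP P y h l = (if (h, l) \<in> P then y else 0)"

text \<open>The pairs of basis vectors that are exchanged along a one-dimensional torus orbit.\<close>

definition matching :: "(nat \<times> nat) set => nat => nat => int => ((nat \<times> nat) \<times> nat \<times> nat) set => bool" where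
  "matching L j j' u P \<longleftrightarrow> P ~= {} \<and> j \<in> {1..d} \<and> j' \<in> {1..d} \<and> j ~= j' \<and> L \<subseteq> B \<and>
    (\<forall>(h, l)\<in>P. h \<in> L \<and> l \<in> B - L \<and> vtx h = vtx l \<and> fst h = j \<and> fst l = j' \<and> shift_of (h, l) = u)"

lemma matchingD:
  assumes "matching L j j' u P" "(h, l) \<in> P"
  shows "h \<in> L" "h \<in> B" "l \<in> B" "l \<notin> L" "vtx h = vtx l" "fst h = j" "fst l = j'" "shift_of (h, l) = u"
  using assms by (auto simp: matching_def)

lemma matching_unique:
  assumes "matching L j j' u P" "(h, l) \<in> P" "(h', l') \<in> P" shows "h = h' \<longleftrightarrow> l = l'"
  using matchingD[OF assms(1,2)] matchingD[OF assms(1,3)] by (auto simp: shift_of_def prod_eq_iff)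

lemma matching_mk_inj:
  assumes "matching L j j' u P" shows "mk L (AP P y) = mk L (AP P y') \<longleftrightarrow> y = y'"
proof
  assume eq: "mk L (AP P y) = mk L (AP P y')"
  obtain h l where hl: "(h, l) \<in> P" using assms by (force simp: matching_def)
  then show "y = y'" using eq matchingD[OF assms hl] unfolding mk_eq_iff' AP_def by (metis DiffI IntI)
qed simp

lemma torus_act_matching:
  assumes m: "matching L j j' u P" and \<gamma>: "\<gamma> \<in> torus"
  shows "torus_act \<gamma> (mk L (AP P y)) = mk L (AP P (torus_char (lab j j' u) \<gamma> * y))"
proof -
  have "AP P y h l * (tw \<gamma> l / tw \<gamma> h) = AP P (torus_char (lab j j' u) \<gamma> * y) h l" for h l
  proof (cases "(h, l) \<in> P")
    case True
    note D = matchingD[OF m True]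
    have "j ~= j'" using m by (simp add: matching_def)
    then show ?thesis using True tw_ratio[OF \<gamma> D(2,3)] D by (simp add: AP_def)
  qed (simp add: AP_def)
  then show ?thesis by (simp add: torus_act_mk[OF \<gamma>])
qed

definition curve :: "(nat \<times> nat) set => ((nat \<times> nat) \<times> nat \<times> nat) set => (nat => 'v set) set" where
  "curve L P = {mk L (AP P y) | y. y ~= 0}"

lemma torus_char_nonzero: assumes "\<gamma> \<in> torus" shows "torus_char \<alpha> \<gamma> ~= 0"
proof -
  have nz: "\<gamma> i ~= 0" if "i \<le> d" for i using assms that by (auto simp: torus_def PiE_iff)
  then show ?thesis by (auto simp: torus_char_def prod_zero_iff)
qed

lemma torus_char_lab_surj:
  assumes "j \<in> {1..d}" "j' \<in> {1..d}" "j ~= j'" "z ~= 0"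
  obtains \<gamma> where "\<gamma> \<in> torus" "torus_char (lab j j' u) \<gamma> = z"
proof
  let ?\<gamma> = "\<lambda>i\<in>{0..d}. if i = j' then z else 1"
  show "?\<gamma> \<in> torus" using assms by (simp add: torus_def)
  then show "torus_char (lab j j' u) ?\<gamma> = z" using assms by (simp add: torus_char_lab)
qed

lemma orbit_matching:
  assumes m: "matching L j j' u P" and y: "y ~= 0" shows "orbit (mk L (AP P y)) = curve L P"
proof
  show "orbit (mk L (AP P y)) \<subseteq> curve L P"
    using y torus_char_nonzero by (auto simp: orbit_def curve_def torus_act_matching[OF m])
  show "curve L P \<subseteq> orbit (mk L (AP P y))"
  proof
    fix N assume "N \<in> curve L P"
    then obtain z where z: "z ~= 0" "N = mk L (AP P z)" by (auto simp: curve_def)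
    have jj: "j \<in> {1..d}" "j' \<in> {1..d}" "j ~= j'" using m by (auto simp: matching_def)
    obtain \<gamma> where "\<gamma> \<in> torus" "torus_char (lab j j' u) \<gamma> = z / y"
      using torus_char_lab_surj[OF jj, of "z / y" u] y z by auto
    then have "N = torus_act \<gamma> (mk L (AP P y))" "\<gamma> \<in> torus"
      using y z torus_act_matching[OF m, of \<gamma> y] by simp_all
    then show "N \<in> orbit (mk L (AP P y))" unfolding orbit_def by blast
  qed
qed

lemma ent_matching: "matching L j j' u P ==> y ~= 0 ==> ent L (AP P y) = P"
  by (auto simp: ent_def AP_def matching_def)

lemma orbit_dim_matching:
  assumes m: "matching L j j' u P" and y: "y ~= 0" shows "orbit_dim (mk L (AP P y)) = 1"
proof -
  have "fs.dim (stab_of d P) = d"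
    by (rule dim_stab_one[of P j d j' u]) (use m in \<open>auto simp: matching_def\<close>)
  then show ?thesis by (simp add: orbit_dim_mk ent_matching[OF m y])
qed

lemma edge_label_matching:
  assumes m: "matching L j j' u P" shows "edge_label (curve L P) (lab j j' u)"
proof -
  define \<phi> where "\<phi> = inv_into (UNIV - {0}) (\<lambda>y. mk L (AP P y))"
  have inj: "inj_on (\<lambda>y. mk L (AP P y)) (UNIV - {0})" by (rule inj_onI) (simp add: matching_mk_inj[OF m])
  have im: "(\<lambda>y. mk L (AP P y)) ` (UNIV - {0}) = curve L P" by (auto simp: curve_def)
  have "bij_betw \<phi> (curve L P) (UNIV - {0})"
    unfolding \<phi>_def by (rule bij_betw_inv_into) (simp add: bij_betw_def inj im)
  moreover have val: "\<phi> (mk L (AP P y)) = y" if "y ~= 0" for y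
    unfolding \<phi>_def using inv_into_f_f[OF inj, of y] that by simp
  moreover have "\<phi> (torus_act \<gamma> N) = torus_char (lab j j' u) \<gamma> * \<phi> N" if \<gamma>: "\<gamma> \<in> torus" and N: "N \<in> curve L P" for \<gamma> N
  proof -
    obtain y where y: "y ~= 0" "N = mk L (AP P y)" using N by (auto simp: curve_def)
    then show ?thesis using torus_char_nonzero[OF \<gamma>] by (simp add: torus_act_matching[OF m \<gamma>] val)
  qed
  ultimately show ?thesis unfolding edge_label_def by blast
qed

text \<open>A label must be trivial on the kernel of the character of the orbit, hence a multiple of
  it, and the multiple is nonzero because the orbit is not a point. Over rational coefficients a
  nonzero multiple defines the same congruence.\<close>

lemma edge_label_unique:
  assumes m: "matching L j j' u P" and lb: "edge_label (curve L P) \<alpha>"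
  shows "\<exists>z. z ~= 0 \<and> (\<forall>i\<in>{0..d}. \<alpha> i = z * lab j j' u i)"
proof -
  have jj: "j \<in> {1..d}" "j' \<in> {1..d}" "j ~= j'" using m by (auto simp: matching_def)
  obtain \<phi> where \<phi>: "bij_betw \<phi> (curve L P) (UNIV - {0})"
    "\<And>\<gamma> N. \<gamma> \<in> torus ==> N \<in> curve L P ==> \<phi> (torus_act \<gamma> N) = torus_char \<alpha> \<gamma> * \<phi> N"
    using lb unfolding edge_label_def by blast
  have N1: "mk L (AP P 1) \<in> curve L P" by (force simp: curve_def)
  then have \<phi>1: "\<phi> (mk L (AP P 1)) ~= 0" using bij_betw_apply[OF \<phi>(1)] by blast
  have ker: "torus_char \<alpha> \<gamma> = 1" if \<gamma>: "\<gamma> \<in> torus" "torus_char (lab j j' u) \<gamma> = 1" for \<gamma>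
    using \<phi>(2)[OF \<gamma>(1) N1] \<phi>1 by (simp add: torus_act_matching[OF m \<gamma>(1)] \<gamma>(2))
  define z where "z = \<alpha> j'"
  have l1: "lab j j' u j' = 1" using jj by (simp add: lab_def)
  have prp: "\<alpha> i = z * lab j j' u i" if i: "i \<in> {0..d}" for i
  proof (cases "i = j'")
    case False
    \<comment> \<open>The test element is 2 at \<open>i\<close>, compensated at \<open>j'\<close>,
      where the known character has exponent one, so that it lies in the kernel.\<close>
    let ?y = "2 powi (- lab j j' u i) :: complex"
    let ?\<gamma> = "\<lambda>k\<in>{0..d}. if k = i then 2 else if k = j' then ?y else 1"
    have \<gamma>: "?\<gamma> \<in> torus" by (auto simp: torus_def)
    have ch: "torus_char \<beta> ?\<gamma> = 2 powi \<beta> i * ?y powi \<beta> j'" for \<beta>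
      unfolding torus_char_def using torus_char_two[of i d j' 2 ?y \<beta>] i jj False by simp
    have "torus_char (lab j j' u) ?\<gamma> = 1" unfolding ch l1 by (simp add: power_int_minus)
    then have "2 powi \<alpha> i * ?y powi z = 1" using ker[OF \<gamma>] by (simp add: ch z_def)
    then have "(2::complex) powi (\<alpha> i + (- lab j j' u i) * z) = 1"
      by (subst power_int_add) (simp_all flip: power_int_mult)
    then show ?thesis unfolding two_powi_eq_1 by (simp add: mult.commute)
  qed (simp add: z_def l1)
  have "z ~= 0"
  proof
    assume "z = 0"
    then have "torus_char \<alpha> \<gamma> = 1" for \<gamma> using prp by (simp add: torus_char_def)
    then have c: "\<phi> (torus_act \<gamma> N) = \<phi> N" if "\<gamma> \<in> torus" "N \<in> curve L P" for \<gamma> N using \<phi>(2) that by simp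
    obtain \<gamma> where \<gamma>: "\<gamma> \<in> torus" "torus_char (lab j j' u) \<gamma> = 2" using torus_char_lab_surj[OF jj, of 2 u] by auto
    have "mk L (AP P 2) \<in> curve L P" by (force simp: curve_def)
    moreover have "\<phi> (mk L (AP P 2)) = \<phi> (mk L (AP P 1))"
      using c[OF \<gamma>(1) N1] torus_act_matching[OF m \<gamma>(1), of 1] \<gamma>(2) by simp
    ultimately have "mk L (AP P 2) = mk L (AP P 1)" using \<phi>(1) N1 by (meson bij_betw_def inj_onD)
    then show False using matching_mk_inj[OF m] by simp
  qed
  then show ?thesis using prp by blast
qed

lemma matching_swap:
  assumes m: "matching L j j' u P"
  defines "L' \<equiv> (L - Domain P) \<union> Range P"
  shows "matching L' j' j (- u) (P\<inverse>)"
proof -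
  have D: "h \<in> L" "h \<in> B" "l \<in> B" "l \<notin> L" "vtx h = vtx l" "fst h = j" "fst l = j'" "shift_of (h, l) = u"
    if "(h, l) \<in> P" for h l using matchingD[OF m that] .
  have "L' \<subseteq> B" using m D(3) by (auto simp: L'_def matching_def)
  moreover have "l \<in> L'" "h \<in> B - L'" "shift_of (l, h) = - u" if hl: "(h, l) \<in> P" for h l
  proof -
    show "l \<in> L'" using hl by (auto simp: L'_def)
    have "h \<notin> Range P" using D(4) D(1)[OF hl] by blast
    then show "h \<in> B - L'" using D(2)[OF hl] hl by (auto simp: L'_def)
    show "shift_of (l, h) = - u" using D(8)[OF hl] by (simp add: shift_of_def)
  qed
  moreover have "P\<inverse> ~= {}" "j \<in> {1..d}" "j' \<in> {1..d}" "j ~= j'" using m by (auto simp: matching_def)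
  ultimately show ?thesis unfolding matching_def ball_pair_iff converse_iff
    using D(5-7) by (metis (no_types))
qed

lemma sum_matching:
  assumes m: "matching L j j' u P" and l: "l \<in> B_at i - L"
  shows "(\<Sum>h\<in>B_at i \<inter> L. AP P y h l * c h) = (if l \<in> Range P then y * c (THE h. (h, l) \<in> P) else 0)"
proof (cases "l \<in> Range P")
  case True
  then obtain h where h: "(h, l) \<in> P" by auto
  have the: "(THE h. (h, l) \<in> P) = h" using h matching_unique[OF m] by blast
  have hm: "h \<in> B_at i \<inter> L" using matchingD[OF m h] l by (auto simp: B_at_iff)
  have "(\<Sum>h\<in>B_at i \<inter> L. AP P y h l * c h) = (\<Sum>k\<in>B_at i \<inter> L. if k = h then y * c k else 0)"
  proof -
    have "(k, l) \<in> P \<longleftrightarrow> k = h" for k using matching_unique[OF m h] h by blast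
    then show ?thesis by (intro sum.cong) (simp_all add: AP_def)
  qed
  then show ?thesis using True hm the by simp
qed (auto simp: AP_def intro!: sum.neutral)

lemma mk_matching_iff:
  assumes m: "matching L j j' u P" and i: "i < n"
  shows "x \<in> mk L (AP P y) i \<longleftrightarrow> x \<in> V i \<and> (\<forall>l\<in>B_at i - L - Range P. coord i l x = 0) \<and>
    (\<forall>(h, l)\<in>P. h \<in> B_at i \<longrightarrow> coord i l x = y * coord i h x)"
proof -
  have "(\<forall>l\<in>B_at i - L. coord i l x = (if l \<in> Range P then y * coord i (THE h. (h, l) \<in> P) x else 0)) \<longleftrightarrow>
     (\<forall>l\<in>B_at i - L - Range P. coord i l x = 0) \<and> (\<forall>(h, l)\<in>P. h \<in> B_at i \<longrightarrow> coord i l x = y * coord i h x)"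
    (is "?A \<longleftrightarrow> ?B")
  proof
    assume A: ?A
    have "coord i l x = y * coord i h x" if "(h, l) \<in> P" "h \<in> B_at i" for h l
    proof -
      have "(THE h. (h, l) \<in> P) = h" using that matching_unique[OF m] by blast
      moreover have "l \<in> B_at i - L" using matchingD[OF m that(1)] that(2) by (simp add: B_at_iff)
      ultimately show ?thesis using A that by (metis RangeI)
    qed
    then show ?B using A by auto
  next
    assume R: ?B
    show ?A
    proof
      fix l assume l: "l \<in> B_at i - L"
      show "coord i l x = (if l \<in> Range P then y * coord i (THE h. (h, l) \<in> P) x else 0)"
      proof (cases "l \<in> Range P")
        case True
        then obtain h where h: "(h, l) \<in> P" by auto
        have the: "(THE h. (h, l) \<in> P) = h" using h matching_unique[OF m] by blast
        have "h \<in> B_at i" using matchingD[OF m h] l by (simp add: B_at_iff)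
        then show ?thesis using R h True the by auto
      qed (use R l in auto)
    qed
  qed
  then show ?thesis using i sum_matching[OF m, of _ i y "\<lambda>h. coord i h x"] by (simp add: mk_iff)
qed

text \<open>The same curve seen from its other end: the roles of the exchanged vectors are
  interchanged and the parameter is inverted.\<close>

lemma mk_matching_swap:
  assumes m: "matching L j j' u P" and y: "y ~= 0"
  shows "mk L (AP P y) = mk ((L - Domain P) \<union> Range P) (AP (P\<inverse>) (1 / y))"
proof (rule extensionalityI[of _ "{..<n}"])
  fix i assume "i \<in> {..<n}"
  then have i: "i < n" by simp
  let ?L' = "(L - Domain P) \<union> Range P"
  have dom: "h \<in> L \<and> h \<notin> Range P" if "h \<in> Domain P" for h using that matchingD[OF m] by blast
  have sets: "B_at i - ?L' - Range (P\<inverse>) = B_at i - L - Range P" using dom by auto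
  have pairs: "(\<forall>(h, l)\<in>P. h \<in> B_at i \<longrightarrow> coord i l x = y * coord i h x) \<longleftrightarrow>
     (\<forall>(h, l)\<in>P\<inverse>. h \<in> B_at i \<longrightarrow> coord i l x = 1 / y * coord i h x)" for x
  proof -
    have "h \<in> B_at i \<longleftrightarrow> l \<in> B_at i" if "(h, l) \<in> P" for h l using matchingD[OF m that] by (simp add: B_at_iff)
    moreover have "a = y * b \<longleftrightarrow> b = 1 / y * a" for a b using y by (auto simp: field_simps)
    ultimately show ?thesis unfolding ball_pair_iff converse_iff by blast
  qed
  show "mk L (AP P y) i = mk ?L' (AP (P\<inverse>) (1 / y)) i"
    unfolding set_eq_iff mk_matching_iff[OF m i] mk_matching_iff[OF matching_swap[OF m] i] sets pairs by blast
qed (auto simp: mk_extensional)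

end

section \<open>Limits and closures in the quiver Grassmannian\<close>

lemma tendsto_fun_iff:
  fixes F :: "'z => 'a => 'b::topological_space"
  shows "(F \<longlongrightarrow> G) filt \<longleftrightarrow> (\<forall>i. ((\<lambda>z. F z i) \<longlongrightarrow> G i) filt)"
proof -
  have "(F \<longlongrightarrow> G) filt \<longleftrightarrow> limitin (product_topology (\<lambda>i. euclidean) UNIV) F G filt"
    by (simp add: euclidean_product_topology)
  then show ?thesis by (simp add: limitin_componentwise)
qed

lemma continuous_entry: "continuous_on UNIV (\<lambda>M :: nat => nat \<times> nat => nat \<times> nat => complex. M i \<beta> \<beta>')"
proof -
  have "continuous_on UNIV (\<lambda>M :: nat => nat \<times> nat => nat \<times> nat => complex. M i)"
    by (rule continuous_on_product_coordinates)
  from continuous_on_product_then_coordinatewise[OF this, of \<beta>]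
  have "continuous_on UNIV (\<lambda>M :: nat => nat \<times> nat => nat \<times> nat => complex. M i \<beta>)" .
  from continuous_on_product_then_coordinatewise[OF this, of \<beta>'] show ?thesis .
qed

context nilpotent_quiver_rep
begin

lemma openin_Gr_top: "openin (Gr_top e) U \<longleftrightarrow> (\<exists>W. open W \<and> U = proj_matrix -` W \<inter> Gr e)"
  by (simp add: Gr_top_def openin_pullback_topology)

lemma topspace_Gr_top [simp]: "topspace (Gr_top e) = Gr e"
  by (simp add: Gr_top_def topspace_pullback_topology)

lemma limitin_GrI:
  assumes "N \<in> Gr e" "\<forall>\<^sub>F z in filt. F z \<in> Gr e"
    "\<And>i \<beta> \<beta>'. ((\<lambda>z. proj_matrix (F z) i \<beta> \<beta>') \<longlongrightarrow> proj_matrix N i \<beta> \<beta>') filt"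
  shows "limitin (Gr_top e) F N filt"
proof -
  have lim: "((\<lambda>z. proj_matrix (F z)) \<longlongrightarrow> proj_matrix N) filt"
    using assms(3) by (simp add: tendsto_fun_iff)
  have "\<forall>\<^sub>F z in filt. F z \<in> U" if U: "openin (Gr_top e) U" "N \<in> U" for U
  proof -
    obtain W where W: "open W" "U = proj_matrix -` W \<inter> Gr e" using U(1) by (auto simp: openin_Gr_top)
    then have "\<forall>\<^sub>F z in filt. proj_matrix (F z) \<in> W" using topological_tendstoD[OF lim] U(2) by blast
    then show ?thesis using assms(2) by eventually_elim (simp add: W)
  qed
  then show ?thesis using assms(1) by (simp add: limitin_def)
qed

lemma limitin_GrD:
  assumes "limitin (Gr_top e) F N filt"
  shows "((\<lambda>z. proj_matrix (F z) i \<beta> \<beta>') \<longlongrightarrow> proj_matrix N i \<beta> \<beta>') filt"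
proof (rule topological_tendstoI)
  fix O' :: "complex set" assume O': "open O'" "proj_matrix N i \<beta> \<beta>' \<in> O'"
  let ?W = "(\<lambda>M. M i \<beta> \<beta>') -` O'"
  have "open ?W" by (rule open_vimage[OF O'(1) continuous_entry])
  then have "openin (Gr_top e) (proj_matrix -` ?W \<inter> Gr e)" unfolding openin_Gr_top by blast
  moreover have "N \<in> proj_matrix -` ?W \<inter> Gr e" using assms O'(2) by (simp add: limitin_def)
  ultimately have "\<forall>\<^sub>F z in filt. F z \<in> proj_matrix -` ?W \<inter> Gr e"
    using assms unfolding limitin_def by blast
  then show "\<forall>\<^sub>F z in filt. proj_matrix (F z) i \<beta> \<beta>' \<in> O'" by eventually_elim simp
qed

text \<open>Used to determine endpoints: equations between entries of projection matrices persist in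
  the closure.\<close>

lemma closure_Gr_const:
  fixes g :: "(nat => nat \<times> nat => nat \<times> nat => complex) => complex"
  assumes "N \<in> Gr_top e closure_of E" "continuous_on UNIV g" "\<And>M. M \<in> E ==> g (proj_matrix M) = c"
  shows "g (proj_matrix N) = c"
proof (rule ccontr)
  assume ne: "g (proj_matrix N) ~= c"
  let ?W = "g -` (- {c})"
  have "open ?W" by (rule open_vimage[OF _ assms(2)]) auto
  then have "openin (Gr_top e) (proj_matrix -` ?W \<inter> Gr e)" unfolding openin_Gr_top by blast
  moreover have "N \<in> proj_matrix -` ?W \<inter> Gr e" using ne assms(1) by (simp add: in_closure_of)
  moreover have cl: "\<forall>T. N \<in> T \<and> openin (Gr_top e) T \<longrightarrow> (\<exists>y. y \<in> E \<and> y \<in> T)"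
    using assms(1) unfolding in_closure_of by (rule conjunct2)
  ultimately obtain M where "M \<in> E" "M \<in> proj_matrix -` ?W \<inter> Gr e"
    using spec[OF cl, of "proj_matrix -` ?W \<inter> Gr e"] by blast
  then show False using assms(3) by simp
qed

lemma limitin_closure:
  assumes "limitin (Gr_top e) F N filt" "filt ~= bot" "\<forall>\<^sub>F z in filt. F z \<in> E"
  shows "N \<in> Gr_top e closure_of E"
  unfolding in_closure_of
proof (intro conjI allI impI)
  show "N \<in> topspace (Gr_top e)" using assms(1) by (simp add: limitin_def)
  fix T assume "N \<in> T \<and> openin (Gr_top e) T"
  then have "\<forall>\<^sub>F z in filt. F z \<in> T" using assms(1) unfolding limitin_def by blast
  then have "\<forall>\<^sub>F z in filt. F z \<in> E \<and> F z \<in> T" using assms(3) by eventually_elim simp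
  then show "\<exists>y. y \<in> E \<and> y \<in> T" using eventually_happens'[OF assms(2)] by blast
qed

text \<open>The matrix of the orthogonal projection onto a member of the family. In the plane of
  each exchanged pair it projects onto the line spanned by the first vector plus \<open>y\<close>
  times the second; elsewhere it is the coordinate projection onto \<open>L\<close>.\<close>

definition pmat :: "(nat \<times> nat) set => ((nat \<times> nat) \<times> nat \<times> nat) set => complex => nat \<times> nat => nat \<times> nat => complex" where
  "pmat L P y \<beta> \<beta>' = (if \<beta> = \<beta>' then
       (if \<beta> \<in> Domain P then 1 / (1 + y * cnj y) else if \<beta> \<in> Range P then y * cnj y / (1 + y * cnj y)
        else if \<beta> \<in> L then 1 else 0)
     else if (\<beta>', \<beta>) \<in> P then y / (1 + y * cnj y)
     else if (\<beta>, \<beta>') \<in> P then cnj y / (1 + y * cnj y) else 0)"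

lemma one_plus_norm_nonzero: "1 + y * cnj y ~= (0::complex)"
proof
  assume "1 + y * cnj y = 0"
  then have "Re (1 + y * cnj y) = 0" by simp
  then have "1 + ((Re y)\<^sup>2 + (Im y)\<^sup>2) = 0" by (simp add: power2_eq_square)
  then show False using sum_power2_ge_zero[of "Re y" "Im y"] by linarith
qed

lemma proj_matrix_eq:
  assumes i: "i < n" and \<beta>: "\<beta> \<in> B_at i" "\<beta>' \<in> B_at i"
    and u: "vec i (\<lambda>\<beta>. Q \<beta>) \<in> mk L A i"
    and orth: "\<And>z. z \<in> mk L A i ==> (\<Sum>\<beta>\<in>B_at i. ((if \<beta> = \<beta>' then 1 else 0) - Q \<beta>) * cnj (coord i \<beta> z)) = 0"
  shows "proj_matrix (mk L A) i \<beta> \<beta>' = Q \<beta>"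
proof -
  have "orth_proj i (mk L A i) (bas \<beta>') = vec i Q"
  proof (rule orth_proj_eqI[OF i mk_subspace[OF i]])
    show "mk L A i \<subseteq> V i" using i by (auto simp: mk_iff)
    show "bas \<beta>' \<in> V i" by (rule bas_V[OF i \<beta>(2)])
    show "vec i Q \<in> mk L A i" using u by simp
    fix z assume z: "z \<in> mk L A i"
    have "herm i (bas \<beta>' - vec i Q) z = (\<Sum>\<beta>\<in>B_at i. ((if \<beta> = \<beta>' then 1 else 0) - Q \<beta>) * cnj (coord i \<beta> z))"
      unfolding herm_diff_left[OF i bas_V[OF i \<beta>(2)] vec_V[OF i]]
      using i \<beta>(2) by (intro sum.cong) (auto simp: coord_bas)
    then show "herm i (bas \<beta>' - vec i Q) z = 0" using orth[OF z] by simp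
  qed
  then show ?thesis using i \<beta> by (simp add: proj_matrix_def)
qed

lemma proj_matrix_mk_0:
  assumes i: "i < n" and \<beta>: "\<beta> \<in> B_at i" "\<beta>' \<in> B_at i"
  shows "proj_matrix (mk L (\<lambda>_ _. 0)) i \<beta> \<beta>' = (if \<beta> = \<beta>' \<and> \<beta> \<in> L then 1 else 0)"
proof (rule proj_matrix_eq[OF i \<beta>])
  show "vec i (\<lambda>\<beta>. if \<beta> = \<beta>' \<and> \<beta> \<in> L then 1 else 0) \<in> mk L (\<lambda>_ _. 0) i" using i by (simp add: mk_iff)
  fix z assume z: "z \<in> mk L (\<lambda>_ _. 0) i"
  show "(\<Sum>\<beta>\<in>B_at i. ((if \<beta> = \<beta>' then 1 else 0) - (if \<beta> = \<beta>' \<and> \<beta> \<in> L then 1 else 0)) * cnj (coord i \<beta> z)) = 0"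
    using z i by (intro sum.neutral) (auto simp: mk_iff)
qed

lemma sum_two:
  assumes "finite I" "a \<in> I" "b \<in> I" "a ~= b" "\<And>k. k \<in> I ==> k ~= a ==> k ~= b ==> g k = 0"
  shows "(\<Sum>k\<in>I. g k) = g a + (g b :: complex)"
proof -
  have "(\<Sum>k\<in>I. g k) = (\<Sum>k\<in>{a, b}. g k)"
    by (rule sum.mono_neutral_right) (use assms in auto)
  then show ?thesis using assms(4) by simp
qed

lemma proj_matrix_matching:
  assumes m: "matching L j j' u P" and i: "i < n" and \<beta>: "\<beta> \<in> B_at i" "\<beta>' \<in> B_at i"
  shows "proj_matrix (mk L (AP P y)) i \<beta> \<beta>' = pmat L P y \<beta> \<beta>'"
proof (rule proj_matrix_eq[OF i \<beta>])
  let ?K = "1 + y * cnj y"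
  note K = one_plus_norm_nonzero[of y]
  have dom: "\<And>h. h \<in> Domain P ==> h \<in> L" and ran: "\<And>l. l \<in> Range P ==> l \<notin> L"
    using m by (auto simp: matching_def)
  have disj: "\<And>h l. (h, l) \<in> P ==> h \<notin> Range P" "\<And>h l. (h, l) \<in> P ==> l \<notin> Domain P"
    using dom ran by blast+
  have uq: "(k, l) \<in> P \<longleftrightarrow> k = h" "(h, k) \<in> P \<longleftrightarrow> k = l" if "(h, l) \<in> P" for h l k
    using matching_unique[OF m that] that by blast+
  have at: "h \<in> B_at i \<longleftrightarrow> l \<in> B_at i" if "(h, l) \<in> P" for h l
    using matchingD[OF m that] by (simp add: B_at_iff)
  have P1: "pmat L P y h h = 1 / ?K" "pmat L P y l l = y * cnj y / ?K" "pmat L P y l h = y / ?K" "pmat L P y h l = cnj y / ?K"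
    "h ~= l" "\<And>k. k ~= h ==> k ~= l ==> pmat L P y h k = 0 \<and> pmat L P y k h = 0 \<and> pmat L P y l k = 0 \<and> pmat L P y k l = 0"
    if hl: "(h, l) \<in> P" for h l
  proof -
    have hd: "h \<in> Domain P" "l \<in> Range P" using hl by auto
    show ne: "h ~= l" using hd disj hl by metis
    show "pmat L P y h h = 1 / ?K" using hd by (simp add: pmat_def)
    show "pmat L P y l l = y * cnj y / ?K" using hd disj(2)[OF hl] by (simp add: pmat_def)
    have "(l, h) \<notin> P" using disj(1)[OF hl] by blast
    then show "pmat L P y l h = y / ?K" "pmat L P y h l = cnj y / ?K" using hl ne by (auto simp: pmat_def)
    show "pmat L P y h k = 0 \<and> pmat L P y k h = 0 \<and> pmat L P y l k = 0 \<and> pmat L P y k l = 0" if "k ~= h" "k ~= l" for k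
    proof -
      have "(k, h) \<notin> P" "(l, k) \<notin> P" using disj[OF hl] by blast+
      moreover have "(h, k) \<notin> P" "(k, l) \<notin> P" using uq[OF hl] that by blast+
      ultimately show ?thesis using that by (simp add: pmat_def)
    qed
  qed
  have P0: "pmat L P y k k' = (if k = k' \<and> k \<in> L then 1 else 0)" if "k \<notin> Domain P" "k \<notin> Range P" for k k'
  proof -
    have "(k, k') \<notin> P" "(k', k) \<notin> P" using that by blast+
    then show ?thesis using that by (cases "k = k'") (simp_all add: pmat_def)
  qed
  have P0': "pmat L P y k' k = (if k = k' \<and> k \<in> L then 1 else 0)" if "k \<notin> Domain P" "k \<notin> Range P" for k k'
  proof -
    have "(k, k') \<notin> P" "(k', k) \<notin> P" using that by blast+
    then show ?thesis using that by (cases "k' = k") (simp_all add: pmat_def)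
  qed
  show "vec i (\<lambda>\<beta>. pmat L P y \<beta> \<beta>') \<in> mk L (AP P y) i"
    unfolding mk_matching_iff[OF m i] ball_pair_iff
  proof (intro conjI ballI allI impI)
    show "vec i (\<lambda>\<beta>. pmat L P y \<beta> \<beta>') \<in> V i" using i by simp
    show "coord i l (vec i (\<lambda>\<beta>. pmat L P y \<beta> \<beta>')) = 0" if "l \<in> B_at i - L - Range P" for l
    proof -
      have "l \<notin> Domain P" using that dom by blast
      then have "pmat L P y l \<beta>' = 0" using P0[of l \<beta>'] that by simp
      then show ?thesis using that i by simp
    qed
    show "coord i l (vec i (\<lambda>\<beta>. pmat L P y \<beta> \<beta>')) = y * coord i h (vec i (\<lambda>\<beta>. pmat L P y \<beta> \<beta>'))"
      if hl: "(h, l) \<in> P" "h \<in> B_at i" for h l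
    proof -
      have "pmat L P y l \<beta>' = y * pmat L P y h \<beta>'"
        using P1[OF hl(1)] by (cases "\<beta>' = h"; cases "\<beta>' = l") auto
      then show ?thesis using i hl at[OF hl(1)] by simp
    qed
  qed
  fix z assume z: "z \<in> mk L (AP P y) i"
  let ?g = "\<lambda>\<beta>. ((if \<beta> = \<beta>' then 1 else 0) - pmat L P y \<beta> \<beta>') * cnj (coord i \<beta> z)"
  have zc: "coord i l z = y * coord i h z" if "(h, l) \<in> P" "h \<in> B_at i" for h l
    using z that unfolding mk_matching_iff[OF m i] by blast
  consider h l where "(h, l) \<in> P" "\<beta>' = h \<or> \<beta>' = l" | "\<beta>' \<notin> Domain P" "\<beta>' \<notin> Range P" by blast
  then show "(\<Sum>\<beta>\<in>B_at i. ?g \<beta>) = 0"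
  proof cases
    case (1 h l)
    have mem: "h \<in> B_at i" "l \<in> B_at i" using 1 \<beta>(2) at[OF 1(1)] by auto
    note Q = P1[OF 1(1)]
    \<comment> \<open>A column belonging to an exchanged pair is supported in the plane of that
      pair.\<close>
    have "(\<Sum>\<beta>\<in>B_at i. ?g \<beta>) = ?g h + ?g l"
      by (rule sum_two) (use mem Q 1(2) in auto)
    also have "\<dots> = 0"
    proof (cases "\<beta>' = h")
      case True
      have "?g h + ?g l = (1 - 1 / ?K) * cnj (coord i h z) - y / ?K * cnj (y * coord i h z)"
        using True Q zc[OF 1(1) mem(1)] by simp
      also have "\<dots> = 0" using K by (simp add: field_simps)
      finally show ?thesis .
    next
      case False
      then have "\<beta>' = l" using 1(2) by simp
      then have "?g h + ?g l = - (cnj y / ?K) * cnj (coord i h z) + (1 - y * cnj y / ?K) * cnj (y * coord i h z)"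
        using Q zc[OF 1(1) mem(1)] by simp
      also have "\<dots> = 0" using K by (simp add: field_simps)
      finally show ?thesis .
    qed
    finally show ?thesis .
  next
    case 2
    have "?g \<beta> = 0" if "\<beta> \<in> B_at i" for \<beta>
    proof (cases "\<beta> = \<beta>'")
      case True
      show ?thesis
      proof (cases "\<beta>' \<in> L")
        case False
        then have "coord i \<beta>' z = 0" using z \<beta>(2) 2 unfolding mk_matching_iff[OF m i] by blast
        then show ?thesis using True by simp
      qed (use P0'[OF 2, of \<beta>] True in simp)
    qed (use P0'[OF 2, of \<beta>] in auto)
    then show ?thesis by (intro sum.neutral) blast
  qed
qed

lemma limit_matching:
  assumes m: "matching L j j' u P" and Gr: "mk L (\<lambda>_ _. 0) \<in> Gr e" "\<forall>\<^sub>F z in filt. mk L (AP P (g z)) \<in> Gr e"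
    and g: "(g \<longlongrightarrow> 0) filt"
  shows "limitin (Gr_top e) (\<lambda>z. mk L (AP P (g z))) (mk L (\<lambda>_ _. 0)) filt"
proof (rule limitin_GrI[OF Gr])
  fix i \<beta> \<beta>'
  show "((\<lambda>z. proj_matrix (mk L (AP P (g z))) i \<beta> \<beta>') \<longlongrightarrow> proj_matrix (mk L (\<lambda>_ _. 0)) i \<beta> \<beta>') filt"
  proof (cases "i < n \<and> \<beta> \<in> B_at i \<and> \<beta>' \<in> B_at i")
    case True
    have c: "((\<lambda>z. cnj (g z)) \<longlongrightarrow> 0) filt" using tendsto_cnj[OF g] by simp
    have k: "((\<lambda>z. 1 + g z * cnj (g z)) \<longlongrightarrow> 1) filt"
      using tendsto_add[OF tendsto_const[of 1] tendsto_mult[OF g c]] by simp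
    have t1: "((\<lambda>z. 1 / (1 + g z * cnj (g z))) \<longlongrightarrow> 1) filt" using tendsto_divide[OF tendsto_const[of 1] k] by simp
    have t2: "((\<lambda>z. g z * cnj (g z) / (1 + g z * cnj (g z))) \<longlongrightarrow> 0) filt"
      using tendsto_divide[OF tendsto_mult[OF g c] k] by simp
    have t3: "((\<lambda>z. g z / (1 + g z * cnj (g z))) \<longlongrightarrow> 0) filt" using tendsto_divide[OF g k] by simp
    have t4: "((\<lambda>z. cnj (g z) / (1 + g z * cnj (g z))) \<longlongrightarrow> 0) filt" using tendsto_divide[OF c k] by simp
    have dr: "\<beta> \<in> Domain P \<longrightarrow> \<beta> \<in> L" "\<beta> \<in> Range P \<longrightarrow> \<beta> \<notin> L" using m by (auto simp: matching_def)
    have "((\<lambda>z. pmat L P (g z) \<beta> \<beta>') \<longlongrightarrow> (if \<beta> = \<beta>' \<and> \<beta> \<in> L then 1 else 0)) filt"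
    proof (cases "\<beta> = \<beta>'")
      case True
      show ?thesis using t1 t2 dr unfolding True[symmetric]
        by (cases "\<beta> \<in> Domain P"; cases "\<beta> \<in> Range P"; cases "\<beta> \<in> L") (simp_all add: pmat_def)
    next
      case False
      then show ?thesis using t3 t4
        by (cases "(\<beta>', \<beta>) \<in> P"; cases "(\<beta>, \<beta>') \<in> P") (simp_all add: pmat_def)
    qed
    then show ?thesis using True by (simp add: proj_matrix_matching[OF m] proj_matrix_mk_0)
  next
    case False
    then have "proj_matrix N i \<beta> \<beta>' = 0" for N by (auto simp: proj_matrix_def)
    then show ?thesis by simp
  qed
qed

lemma closure_curve_start:
  assumes m: "matching L j j' u P" and Gr: "\<And>y. mk L (AP P y) \<in> Gr e"
  shows "mk L (\<lambda>_ _. 0) \<in> Gr_top e closure_of (curve L P)"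
proof (rule limitin_closure)
  have "AP P 0 = (\<lambda>_ _. 0)" by (auto simp: AP_def fun_eq_iff)
  then have "mk L (\<lambda>_ _. 0) \<in> Gr e" using Gr[of 0] by simp
  then show "limitin (Gr_top e) (\<lambda>z. mk L (AP P z)) (mk L (\<lambda>_ _. 0)) (at 0)"
    by (rule limit_matching[OF m]) (use Gr in auto)
  have "\<forall>\<^sub>F z in at (0::complex). z ~= 0" by (simp add: eventually_at_filter)
  then show "\<forall>\<^sub>F z in at 0. mk L (AP P z) \<in> curve L P" by eventually_elim (auto simp: curve_def)
qed simp

lemma curve_swap:
  assumes m: "matching L j j' u P" shows "curve L P = curve ((L - Domain P) \<union> Range P) (P\<inverse>)"
proof
  let ?L' = "(L - Domain P) \<union> Range P"
  show "curve L P \<subseteq> curve ?L' (P\<inverse>)"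
  proof
    fix N assume "N \<in> curve L P"
    then obtain y where y: "y ~= 0" "N = mk L (AP P y)" by (auto simp: curve_def)
    then have "N = mk ?L' (AP (P\<inverse>) (1 / y))" using mk_matching_swap[OF m] by simp
    then show "N \<in> curve ?L' (P\<inverse>)" unfolding curve_def using y(1) by (intro CollectI exI[of _ "1 / y"]) simp
  qed
  show "curve ?L' (P\<inverse>) \<subseteq> curve L P"
  proof
    fix N assume "N \<in> curve ?L' (P\<inverse>)"
    then obtain z where z: "z ~= 0" "N = mk ?L' (AP (P\<inverse>) z)" by (auto simp: curve_def)
    then have "N = mk L (AP P (1 / z))" using mk_matching_swap[OF m, of "1 / z"] by simp
    then show "N \<in> curve L P" unfolding curve_def using z(1) by (intro CollectI exI[of _ "1 / z"]) simp
  qed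
qed

lemma closure_curve_end:
  assumes m: "matching L j j' u P" and Gr: "\<And>y. mk L (AP P y) \<in> Gr e"
    and L': "mk ((L - Domain P) \<union> Range P) (\<lambda>_ _. 0) \<in> Gr e"
  shows "mk ((L - Domain P) \<union> Range P) (\<lambda>_ _. 0) \<in> Gr_top e closure_of (curve L P)"
  unfolding curve_swap[OF m]
proof (rule closure_curve_start[OF matching_swap[OF m]])
  fix y
  show "mk (L - Domain P \<union> Range P) (AP (P\<inverse>) y) \<in> Gr e"
  proof (cases "y = 0")
    case True
    have "AP (P\<inverse>) 0 = (\<lambda>_ _. 0)" by (auto simp: AP_def fun_eq_iff)
    then show ?thesis using True L' by simp
  next
    case False
    then show ?thesis using mk_matching_swap[OF m, of "1 / y"] Gr[of "1 / y"] by simp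
  qed
qed

text \<open>Along the curve the diagonal entries are constant away from the exchanged pairs, add up
  to one in each pair, and agree for all first members. For a coordinate subspace in the closure
  this leaves only all first members or all second members.\<close>

lemma closure_curve_only:
  assumes m: "matching L j j' u P" and K: "K \<subseteq> B"
    and cl: "mk K (\<lambda>_ _. 0) \<in> Gr_top e closure_of (curve L P)"
  shows "K = L \<or> K = (L - Domain P) \<union> Range P"
proof -
  have dom: "\<And>h. h \<in> Domain P ==> h \<in> L" and ran: "\<And>l. l \<in> Range P ==> l \<notin> L"
    using m by (auto simp: matching_def)
  have PB: "h \<in> B" "l \<in> B" if "(h, l) \<in> P" for h l using matchingD[OF m that] by auto
  have LB: "L \<subseteq> B" using m by (simp add: matching_def)
  have pm: "proj_matrix (mk L (AP P y)) (vtx \<beta>) \<beta> \<beta> = pmat L P y \<beta> \<beta>" if "\<beta> \<in> B" for \<beta> y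
    by (rule proj_matrix_matching[OF m]) (use that in \<open>auto simp: B_at_iff\<close>)
  have k: "proj_matrix (mk K (\<lambda>_ _. 0)) (vtx \<beta>) \<beta> \<beta> = (if \<beta> \<in> K then 1 else 0)" if "\<beta> \<in> B" for \<beta>
    using proj_matrix_mk_0[of "vtx \<beta>" \<beta> \<beta> K] that by (simp add: B_at_iff)
  have out: "\<beta> \<in> K \<longleftrightarrow> \<beta> \<in> L" if "\<beta> \<in> B" "\<beta> \<notin> Domain P" "\<beta> \<notin> Range P" for \<beta>
  proof -
    have "proj_matrix (mk K (\<lambda>_ _. 0)) (vtx \<beta>) \<beta> \<beta> = (if \<beta> \<in> L then 1 else 0)"
      by (rule closure_Gr_const[OF cl continuous_entry]) (use that in \<open>auto simp: curve_def pm pmat_def\<close>)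
    then show ?thesis using k[OF that(1)] by (auto split: if_splits)
  qed
  have tr: "l \<in> K \<longleftrightarrow> h \<notin> K" if hl: "(h, l) \<in> P" for h l
  proof -
    let ?g = "\<lambda>M :: nat => nat \<times> nat => nat \<times> nat => complex. M (vtx h) h h + M (vtx l) l l"
    have "?g (proj_matrix (mk K (\<lambda>_ _. 0))) = 1"
    proof (rule closure_Gr_const[OF cl])
      show "continuous_on UNIV ?g" by (intro continuous_on_add continuous_entry)
      fix M assume "M \<in> curve L P"
      then obtain y where y: "M = mk L (AP P y)" by (auto simp: curve_def)
      have "h \<in> Domain P" "l \<in> Range P" "l \<notin> Domain P" using hl dom ran by blast+
      then show "?g (proj_matrix M) = 1" using one_plus_norm_nonzero[of y] PB[OF hl]
        by (simp add: y pm pmat_def add_divide_distrib[symmetric])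
    qed
    then show ?thesis using k PB[OF hl] by (auto split: if_splits)
  qed
  obtain h0 l0 where hl0: "(h0, l0) \<in> P" using m by (force simp: matching_def)
  have same: "h \<in> K \<longleftrightarrow> h0 \<in> K" if hl: "(h, l) \<in> P" for h l
  proof -
    let ?g = "\<lambda>M :: nat => nat \<times> nat => nat \<times> nat => complex. M (vtx h) h h - M (vtx h0) h0 h0"
    have "?g (proj_matrix (mk K (\<lambda>_ _. 0))) = 0"
    proof (rule closure_Gr_const[OF cl])
      show "continuous_on UNIV ?g" by (intro continuous_on_diff continuous_entry)
      fix M assume "M \<in> curve L P"
      then obtain y where y: "M = mk L (AP P y)" by (auto simp: curve_def)
      have "h \<in> Domain P" "h0 \<in> Domain P" using hl hl0 by blast+
      then show "?g (proj_matrix M) = 0" using PB[OF hl] PB[OF hl0] by (simp add: y pm pmat_def)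
    qed
    then show ?thesis using k PB[OF hl] PB[OF hl0] by (auto split: if_splits)
  qed
  show ?thesis
  proof (cases "h0 \<in> K")
    case True
    have "\<beta> \<in> K \<longleftrightarrow> \<beta> \<in> L" if "\<beta> \<in> B" for \<beta>
      using True out[OF that] same tr dom ran by blast
    then show ?thesis using K LB by blast
  next
    case False
    have "\<beta> \<in> K \<longleftrightarrow> \<beta> \<in> (L - Domain P) \<union> Range P" if "\<beta> \<in> B" for \<beta>
      using False out[OF that] same tr dom ran by blast
    moreover have "(L - Domain P) \<union> Range P \<subseteq> B" using LB PB by blast
    ultimately show ?thesis using K by blast
  qed
qed

end

section \<open>Homogeneous representations as index shifts\<close>

lemma int_threshold:
  fixes Q :: "int => bool"
  assumes mono: "\<And>z. Q z ==> Q (z + 1)" and lo: "\<And>z. z \<le> lo ==> \<not> Q z" and hi: "Q hi"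
  shows "\<exists>z0. \<forall>z. Q z \<longleftrightarrow> z0 \<le> z"
proof -
  have mono': "Q (z + int m)" if "Q z" for z m
  proof (induction m)
    case (Suc m) then show ?case using mono[of "z + int m"] by (simp add: algebra_simps)
  qed (simp add: that)
  have hl: "lo < hi" using lo hi by (meson linorder_not_le)
  define k where "k = (LEAST k. Q (lo + int k))"
  have ex: "Q (lo + int (nat (hi - lo)))" using hl hi by simp
  then have Qk: "Q (lo + int k)" unfolding k_def by (rule LeastI)
  have "Q z \<longleftrightarrow> lo + int k \<le> z" for z
  proof
    assume Qz: "Q z"
    then have "lo < z" using lo by (meson linorder_not_le)
    then have "Q (lo + int (nat (z - lo)))" using Qz by simp
    then have "k \<le> nat (z - lo)" unfolding k_def by (rule Least_le)
    then show "lo + int k \<le> z" using \<open>lo < z\<close> by simp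
  next
    assume "lo + int k \<le> z"
    then show "Q z" using mono'[OF Qk, of "nat (z - (lo + int k))"] by simp
  qed
  then show ?thesis by blast
qed

locale homog_rep = nilpotent_quiver_rep scale n V f d src len bas
  for scale :: "complex => 'v::ab_group_add => 'v" and n V f d src len bas +
  fixes v :: "nat => nat => nat \<times> nat" and wt :: "nat \<times> nat => int"
  assumes homog: "homogeneous v wt"
begin

abbreviation nx :: "nat => nat" where "nx i \<equiv> (i + 1) mod n"

section \<open>Constant index shifts at each vertex\<close>

definition mdim :: "nat => nat" where "mdim i = card (B_at i)"

lemma dim_V: "i < n ==> dim (V i) = mdim i"
  using dim_span_eq_card_independent[OF bas_independent, of i] card_image[OF bas_inj, of i]
  by (simp add: bas_span mdim_def)

lemma v_bij: "i < n ==> bij_betw (v i) {1..mdim i} (B_at i)"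
  using homog by (simp add: homogeneous_def indexing_def dim_V)

definition idx :: "nat \<times> nat => nat" where
  "idx \<beta> = inv_into {1..mdim (vtx \<beta>)} (v (vtx \<beta>)) \<beta>"

lemma v_B_at: "i < n ==> k \<in> {1..mdim i} ==> v i k \<in> B_at i"
  using v_bij bij_betw_apply by fast

lemma idx_v: "i < n ==> k \<in> {1..mdim i} ==> idx (v i k) = k"
  using v_B_at[of i k] bij_betw_inv_into_left[OF v_bij] by (simp add: idx_def B_at_iff)

lemma idx_range: "\<beta> \<in> B_at i ==> idx \<beta> \<in> {1..mdim i}"
  and v_idx: "\<beta> \<in> B_at i ==> v i (idx \<beta>) = \<beta>"
proof -
  assume \<beta>: "\<beta> \<in> B_at i"
  then have i: "i < n" "vtx \<beta> = i" using vtx_less[of \<beta>] by (auto simp: B_at_iff)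
  show "idx \<beta> \<in> {1..mdim i}"
    using bij_betw_apply[OF bij_betw_inv_into[OF v_bij[OF i(1)]] \<beta>] by (simp add: idx_def i(2))
  show "v i (idx \<beta>) = \<beta>"
    using bij_betw_inv_into_right[OF v_bij[OF i(1)] \<beta>] by (simp add: idx_def i(2))
qed

lemma inj_idx: "inj_on idx (B_at i)"
  by (rule inj_onI) (metis v_idx)

lemma f_bas_iff: "\<beta> \<in> B_at i ==> f i (bas \<beta>) = (if succ \<beta> \<in> B then bas (succ \<beta>) else 0)"
  using f_bas_succ[of \<beta>] by (simp add: B_at_iff)

lemma succ_B_at: "\<beta> \<in> B_at i ==> succ \<beta> \<in> B ==> succ \<beta> \<in> B_at (nx i)"
  using vtx_succ[of \<beta>] by (simp add: B_at_iff)

lemma B_at_less: "\<beta> \<in> B_at i ==> i < n"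
  using vtx_less[of \<beta>] by (simp add: B_at_iff)

lemma align_kernel:
  assumes "\<beta> \<in> B_at i" "\<beta>' \<in> B_at i" "succ \<beta> \<notin> B" "succ \<beta>' \<in> B" shows "idx \<beta>' < idx \<beta>"
proof -
  have i: "i < n" using B_at_less assms(1) .
  have "f i (bas (v i (idx \<beta>))) = 0" using assms f_bas_iff by (simp add: v_idx)
  moreover have "f i (bas (v i (idx \<beta>'))) ~= 0"
    using assms f_bas_iff bas_nonzero[OF _ succ_B_at[OF assms(2,4)]] by (simp add: v_idx)
  moreover have "idx \<beta> \<in> {1..dim (V i)}" "idx \<beta>' \<in> {1..dim (V i)}" using idx_range assms i by (simp_all add: dim_V)
  ultimately show ?thesis using homog i unfolding homogeneous_def aligned_def by blast
qed

lemma align_mono: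
  assumes "\<beta> \<in> B_at i" "\<beta>' \<in> B_at i" "succ \<beta> \<in> B" "succ \<beta>' \<in> B" "idx \<beta>' < idx \<beta>"
  shows "idx (succ \<beta>') < idx (succ \<beta>)"
proof -
  have i: "i < n" using B_at_less assms(1) .
  have s: "succ \<beta> \<in> B_at (nx i)" "succ \<beta>' \<in> B_at (nx i)" using succ_B_at assms by auto
  have "f i (bas (v i (idx \<beta>))) = bas (v (nx i) (idx (succ \<beta>)))"
    "f i (bas (v i (idx \<beta>'))) = bas (v (nx i) (idx (succ \<beta>')))"
    using assms f_bas_iff s by (simp_all add: v_idx)
  moreover have "idx \<beta> \<in> {1..dim (V i)}" "idx \<beta>' \<in> {1..dim (V i)}" using idx_range assms i by (simp_all add: dim_V)
  moreover have "idx (succ \<beta>) \<in> {1..dim (V (nx i))}" "idx (succ \<beta>') \<in> {1..dim (V (nx i))}"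
    using idx_range[OF s(1)] idx_range[OF s(2)] by (simp_all add: dim_V)
  ultimately show ?thesis using homog i assms(5) unfolding homogeneous_def aligned_def by blast
qed

text \<open>The constant amount by which the map at \<open>i\<close> raises the index of a basis
  vector. If the map is zero, the default exceeds the dimension at the next vertex, so that every
  shifted index overshoots.\<close>

definition cshift :: "nat => nat" where
  "cshift i = (if \<exists>\<beta>\<in>B_at i. succ \<beta> \<in> B then idx (succ (v i 1)) - 1 else mdim (nx i) + 1)"

text \<open>If the map is nonzero, alignment of the kernel shows that already the first vector has
  nonzero image; (H2) then makes the images of its successors consecutive until the next vertex is
  exhausted, and order preservation excludes any further image.\<close>

lemma shift_facts:
  assumes i: "i < n"
  shows "\<And>\<beta>. \<beta> \<in> B_at i ==> succ \<beta> \<in> B \<longleftrightarrow> idx \<beta> + cshift i \<le> mdim (nx i)"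
    and "\<And>\<beta>. \<beta> \<in> B_at i ==> succ \<beta> \<in> B ==> idx (succ \<beta>) = idx \<beta> + cshift i"
    and "mdim (nx i) \<le> mdim i + cshift i"
proof -
  have "(\<forall>\<beta>\<in>B_at i. (succ \<beta> \<in> B \<longleftrightarrow> idx \<beta> + cshift i \<le> mdim (nx i)) \<and>
     (succ \<beta> \<in> B \<longrightarrow> idx (succ \<beta>) = idx \<beta> + cshift i)) \<and> mdim (nx i) \<le> mdim i + cshift i"
  proof (cases "\<exists>\<beta>\<in>B_at i. succ \<beta> \<in> B")
    case False
    then show ?thesis by (auto simp: cshift_def)
  next
    case True
    then obtain \<beta>0 where \<beta>0: "\<beta>0 \<in> B_at i" "succ \<beta>0 \<in> B" by blast
    have "idx \<beta>0 \<in> {1..mdim i}" using idx_range \<beta>0 by blast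
    then have one: "1 \<in> {1..mdim i}" by simp
    let ?b = "v i 1"
    have b: "?b \<in> B_at i" "idx ?b = 1" using v_B_at[OF i one] idx_v[OF i one] .
    have sb: "succ ?b \<in> B"
    proof (rule ccontr)
      assume "succ ?b \<notin> B"
      then have "idx \<beta>0 < 1" using align_kernel[OF b(1) \<beta>0(1) _ \<beta>0(2)] b(2) by simp
      then show False using idx_range[OF \<beta>0(1)] by simp
    qed
    let ?k = "idx (succ ?b)"
    have sbB: "succ ?b \<in> B_at (nx i)" by (rule succ_B_at[OF b(1) sb])
    have k: "1 \<le> ?k" "?k \<le> mdim (nx i)" using idx_range[OF sbB] by auto
    have c: "cshift i = ?k - 1" using True by (simp add: cshift_def)
    have star: "k \<le> mdim i \<and> succ (v i k) = v (nx i) (k + cshift i)" if "1 \<le> k" "k + cshift i \<le> mdim (nx i)" for k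
    proof (cases "k = 1")
      case True
      then show ?thesis using one c k v_idx[OF sbB] by simp
    next
      case False
      let ?r = "k - 1"
      have r: "?r \<in> {1..dim (V (nx i)) - ?k}" using False that c k by (auto simp: dim_V)
      have "f i (bas ?b) = bas (v (nx i) ?k)" using f_bas_iff[OF b(1)] sb v_idx[OF sbB] by simp
      moreover have "1 \<in> {1..dim (V i)}" "?k \<in> {1..dim (V (nx i))}" "dim (V (nx i)) - ?k > 0"
        using one i k r by (auto simp: dim_V)
      ultimately have "1 + ?r \<le> dim (V i) \<and> f i (bas (v i (1 + ?r))) = bas (v (nx i) (?k + ?r))"
        using homog i r unfolding homogeneous_def gap_free_def by blast
      moreover have "1 + ?r = k" "?k + ?r = k + cshift i" using that k c by auto
      ultimately have g: "k \<le> mdim i" "f i (bas (v i k)) = bas (v (nx i) (k + cshift i))"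
        using i by (simp_all add: dim_V)
      have vk: "v i k \<in> B_at i" using v_B_at[OF i] that g by simp
      have vk': "v (nx i) (k + cshift i) \<in> B_at (nx i)" using v_B_at[of "nx i" "k + cshift i"] that by simp
      have "bas (v (nx i) (k + cshift i)) ~= 0" using bas_nonzero[OF _ vk'] by simp
      then have "succ (v i k) \<in> B" "bas (succ (v i k)) = bas (v (nx i) (k + cshift i))"
        using f_bas_iff[OF vk] g(2) by (auto split: if_splits)
      then have "succ (v i k) = v (nx i) (k + cshift i)"
        using inj_onD[OF bas_inj[of "nx i"]] succ_B_at[OF vk] vk' by simp
      then show ?thesis using g(1) by simp
    qed
    let ?k0 = "mdim (nx i) - cshift i"
    have k0: "1 \<le> ?k0" "?k0 + cshift i = mdim (nx i)" using k c by auto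
    have k0m: "?k0 \<le> mdim i" "succ (v i ?k0) = v (nx i) (mdim (nx i))" using star[OF k0(1)] k0(2) by auto
    have "(succ \<beta> \<in> B \<longleftrightarrow> idx \<beta> + cshift i \<le> mdim (nx i)) \<and>
     (succ \<beta> \<in> B \<longrightarrow> idx (succ \<beta>) = idx \<beta> + cshift i)" if \<beta>: "\<beta> \<in> B_at i" for \<beta>
    proof (cases "idx \<beta> + cshift i \<le> mdim (nx i)")
      case True
      have "succ \<beta> = v (nx i) (idx \<beta> + cshift i)" using star[OF _ True] idx_range[OF \<beta>] v_idx[OF \<beta>] by simp
      moreover have "idx \<beta> + cshift i \<in> {1..mdim (nx i)}" using True idx_range[OF \<beta>] by simp
      ultimately show ?thesis using True v_B_at[of "nx i"] idx_v[of "nx i"] by (simp add: B_at_iff)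
    next
      case False
      \<comment> \<open>The vector of index \<open>?k0\<close> is already sent to the last vector of
        the next vertex; by alignment a later one with nonzero image would have to go beyond
        it.\<close>
      have "succ \<beta> \<notin> B"
      proof
        assume s: "succ \<beta> \<in> B"
        have m: "v i ?k0 \<in> B_at i" "idx (v i ?k0) = ?k0" using v_B_at[OF i] idx_v[OF i] k0m k0 by auto
        have "mdim (nx i) \<in> {1..mdim (nx i)}" using k0 by simp
        then have m': "succ (v i ?k0) \<in> B" "idx (succ (v i ?k0)) = mdim (nx i)"
          using k0m(2) v_B_at[of "nx i"] idx_v[of "nx i"] by (simp_all add: B_at_iff)
        have "?k0 < idx \<beta>" using False k0 by linarith
        then have "mdim (nx i) < idx (succ \<beta>)" using align_mono[OF \<beta> m(1) s m'(1)] m m' by simp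
        then show False using idx_range[OF succ_B_at[OF \<beta> s]] by simp
      qed
      then show ?thesis using False by simp
    qed
    then show ?thesis using k0m k0 by auto
  qed
  then show "\<And>\<beta>. \<beta> \<in> B_at i ==> succ \<beta> \<in> B \<longleftrightarrow> idx \<beta> + cshift i \<le> mdim (nx i)"
    "\<And>\<beta>. \<beta> \<in> B_at i ==> succ \<beta> \<in> B ==> idx (succ \<beta>) = idx \<beta> + cshift i"
    "mdim (nx i) \<le> mdim i + cshift i" by blast+
qed

definition C :: int where "C = (\<Sum>i<n. int (cshift i))"

text \<open>With total shift zero every map would send the first basis vector to the first basis
  vector, and the summand containing the one at vertex 0 would never end.\<close>

lemma C_positive: "C > 0"
proof (rule ccontr)
  assume "\<not> C > 0"
  then have "C = 0" unfolding C_def by (smt (verit) of_nat_0_le_iff sum_nonneg)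
  then have z: "cshift i = 0" if "i < n" for i using that unfolding C_def by (simp add: sum_nonneg_eq_0_iff)
  have one: "v i 1 \<in> B_at i \<and> idx (v i 1) = 1 \<and> succ (v i 1) \<in> B" if i: "i < n" for i
  proof -
    have ex: "\<exists>\<beta>\<in>B_at i. succ \<beta> \<in> B" using z[OF i] by (auto simp: cshift_def split: if_splits)
    then obtain \<beta> where \<beta>: "\<beta> \<in> B_at i" "succ \<beta> \<in> B" by blast
    then have r: "1 \<in> {1..mdim i}" "1 \<in> {1..mdim (nx i)}"
      using idx_range[OF \<beta>(1)] idx_range[OF succ_B_at[OF \<beta>]] by auto
    then show ?thesis using v_B_at[OF i r(1)] idx_v[OF i r(1)] shift_facts(1)[OF i] z[OF i] by simp
  qed
  have n0: "0 < n" using n_pos by simp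
  obtain j p where jp: "v 0 1 = (j, p)" by fastforce
  have "(j, p + m) \<in> B \<and> idx (j, p + m) = 1" for m
  proof (induction m)
    case 0 then show ?case using one[OF n0] jp by (simp add: B_at_iff)
  next
    case (Suc m)
    let ?\<beta> = "(j, p + m)"
    let ?i = "vtx ?\<beta>"
    have \<beta>: "?\<beta> \<in> B_at ?i" using Suc by (simp add: B_at_iff)
    have "?\<beta> = v ?i 1" using v_idx[OF \<beta>] Suc by simp
    then have "succ ?\<beta> \<in> B" using one[of ?i] by simp
    then show ?case using shift_facts(2)[OF vtx_less \<beta>] Suc z[of ?i] by simp
  qed
  from this[of "len j"] show False by (auto simp: B_def)
qed

section \<open>Unrolling the cyclic quiver into levels and positions\<close>

definition vx :: "int => nat" where "vx z = nat (z mod int n)"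

text \<open>The index shift accumulated between level 0 and level \<open>z\<close>, counted
  negatively below 0. Subtracting it from the index gives a position that the maps preserve.\<close>

definition ctot :: "int => int" where
  "ctot z = (\<Sum>i<vx z. int (cshift i)) + (z div int n) * C"

lemma vx_less [simp]: "vx z < n"
  using n_pos by (simp add: vx_def nat_less_iff)

lemma vx_nat [simp]: "i < n ==> vx (int i) = i"
  by (simp add: vx_def nat_mod_distrib)

lemma vx_mod: "vx z = vx z' \<longleftrightarrow> z mod int n = z' mod int n"
  using n_pos by (simp add: vx_def nat_eq_iff)

lemma vx_step: "vx (z + 1) = nx (vx z)"
proof -
  have "(z + 1) mod int n = (z mod int n + 1) mod int n" by (simp add: mod_simps)
  then show ?thesis using n_pos by (simp add: vx_def nat_mod_distrib nat_add_distrib)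
qed

lemma vx_period: "vx (z + t * int n) = vx z"
  by (simp add: vx_def)

lemma ctot_period: "ctot (z + t * int n) = ctot z + t * C"
  using n_pos by (simp add: ctot_def vx_period algebra_simps)

lemma ctot_step: "ctot (z + 1) = ctot z + int (cshift (vx z))"
proof -
  have n: "int n > 0" using n_pos by simp
  show ?thesis
  proof (cases "vx z + 1 = n")
    case True
    then have zm: "z mod int n = int n - 1" by (simp add: vx_def) (metis One_nat_def Suc_eq_plus1 add_diff_cancel_right' int_nat_eq n of_nat_1 of_nat_add pos_mod_sign)
    then have z: "z + 1 = (z div int n + 1) * int n" by (metis add_diff_cancel_right' div_mult_mod_eq diff_add_cancel distrib_right mult_1 add.assoc)
    then have "(z + 1) div int n = z div int n + 1" "(z + 1) mod int n = 0" using n by simp_all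
    moreover have "C = (\<Sum>i<vx z. int (cshift i)) + int (cshift (vx z))"
    proof -
      have "{..<n} = insert (vx z) {..<vx z}" using True by auto
      then show ?thesis by (simp add: C_def)
    qed
    ultimately show ?thesis by (simp add: ctot_def vx_def algebra_simps)
  next
    case False
    then have lt: "z mod int n + 1 < int n" using vx_less[of z] by (simp add: vx_def nat_less_iff)
    have z: "z + 1 = (z mod int n + 1) + (z div int n) * int n" by simp
    have "z + 1 = int n * (z div int n) + (z mod int n + 1)" by simp
    moreover have "0 \<le> z mod int n + 1" using n by (simp add: add_increasing2)
    ultimately have "(z + 1) div int n = z div int n" "(z + 1) mod int n = z mod int n + 1"
      using lt by (rule int_div_pos_eq, intro int_mod_pos_eq)
    moreover have "nat (z mod int n + 1) = Suc (nat (z mod int n))" using n by (simp add: nat_add_distrib)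
    ultimately show ?thesis by (simp add: ctot_def vx_def)
  qed
qed

lemma ctot_mono: "z \<le> z' ==> ctot z \<le> ctot z'"
proof -
  assume "z \<le> z'"
  then obtain m where "z' = z + int m" by (metis zle_iff_zadd)
  moreover have "ctot z \<le> ctot (z + int m)"
  proof (induction m)
    case (Suc m)
    have "ctot (z + int (Suc m)) = ctot (z + int m) + int (cshift (vx (z + int m)))"
      using ctot_step[of "z + int m"] by (simp add: algebra_simps)
    then show ?case using Suc by simp
  qed simp
  ultimately show ?thesis by simp
qed

text \<open>At level \<open>z\<close> the position \<open>k\<close> has index
  \<open>k + ctot z\<close>; the condition says that this is an index of an existing basis
  vector.\<close>

definition inbox :: "int => int => bool" where
  "inbox z k \<longleftrightarrow> 1 \<le> k + ctot z \<and> k + ctot z \<le> int (mdim (vx z))"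

text \<open>The basis vector at level \<open>z\<close> and position \<open>k\<close>: levels unroll the cyclic quiver, and positions are
  shifted so that the maps of the representation preserve them.\<close>

definition el :: "int => int => nat \<times> nat" where
  "el z k = v (vx z) (nat (k + ctot z))"

lemma el_B_at: "inbox z k ==> el z k \<in> B_at (vx z)"
  and idx_el: "inbox z k ==> int (idx (el z k)) = k + ctot z"
proof -
  assume "inbox z k"
  then have "nat (k + ctot z) \<in> {1..mdim (vx z)}" by (auto simp: inbox_def)
  then show "el z k \<in> B_at (vx z)" "int (idx (el z k)) = k + ctot z"
    using v_B_at[of "vx z"] idx_v[of "vx z"] \<open>inbox z k\<close> by (auto simp: el_def inbox_def)
qed

lemma el_eqI: "inbox z k ==> \<beta> \<in> B_at (vx z) ==> int (idx \<beta>) = k + ctot z ==> el z k = \<beta>"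
  by (metis el_def nat_int v_idx)

lemma ex_el: assumes "\<beta> \<in> B_at (vx z)" shows "inbox z (int (idx \<beta>) - ctot z)" "el z (int (idx \<beta>) - ctot z) = \<beta>"
proof -
  show "inbox z (int (idx \<beta>) - ctot z)" using idx_range[OF assms] by (simp add: inbox_def)
  then show "el z (int (idx \<beta>) - ctot z) = \<beta>" using assms by (intro el_eqI) auto
qed

lemma el_inj_pos: "inbox z k ==> inbox z k' ==> el z k = el z k' ==> k = k'"
  by (metis idx_el add_right_cancel)

lemma inbox_period: "inbox (z + t * int n) k \<longleftrightarrow> inbox z (k + t * C)"
  by (simp add: inbox_def vx_period ctot_period algebra_simps)

text \<open>The source of periodicity: a full turn in level is equivalent to a translation of the
  position by \<open>C\<close>.\<close>

lemma el_period: "el (z + t * int n) k = el z (k + t * C)"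
  by (simp add: el_def vx_period ctot_period algebra_simps)

lemma el_step:
  assumes "inbox z k"
  shows "succ (el z k) \<in> B \<longleftrightarrow> inbox (z + 1) k" "inbox (z + 1) k ==> succ (el z k) = el (z + 1) k"
proof -
  have e: "el z k \<in> B_at (vx z)" by (rule el_B_at[OF assms])
  have ix: "int (idx (el z k) + cshift (vx z)) = k + ctot (z + 1)"
    using idx_el[OF assms] ctot_step[of z] by simp
  have "1 \<le> k + ctot (z + 1)" using assms ctot_step[of z] by (simp add: inbox_def)
  then have "inbox (z + 1) k \<longleftrightarrow> idx (el z k) + cshift (vx z) \<le> mdim (nx (vx z))"
    unfolding inbox_def vx_step ix[symmetric] by linarith
  then show iff: "succ (el z k) \<in> B \<longleftrightarrow> inbox (z + 1) k" using shift_facts(1)[OF vx_less e] by simp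
  assume b: "inbox (z + 1) k"
  then have s: "succ (el z k) \<in> B" using iff by simp
  show "succ (el z k) = el (z + 1) k"
  proof (rule el_eqI[OF b, symmetric])
    show "succ (el z k) \<in> B_at (vx (z + 1))" using succ_B_at[OF e s] by (simp only: vx_step)
    show "int (idx (succ (el z k))) = k + ctot (z + 1)" using shift_facts(2)[OF vx_less e s] ix by simp
  qed
qed

text \<open>By \<open>shift_facts\<close> the dimension at the next vertex grows by at most the
  index shift, so a position above the top of its level remains above the top.\<close>

lemma over_step: "int (mdim (vx z)) < k + ctot z ==> int (mdim (vx (z + 1))) < k + ctot (z + 1)"
  using shift_facts(3)[OF vx_less, of z] ctot_step[of z] by (simp only: vx_step)

lemma over_mono: assumes "int (mdim (vx z)) < k + ctot z" "z \<le> z'" shows "int (mdim (vx z')) < k + ctot z'"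
proof -
  obtain m where "z' = z + int m" using assms(2) by (metis zle_iff_zadd)
  moreover have "int (mdim (vx (z + int m))) < k + ctot (z + int m)"
  proof (induction m)
    case (Suc m)
    then show ?case using over_step[of "z + int m" k] by (simp add: algebra_simps)
  qed (use assms in simp)
  ultimately show ?thesis by simp
qed

lemma el_pred:
  assumes "inbox z k" "el z k = succ h" shows "inbox (z - 1) k \<and> el (z - 1) k = h"
proof -
  have sB: "succ h \<in> B_at (vx z)" using el_B_at[OF assms(1)] assms(2) by simp
  then have hB: "h \<in> B" by (simp add: B_at_iff succ_B_D)
  have "(vtx h + 1) mod n = (vx (z - 1) + 1) mod n"
    using sB vtx_succ[of h] vx_step[of "z - 1"] by (simp add: B_at_iff)
  then have "vtx h = vx (z - 1)" using Suc_mod_cancel[OF vx_less, of "vtx h" "z - 1"] vtx_less[of h] by simp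
  then have h: "h \<in> B_at (vx (z - 1))" using hB by (simp add: B_at_iff)
  let ?k = "int (idx h) - ctot (z - 1)"
  have e: "inbox (z - 1) ?k" "el (z - 1) ?k = h" by (rule ex_el[OF h])+
  have "succ (el (z - 1) ?k) \<in> B" using e sB by (simp add: B_at_iff)
  then have "inbox (z - 1 + 1) ?k" "succ (el (z - 1) ?k) = el (z - 1 + 1) ?k" using el_step[OF e(1)] by blast+
  then have "?k = k" using el_inj_pos[OF _ assms(1), of ?k] assms(2) e(2) by simp
  then show ?thesis using e by simp
qed

text \<open>A summand can start only where its position has just entered from below; had it been
  occupied one level earlier, the vector there would map to the starting vector.\<close>

lemma el_start:
  assumes "inbox z k" "snd (el z k) = 0" shows "k + ctot (z - 1) \<le> 0"
proof (rule ccontr)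
  assume "\<not> ?thesis"
  moreover have "k + ctot (z - 1) \<le> int (mdim (vx (z - 1)))"
    using assms(1) shift_facts(3)[OF vx_less, of "z - 1"] ctot_step[of "z - 1"] vx_step[of "z - 1"]
    by (simp add: inbox_def)
  ultimately have b: "inbox (z - 1) k" by (simp add: inbox_def)
  then have "succ (el (z - 1) k) = el z k" using el_step(2)[OF b] assms(1) by simp
  then have "snd (el z k) = snd (el (z - 1) k) + 1" by (metis snd_conv succ_def)
  then show False using assms(2) by simp
qed

section \<open>The positions of the summands\<close>

definition kap :: "nat => int" where
  "kap j = int (idx (j, 0)) - ctot (int (src j))"

lemma vtx_0: "j \<in> {1..d} ==> vtx (j, 0) = src j"
  by (simp add: vtx_def src_less)

lemma start_B: "j \<in> {1..d} ==> (j, 0) \<in> B"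
  using len_pos[of j] by (simp add: B_def)

text \<open>With its first vector placed at level \<open>src j\<close>, a whole summand stays at one
  position while the level increases.\<close>

lemma el_kap:
  assumes "(j, p) \<in> B" shows "inbox (int (src j) + int p) (kap j) \<and> el (int (src j) + int p) (kap j) = (j, p)"
  using assms
proof (induction p)
  case 0
  then have j: "j \<in> {1..d}" by (simp add: B_def)
  have "(j, 0) \<in> B_at (vx (int (src j)))" using 0 vtx_0[OF j] src_less[OF j] by (simp add: B_at_iff)
  then show ?case using ex_el[of "(j, 0)" "int (src j)"] by (simp add: kap_def)
next
  case (Suc p)
  then have "(j, p) \<in> B" by (auto simp: B_def)
  then have IH: "inbox (int (src j) + int p) (kap j)" "el (int (src j) + int p) (kap j) = (j, p)" using Suc.IH by auto
  then have "succ (el (int (src j) + int p) (kap j)) \<in> B" using Suc.prems by simp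
  then have "inbox (int (src j) + int p + 1) (kap j)"
    "succ (el (int (src j) + int p) (kap j)) = el (int (src j) + int p + 1) (kap j)"
    using el_step[OF IH(1)] by blast+
  then show ?case using IH(2) by (simp add: algebra_simps)
qed

text \<open>The summand fills all occupied levels of its position: below its start the index is not
  yet positive, and beyond its end the position is above the top.\<close>

lemma inbox_kap:
  assumes j: "j \<in> {1..d}" and b: "inbox z (kap j)"
  shows "\<exists>p. z = int (src j) + int p \<and> (j, p) \<in> B"
proof -
  have e0: "inbox (int (src j)) (kap j)" "el (int (src j)) (kap j) = (j, 0)"
    using el_kap[OF start_B[OF j]] by simp_all
  have "kap j + ctot (int (src j) - 1) \<le> 0" using el_start[OF e0(1)] e0(2) by simp
  then have "\<not> z \<le> int (src j) - 1" using b ctot_mono[of z "int (src j) - 1"] by (auto simp: inbox_def)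
  then obtain p where p: "z = int (src j) + int p" using zle_iff_zadd[of "int (src j)" z] by auto
  have "p < len j"
  proof (rule ccontr)
    assume np: "\<not> p < len j"
    let ?q = "len j - 1"
    have q: "(j, ?q) \<in> B" using j len_pos[OF j] by (simp add: B_def)
    note e = el_kap[OF q]
    have "succ (j, ?q) \<notin> B" using len_pos[OF j] by (simp add: B_def)
    then have nb: "\<not> inbox (int (src j) + int ?q + 1) (kap j)" using el_step(1)[OF conjunct1[OF e]] e by simp
    have "1 \<le> kap j + ctot (int (src j) + int ?q + 1)"
      using e ctot_step[of "int (src j) + int ?q"] by (simp add: inbox_def)
    then have "int (mdim (vx (int (src j) + int ?q + 1))) < kap j + ctot (int (src j) + int ?q + 1)"
      using nb by (simp add: inbox_def)
    then have "int (mdim (vx z)) < kap j + ctot z" by (rule over_mono) (use p np len_pos[OF j] in simp)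
    then show False using b by (simp add: inbox_def)
  qed
  then show ?thesis using p j by (auto simp: B_def)
qed

lemma inbox_real:
  assumes b: "inbox z k" and e: "el z k = (j, p)"
  shows "\<exists>t. k = kap j + t * C \<and> z = int (src j) + int p - t * int n"
proof -
  have jp: "(j, p) \<in> B" "vtx (j, p) = vx z" using el_B_at[OF b] e by (auto simp: B_at_iff)
  note k = el_kap[OF jp(1)]
  have "vx (int (src j) + int p) = vx z"
    using el_B_at[OF conjunct1[OF k]] k jp(2) by (simp add: B_at_iff)
  then have "int n dvd (int (src j) + int p) - z" by (simp add: vx_mod mod_eq_dvd_iff)
  then obtain t where t: "(int (src j) + int p) - z = int n * t" ..
  then have z: "z = int (src j) + int p + (- t) * int n" by (simp add: algebra_simps)
  have "inbox (int (src j) + int p) (k + (- t) * C)" "el (int (src j) + int p) (k + (- t) * C) = (j, p)"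
    using b e unfolding z inbox_period el_period by simp_all
  then have "k + (- t) * C = kap j" using el_inj_pos k by metis
  then show ?thesis using z by (intro exI[of _ t]) (simp add: algebra_simps)
qed

lemma kap_inj:
  assumes j: "j \<in> {1..d}" "j' \<in> {1..d}" and eq: "kap j' = kap j + t * C" shows "j = j'"
proof -
  note e = el_kap[OF start_B[OF j(1)]]
  have "inbox (int (src j) + (- t) * int n) (kap j')" "el (int (src j) + (- t) * int n) (kap j') = (j, 0)"
    using e unfolding inbox_period el_period eq by simp_all
  moreover obtain p where "int (src j) + (- t) * int n = int (src j') + int p" "(j', p) \<in> B"
    using inbox_kap[OF j(2)] calculation(1) by blast
  ultimately have "(j, 0) = (j', p)" using el_kap by metis
  then show ?thesis by simp
qed

definition real_pos :: "int => nat => bool" where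
  "real_pos k j \<longleftrightarrow> j \<in> {1..d} \<and> kap j mod C = k mod C"

text \<open>The variable of a position is the number of the summand in its residue class. Classes
  without a summand are given distinct auxiliary variables above \<open>d\<close>.\<close>

definition cls :: "int => nat" where
  "cls k = (if \<exists>j. real_pos k j then THE j. real_pos k j else d + 1 + nat (k mod C))"

text \<open>Normalised so that the vector at level \<open>z\<close> and position \<open>k\<close>
  has place \<open>off k + z\<close> in its summand; for positions without a summand only the shift
  rule matters.\<close>

definition off :: "int => int" where
  "off k = (if \<exists>j. real_pos k j then ((k - kap (THE j. real_pos k j)) div C) * int n - int (src (THE j. real_pos k j))
     else (k div C) * int n)"

lemma mod_C_iff: "k mod C = l mod C \<longleftrightarrow> (\<exists>t. k = l + t * C)"
proof
  assume "k mod C = l mod C"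
  then have "C dvd k - l" by (simp add: mod_eq_dvd_iff)
  then obtain t where "k - l = C * t" ..
  then show "\<exists>t. k = l + t * C" by (intro exI[of _ t]) (simp add: algebra_simps)
qed auto

lemma real_pos_unique: "real_pos k j ==> real_pos k j' ==> j = j'"
proof -
  assume "real_pos k j" "real_pos k j'"
  then have "j \<in> {1..d}" "j' \<in> {1..d}" "kap j' mod C = kap j mod C" by (auto simp: real_pos_def)
  then show ?thesis using kap_inj unfolding mod_C_iff by blast
qed

lemma cls_real: assumes "real_pos k j" shows "cls k = j"
proof -
  have "(THE j. real_pos k j) = j" using assms real_pos_unique by blast
  then show ?thesis using assms by (auto simp: cls_def)
qed

lemma off_real: assumes "j \<in> {1..d}" shows "off (kap j + t * C) = t * int n - int (src j)"
proof -
  have r: "real_pos (kap j + t * C) j" using assms by (simp add: real_pos_def)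
  have the: "(THE j'. real_pos (kap j + t * C) j') = j"
  proof (rule the_equality)
    show "real_pos (kap j + t * C) j" by (rule r)
    show "x = j" if "real_pos (kap j + t * C) x" for x by (rule real_pos_unique[OF that r])
  qed
  show ?thesis unfolding off_def the using r C_positive by auto
qed

sublocale aff: affine_poly C "int n" cls off
proof
  show "C > 0" by (rule C_positive)
  show "int n > 0" using n_pos by simp
  have pos: "cls k = (if \<exists>j. real_pos k j then cls k else d + 1 + nat (k mod C))" for k by (simp add: cls_def)
  show "1 \<le> cls k" for k
  proof (cases "\<exists>j. real_pos k j")
    case True
    then obtain j where "real_pos k j" by blast
    then show ?thesis using cls_real by (auto simp: real_pos_def)
  qed (simp add: cls_def)
  show "(cls k = cls l) = (k mod C = l mod C)" for k l
  proof
    assume "k mod C = l mod C"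
    then have "real_pos k = real_pos l" by (simp add: real_pos_def fun_eq_iff)
    then show "cls k = cls l" using \<open>k mod C = l mod C\<close> by (simp add: cls_def)
  next
    assume eq: "cls k = cls l"
    have le: "cls m \<le> d \<longleftrightarrow> (\<exists>j. real_pos m j)" for m
    proof
      assume "cls m \<le> d"
      then show "\<exists>j. real_pos m j" by (rule contrapos_pp) (simp add: cls_def)
    next
      assume "\<exists>j. real_pos m j"
      then obtain j where j: "real_pos m j" ..
      then have "j \<le> d" by (simp add: real_pos_def)
      then show "cls m \<le> d" using cls_real[OF j] by simp
    qed
    show "k mod C = l mod C"
    proof (cases "\<exists>j. real_pos k j")
      case True
      then have "\<exists>j. real_pos l j" using le[of k] le[of l] eq by simp
      then obtain j j' where "real_pos k j" "real_pos l j'" using True by blast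
      then show ?thesis using eq cls_real by (metis real_pos_def)
    next
      case False
      then have "\<not> (\<exists>j. real_pos l j)" using le[of k] le[of l] eq by simp
      then have "nat (k mod C) = nat (l mod C)" using False eq by (simp add: cls_def)
      then show ?thesis using C_positive by (simp add: nat_eq_iff)
    qed
  qed
  show "off (k + C) = off k + int n" for k
  proof (cases "\<exists>j. real_pos k j")
    case True
    then obtain j where j: "real_pos k j" by blast
    then have "k mod C = kap j mod C" by (simp add: real_pos_def)
    then obtain t where t: "k = kap j + t * C" unfolding mod_C_iff by blast
    have jd: "j \<in> {1..d}" using j by (simp add: real_pos_def)
    have "k + C = kap j + (t + 1) * C" using t by (simp add: algebra_simps)
    then have "off (k + C) = (t + 1) * int n - int (src j)" using off_real[OF jd, of "t + 1"] by simp
    moreover have "off k = t * int n - int (src j)" unfolding t by (rule off_real[OF jd])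
    ultimately show ?thesis by (simp add: algebra_simps)
  next
    case False
    moreover have "real_pos (k + C) = real_pos k" by (simp add: real_pos_def fun_eq_iff)
    ultimately show ?thesis using C_positive by (simp add: off_def algebra_simps)
  qed
qed

lemma el_coords:
  assumes "inbox z k" shows "fst (el z k) = cls k" "int (snd (el z k)) = off k + z"
proof -
  obtain j p where jp: "el z k = (j, p)" by fastforce
  then have j: "j \<in> {1..d}" using el_B_at[OF assms] by (simp add: B_at_iff B_def)
  obtain t where t: "k = kap j + t * C" "z = int (src j) + int p - t * int n" using inbox_real[OF assms jp] by blast
  have "real_pos k j" using t j by (simp add: real_pos_def)
  then show "fst (el z k) = cls k" using cls_real jp by simp
  show "int (snd (el z k)) = off k + z" using off_real[OF j, of t] t jp by simp
qed

lemma el_of_coords: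
  assumes \<beta>: "\<beta> \<in> B" and "fst \<beta> = cls k" "int (snd \<beta>) = off k + z" shows "inbox z k \<and> el z k = \<beta>"
proof -
  obtain j p where jp: "\<beta> = (j, p)" by fastforce
  have j: "j \<in> {1..d}" using \<beta> jp by (simp add: B_def)
  have "cls k = cls (kap j)" using assms(2) jp cls_real[of "kap j" j] j by (simp add: real_pos_def)
  then obtain t where t: "k = kap j + t * C" unfolding aff.cls_eq_iff mod_C_iff by blast
  have z: "z = (int (src j) + int p) + (- t) * int n" using assms(3) off_real[OF j, of t] t jp by (simp add: algebra_simps)
  show ?thesis using el_kap[of j p] \<beta> unfolding z inbox_period el_period t jp by simp
qed

lemma el_inj_level: "inbox z k ==> inbox z' k ==> el z k = el z' k ==> z = z'"
  by (metis add_left_cancel el_coords(2))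

end

section \<open>Fixed points as periodic functions\<close>

lemma eq_if_same_upper: "(\<And>z. (x::int) \<le> z \<longleftrightarrow> y \<le> z) ==> x = y"
  by (metis order_antisym order_refl)

context homog_rep
begin

definition over :: "int => int => bool" where
  "over z k \<longleftrightarrow> int (mdim (vx z)) < k + ctot z"

text \<open>The index set of a subrepresentation is completed by all positions above the top. After
  this completion membership is monotone in the level, so it is governed by a threshold.\<close>

definition inK :: "(nat \<times> nat) set => int => int => bool" where
  "inK L z k \<longleftrightarrow> over z k \<or> (inbox z k \<and> el z k \<in> L)"

definition upclosed :: "(nat \<times> nat) set => bool" where
  "upclosed L \<longleftrightarrow> L \<subseteq> B \<and> (\<forall>h\<in>L. succ h \<in> B \<longrightarrow> succ h \<in> L)"

lemma over_inbox: "over z k ==> \<not> inbox z k"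
  by (simp add: over_def inbox_def)

lemma regime: "k + ctot z \<le> 0 \<or> inbox z k \<or> over z k"
  by (auto simp: over_def inbox_def)

lemma under_regime: assumes "k + ctot z \<le> 0" shows "\<not> inbox z k" "\<not> over z k"
  using assms by (auto simp: over_def inbox_def)

lemma inK_step: assumes "upclosed L" "inK L z k" shows "inK L (z + 1) k"
proof (cases "over z k")
  case True then show ?thesis using over_step by (simp add: inK_def over_def)
next
  case False
  then have b: "inbox z k" "el z k \<in> L" using assms by (auto simp: inK_def)
  show ?thesis
  proof (cases "inbox (z + 1) k")
    case True
    have s: "succ (el z k) \<in> B" "succ (el z k) = el (z + 1) k" using el_step[OF b(1)] True by simp_all
    then have "el (z + 1) k \<in> L" using assms(1) b(2) unfolding upclosed_def by metis
    then show ?thesis using True by (simp add: inK_def)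
  next
    case False
    have "1 \<le> k + ctot (z + 1)" using b ctot_step[of z] by (simp add: inbox_def)
    then show ?thesis using False by (simp add: inK_def over_def inbox_def)
  qed
qed

lemma low_level: "\<exists>lo. \<forall>z\<le>lo. k + ctot z \<le> 0"
proof -
  let ?t = "- (\<bar>k\<bar> + \<bar>ctot 0\<bar>)"
  have "?t * C \<le> ?t" using C_positive mult_left_mono_neg[of 1 C ?t] by simp
  then have "k + ctot (0 + ?t * int n) \<le> 0" unfolding ctot_period by linarith
  then have "\<forall>z\<le>0 + ?t * int n. k + ctot z \<le> 0" using ctot_mono by (meson add_left_mono order_trans)
  then show ?thesis by blast
qed

lemma high_level: "\<exists>hi. over hi k"
proof -
  let ?t = "\<bar>k\<bar> + \<bar>ctot 0\<bar> + int (mdim (vx 0)) + 1"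
  have "?t \<le> ?t * C" using C_positive mult_left_mono[of 1 C ?t] by simp
  then have "over (0 + ?t * int n) k" unfolding over_def ctot_period vx_period by linarith
  then show ?thesis by blast
qed

text \<open>The level at which a position enters the completed index set.\<close>

definition nu :: "(nat \<times> nat) set => int => int" where
  "nu L k = (THE z0. \<forall>z. inK L z k \<longleftrightarrow> z0 \<le> z)"

lemma nu_le_iff: assumes up: "upclosed L" shows "nu L k \<le> z \<longleftrightarrow> inK L z k"
proof -
  obtain lo where lo: "\<And>z. z \<le> lo ==> k + ctot z \<le> 0" using low_level by blast
  obtain hi where hi: "over hi k" using high_level by blast
  have "\<exists>z0. \<forall>z. inK L z k \<longleftrightarrow> z0 \<le> z"
  proof (rule int_threshold)
    show "inK L (z + 1) k" if "inK L z k" for z by (rule inK_step[OF up that])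
    show "\<not> inK L z k" if "z \<le> lo" for z using under_regime[OF lo[OF that]] by (simp add: inK_def)
    show "inK L hi k" using hi by (simp add: inK_def)
  qed
  then obtain z0 where z0: "\<forall>z. inK L z k \<longleftrightarrow> z0 \<le> z" by blast
  have "nu L k = z0"
    unfolding nu_def
  proof (rule the_equality)
    show "\<forall>z. inK L z k \<longleftrightarrow> z0 \<le> z" by (rule z0)
    show "x = z0" if "\<forall>z. inK L z k \<longleftrightarrow> x \<le> z" for x using that z0 by (metis eq_if_same_upper)
  qed
  then show ?thesis using z0 by simp
qed

lemma nu_el: "upclosed L ==> inbox z k ==> el z k \<in> L \<longleftrightarrow> nu L k \<le> z"
  using over_inbox by (auto simp: nu_le_iff inK_def)

lemma inK_period: "inK L (z + t * int n) k \<longleftrightarrow> inK L z (k + t * C)"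
  unfolding inK_def inbox_period el_period over_def vx_period ctot_period by (simp add: ac_simps)

lemma nu_periodic: assumes "upclosed L" shows "aff.periodic (nu L)"
  unfolding aff.periodic_def
proof
  fix k
  show "nu L (k + C) = nu L k - int n"
  proof (rule eq_if_same_upper)
    fix z
    have "nu L (k + C) \<le> z \<longleftrightarrow> nu L k \<le> z + int n"
      using inK_period[of L z 1 k] by (simp add: nu_le_iff[OF assms])
    then show "nu L (k + C) \<le> z \<longleftrightarrow> nu L k - int n \<le> z" by linarith
  qed
qed

definition lev :: "nat \<times> nat => int" where "lev \<beta> = int (vtx \<beta>)"

definition pos :: "nat \<times> nat => int" where "pos \<beta> = int (idx \<beta>) - ctot (lev \<beta>)"

lemma el_pos: assumes "\<beta> \<in> B" shows "inbox (lev \<beta>) (pos \<beta>)" "el (lev \<beta>) (pos \<beta>) = \<beta>"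
  using ex_el[of \<beta> "lev \<beta>"] assms by (simp_all add: pos_def lev_def B_at_iff)

lemma el_reduce:
  assumes "inbox z k" shows "\<exists>t. pos (el z k) = k + t * C \<and> z = lev (el z k) + t * int n"
proof -
  define \<beta> where "\<beta> = el z k"
  have \<beta>: "\<beta> \<in> B" "vtx \<beta> = vx z" using el_B_at[OF assms] by (simp_all add: \<beta>_def B_at_iff)
  define t where "t = z div int n"
  have "lev \<beta> = z mod int n" using n_pos by (simp add: lev_def \<beta>(2) vx_def)
  then have z: "z = lev \<beta> + t * int n" by (simp add: t_def)
  have "inbox (lev \<beta>) (k + t * C)" "el (lev \<beta>) (k + t * C) = \<beta>"
    using assms \<beta>_def unfolding z inbox_period el_period by simp_all
  then have "pos \<beta> = k + t * C" using el_inj_pos el_pos[OF \<beta>(1)] by metis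
  then show ?thesis using z unfolding \<beta>_def by blast
qed

section \<open>Periodic functions that come from fixed points\<close>

definition setof :: "(int => int) => (nat \<times> nat) set" where
  "setof K = {\<beta> \<in> B. K (pos \<beta>) \<le> lev \<beta>}"

lemma setof_el: assumes per: "aff.periodic K" and b: "inbox z k" shows "el z k \<in> setof K \<longleftrightarrow> K k \<le> z"
proof -
  obtain t where t: "pos (el z k) = k + t * C" "z = lev (el z k) + t * int n" using el_reduce[OF b] by blast
  have "K (pos (el z k)) = K k - t * int n" unfolding t(1) by (rule aff.periodic_shift[OF per])
  moreover have "el z k \<in> B" using el_B_at[OF b] by (simp add: B_at_iff)
  ultimately show ?thesis using t(2) by (auto simp: setof_def)
qed

text \<open>The functions of the form \<open>nu L\<close>: a position may not enter while its index
  is not yet positive, and must have entered once it is above the top.\<close>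

definition good :: "(int => int) => bool" where
  "good K \<longleftrightarrow> aff.periodic K \<and> (\<forall>z k. k + ctot z \<le> 0 \<longrightarrow> z < K k) \<and> (\<forall>z k. over z k \<longrightarrow> K k \<le> z)"

lemma good_nu: assumes "upclosed L" shows "good (nu L)"
  unfolding good_def
proof (intro conjI allI impI)
  show "aff.periodic (nu L)" by (rule nu_periodic[OF assms])
  show "z < nu L k" if "k + ctot z \<le> 0" for z k
    using under_regime[OF that] nu_le_iff[OF assms, of k z] by (simp add: inK_def)
  show "nu L k \<le> z" if "over z k" for z k using that nu_le_iff[OF assms] by (simp add: inK_def)
qed

lemma upclosed_setof: assumes "good K" shows "upclosed (setof K)"
  unfolding upclosed_def
proof (intro conjI ballI impI)
  show "setof K \<subseteq> B" by (auto simp: setof_def)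
  fix h assume h: "h \<in> setof K" "succ h \<in> B"
  then have hB: "h \<in> B" by (simp add: setof_def)
  note e = el_pos[OF hB]
  have per: "aff.periodic K" using assms by (simp add: good_def)
  have b: "inbox (lev h + 1) (pos h)" "succ h = el (lev h + 1) (pos h)" using el_step[OF e(1)] e(2) h(2) by auto
  have "K (pos h) \<le> lev h" using h by (simp add: setof_def)
  then show "succ h \<in> setof K" unfolding b(2) setof_el[OF per b(1)] by simp
qed

lemma nu_setof: assumes "good K" shows "nu (setof K) = K"
proof
  fix k
  have per: "aff.periodic K" using assms by (simp add: good_def)
  show "nu (setof K) k = K k"
  proof (rule eq_if_same_upper)
    fix z
    have "inK (setof K) z k \<longleftrightarrow> K k \<le> z"
      using regime[of k z]
    proof (elim disjE)
      assume u: "k + ctot z \<le> 0"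
      then have "z < K k" using assms by (simp add: good_def)
      then show ?thesis using under_regime[OF u] by (simp add: inK_def)
    next
      assume b: "inbox z k"
      then have "\<not> over z k" using over_inbox by blast
      then show ?thesis using b by (simp add: inK_def setof_el[OF per b])
    next
      assume o: "over z k"
      then have "K k \<le> z" using assms by (simp add: good_def)
      then show ?thesis using o by (simp add: inK_def)
    qed
    then show "nu (setof K) k \<le> z \<longleftrightarrow> K k \<le> z" by (simp add: nu_le_iff[OF upclosed_setof[OF assms]])
  qed
qed

lemma setof_nu: assumes "upclosed L" shows "setof (nu L) = L"
proof -
  have "\<beta> \<in> setof (nu L) \<longleftrightarrow> \<beta> \<in> L" if "\<beta> \<in> B" for \<beta>
    using nu_el[OF assms el_pos(1)[OF that]] el_pos(2)[OF that] that by (simp add: setof_def)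
  moreover have "L \<subseteq> B" using assms by (simp add: upclosed_def)
  ultimately show ?thesis by (auto simp: setof_def)
qed

text \<open>For a good function the counted positions have positive index automatically, so counting
  up to the last position of the level gives the dimension at the vertex. This links the dimension
  vector to the Bruhat order.\<close>

lemma card_setof:
  assumes K: "good K" and i: "i < n"
  shows "card (B_at i \<inter> setof K) = aff.cnt K (int i) (int (mdim i) - ctot (int i))"
proof -
  have per: "aff.periodic K" using K by (simp add: good_def)
  let ?S = "{k. k \<le> int (mdim i) - ctot (int i) \<and> K k \<le> int i}"
  have box: "inbox (int i) k" if "k \<in> ?S" for k
  proof -
    have "\<not> k + ctot (int i) \<le> 0" using K that unfolding good_def by (metis (mono_tags, lifting) linorder_not_le mem_Collect_eq)
    then show ?thesis using that i by (simp add: inbox_def)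
  qed
  have "bij_betw (el (int i)) ?S (B_at i \<inter> setof K)"
    unfolding bij_betw_def
  proof
    show "inj_on (el (int i)) ?S" by (rule inj_onI) (use el_inj_pos box in blast)
    show "el (int i) ` ?S = B_at i \<inter> setof K"
    proof (intro equalityI subsetI)
      fix \<beta> assume "\<beta> \<in> el (int i) ` ?S"
      then obtain k where k: "k \<in> ?S" "\<beta> = el (int i) k" by blast
      then show "\<beta> \<in> B_at i \<inter> setof K" using el_B_at[OF box[OF k(1)]] setof_el[OF per box[OF k(1)]] i by simp
    next
      fix \<beta> assume \<beta>: "\<beta> \<in> B_at i \<inter> setof K"
      let ?k = "int (idx \<beta>) - ctot (int i)"
      have e: "inbox (int i) ?k" "el (int i) ?k = \<beta>" using ex_el[of \<beta> "int i"] \<beta> i by simp_all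
      then have "K ?k \<le> int i" using \<beta> setof_el[OF per e(1)] by simp
      moreover have "?k \<le> int (mdim i) - ctot (int i)" using e(1) i by (simp add: inbox_def)
      ultimately show "\<beta> \<in> el (int i) ` ?S" using e(2) by (intro image_eqI[of _ _ ?k]) simp_all
    qed
  qed
  then show ?thesis by (simp add: aff.cnt_def bij_betw_same_card)
qed

definition hat :: "(nat => nat) => (int => int) set" where
  "hat e = nu ` fixed_index e"

lemma fixed_index_iff: "L \<in> fixed_index e \<longleftrightarrow> upclosed L \<and> (\<forall>i<n. card (B_at i \<inter> L) = e i)"
  by (auto simp: fixed_index_def upclosed_def)

lemma hat_iff: "K \<in> hat e \<longleftrightarrow> good K \<and> (\<forall>i<n. aff.cnt K (int i) (int (mdim i) - ctot (int i)) = e i)"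
proof
  assume "K \<in> hat e"
  then obtain L where "L \<in> fixed_index e" "K = nu L" by (auto simp: hat_def)
  then show "good K \<and> (\<forall>i<n. aff.cnt K (int i) (int (mdim i) - ctot (int i)) = e i)"
    using good_nu[of L] card_setof[OF good_nu[of L]] by (simp add: fixed_index_iff setof_nu)
next
  assume K: "good K \<and> (\<forall>i<n. aff.cnt K (int i) (int (mdim i) - ctot (int i)) = e i)"
  then have "setof K \<in> fixed_index e" by (simp add: fixed_index_iff upclosed_setof card_setof)
  moreover have "K = nu (setof K)" using K nu_setof by simp
  ultimately show "K \<in> hat e" unfolding hat_def by blast
qed

lemma setof_hat: "K \<in> hat e ==> setof K \<in> fixed_index e"
  by (auto simp: hat_def fixed_index_iff setof_nu)

lemma hat_periodic: "K \<in> hat e ==> aff.periodic K"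
  by (simp add: hat_iff good_def)

lemma finite_fixed_index: "finite (fixed_index e)"
  by (rule finite_subset[of _ "Pow B"]) (auto simp: fixed_index_def)

lemma finite_hat: "finite (hat e)"
  by (simp add: hat_def finite_fixed_index)

text \<open>Beyond the last position of level \<open>z\<close> the function \<open>nu L\<close> is at most \<open>z\<close>, so the difference of
  the two counting functions can only grow there; as it vanishes eventually, it vanishes
  throughout.\<close>

lemma below_nu:
  assumes up: "upclosed L" and bl: "aff.below K (nu L)"
  shows "over z k ==> K k \<le> z"
    and "aff.cnt K z (int (mdim (vx z)) - ctot z) = aff.cnt (nu L) z (int (mdim (vx z)) - ctot z)"
proof -
  let ?A = "int (mdim (vx z)) - ctot z"
  have per: "aff.periodic K" "aff.periodic (nu L)" using bl by (simp_all add: aff.below_def)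
  define D where "D m = int (aff.cnt (nu L) z (?A + int m)) - int (aff.cnt K z (?A + int m))" for m
  have st: "D (Suc m) = D m + (if K (?A + int (Suc m)) \<le> z then 0 else 1)" for m
  proof -
    have pre: "?A + int (Suc m) - 1 = ?A + int m" by simp
    have "over z (?A + int (Suc m))" by (simp add: over_def)
    then have "nu L (?A + int (Suc m)) \<le> z" using nu_le_iff[OF up] by (simp add: inK_def)
    then have c2: "aff.cnt (nu L) z (?A + int (Suc m)) = aff.cnt (nu L) z (?A + int m) + 1"
      using aff.cnt_step[OF per(2), of z "?A + int (Suc m)", unfolded pre] by (simp only: if_True)
    have c1: "aff.cnt K z (?A + int (Suc m)) = aff.cnt K z (?A + int m) + (if K (?A + int (Suc m)) \<le> z then 1 else 0)"
      by (rule aff.cnt_step[OF per(1), of z "?A + int (Suc m)", unfolded pre])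
    show ?thesis unfolding D_def c1 c2 by simp
  qed
  have mono: "D m \<le> D (m + r)" for m r
  proof (induction r)
    case (Suc r) then show ?case using st[of "m + r"] by (simp split: if_splits)
  qed simp
  have nonneg: "D m \<ge> 0" for m using bl by (simp add: D_def aff.below_def)
  have "\<forall>v. \<exists>A0. \<forall>A\<ge>A0. aff.cnt K v A = aff.cnt (nu L) v A" using bl by (simp add: aff.below_def)
  then obtain A0 where A0: "\<forall>A\<ge>A0. aff.cnt K z A = aff.cnt (nu L) z A" by blast
  have D0: "D m = 0" for m
  proof -
    have "A0 \<le> ?A + int (m + nat (A0 - ?A))" by linarith
    then have "D (m + nat (A0 - ?A)) = 0" using A0 unfolding D_def by simp
    then show ?thesis using mono[of m "nat (A0 - ?A)"] nonneg[of m] by linarith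
  qed
  show "aff.cnt K z ?A = aff.cnt (nu L) z ?A" using D0[of 0] by (simp add: D_def)
  assume "over z k"
  then have "k = ?A + int (Suc (nat (k - ?A - 1)))" by (simp add: over_def)
  moreover have "K (?A + int (Suc m)) \<le> z" for m using st[of m] D0 by (simp split: if_splits)
  ultimately show "K k \<le> z" by metis
qed

text \<open>Membership is governed by counts. No position of nonpositive index is counted for
  \<open>K'\<close>, hence none for the smaller \<open>K\<close>; the conditions above the top and
  the dimensions come from \<open>below_nu\<close>.\<close>

lemma hat_down: assumes "K' \<in> hat e" "aff.below K K'" shows "K \<in> hat e"
proof -
  obtain L where L: "L \<in> fixed_index e" "K' = nu L" using assms(1) by (auto simp: hat_def)
  have up: "upclosed L" using L by (simp add: fixed_index_iff)
  have per: "aff.periodic K" and bl: "aff.below K (nu L)" using assms L by (simp_all add: aff.below_def)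
  have under: "z < K k" if u: "k + ctot z \<le> 0" for z k
  proof -
    have "\<not> nu L k \<le> z" if "k \<le> - ctot z" for k
    proof -
      have "k + ctot z \<le> 0" using that by linarith
      then have "z < nu L k" using good_nu[OF up] unfolding good_def by blast
      then show ?thesis by simp
    qed
    then have "{k. k \<le> - ctot z \<and> nu L k \<le> z} = {}" by blast
    then have "aff.cnt (nu L) z (- ctot z) = 0" unfolding aff.cnt_def by (simp only: card.empty)
    then have "aff.cnt K z (- ctot z) = 0" using bl by (metis aff.below_def le_zero_eq)
    then have "{k. k \<le> - ctot z \<and> K k \<le> z} = {}" using aff.finite_below[OF per] by (simp add: aff.cnt_def)
    then have "k \<notin> {k. k \<le> - ctot z \<and> K k \<le> z}" by blast
    moreover have "k \<le> - ctot z" using u by linarith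
    ultimately show ?thesis by (simp add: not_le)
  qed
  have "good K" unfolding good_def using per under below_nu(1)[OF up bl] by blast
  moreover have "aff.cnt K (int i) (int (mdim i) - ctot (int i)) = e i" if "i < n" for i
    using below_nu(2)[OF up bl, of "int i"] assms(1) that unfolding hat_iff L(2) by simp
  ultimately show ?thesis by (simp add: hat_iff)
qed

lemma hat_refl:
  assumes "K \<in> hat e" "a < b" "K a < K b" shows "K \<circ> aff.refl a b \<in> hat e"
  by (rule hat_down[OF assms(1)]) (rule aff.below_comp_refl[OF hat_periodic[OF assms(1)] assms(2,3)])

section \<open>The one-parameter families\<close>

text \<open>When \<open>a\<close> and \<open>b\<close> exchange their entering levels, the vectors
  affected are those at the levels where \<open>a\<close> has entered and \<open>b\<close> has
  not.\<close>

definition PP :: "(nat \<times> nat) set => int => int => ((nat \<times> nat) \<times> nat \<times> nat) set" where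
  "PP L a b = {(el z a, el z b) | z. nu L a \<le> z \<and> z < nu L b}"

lemma PP_I: "nu L a \<le> z ==> z < nu L b ==> (el z a, el z b) \<in> PP L a b"
  unfolding PP_def by (intro CollectI exI[of _ z]) simp

lemma PP_translate:
  assumes "upclosed L" shows "PP L (a + t * C) (b + t * C) = PP L a b"
proof -
  have sh: "nu L (k + t * C) = nu L k - t * int n" for k by (rule aff.periodic_shift[OF nu_periodic[OF assms]])
  have "PP L (a + t * C) (b + t * C) = {(el (z + t * int n) a, el (z + t * int n) b) | z. nu L a \<le> z + t * int n \<and> z + t * int n < nu L b}"
    unfolding PP_def sh el_period by (simp add: algebra_simps)
  also have "\<dots> = PP L a b"
  proof (intro equalityI subsetI)
    fix x assume "x \<in> PP L a b"
    then obtain z where "x = (el z a, el z b)" "nu L a \<le> z" "z < nu L b" by (auto simp: PP_def)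
    then show "x \<in> {(el (z + t * int n) a, el (z + t * int n) b) | z. nu L a \<le> z + t * int n \<and> z + t * int n < nu L b}"
      by (intro CollectI exI[of _ "z - t * int n"]) simp
  qed (auto simp: PP_def)
  finally show ?thesis .
qed

lemma coord_f_el:
  assumes i: "i < n" "vx z = i" and x: "x \<in> V i" and b: "inbox (z + 1) k"
  shows "coord (nx i) (el (z + 1) k) (f i x) = (if inbox z k then coord i (el z k) x else 0)"
proof (cases "inbox z k")
  case True
  then have s: "succ (el z k) \<in> B" "succ (el z k) = el (z + 1) k" using el_step[OF True] b by simp_all
  then show ?thesis using coord_f_succ[OF i(1) x, of "el z k"] el_B_at[OF True] i(2) True by simp
next
  case False
  have e: "el (z + 1) k \<in> B_at (nx i)" using el_B_at[OF b] i(2) by (simp only: vx_step)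
  have "snd (el (z + 1) k) = 0"
  proof (rule ccontr)
    assume "snd (el (z + 1) k) ~= 0"
    then have "el (z + 1) k = succ (fst (el (z + 1) k), snd (el (z + 1) k) - 1)" by (simp add: prod_eq_iff)
    then have "inbox (z + 1 - 1) k" using el_pred[OF b] by blast
    then show False using False by simp
  qed
  then show ?thesis using coord_f_start[OF i(1) x, of "fst (el (z + 1) k)"] e False by (metis prod.collapse)
qed

context
  fixes e L a b
  assumes L: "L \<in> fixed_index e" and ab: "a < b" "nu L a < nu L b"
begin

lemma up: "upclosed L" using L by (simp add: fixed_index_iff)

lemma ab_mod: "a mod C ~= b mod C" by (rule aff.inv_pairs_mod[OF nu_periodic[OF up] ab])

lemma ab_cls: "cls a ~= cls b" using ab_mod by (simp add: aff.cls_eq_iff)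

text \<open>Position \<open>b\<close> has not entered, so it is not above the top, and neither is
  the smaller position \<open>a\<close>. Having entered, \<open>a\<close> is occupied, and the
  larger position \<open>b\<close> then has positive index as well.\<close>

lemma pair_box:
  assumes "nu L a \<le> z" "z < nu L b"
  shows "inbox z a" "inbox z b" "el z a \<in> L" "el z b \<notin> L"
proof -
  have K: "inK L z a" "\<not> inK L z b" using assms nu_le_iff[OF up] by (simp_all flip: not_le)
  then have nb: "\<not> over z b" by (simp add: inK_def)
  then have "\<not> over z a" using ab(1) by (simp add: over_def)
  then show a: "inbox z a" "el z a \<in> L" using K(1) by (simp_all add: inK_def)
  then show "inbox z b" using nb ab(1) by (simp add: over_def inbox_def)
  then show "el z b \<notin> L" using K(2) by (simp add: inK_def)
qed

lemma cls_range: "cls a \<in> {1..d}" "cls b \<in> {1..d}"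
proof -
  note p = pair_box[of "nu L a", OF order_refl ab(2)]
  show "cls a \<in> {1..d}" "cls b \<in> {1..d}"
    using el_B_at[OF p(1)] el_B_at[OF p(2)] el_coords(1)[OF p(1)] el_coords(1)[OF p(2)] by (auto simp: B_at_iff B_def)
qed

lemma matching_PP: "matching L (cls a) (cls b) (off b - off a) (PP L a b)"
  unfolding matching_def ball_pair_iff
proof (intro conjI allI impI)
  show "PP L a b ~= {}" using PP_I[of L a "nu L a" b] ab(2) by auto
  show "L \<subseteq> B" using up by (simp add: upclosed_def)
  fix h l assume "(h, l) \<in> PP L a b"
  then obtain z where z: "h = el z a" "l = el z b" "nu L a \<le> z" "z < nu L b" by (auto simp: PP_def)
  note p = pair_box[OF z(3,4)]
  show "h \<in> L" "l \<in> B - L" "vtx h = vtx l" using p z el_B_at[OF p(1)] el_B_at[OF p(2)] by (auto simp: B_at_iff)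
  show "fst h = cls a" "fst l = cls b" "shift_of (h, l) = off b - off a"
    using z el_coords[OF p(1)] el_coords[OF p(2)] by (simp_all add: shift_of_def)
qed (use cls_range ab_cls in auto)

lemma Range_PP: assumes "inbox z b" shows "el z b \<in> Range (PP L a b) \<longleftrightarrow> nu L a \<le> z \<and> z < nu L b"
proof
  assume "el z b \<in> Range (PP L a b)"
  then obtain z' where "el z b = el z' b" "nu L a \<le> z'" "z' < nu L b" by (auto simp: PP_def)
  then show "nu L a \<le> z \<and> z < nu L b" using el_inj_level[OF assms] pair_box(2)[of z'] by metis
qed (auto simp: PP_def)

lemma Domain_PP: assumes "inbox z a" shows "el z a \<in> Domain (PP L a b) \<longleftrightarrow> nu L a \<le> z \<and> z < nu L b"
proof
  assume "el z a \<in> Domain (PP L a b)"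
  then obtain z' where "el z a = el z' a" "nu L a \<le> z'" "z' < nu L b" by (auto simp: PP_def)
  then show "nu L a \<le> z \<and> z < nu L b" using el_inj_level[OF assms] pair_box(1)[of z'] by metis
qed (auto simp: PP_def)

lemma PP_cls: "h \<in> Domain (PP L a b) ==> fst h = cls a" "l \<in> Range (PP L a b) ==> fst l = cls b"
proof -
  show "fst h = cls a" if "h \<in> Domain (PP L a b)"
    using that by (elim DomainE) (rule matchingD(6)[OF matching_PP])
  show "fst l = cls b" if "l \<in> Range (PP L a b)"
    using that by (elim RangeE) (rule matchingD(7)[OF matching_PP])
qed

text \<open>The maps preserve positions, so the relation between the coordinates at \<open>a\<close>
  and \<open>b\<close> is carried from level to level; only its first and last levels need
  attention.\<close>

lemma family_Gr: "mk L (AP (PP L a b) y) \<in> Gr e"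
proof -
  let ?P = "PP L a b" and ?M = "mk L (AP (PP L a b) y)"
  note mi = mk_matching_iff[OF matching_PP]
  have stable: "f i x \<in> ?M (nx i)" if i: "i < n" and x: "x \<in> ?M i" for i x
  proof -
    have xV: "x \<in> V i" using x i by (simp add: mk_iff)
    have out: "coord i l x = 0" if "l \<in> B_at i" "l \<notin> L" "l \<notin> Range ?P" for l using x that by (simp add: mi[OF i])
    have rel: "coord i l x = y * coord i h x" if "(h, l) \<in> ?P" "h \<in> B_at i" for h l
      using x that unfolding mi[OF i] ball_pair_iff by blast
    have "coord (nx i) l (f i x) = 0" if l: "l \<in> B_at (nx i)" "l \<notin> L" "l \<notin> Range ?P" for l
    proof -
      let ?z = "int i"
      have vz: "vx ?z = i" "vx (?z + 1) = nx i" using i vx_step[of ?z] by simp_all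
      define k where "k = int (idx l) - ctot (?z + 1)"
      have k: "inbox (?z + 1) k" "el (?z + 1) k = l"
        unfolding k_def by (rule ex_el; use l(1) vz(2) in simp)+
      have "coord i (el ?z k) x = 0" if b: "inbox ?z k"
      proof (rule out)
        show "el ?z k \<in> B_at i" using el_B_at[OF b] vz by simp
        show "el ?z k \<notin> L" using nu_el[OF up b] nu_el[OF up k(1)] k(2) l(2) by auto
        show "el ?z k \<notin> Range ?P"
        proof
          assume "el ?z k \<in> Range ?P"
          then obtain z' where z': "el ?z k = el z' b" "nu L a \<le> z'" "z' < nu L b" by (auto simp: PP_def)
          have bb: "inbox z' b" by (rule pair_box(2)[OF z'(2,3)])
          have "succ (el ?z k) \<in> B" "succ (el ?z k) = l" using el_step[OF b] k by simp_all
          then have lb: "inbox (z' + 1) b" "l = el (z' + 1) b" using el_step[OF bb] z'(1) by simp_all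
          \<comment> \<open>If the exchanged pairs continue, \<open>l\<close> is the partner at the
            next level; otherwise \<open>b\<close> enters there and \<open>l\<close> belongs to
            \<open>L\<close>. Both are excluded.\<close>
          show False
          proof (cases "z' + 1 < nu L b")
            case True
            then show False using Range_PP[OF lb(1)] lb(2) l(3) z'(2) by simp
          next
            case False
            then show False using nu_el[OF up lb(1)] lb(2) l(2) by simp
          qed
        qed
      qed
      then show ?thesis using coord_f_el[OF i vz(1) xV k(1)] k(2) by simp
    qed
    moreover have "coord (nx i) l (f i x) = y * coord (nx i) h (f i x)"
      if hl: "(h, l) \<in> ?P" "h \<in> B_at (nx i)" for h l
    proof -
      obtain z1 where z1: "h = el z1 a" "l = el z1 b" "nu L a \<le> z1" "z1 < nu L b" using hl(1) by (auto simp: PP_def)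
      define z where "z = z1 - 1"
      have z1z: "z1 = z + 1" by (simp add: z_def)
      note p = pair_box[OF z1(3,4)]
      have "nx (vx z) = nx i" using el_B_at[OF p(1)] hl(2) z1(1) unfolding z1z vx_step by (simp add: B_at_iff)
      then have vz: "vx z = i" using Suc_mod_cancel[OF i, of "vx z"] by simp
      have ca: "coord (nx i) h (f i x) = (if inbox z a then coord i (el z a) x else 0)"
        using coord_f_el[OF i vz xV] p(1) z1(1) unfolding z1z by blast
      have cb: "coord (nx i) l (f i x) = (if inbox z b then coord i (el z b) x else 0)"
        using coord_f_el[OF i vz xV] p(2) z1(2) unfolding z1z by blast
      show ?thesis
      proof (cases "nu L a \<le> z")
        case True
        have zb: "z < nu L b" using z1(4) z1z by simp
        note q = pair_box[OF True zb]
        have "(el z a, el z b) \<in> ?P" using True zb by (auto simp: PP_def)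
        then show ?thesis using rel[of "el z a" "el z b"] el_B_at[OF q(1)] vz q ca cb by simp
      next
        case False
        \<comment> \<open>Here \<open>z + 1 = nu L a\<close> is the first level of the family: at
          level \<open>z\<close> neither position has entered nor takes part in a pair, so both
          coordinates vanish.\<close>
        have "coord i (el z a) x = 0" if ba: "inbox z a"
        proof (rule out)
          show "el z a \<in> B_at i" using el_B_at[OF ba] vz by simp
          show "el z a \<notin> L" using nu_el[OF up ba] False by simp
          show "el z a \<notin> Range ?P" using PP_cls(2) el_coords(1)[OF ba] ab_cls by metis
        qed
        moreover have "coord i (el z b) x = 0" if bb: "inbox z b"
        proof (rule out)
          show "el z b \<in> B_at i" using el_B_at[OF bb] vz by simp
          show "el z b \<notin> L" using nu_el[OF up bb] False ab(2) by simp
          show "el z b \<notin> Range ?P" using Range_PP[OF bb] False by simp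
        qed
        ultimately show ?thesis using ca cb by simp
      qed
    qed
    ultimately show ?thesis unfolding mi[OF next_less(1)] ball_pair_iff using f_into[OF i xV] by blast
  qed
  have "subrep ?M"
    unfolding subrep_def
  proof (intro conjI allI impI mk_extensional)
    fix i assume i: "i < n"
    show "subspace (?M i)" by (rule mk_subspace[OF i])
    show "?M i \<subseteq> V i" using i by (auto simp: mk_iff)
    show "f i ` ?M i \<subseteq> ?M (nx i)" using stable[OF i] by blast
  qed
  then show ?thesis using L by (simp add: Gr_def dim_mk fixed_index_iff)
qed

lemma endpoint_set: "setof (nu L \<circ> aff.refl a b) = (L - Domain (PP L a b)) \<union> Range (PP L a b)"
proof -
  let ?P = "PP L a b" and ?K = "nu L \<circ> aff.refl a b"
  have per: "aff.periodic ?K" using nu_periodic[OF up] by simp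
  have "\<beta> \<in> setof ?K \<longleftrightarrow> \<beta> \<in> (L - Domain ?P) \<union> Range ?P" if \<beta>: "\<beta> \<in> B" for \<beta>
  proof -
    consider "fst \<beta> = cls a" | "fst \<beta> = cls b" | "fst \<beta> ~= cls a" "fst \<beta> ~= cls b" by blast
    then show ?thesis
    proof cases
      case 1
      let ?z = "int (snd \<beta>) - off a"
      have e: "inbox ?z a" "el ?z a = \<beta>" using el_of_coords[OF \<beta> 1, of ?z] by simp_all
      have "\<beta> \<notin> Range ?P" using PP_cls(2) 1 ab_cls by metis
      moreover have "\<beta> \<in> setof ?K \<longleftrightarrow> nu L b \<le> ?z" using setof_el[OF per e(1)] e(2) ab_mod by simp
      moreover have "\<beta> \<in> L \<longleftrightarrow> nu L a \<le> ?z" using nu_el[OF up e(1)] e(2) by simp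
      moreover have "\<beta> \<in> Domain ?P \<longleftrightarrow> nu L a \<le> ?z \<and> ?z < nu L b" using Domain_PP[OF e(1)] e(2) by simp
      ultimately show ?thesis using ab(2) by auto
    next
      case 2
      let ?z = "int (snd \<beta>) - off b"
      have e: "inbox ?z b" "el ?z b = \<beta>" using el_of_coords[OF \<beta> 2, of ?z] by simp_all
      have "\<beta> \<notin> Domain ?P" using PP_cls(1) 2 ab_cls by metis
      moreover have "\<beta> \<in> setof ?K \<longleftrightarrow> nu L a \<le> ?z" using setof_el[OF per e(1)] e(2) ab_mod by simp
      moreover have "\<beta> \<in> L \<longleftrightarrow> nu L b \<le> ?z" using nu_el[OF up e(1)] e(2) by simp
      moreover have "\<beta> \<in> Range ?P \<longleftrightarrow> nu L a \<le> ?z \<and> ?z < nu L b" using Range_PP[OF e(1)] e(2) by simp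
      ultimately show ?thesis using ab(2) by auto
    next
      case 3
      note e = el_pos[OF \<beta>]
      have "cls (pos \<beta>) = fst \<beta>" using el_coords(1)[OF e(1)] e(2) by simp
      then have "aff.refl a b (pos \<beta>) = pos \<beta>" using 3 by (auto simp: aff.refl_def aff.cls_eq_iff[symmetric])
      then have "\<beta> \<in> setof ?K \<longleftrightarrow> \<beta> \<in> L" using setof_el[OF per e(1)] nu_el[OF up e(1)] e(2) by simp
      moreover have "\<beta> \<notin> Domain ?P" "\<beta> \<notin> Range ?P" using PP_cls 3 by metis+
      ultimately show ?thesis by simp
    qed
  qed
  moreover have "(L - Domain ?P) \<union> Range ?P \<subseteq> B" using up matchingD(3)[OF matching_PP] by (auto simp: upclosed_def)
  moreover have "setof ?K \<subseteq> B" by (auto simp: setof_def)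
  ultimately show ?thesis by blast
qed

lemma endpoint_index: "(L - Domain (PP L a b)) \<union> Range (PP L a b) \<in> fixed_index e"
proof -
  have "nu L \<in> hat e" using L by (simp add: hat_def)
  then have "nu L \<circ> aff.refl a b \<in> hat e" using ab by (intro hat_refl)
  then show ?thesis using setof_hat endpoint_set by metis
qed

end

section \<open>Echelon forms and torus fixed points\<close>

lemma succ_at_D: assumes "i < n" "succ k \<in> B_at (nx i)" shows "k \<in> B_at i"
  using assms vtx_succ[of k] Suc_mod_cancel[OF assms(1), of "vtx k"] vtx_less[of k] succ_B_D[of k]
  by (simp add: B_at_iff)

text \<open>The pivots form a fixed point: alignment makes the maps preserve the order of indices,
  so the image of a vector with pivot \<open>h\<close> has pivot \<open>succ h\<close> whenever the
  latter exists. Geometrically, \<open>L\<close> is the fixed point whose attracting cell contains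
  \<open>N\<close>.\<close>

lemma echelon_form:
  assumes N: "N \<in> Gr e"
  shows "\<exists>L\<in>fixed_index e. \<exists>A. N = mk L A \<and> (\<forall>h l. (h, l) \<in> ent L A \<longrightarrow> idx h < idx l)"
proof -
  have sub: "subspace (N i)" "N i \<subseteq> V i" "f i ` N i \<subseteq> N (nx i)" and dm: "dim (N i) = e i" if "i < n" for i
    using N that by (simp_all add: Gr_def subrep_def)
  define Li where "Li i = {h \<in> B_at i. \<exists>x\<in>N i. coord i h x ~= 0 \<and> (\<forall>l\<in>B_at i. idx l < idx h \<longrightarrow> coord i l x = 0)}" for i
  have "\<forall>i<n. \<exists>A. N i = mk (Li i) A i \<and> (\<forall>h l. A h l ~= 0 \<longrightarrow> h \<in> Li i \<and> l \<in> B_at i - Li i \<and> idx h < idx l)"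
    unfolding Li_def using echelon_exists[OF _ sub(1,2) inj_idx] by blast
  then obtain Ai where Ai: "\<And>i. i < n ==> N i = mk (Li i) (Ai i) i"
    "\<And>i h l. i < n ==> Ai i h l ~= 0 ==> idx h < idx l" by metis
  define L where "L = {h \<in> B. h \<in> Li (vtx h)}"
  define A where "A h l = Ai (vtx h) h l" for h l
  have LB: "B_at i \<inter> L = B_at i \<inter> Li i" for i by (auto simp: L_def B_at_iff)
  then have LB': "B_at i - L = B_at i - Li i" for i by blast
  have "N = mk L A"
  proof (rule extensionalityI[of _ "{..<n}"])
    show "N \<in> extensional {..<n}" using N by (simp add: Gr_def subrep_def)
    show "mk L A \<in> extensional {..<n}" by (rule mk_extensional)
    fix i assume "i \<in> {..<n}"
    then have i: "i < n" by simp
    have "(\<Sum>h\<in>B_at i \<inter> Li i. A h l * coord i h x) = (\<Sum>h\<in>B_at i \<inter> Li i. Ai i h l * coord i h x)" for l x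
      by (intro sum.cong) (auto simp: A_def B_at_iff)
    then show "N i = mk L A i" unfolding Ai(1)[OF i] set_eq_iff mk_iff[OF i] LB LB' by simp
  qed
  moreover have "idx h < idx l" if "(h, l) \<in> ent L A" for h l
  proof -
    have "A h l ~= 0" using that by (simp add: ent_def)
    then show ?thesis using Ai(2)[of "vtx h" h l] by (simp add: A_def)
  qed
  moreover have "L \<in> fixed_index e"
    unfolding fixed_index_def
  proof (intro CollectI conjI ballI allI impI)
    show "L \<subseteq> B" by (auto simp: L_def)
    show "card (B_at i \<inter> L) = e i" if "i < n" for i using dm[OF that] dim_mk[OF that] calculation(1) by simp
    fix h assume h: "h \<in> L" "succ h \<in> B"
    define i where "i = vtx h"
    have i: "i < n" by (simp add: i_def)
    have hi: "h \<in> B_at i" "h \<in> Li i" using h by (simp_all add: L_def i_def B_at_iff)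
    then obtain x where x: "x \<in> N i" "coord i h x ~= 0" "\<And>l. l \<in> B_at i ==> idx l < idx h ==> coord i l x = 0"
      by (auto simp: Li_def)
    have xV: "x \<in> V i" using x(1) sub(2)[OF i] by blast
    have sh: "succ h \<in> B_at (nx i)" by (rule succ_B_at[OF hi(1) h(2)])
    have fx: "f i x \<in> N (nx i)" using x(1) sub(3)[OF i] by blast
    have "coord (nx i) (succ h) (f i x) ~= 0" using coord_f_succ[OF i xV hi(1) h(2)] x(2) by simp
    moreover have "coord (nx i) l (f i x) = 0" if l: "l \<in> B_at (nx i)" "idx l < idx (succ h)" for l
    proof (cases "snd l")
      case 0
      then show ?thesis using coord_f_start[OF i xV, of "fst l"] l(1) by (metis prod.collapse)
    next
      case (Suc p)
      define k where "k = (fst l, p)"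
      have lk: "l = succ k" using Suc by (simp add: k_def prod_eq_iff)
      have k: "k \<in> B_at i" by (rule succ_at_D[OF i]) (use l(1) lk in simp)
      have sk: "succ k \<in> B" using l(1) lk by (simp add: B_at_iff)
      \<comment> \<open>Alignment is needed in contrapositive form: a later \<open>k\<close> would
        have a later successor.\<close>
      have "idx k < idx h"
      proof (rule ccontr)
        assume "\<not> idx k < idx h"
        then consider "idx k = idx h" | "idx h < idx k" by linarith
        then show False
        proof cases
          case 1
          then have "k = h" using inj_onD[OF inj_idx _ k hi(1)] by simp
          then show False using l(2) lk by simp
        next
          case 2
          then show False using align_mono[OF k hi(1) sk h(2)] l(2) lk by simp
        qed
      qed
      then show ?thesis using coord_f_succ[OF i xV k sk] x(3)[OF k] lk by simp
    qed
    ultimately have "succ h \<in> Li (nx i)" using sh fx unfolding Li_def by blast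
    then show "succ h \<in> L" using sh by (simp add: L_def B_at_iff)
  qed
  ultimately show ?thesis by blast
qed

text \<open>At a common level the order of positions is the order of indices, so an entry of an
  echelon matrix gives an inversion of \<open>nu L\<close>.\<close>

lemma ent_levels:
  assumes L: "L \<in> fixed_index e" and hl: "(h, l) \<in> ent L A" "idx h < idx l"
  shows "pos h < pos l" "lev l = lev h" "nu L (pos h) \<le> lev h" "lev h < nu L (pos l)" "fst h ~= fst l"
proof -
  have up: "upclosed L" using L by (simp add: fixed_index_iff)
  have h: "h \<in> B" "h \<in> L" "l \<in> B" "l \<notin> L" "vtx h = vtx l" using hl(1) by (auto simp: ent_def)
  show lv: "lev l = lev h" by (simp add: lev_def h(5))
  show lt: "pos h < pos l" using hl(2) by (simp add: pos_def lv)
  show nh: "nu L (pos h) \<le> lev h" using nu_el[OF up el_pos(1)[OF h(1)]] el_pos(2)[OF h(1)] h(2) by simp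
  show nl: "lev h < nu L (pos l)" using nu_el[OF up el_pos(1)[OF h(3)]] el_pos(2)[OF h(3)] h(4) lv by simp
  have "pos h mod C ~= pos l mod C" by (rule aff.inv_pairs_mod[OF nu_periodic[OF up] lt]) (use nh nl in simp)
  then show "fst h ~= fst l"
    using el_coords(1)[OF el_pos(1)[OF h(1)]] el_coords(1)[OF el_pos(1)[OF h(3)]] el_pos(2)[OF h(1)] el_pos(2)[OF h(3)]
    by (simp add: aff.cls_eq_iff)
qed

lemma fixed_points_eq: "fixed_points e = (\<lambda>L. mk L (\<lambda>_ _. 0)) ` fixed_index e"
proof (intro equalityI subsetI)
  fix N assume N: "N \<in> fixed_points e"
  then have "N \<in> Gr e" by (simp add: fixed_points_def)
  then obtain L A where LA: "L \<in> fixed_index e" "N = mk L A" "\<And>h l. (h, l) \<in> ent L A ==> idx h < idx l"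
    using echelon_form by blast
  have "ent L A = {}"
  proof (rule ccontr)
    assume "ent L A ~= {}"
    then obtain h l where hl: "(h, l) \<in> ent L A" by auto
    have ne: "fst h ~= fst l" by (rule ent_levels(5)[OF LA(1) hl LA(3)[OF hl]])
    \<comment> \<open>Scaling only the summand of \<open>l\<close> separates the weights of the two
      ends of an entry.\<close>
    let ?\<gamma> = "\<lambda>i\<in>{0..d}. if i = fst l then 2 else 1 :: complex"
    have \<gamma>: "?\<gamma> \<in> torus" by (auto simp: torus_def)
    then have "torus_act ?\<gamma> (mk L A) = mk L A" using N LA(2) by (simp add: fixed_points_def)
    then have "tw ?\<gamma> h = tw ?\<gamma> l" using hl unfolding torus_fix_iff[OF \<gamma>] by blast
    moreover have "fst h \<in> {1..d}" "fst l \<in> {1..d}" using hl by (auto simp: ent_def B_def)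
    ultimately show False using ne by (simp add: tw_def case_prod_unfold)
  qed
  then have "A h l = 0" if "h \<in> B \<inter> L" "l \<in> B - L" "vtx h = vtx l" for h l
  proof -
    have "(h, l) \<notin> ent L A" using \<open>ent L A = {}\<close> by simp
    then show ?thesis using that by (simp add: ent_def)
  qed
  then have "mk L A = mk L (\<lambda>_ _. 0)" unfolding mk_eq_iff' by blast
  then show "N \<in> (\<lambda>L. mk L (\<lambda>_ _. 0)) ` fixed_index e" using LA by blast
qed (use mk_0_fixed in blast)

end

section \<open>The edges of the moment graph\<close>

context affine_refl
begin

text \<open>At \<open>a\<close> the value strictly increases, which for the second reflection can
  happen only in the class of \<open>a'\<close>; this identifies the first entries, and then the
  moved value identifies the second ones. Hence distinct edges from a point have distinct other
  ends.\<close>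

lemma comp_refl_determines:
  assumes per: "periodic \<nu>" and p: "(a, b) \<in> inv_pairs \<nu>" "(a', b') \<in> inv_pairs \<nu>"
    and eq: "\<nu> \<circ> refl a b = \<nu> \<circ> refl a' b'"
  shows "(a, b) = (a', b')"
proof -
  have A: "0 \<le> a" "a < C" "a < b" "\<nu> a < \<nu> b" "0 \<le> a'" "a' < C" "a' < b'" "\<nu> a' < \<nu> b'"
    using p by (auto simp: inv_pairs_def)
  have ne: "a mod C ~= b mod C" "a' mod C ~= b' mod C" using inv_pairs_mod[OF per] A by blast+
  have e: "\<nu> (refl a b k) = \<nu> (refl a' b' k)" for k using fun_cong[OF eq, of k] by simp
  have ea: "\<nu> b = \<nu> (refl a' b' a)" and eb: "\<nu> a = \<nu> (refl a' b' b)" using e[of a] e[of b] ne by simp_all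
  have "a mod C = a' mod C"
  proof (rule ccontr)
    assume n: "a mod C ~= a' mod C"
    have "a mod C = b' mod C"
    proof (rule ccontr)
      assume "a mod C ~= b' mod C"
      then have "refl a' b' a = a" using n by (simp add: refl_def)
      then show False using ea A by simp
    qed
    then obtain t where t: "a = b' + t * C" unfolding cong_iff by blast
    have "refl a' b' a = a' + t * C" unfolding t refl_shift using ne by simp
    then show False using ea A periodic_shift[OF per] unfolding t by simp
  qed
  then have aa: "a = a'" using A by simp
  then have "b mod C ~= a' mod C" using ne by simp
  have "b mod C = b' mod C"
  proof (rule ccontr)
    assume "b mod C ~= b' mod C"
    then have "refl a' b' b = b" using \<open>b mod C ~= a' mod C\<close> by (simp add: refl_def)
    then show False using eb A by simp
  qed
  then obtain t where t: "b = b' + t * C" unfolding cong_iff by blast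
  have "\<nu> b = \<nu> b'" using ea aa ne by simp
  then have "t * n = 0" using periodic_shift[OF per, of b' t] t by simp
  then have "t = 0" using n_pos' by simp
  then show ?thesis using aa t by simp
qed

end

context homog_rep
begin

abbreviation fp :: "(nat \<times> nat) set => nat => 'v set" where
  "fp L \<equiv> mk L (\<lambda>_ _. 0)"

text \<open>The map sends the echelon vector over position \<open>a\<close> at level
  \<open>z\<close> into the subrepresentation at the next level. Its coordinate at \<open>b\<close>
  is known directly and also through the graph equation, where only the entry over \<open>a\<close>
  contributes.\<close>

lemma value_step:
  assumes N: "mk L A \<in> Gr e" and L: "L \<in> fixed_index e" and ab: "a < b" "nu L a < nu L b"
    and ents: "\<And>h l. (h, l) \<in> ent L A ==> (h, l) \<in> PP L a b" and z: "nu L a \<le> z" "z + 1 < nu L b"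
  shows "A (el (z + 1) a) (el (z + 1) b) = A (el z a) (el z b)"
proof -
  let ?i = "vx z" and ?l = "el (z + 1) b"
  have i: "?i < n" by simp
  have z': "z < nu L b" "nu L a \<le> z + 1" using z by simp_all
  note p = pair_box[OF L ab z(1) z'(1)]
  note q = pair_box[OF L ab z'(2) z(2)]
  let ?x = "ech L A ?i (el z a)"
  have h: "el z a \<in> B_at ?i \<inter> L" using el_B_at[OF p(1)] p(3) by simp
  have x: "?x \<in> mk L A ?i" by (rule ech_mk[OF i h])
  have xV: "?x \<in> V ?i" using x i by (simp add: mk_iff)
  have fx: "f ?i ?x \<in> mk L A (nx ?i)" using N x i unfolding Gr_def subrep_def by blast
  have cx: "coord ?i \<beta> ?x = (if \<beta> = el z a then 1 else if \<beta> \<in> L then 0 else A (el z a) \<beta>)" if "\<beta> \<in> B_at ?i" for \<beta>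
    using that i by (simp add: ech_def)
  have "el z b ~= el z a" using p(3,4) by auto
  then have "A (el z a) (el z b) = coord (nx ?i) ?l (f ?i ?x)"
    using coord_f_el[OF i refl xV q(2)] p cx[OF el_B_at[OF p(2)]] by simp
  also have "\<dots> = (\<Sum>h\<in>B_at (nx ?i) \<inter> L. A h ?l * coord (nx ?i) h (f ?i ?x))"
    using fx el_B_at[OF q(2)] q(4) unfolding vx_step mk_iff[OF next_less(1)] by blast
  also have "\<dots> = (\<Sum>h\<in>B_at (nx ?i) \<inter> L. if h = el (z + 1) a then A h ?l * coord (nx ?i) h (f ?i ?x) else 0)"
  proof (intro sum.cong refl)
    fix h assume h: "h \<in> B_at (nx ?i) \<inter> L"
    have "A h ?l = 0" if ne: "h ~= el (z + 1) a"
    proof (rule ccontr)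
      assume "A h ?l ~= 0"
      then have "(h, ?l) \<in> ent L A" using h el_B_at[OF q(2)] q(4) by (simp add: ent_def B_at_iff vx_step)
      then have "(h, ?l) \<in> PP L a b" by (rule ents)
      then obtain z1 where z1: "h = el z1 a" "?l = el z1 b" "nu L a \<le> z1" "z1 < nu L b" by (auto simp: PP_def)
      then have "z + 1 = z1" using el_inj_level[OF q(2)] pair_box(2)[OF L ab z1(3,4)] by blast
      then show False using z1 ne by simp
    qed
    then show "A h ?l * coord (nx ?i) h (f ?i ?x) = (if h = el (z + 1) a then A h ?l * coord (nx ?i) h (f ?i ?x) else 0)" by simp
  qed
  also have "\<dots> = A (el (z + 1) a) ?l * coord (nx ?i) (el (z + 1) a) (f ?i ?x)"
    using el_B_at[OF q(1)] q(3) by (simp add: vx_step)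
  also have "coord (nx ?i) (el (z + 1) a) (f ?i ?x) = 1"
    using coord_f_el[OF i refl xV q(1)] p(1) cx[OF el_B_at[OF p(1)]] by simp
  finally show ?thesis by simp
qed

text \<open>A stabiliser of codimension one forces all entries of the echelon matrix to impose one
  equation, hence to join the same two summands with the same shift. They then belong to one family
  \<open>PP L a b\<close>, along which the entry is constant.\<close>

lemma one_dim_orbit_curve:
  assumes "E \<in> one_dim_orbits e"
  shows "\<exists>L\<in>fixed_index e. \<exists>a b. a < b \<and> nu L a < nu L b \<and> E = curve L (PP L a b)"
proof -
  obtain N where N: "N \<in> Gr e" "orbit_dim N = 1" "E = orbit N" using assms by (auto simp: one_dim_orbits_def)
  obtain L A where L: "L \<in> fixed_index e" and NA: "N = mk L A" and ord: "\<And>h l. (h, l) \<in> ent L A ==> idx h < idx l"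
    using echelon_form[OF N(1)] by blast
  have up: "upclosed L" using L by (simp add: fixed_index_iff)
  have dimS: "fs.dim (stab_of d (ent L A)) = d" using N(2) orbit_dim_mk NA by simp
  then have "ent L A ~= {}" using dim_stab_empty[of d] by auto
  then obtain h l where hl: "(h, l) \<in> ent L A" by auto
  define a where "a = pos h"
  define b where "b = pos l"
  note lv = ent_levels[OF L hl ord[OF hl]]
  have hB: "h \<in> B" "l \<in> B" using hl by (auto simp: ent_def)
  have eh: "inbox (lev h) a" "el (lev h) a = h" and el: "inbox (lev h) b" "el (lev h) b = l"
    using el_pos[OF hB(1)] el_pos[OF hB(2)] lv(2) by (simp_all add: a_def b_def)
  have ab: "a < b" "nu L a < nu L b" using lv by (simp_all add: a_def b_def)
  have cls: "cls a = fst h" "cls b = fst l" "off a = int (snd h) - lev h" "off b = int (snd l) - lev h"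
    using el_coords[OF eh(1)] el_coords[OF el(1)] eh(2) el(2) by simp_all
  have sub: "(h1, l1) \<in> PP L a b" if e1: "(h1, l1) \<in> ent L A" for h1 l1
  proof -
    note lv1 = ent_levels[OF L e1 ord[OF e1]]
    have B1: "h1 \<in> B" "l1 \<in> B" "h1 \<in> L" "l1 \<notin> L" using e1 by (auto simp: ent_def)
    have par: "fst h1 = fst h \<and> fst l1 = fst l \<and> shift_of (h1, l1) = shift_of (h, l)"
    proof (rule ccontr)
      assume ne: "\<not> ?thesis"
      \<comment> \<open>A reversed pair would put the position \<open>b\<close> into
        \<open>L\<close> and leave \<open>a\<close> outside at one and the same level, although
        \<open>a\<close> enters earlier.\<close>
      have anti: "\<not> (fst h1 = fst l \<and> fst l1 = fst h \<and> shift_of (h1, l1) = - shift_of (h, l))"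
      proof
        assume r: "fst h1 = fst l \<and> fst l1 = fst h \<and> shift_of (h1, l1) = - shift_of (h, l)"
        let ?z = "int (snd h1) - off b"
        have zb: "inbox ?z b" "el ?z b = h1" using el_of_coords[OF B1(1), of b ?z] r cls by simp_all
        have "int (snd l1) = off a + ?z" using r cls by (simp add: shift_of_def)
        then have za: "inbox ?z a" "el ?z a = l1" using el_of_coords[OF B1(2), of a ?z] r cls by simp_all
        show False using nu_el[OF up za(1)] nu_el[OF up zb(1)] za(2) zb(2) B1(3,4) ab(2) by simp
      qed
      have rng: "fst h \<in> {1..d}" "fst l \<in> {1..d}" "fst h1 \<in> {1..d}" "fst l1 \<in> {1..d}"
        using hB B1(1,2) by (auto simp: B_def)
      have "fs.dim (stab_of d (ent L A)) + 1 \<le> d"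
        by (rule dim_stab_two[OF hl e1 rng(1,2) lv(5) rng(3,4) lv1(5) ne anti])
      then show False using dimS by simp
    qed
    let ?z = "int (snd h1) - off a"
    have za: "inbox ?z a" "el ?z a = h1" using el_of_coords[OF B1(1), of a ?z] par cls by simp_all
    have "int (snd l1) = off b + ?z" using par cls by (simp add: shift_of_def)
    then have zb: "inbox ?z b" "el ?z b = l1" using el_of_coords[OF B1(2), of b ?z] par cls by simp_all
    have "nu L a \<le> ?z" "?z < nu L b" using nu_el[OF up za(1)] nu_el[OF up zb(1)] za zb B1 by auto
    then show ?thesis using PP_I[of L a ?z b] za(2) zb(2) by simp
  qed
  let ?P = "PP L a b"
  \<comment> \<open>The common value of the entries is read off at the first level of the family; it
    is nonzero because the initial entry belongs to the family.\<close>
  define y where "y = A (el (nu L a) a) (el (nu L a) b)"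
  have val: "A (el (nu L a + int m) a) (el (nu L a + int m) b) = y" if "nu L a + int m < nu L b" for m
    using that
  proof (induction m)
    case (Suc m)
    have "A (el (nu L a + int m + 1) a) (el (nu L a + int m + 1) b) = A (el (nu L a + int m) a) (el (nu L a + int m) b)"
      by (rule value_step[OF _ L ab sub]) (use Suc.prems N(1) NA in simp_all)
    moreover have "nu L a + int (Suc m) = nu L a + int m + 1" by simp
    ultimately show ?case using Suc by (simp only:)
  qed (simp add: y_def)
  have valP: "A h l = y" if hl: "(h, l) \<in> ?P" for h l
  proof -
    obtain z where z: "h = el z a" "l = el z b" "nu L a \<le> z" "z < nu L b" using hl by (auto simp: PP_def)
    then show ?thesis using val[of "nat (z - nu L a)"] by simp
  qed
  have "A h l = AP ?P y h l" if "h \<in> B \<inter> L" "l \<in> B - L" "vtx h = vtx l" for h l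
  proof (cases "(h, l) \<in> ?P")
    case False
    then have "(h, l) \<notin> ent L A" using sub by blast
    then show ?thesis using that False by (simp add: ent_def AP_def)
  qed (simp add: valP AP_def)
  then have eqA: "mk L A = mk L (AP ?P y)" unfolding mk_eq_iff' by blast
  have "y ~= 0" using valP[OF sub[OF hl]] hl by (auto simp: ent_def)
  then have "E = curve L ?P" using orbit_matching[OF matching_PP[OF L ab]] N(3) NA eqA by simp
  then show ?thesis using L ab by blast
qed

lemma curve_one_dim:
  assumes L: "L \<in> fixed_index e" and ab: "a < b" "nu L a < nu L b"
  shows "curve L (PP L a b) \<in> one_dim_orbits e"
proof -
  note m = matching_PP[OF L ab]
  have "curve L (PP L a b) = orbit (mk L (AP (PP L a b) 1))" using orbit_matching[OF m, of 1] by simp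
  moreover have "orbit_dim (mk L (AP (PP L a b) 1)) = 1" using orbit_dim_matching[OF m, of 1] by simp
  moreover have "mk L (AP (PP L a b) 1) \<in> Gr e" by (rule family_Gr[OF L ab])
  ultimately show ?thesis unfolding one_dim_orbits_def by blast
qed

lemma fp_Gr: "L \<in> fixed_index e ==> fp L \<in> Gr e"
  using mk_0_fixed by (simp add: fixed_points_def)

lemma fixed_index_B: "L \<in> fixed_index e ==> L \<subseteq> B"
  by (simp add: fixed_index_def)

lemma endpoints_curve:
  assumes L: "L \<in> fixed_index e" and ab: "a < b" "nu L a < nu L b"
  shows "edge_endpoints e (curve L (PP L a b)) = {fp L, fp (setof (nu L \<circ> aff.refl a b))}"
proof -
  let ?L' = "(L - Domain (PP L a b)) \<union> Range (PP L a b)"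
  note m = matching_PP[OF L ab] and Gr = family_Gr[OF L ab] and L' = endpoint_index[OF L ab]
  have "fp L \<in> edge_endpoints e (curve L (PP L a b))"
    using closure_curve_start[OF m Gr] mk_0_fixed[OF L] by (simp add: edge_endpoints_def)
  moreover have "fp ?L' \<in> edge_endpoints e (curve L (PP L a b))"
    using closure_curve_end[OF m Gr fp_Gr[OF L']] mk_0_fixed[OF L'] by (simp add: edge_endpoints_def)
  moreover have "N \<in> {fp L, fp ?L'}" if N: "N \<in> edge_endpoints e (curve L (PP L a b))" for N
  proof -
    obtain K where K: "K \<in> fixed_index e" "N = fp K" using N by (auto simp: edge_endpoints_def fixed_points_eq)
    have "K = L \<or> K = ?L'"
      by (rule closure_curve_only[where e = e, OF m fixed_index_B[OF K(1)]]) (use N K(2) in \<open>simp add: edge_endpoints_def\<close>)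
    then show ?thesis using K(2) by blast
  qed
  ultimately show ?thesis unfolding endpoint_set[OF L ab] by blast
qed

lemma wt_succ: assumes "i < n" shows "\<exists>c. \<forall>\<beta>\<in>B_at i. succ \<beta> \<in> B \<longrightarrow> wt (succ \<beta>) = wt \<beta> + c"
proof -
  obtain c where c: "\<forall>k\<in>{1..dim (V i)}. \<forall>l\<in>{1..dim (V (nx i))}.
      f i (bas (v i k)) = bas (v (nx i) l) \<longrightarrow> wt (v (nx i) l) = wt (v i k) + c"
    using homog assms unfolding homogeneous_def attractive_grading_def by blast
  have "wt (succ \<beta>) = wt \<beta> + c" if \<beta>: "\<beta> \<in> B_at i" "succ \<beta> \<in> B" for \<beta>
  proof -
    have s: "succ \<beta> \<in> B_at (nx i)" by (rule succ_B_at[OF \<beta>])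
    have "idx \<beta> \<in> {1..dim (V i)}" "idx (succ \<beta>) \<in> {1..dim (V (nx i))}"
      using idx_range[OF \<beta>(1)] idx_range[OF s] assms by (simp_all add: dim_V)
    moreover have "f i (bas (v i (idx \<beta>))) = bas (v (nx i) (idx (succ \<beta>)))"
      using f_bas_iff[OF \<beta>(1)] \<beta>(2) v_idx[OF \<beta>(1)] v_idx[OF s] by simp
    ultimately show ?thesis using c v_idx[OF \<beta>(1)] v_idx[OF s] by metis
  qed
  then show ?thesis by blast
qed

lemma wt_mono: assumes "\<beta> \<in> B_at i" "\<beta>' \<in> B_at i" "idx \<beta> < idx \<beta>'" shows "wt \<beta> < wt \<beta>'"
proof -
  have i: "i < n" by (rule B_at_less[OF assms(1)])
  have "idx \<beta> \<in> {1..dim (V i)}" "idx \<beta>' \<in> {1..dim (V i)}"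
    using idx_range[OF assms(1)] idx_range[OF assms(2)] i by (simp_all add: dim_V)
  then have "wt (v i (idx \<beta>)) < wt (v i (idx \<beta>'))"
    using homog assms(3) i unfolding homogeneous_def attractive_grading_def by blast
  then show ?thesis using v_idx[OF assms(1)] v_idx[OF assms(2)] by simp
qed

text \<open>Both members of a pair gain the same amount of grading at each step, so the difference
  is constant along the family; it is positive because the grading increases with the index.\<close>

lemma wt_diff:
  assumes L: "L \<in> fixed_index e" and ab: "a < b" "nu L a < nu L b"
  obtains w where "w > 0" "\<And>h l. (h, l) \<in> PP L a b ==> wt l - wt h = w"
proof
  define D where "D z = wt (el z b) - wt (el z a)" for z
  have st: "D (z + 1) = D z" if "nu L a \<le> z" "z + 1 < nu L b" for z
  proof -
    have z': "z < nu L b" "nu L a \<le> z + 1" using that by simp_all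
    note p = pair_box[OF L ab that(1) z'(1)]
    note q = pair_box[OF L ab z'(2) that(2)]
    obtain c where c: "\<forall>\<beta>\<in>B_at (vx z). succ \<beta> \<in> B \<longrightarrow> wt (succ \<beta>) = wt \<beta> + c" using wt_succ[OF vx_less] by blast
    have "wt (el (z + 1) k) = wt (el z k) + c" if "inbox z k" "inbox (z + 1) k" for k
      using c el_B_at[OF that(1)] el_step[OF that(1)] that(2) by metis
    then show ?thesis using p q by (simp add: D_def)
  qed
  have D: "D (nu L a + int m) = D (nu L a)" if "nu L a + int m < nu L b" for m
    using that
  proof (induction m)
    case (Suc m)
    have "D (nu L a + int m + 1) = D (nu L a + int m)" by (rule st) (use Suc.prems in simp_all)
    moreover have "nu L a + int (Suc m) = nu L a + int m + 1" by simp
    ultimately show ?case using Suc by (simp only:)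
  qed simp
  show "D (nu L a) > 0"
  proof -
    note p = pair_box[OF L ab order_refl ab(2)]
    have "idx (el (nu L a) a) < idx (el (nu L a) b)" using idx_el[OF p(1)] idx_el[OF p(2)] ab(1) by linarith
    then show ?thesis using wt_mono[OF el_B_at[OF p(1)] el_B_at[OF p(2)]] by (simp add: D_def)
  qed
  fix h l assume "(h, l) \<in> PP L a b"
  then obtain z where z: "h = el z a" "l = el z b" "nu L a \<le> z" "z < nu L b" by (auto simp: PP_def)
  then show "wt l - wt h = D (nu L a)" using D[of "nat (z - nu L a)"] by (simp add: D_def)
qed

text \<open>The cocharacter multiplies the parameter by a positive power of \<open>z\<close>, so the
  limit at zero is \<open>fp L\<close>. Diagonal entries of the projection matrices separate fixed
  points, which makes the starting point unique.\<close>

lemma edge_starts_curve: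
  assumes ind: "induces_grading e \<kappa> wt" and L: "L \<in> fixed_index e" and ab: "a < b" "nu L a < nu L b"
    and K: "K \<in> fixed_index e"
  shows "edge_starts_at e \<kappa> (curve L (PP L a b)) (fp K) \<longleftrightarrow> K = L"
proof -
  let ?P = "PP L a b"
  note m = matching_PP[OF L ab] and Gr = family_Gr[OF L ab]
  obtain w where w: "w > 0" "\<And>h l. (h, l) \<in> ?P ==> wt l - wt h = w" using wt_diff[OF L ab] by blast
  have act: "torus_act (cochar \<kappa> z) (mk L (AP ?P y)) = mk L (AP ?P (y * z powi w))" if z: "z ~= 0" for z y
  proof -
    have "torus_act (cochar \<kappa> z) (mk L (AP ?P y)) = diag_act (\<lambda>\<beta>. z powi wt \<beta>) (mk L (AP ?P y))"
      using ind Gr z by (simp add: induces_grading_def)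
    also have "\<dots> = mk L (\<lambda>h l. AP ?P y h l * (z powi wt l / z powi wt h))" by (rule diag_act_mk) (use z in simp)
    also have "(\<lambda>h l. AP ?P y h l * (z powi wt l / z powi wt h)) = AP ?P (y * z powi w)"
    proof (intro ext)
      fix h l
      show "AP ?P y h l * (z powi wt l / z powi wt h) = AP ?P (y * z powi w) h l"
        using w(2)[of h l] power_int_diff[of z "wt l" "wt h"] z by (auto simp: AP_def)
    qed
    finally show ?thesis .
  qed
  have lim: "limitin (Gr_top e) (\<lambda>z. torus_act (cochar \<kappa> z) N) (fp L) (at 0)" if N: "N \<in> curve L ?P" for N
  proof -
    obtain y where y: "N = mk L (AP ?P y)" using N by (auto simp: curve_def)
    obtain k where k: "w = int k" "k > 0" using w(1) by (metis zero_less_imp_eq_int)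
    have "((\<lambda>z::complex. y * z ^ k) \<longlongrightarrow> y * 0 ^ k) (at 0)" by (intro tendsto_intros)
    moreover have "y * 0 ^ k = 0" using k(2) by simp
    ultimately have "((\<lambda>z::complex. y * z powi w) \<longlongrightarrow> 0) (at 0)"
      unfolding k(1) power_int_of_nat by (simp only:)
    then have l: "limitin (Gr_top e) (\<lambda>z. mk L (AP ?P (y * z powi w))) (fp L) (at 0)"
      by (intro limit_matching[OF m fp_Gr[OF L]]) (simp_all add: Gr)
    show ?thesis by (rule limitin_transform_eventually[OF _ l]) (auto simp: eventually_at_filter act y)
  qed
  show ?thesis
  proof
    assume "K = L"
    moreover have "fp L \<in> edge_endpoints e (curve L ?P)" by (simp add: endpoints_curve[OF L ab])
    ultimately show "edge_starts_at e \<kappa> (curve L ?P) (fp K)" using lim by (simp add: edge_starts_at_def)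
  next
    assume st: "edge_starts_at e \<kappa> (curve L ?P) (fp K)"
    have N1: "mk L (AP ?P 1) \<in> curve L ?P" by (force simp: curve_def)
    then have lK: "limitin (Gr_top e) (\<lambda>z. torus_act (cochar \<kappa> z) (mk L (AP ?P 1))) (fp K) (at 0)"
      using st by (simp add: edge_starts_at_def)
    have "\<beta> \<in> K \<longleftrightarrow> \<beta> \<in> L" if \<beta>: "\<beta> \<in> B" for \<beta>
    proof -
      have "proj_matrix (fp K) (vtx \<beta>) \<beta> \<beta> = proj_matrix (fp L) (vtx \<beta>) \<beta> \<beta>"
        by (rule tendsto_unique[OF _ limitin_GrD[OF lK] limitin_GrD[OF lim[OF N1]]]) simp
      then show ?thesis using proj_matrix_mk_0[of "vtx \<beta>" \<beta> \<beta>] \<beta> by (simp add: B_at_iff split: if_splits)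
    qed
    then show "K = L" using fixed_index_B[OF K] fixed_index_B[OF L] by blast
  qed
qed

lemma out_edges_eq:
  assumes ind: "induces_grading e \<kappa> wt" and L: "L \<in> fixed_index e"
  shows "out_edges e \<kappa> (fp L) = (\<lambda>(a, b). Gr_top e closure_of curve L (PP L a b)) ` aff.inv_pairs (nu L)"
proof (intro equalityI subsetI)
  have up: "upclosed L" using L by (simp add: fixed_index_iff)
  fix Z assume "Z \<in> out_edges e \<kappa> (fp L)"
  then obtain E where E: "E \<in> one_dim_orbits e" "edge_starts_at e \<kappa> E (fp L)" "Z = Gr_top e closure_of E"
    by (auto simp: out_edges_def)
  obtain L1 a b where c: "L1 \<in> fixed_index e" "a < b" "nu L1 a < nu L1 b" "E = curve L1 (PP L1 a b)"
    using one_dim_orbit_curve[OF E(1)] by blast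
  have LL: "L1 = L" using edge_starts_curve[OF ind c(1-3) L] E(2) c(4) by simp
  \<comment> \<open>Translation by this multiple of \<open>C\<close> moves the first position into
    \<open>[0, C)\<close> without changing the curve.\<close>
  define t where "t = - (a div C)"
  have "a + t * C = a mod C" unfolding t_def using minus_div_mult_eq_mod[of a C] by simp
  then have "0 \<le> a + t * C" "a + t * C < C" using C_positive by simp_all
  then have "(a + t * C, b + t * C) \<in> aff.inv_pairs (nu L)"
    using c(2,3) unfolding LL by (simp add: aff.inv_pairs_def aff.periodic_shift[OF nu_periodic[OF up]])
  moreover have "Z = Gr_top e closure_of curve L (PP L (a + t * C) (b + t * C))"
    unfolding PP_translate[OF up] using E(3) c(4) LL by simp
  ultimately show "Z \<in> (\<lambda>(a, b). Gr_top e closure_of curve L (PP L a b)) ` aff.inv_pairs (nu L)" by force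
next
  fix Z assume "Z \<in> (\<lambda>(a, b). Gr_top e closure_of curve L (PP L a b)) ` aff.inv_pairs (nu L)"
  then obtain a b where "(a, b) \<in> aff.inv_pairs (nu L)" and Z: "Z = Gr_top e closure_of curve L (PP L a b)" by auto
  then have ab: "a < b" "nu L a < nu L b" by (auto simp: aff.inv_pairs_def)
  show "Z \<in> out_edges e \<kappa> (fp L)"
    unfolding out_edges_def using curve_one_dim[OF L ab] edge_starts_curve[OF ind L ab L] Z by blast
qed

lemma fp_inj: "L \<in> fixed_index e ==> K \<in> fixed_index e ==> fp L = fp K \<longleftrightarrow> L = K"
  by (rule mk_0_eq_iff) (auto dest: fixed_index_B)

lemma hat_nu: "L \<in> fixed_index e ==> nu L \<in> hat e"
  by (simp add: hat_def)

lemma nu_setof_hat: "K \<in> hat e ==> nu (setof K) = K"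
  by (simp add: hat_iff nu_setof)

text \<open>Edges are closures of orbits. Equal closures have equal endpoints, and the endpoint
  other than \<open>fp L\<close> recovers the inversion.\<close>

lemma card_out_edges:
  assumes ind: "induces_grading e \<kappa> wt" and L: "L \<in> fixed_index e"
  shows "card (out_edges e \<kappa> (fp L)) = card (aff.inv_pairs (nu L))"
  unfolding out_edges_eq[OF assms]
proof (rule card_image, rule inj_onI)
  fix q q' assume q: "q \<in> aff.inv_pairs (nu L)" "q' \<in> aff.inv_pairs (nu L)"
    and eq: "(\<lambda>(a, b). Gr_top e closure_of curve L (PP L a b)) q = (\<lambda>(a, b). Gr_top e closure_of curve L (PP L a b)) q'"
  obtain a b a' b' where qq: "q = (a, b)" "q' = (a', b')" by fastforce
  have ab: "a < b" "nu L a < nu L b" and ab': "a' < b'" "nu L a' < nu L b'"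
    using q qq by (auto simp: aff.inv_pairs_def)
  have per: "aff.periodic (nu L)" using hat_periodic[OF hat_nu[OF L]] .
  have H: "nu L \<circ> aff.refl a b \<in> hat e" "nu L \<circ> aff.refl a' b' \<in> hat e"
    using hat_refl[OF hat_nu[OF L]] ab ab' by blast+
  have ne: "fp (setof (nu L \<circ> aff.refl a b)) ~= fp L" if ab: "a < b" "nu L a < nu L b" and H: "nu L \<circ> aff.refl a b \<in> hat e" for a b
  proof
    assume "fp (setof (nu L \<circ> aff.refl a b)) = fp L"
    then have "nu L \<circ> aff.refl a b = nu L" using fp_inj[OF setof_hat[OF H] L] nu_setof_hat[OF H] by simp
    then have "nu L (aff.refl a b a) = nu L a" by (metis comp_apply)
    then show False using aff.inv_pairs_mod[OF per ab] ab by simp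
  qed
  have "edge_endpoints e (curve L (PP L a b)) = edge_endpoints e (curve L (PP L a' b'))"
    using eq by (simp add: edge_endpoints_def qq)
  then have "fp (setof (nu L \<circ> aff.refl a b)) = fp (setof (nu L \<circ> aff.refl a' b'))"
    unfolding endpoints_curve[OF L ab] endpoints_curve[OF L ab'] using ne[OF ab H(1)] ne[OF ab' H(2)] by blast
  then have "nu L \<circ> aff.refl a b = nu L \<circ> aff.refl a' b'"
    using fp_inj[OF setof_hat[OF H(1)] setof_hat[OF H(2)]] nu_setof_hat[OF H(1)] nu_setof_hat[OF H(2)] by metis
  then show "q = q'" using aff.comp_refl_determines[OF per] q qq by blast
qed

end

section \<open>The structure algebra of the quiver Grassmannian\<close>

context affine_weights
begin

lemma comp_refl_fixed: assumes per: "periodic x" and eq: "x a = x b" shows "x \<circ> refl a b = x"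
proof
  fix k
  show "(x \<circ> refl a b) k = x k"
  proof (cases "a mod C = b mod C")
    case False
    consider t where "k = a + t * C" | t where "k = b + t * C" | "k mod C ~= a mod C" "k mod C ~= b mod C"
      unfolding cong_iff by blast
    then show ?thesis
    proof cases
      case 1 then show ?thesis using False eq by (simp add: refl_shift periodic_shift[OF per])
    next
      case 2 then show ?thesis using False eq by (simp add: refl_shift periodic_shift[OF per])
    next
      case 3 then show ?thesis by (simp add: refl_def)
    qed
  qed (simp add: refl_def)
qed

text \<open>Each edge needs to be examined only from its larger end; from the smaller end the
  difference changes sign, and equal values give a loop.\<close>

lemma gkm_ascents:
  assumes per: "\<And>x. x \<in> D ==> periodic x"
    and asc: "\<And>x a b. x \<in> D ==> a < b ==> x a < x b ==> x \<circ> refl a b \<in> D ==>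
      \<omega> a - \<omega> b dvd f x - f (x \<circ> refl a b)"
  shows "gkm D f"
proof -
  have one: "\<omega> a - \<omega> b dvd f x - f (x \<circ> refl a b)"
    if x: "x \<in> D" "x \<circ> refl a b \<in> D" and ab: "a mod C ~= b mod C" "a < b" for x a b
  proof -
    consider "x a < x b" | "x a = x b" | "x b < x a" by linarith
    then show ?thesis
    proof cases
      case 1 then show ?thesis by (rule asc[OF x(1) ab(2) _ x(2)])
    next
      case 2 then show ?thesis using comp_refl_fixed[OF per[OF x(1)]] by simp
    next
      case 3
      let ?y = "x \<circ> refl a b"
      have y: "?y \<circ> refl a b = x" by (simp add: comp_assoc)
      have "?y a < ?y b" using 3 ab by simp
      then have "\<omega> a - \<omega> b dvd f ?y - f x" using asc[OF x(2) ab(2)] x(1) unfolding y by blast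
      moreover have "f x - f ?y = - (f ?y - f x)" by simp
      ultimately show ?thesis by (simp only: dvd_minus_iff)
    qed
  qed
  show ?thesis
    unfolding gkm_def
  proof (intro ballI allI impI)
    fix x a b assume x: "x \<in> D" "a mod C ~= b mod C" "x \<circ> refl a b \<in> D"
    show "\<omega> a - \<omega> b dvd f x - f (x \<circ> refl a b)"
    proof (cases "a < b")
      case True then show ?thesis using one x by blast
    next
      case False
      then have "b < a" using x(2) by (cases "a = b") auto
      then have "\<omega> b - \<omega> a dvd f x - f (x \<circ> refl a b)" using one[of x b a] x by (simp add: refl_commute[of b a])
      then show ?thesis using minus_dvd_iff[of "\<omega> b - \<omega> a"] by simp
    qed
  qed
qed

end

lemma homog_of_int [simp]: "homog 0 (of_int z)"
  using homog_const[of "of_int z"] by simp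

context affine_poly
begin

lemma homog_root: "homog 1 (\<omega> a - \<omega> b)"
proof -
  have "homog 1 (\<omega> k)" for k
  proof -
    have "homog (0 + 1) (of_int (off k) * var 0)" by (rule homog_mult[OF homog_of_int homog_var])
    then show ?thesis unfolding \<omega>_def by (intro homog_add homog_var) simp
  qed
  then show ?thesis by (intro homog_diff)
qed

end

context homog_rep
begin

section \<open>Edge conditions as congruences modulo roots\<close>

definition pt :: "(int => int) => nat => 'v set" where
  "pt K = fp (setof K)"

lemma pt_nu: "L \<in> fixed_index e ==> pt (nu L) = fp L"
  by (simp add: pt_def setof_nu fixed_index_iff)

lemma pt_bij: "bij_betw pt (hat e) (fixed_points e)"
  unfolding bij_betw_def
proof
  show "inj_on pt (hat e)"
  proof (rule inj_onI)
    fix K K' assume K: "K \<in> hat e" "K' \<in> hat e" "pt K = pt K'"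
    then have "setof K = setof K'" using fp_inj[OF setof_hat setof_hat] by (simp add: pt_def)
    then show "K = K'" using nu_setof_hat K by metis
  qed
  have "pt ` hat e = (\<lambda>L. pt (nu L)) ` fixed_index e" by (auto simp: hat_def)
  also have "\<dots> = fixed_points e" unfolding fixed_points_eq by (intro image_cong) (simp_all add: pt_nu)
  finally show "pt ` hat e = fixed_points e" .
qed

lemma pt_fixed: "K \<in> hat e ==> pt K \<in> fixed_points e"
  using bij_betw_apply[OF pt_bij] .

lemma finite_fixed_points: "finite (fixed_points e)"
  by (simp add: fixed_points_eq finite_fixed_index)

text \<open>For an actual edge both positions belong to summands, since \<open>pair_box\<close>
  finds basis vectors of \<open>M\<close> there. Hence the label involves no auxiliary
  variable.\<close>

lemma root_range:
  assumes "K \<in> hat e" "a < b" "K a < K b"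
  shows "cls a \<in> {1..d}" "cls b \<in> {1..d}" "vars_le d (aff.\<omega> a - aff.\<omega> b)"
proof -
  have L: "setof K \<in> fixed_index e" "nu (setof K) = K" using assms(1) by (simp_all add: setof_hat nu_setof_hat)
  have lt: "nu (setof K) a < nu (setof K) b" using assms(3) L(2) by simp
  show c: "cls a \<in> {1..d}" "cls b \<in> {1..d}" using cls_range[OF L(1) assms(2) lt] by blast+
  then show "vars_le d (aff.\<omega> a - aff.\<omega> b)"
    unfolding aff.\<omega>_def by (intro vars_le_diff vars_le_add vars_le_mult) auto
qed

lemma char_class_lab:
  assumes "j \<in> {1..d}" "j' \<in> {1..d}" "j ~= j'"
  shows "char_class (lab j j' u) = var j' - var j + of_int u * var 0"
proof -
  have "char_class (lab j j' u) = (\<Sum>i\<in>{0, j, j'}. of_int (lab j j' u i) * var i)"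
    unfolding char_class_def by (rule sum.mono_neutral_right) (use assms in \<open>auto simp: lab_def\<close>)
  then show ?thesis using assms by (simp add: lab_def)
qed

lemma char_class_edge:
  assumes "L \<in> fixed_index e" "a < b" "nu L a < nu L b"
  shows "char_class (lab (cls a) (cls b) (off b - off a)) = aff.\<omega> b - aff.\<omega> a"
  by (simp add: char_class_lab[OF cls_range[OF assms] ab_cls[OF assms]] aff.\<omega>_diff)

lemma edge_conditions_gkm:
  assumes "\<forall>E\<in>one_dim_orbits e. \<forall>\<alpha>. edge_label E \<alpha> \<longrightarrow>
       (\<forall>x\<in>edge_endpoints e E. \<forall>y\<in>edge_endpoints e E. \<exists>r\<in>carrier (R_ring d). g x - g y = char_class \<alpha> * r)"
  shows "aff.gkm (hat e) (\<lambda>K. g (pt K))"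
proof (rule aff.gkm_ascents[OF hat_periodic])
  fix x a b assume x: "x \<in> hat e" and ab: "a < b" "x a < x b"
  define L where "L = setof x"
  have L: "L \<in> fixed_index e" "nu L = x" using x by (simp_all add: L_def setof_hat nu_setof_hat)
  have lt: "nu L a < nu L b" using ab L by simp
  have lb: "edge_label (curve L (PP L a b)) (lab (cls a) (cls b) (off b - off a))"
    by (rule edge_label_matching[OF matching_PP[OF L(1) ab(1) lt]])
  have "fp L \<in> edge_endpoints e (curve L (PP L a b))" "pt (x \<circ> aff.refl a b) \<in> edge_endpoints e (curve L (PP L a b))"
    unfolding endpoints_curve[OF L(1) ab(1) lt] by (simp_all add: pt_def L(2))
  then obtain r where "g (fp L) - g (pt (x \<circ> aff.refl a b)) = (aff.\<omega> b - aff.\<omega> a) * r"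
    using assms curve_one_dim[OF L(1) ab(1) lt] lb unfolding char_class_edge[OF L(1) ab(1) lt, symmetric] by blast
  moreover have "fp L = pt x" by (simp add: pt_def L_def)
  ultimately have "g (pt x) - g (pt (x \<circ> aff.refl a b)) = (aff.\<omega> a - aff.\<omega> b) * (- r)" by (simp add: algebra_simps)
  then show "aff.\<omega> a - aff.\<omega> b dvd g (pt x) - g (pt (x \<circ> aff.refl a b))" by (rule dvdI)
qed

text \<open>An admissible label is a nonzero integer multiple of the root, and the integer is
  invertible over the rationals.\<close>

lemma gkm_edge_conditions:
  assumes gkm: "aff.gkm (hat e) (\<lambda>K. g (pt K))" and vars: "\<And>M. M \<in> fixed_points e ==> vars_le d (g M)"
    and E: "E \<in> one_dim_orbits e" and lb: "edge_label E \<alpha>"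
    and xy: "x \<in> edge_endpoints e E" "y \<in> edge_endpoints e E"
  shows "\<exists>r\<in>carrier (R_ring d). g x - g y = char_class \<alpha> * r"
proof -
  obtain L a b where L: "L \<in> fixed_index e" and ab: "a < b" "nu L a < nu L b" and EL: "E = curve L (PP L a b)"
    using one_dim_orbit_curve[OF E] by blast
  let ?lab = "lab (cls a) (cls b) (off b - off a)"
  let ?D = "aff.\<omega> b - aff.\<omega> a"
  let ?K = "nu L \<circ> aff.refl a b"
  obtain z where z: "z ~= 0" "\<forall>i\<in>{0..d}. \<alpha> i = z * ?lab i"
    using edge_label_unique[OF matching_PP[OF L ab]] lb unfolding EL by blast
  have "char_class \<alpha> = (\<Sum>i\<in>{0..d}. of_int z * (of_int (?lab i) * var i))"
    unfolding char_class_def by (intro sum.cong) (simp_all add: z(2) mult.assoc)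
  also have "\<dots> = of_int z * ?D" unfolding char_class_edge[OF L ab, symmetric] by (simp add: char_class_def sum_distrib_left)
  finally have cc: "char_class \<alpha> = of_int z * ?D" .
  have H: "nu L \<in> hat e" "?K \<in> hat e" using hat_nu[OF L] hat_refl[OF hat_nu[OF L] ab] by simp_all
  have Dv: "vars_le d ?D" using root_range(3)[OF H(1) ab] vars_le_uminus[of d ?D] by simp
  obtain q0 where q0: "g (fp L) - g (pt ?K) = (aff.\<omega> a - aff.\<omega> b) * q0"
    using aff.gkmD[OF gkm H(1) ab_mod[OF L ab] H(2)] by (auto simp: pt_nu[OF L] elim: dvdE)
  \<comment> \<open>The quotient is first known only in the larger ring; the other members of the
    equation lie in R, so truncation brings it there.\<close>
  define q where "q = truncate d (- q0)"
  have "vars_le d (g (fp L) - g (pt ?K))"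
    using vars pt_fixed[OF H(1)] pt_fixed[OF H(2)] pt_nu[OF L] by (metis vars_le_diff)
  then have "g (fp L) - g (pt ?K) = truncate d (g (fp L) - g (pt ?K))" by simp
  also have "\<dots> = truncate d (?D * (- q0))" unfolding q0 by (simp add: algebra_simps)
  also have "\<dots> = ?D * q" unfolding truncate_mult q_def using Dv by simp
  finally have gq: "g (fp L) - g (pt ?K) = ?D * q" .
  define c :: poly_R where "c = Poly_Mapping.single 0 (1 / of_int z)"
  have "of_int z = (Poly_Mapping.single 0 (of_int z) :: poly_R)" by simp
  then have zc: "of_int z * c = 1" using z(1) unfolding c_def by (simp only: mult_single) simp
  have "char_class \<alpha> * (c * q) = (of_int z * c) * (?D * q)" unfolding cc by (simp only: ac_simps)
  also have "\<dots> = ?D * q" unfolding zc by (rule mult_1)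
  also have "\<dots> = g (fp L) - g (pt ?K)" by (rule gq[symmetric])
  finally have e: "g (fp L) - g (pt ?K) = char_class \<alpha> * (c * q)" by (rule sym)
  have v: "vars_le d (c * q)" unfolding c_def q_def by (intro vars_le_mult) simp_all
  have "x \<in> {fp L, pt ?K}" "y \<in> {fp L, pt ?K}" using xy unfolding EL endpoints_curve[OF L ab] by (simp_all add: pt_def)
  then consider "x = y" | "x = fp L" "y = pt ?K" | "x = pt ?K" "y = fp L" by blast
  then show ?thesis
  proof cases
    case 1 then show ?thesis by (intro bexI[of _ 0]) (simp_all add: carrier_R_ring)
  next
    case 2 show ?thesis unfolding 2 carrier_R_ring using e v by blast
  next
    case 3
    have "g x - g y = char_class \<alpha> * (- (c * q))" using e 3 by (metis minus_diff_eq mult_minus_right)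
    then show ?thesis using v by (intro bexI[of _ "- (c * q)"]) (simp_all add: carrier_R_ring)
  qed
qed

lemma HT_carrier_iff:
  "g \<in> HT_carrier e \<longleftrightarrow> g \<in> extensional (fixed_points e) \<and> (\<forall>M\<in>fixed_points e. vars_le d (g M)) \<and>
    aff.gkm (hat e) (\<lambda>K. g (pt K))"
proof -
  have "finite {i \<in> fixed_points e. g i ~= 0}" using finite_fixed_points[of e] by simp
  then have base: "g \<in> carrier (direct_sum (fixed_points e) (\<lambda>_. Triv d 0)) \<longleftrightarrow>
      g \<in> extensional (fixed_points e) \<and> (\<forall>M\<in>fixed_points e. vars_le d (g M))"
    by (auto simp: direct_sum_def Triv_def carrier_R_ring PiE_iff)
  show ?thesis
  proof
    assume "g \<in> HT_carrier e"
    then show "g \<in> extensional (fixed_points e) \<and> (\<forall>M\<in>fixed_points e. vars_le d (g M)) \<and>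
        aff.gkm (hat e) (\<lambda>K. g (pt K))"
      unfolding HT_carrier_def mem_Collect_eq base using edge_conditions_gkm by blast
  next
    assume "g \<in> extensional (fixed_points e) \<and> (\<forall>M\<in>fixed_points e. vars_le d (g M)) \<and>
        aff.gkm (hat e) (\<lambda>K. g (pt K))"
    then show "g \<in> HT_carrier e"
      unfolding HT_carrier_def mem_Collect_eq base using gkm_edge_conditions by blast
  qed
qed

text \<open>Additivity of \<open>T\<close> and compatibility with the labels of actual edges
  suffice; truncation and homogeneous components are the two applications.\<close>

lemma gkm_map:
  assumes h: "aff.gkm (hat e) h" and diff: "\<And>x y. T (x - y) = T x - T y"
    and T: "\<And>K a b q. K \<in> hat e ==> a < b ==> K a < K b ==> aff.\<omega> a - aff.\<omega> b dvd T ((aff.\<omega> a - aff.\<omega> b) * q)"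
  shows "aff.gkm (hat e) (\<lambda>K. T (h K))"
proof (rule aff.gkm_ascents[OF hat_periodic])
  fix x a b assume x: "x \<in> hat e" "a < b" "x a < x b" "x \<circ> aff.refl a b \<in> hat e"
  have "a mod C ~= b mod C" by (rule aff.inv_pairs_mod[OF hat_periodic[OF x(1)] x(2,3)])
  then obtain q where "h x - h (x \<circ> aff.refl a b) = (aff.\<omega> a - aff.\<omega> b) * q"
    using aff.gkmD[OF h x(1) _ x(4)] by (auto elim: dvdE)
  then show "aff.\<omega> a - aff.\<omega> b dvd T (h x) - T (h (x \<circ> aff.refl a b))"
    using T[OF x(1-3), of q] by (simp flip: diff)
qed

lemma gkm_truncate: assumes "aff.gkm (hat e) h" shows "aff.gkm (hat e) (\<lambda>K. truncate d (h K))"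
proof (rule gkm_map[OF assms truncate_diff])
  fix K a b q assume "K \<in> hat e" "a < b" "K a < K b"
  then have "vars_le d (aff.\<omega> a - aff.\<omega> b)" by (rule root_range(3))
  then show "aff.\<omega> a - aff.\<omega> b dvd truncate d ((aff.\<omega> a - aff.\<omega> b) * q)" by (simp add: truncate_mult)
qed

lemma gkm_hcomp: assumes "aff.gkm (hat e) h" shows "aff.gkm (hat e) (\<lambda>K. hcomp k (h K))"
proof (rule gkm_map[OF assms hcomp_diff])
  fix K a b q
  show "aff.\<omega> a - aff.\<omega> b dvd hcomp k ((aff.\<omega> a - aff.\<omega> b) * q)"
  proof (cases k)
    case 0
    then show ?thesis using hcomp_mult_low[OF aff.homog_root, of 0 a b q] by simp
  next
    case (Suc l)
    then have "hcomp k ((aff.\<omega> a - aff.\<omega> b) * q) = (aff.\<omega> a - aff.\<omega> b) * hcomp l q"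
      using hcomp_mult[OF aff.homog_root, of l a b q] by simp
    then show ?thesis by simp
  qed
qed

lemma down_hat: "K \<in> hat e ==> aff.down K \<subseteq> hat e"
  by (auto simp: aff.down_def intro: hat_down)

lemma euler_hat:
  assumes "K \<in> hat e"
  shows "vars_le d (aff.euler K)" "homog (card (aff.inv_pairs K)) (aff.euler K)"
proof -
  show "vars_le d (aff.euler K)"
    unfolding aff.euler_def
    by (rule vars_le_prod) (use root_range(3)[OF assms] in \<open>auto simp: aff.inv_pairs_def\<close>)
  have "homog (\<Sum>q\<in>aff.inv_pairs K. 1) (\<Prod>q\<in>aff.inv_pairs K. case q of (a, b) => aff.\<omega> a - aff.\<omega> b)"
    by (rule homog_prod) (auto simp: aff.finite_inv_pairs[OF hat_periodic[OF assms]] aff.homog_root[unfolded One_nat_def])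
  then show "homog (card (aff.inv_pairs K)) (aff.euler K)" by (simp add: aff.euler_def)
qed

text \<open>Truncation and passage to one homogeneous component preserve sections, and neither
  alters the value at \<open>K\<close>, because the Euler class is homogeneous and lies in
  R.\<close>

lemma homogeneous_class_exists:
  assumes K: "K \<in> hat e"
  shows "\<exists>p. aff.gkm (hat e) p \<and> (\<forall>x. vars_le d (p x) \<and> homog (card (aff.inv_pairs K)) (p x)) \<and>
    p K = aff.euler K \<and> (\<forall>x\<in>hat e. \<not> aff.below K x \<longrightarrow> p x = 0)"
proof -
  obtain p where p: "aff.gkm (hat e) p" "p K = aff.euler K" "\<forall>x\<in>hat e. \<not> aff.below K x \<longrightarrow> p x = 0"
  proof -
    have "\<exists>p. aff.gkm (hat e) p \<and> p K = aff.euler K \<and> (\<forall>x\<in>hat e. \<not> aff.below K x \<longrightarrow> p x = 0)"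
      by (rule aff.gkm_class_exists[OF finite_hat _ _ K]) (erule hat_periodic, erule down_hat)
    then show ?thesis using that by blast
  qed
  let ?p = "\<lambda>x. hcomp (card (aff.inv_pairs K)) (truncate d (p x))"
  have "?p K = aff.euler K" using p(2) euler_hat[OF K] by (simp add: hcomp_homog)
  then show ?thesis
    using gkm_hcomp[OF gkm_truncate[OF p(1)]] p(3) by (intro exI[of _ ?p]) (simp add: vars_le_hcomp)
qed

section \<open>The action of the symmetric group\<close>

lemma coord_summand:
  assumes s: "s < n" and j: "j \<in> {1..d}" and x: "x \<in> summand j s"
  shows "x \<in> V s" "\<And>\<beta>. \<beta> \<in> B_at s ==> coord s \<beta> x ~= 0 ==> fst \<beta> = j"
proof -
  let ?S = "{x \<in> V s. \<forall>\<beta>\<in>B_at s. fst \<beta> ~= j \<longrightarrow> coord s \<beta> x = 0}"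
  let ?G = "{bas (j, p) | p. p < len j \<and> (src j + p) mod n = s}"
  have gB: "(j, p) \<in> B_at s" if "p < len j" "(src j + p) mod n = s" for p using that j by (simp add: basis_at_def)
  have "?G \<subseteq> ?S"
  proof
    fix x assume "x \<in> ?G"
    then obtain p where p: "x = bas (j, p)" "p < len j" "(src j + p) mod n = s" by blast
    have m: "(j, p) \<in> B_at s" by (rule gB[OF p(2,3)])
    show "x \<in> ?S" using bas_V[OF s m] coord_bas[OF s _ m] p(1) by auto
  qed
  moreover have "subspace ?S"
    by (rule subspaceI) (auto simp: subspace_0[OF V_subspace[OF s]] subspace_add[OF V_subspace[OF s]]
      subspace_scale[OF V_subspace[OF s]] coord_add[OF s] coord_scale[OF s])
  ultimately have "span ?G \<subseteq> ?S" by (rule span_minimal)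
  then have "x \<in> ?S" using x s by (auto simp: summand_def)
  then show "x \<in> V s" "\<And>\<beta>. \<beta> \<in> B_at s ==> coord s \<beta> x ~= 0 ==> fst \<beta> = j" by blast+
qed

text \<open>The image of the first vector of summand \<open>j\<close> survives
  \<open>len j - 1\<close> steps of the path. Some basis vector of summand \<open>j'\<close> at the
  vertex \<open>src j\<close> must survive them too, and its place is the witness \<open>q\<close>.
  Applying this in both directions makes the lengths equal and the sources agree.\<close>

lemma iso_strands:
  assumes iso: "isomorphic_subreps (summand j) (summand j')" and j: "j \<in> {1..d}" "j' \<in> {1..d}"
  shows "\<exists>q. (src j' + q) mod n = src j \<and> q + len j \<le> len j'"
proof -
  obtain \<phi> where \<phi>: "\<And>i. i < n ==> bij_betw (\<phi> i) (summand j i) (summand j' i)"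
    "\<And>i c x. i < n ==> x \<in> summand j i ==> \<phi> i (scale c x) = scale c (\<phi> i x)"
    "\<And>i x. i < n ==> x \<in> summand j i ==> \<phi> (nx i) (f i x) = f i (\<phi> i x)"
    using iso unfolding isomorphic_subreps_def by blast
  define s where "s = src j"
  have s: "s < n" using src_less[OF j(1)] by (simp add: s_def)
  have lt: "(s + p) mod n < n" for p using s by simp
  have mem: "bas (j, p) \<in> summand j ((s + p) mod n)" if "p < len j" for p
    using that s by (auto simp: summand_def s_def intro!: span_base)
  define y where "y = \<phi> s (bas (j, 0))"
  have y: "y \<in> summand j' s"
    using bij_betw_apply[OF \<phi>(1)[OF s], of "bas (j, 0)"] mem[of 0] len_pos[OF j(1)] s by (simp add: y_def)
  have com: "path_map s p y = \<phi> ((s + p) mod n) (bas (j, p))" if "p < len j" for p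
    using that
  proof (induction p)
    case 0 then show ?case using s by (simp add: y_def)
  next
    case (Suc p)
    have "path_map s (Suc p) y = f ((s + p) mod n) (\<phi> ((s + p) mod n) (bas (j, p)))" using Suc by simp
    also have "\<dots> = \<phi> (nx ((s + p) mod n)) (f ((s + p) mod n) (bas (j, p)))"
      using \<phi>(3)[OF lt mem] Suc.prems by simp
    also have "f ((s + p) mod n) (bas (j, p)) = bas (j, Suc p)" using f_bas[OF j(1), of p] Suc.prems by (simp add: s_def)
    also have "nx ((s + p) mod n) = (s + Suc p) mod n" by (simp add: mod_simps)
    finally show ?case .
  qed
  define m where "m = len j - 1"
  have m: "m < len j" "len j = m + 1" using len_pos[OF j(1)] by (simp_all add: m_def)
  \<comment> \<open>After \<open>p\<close> steps every nonzero coordinate belongs to summand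
    \<open>j'\<close>, has advanced by at least \<open>p\<close> places, and started at the vertex
    \<open>s\<close>.\<close>
  have tr: "path_map s p y \<in> V ((s + p) mod n) \<and> (\<forall>\<beta>\<in>B_at ((s + p) mod n). coord ((s + p) mod n) \<beta> (path_map s p y) ~= 0 \<longrightarrow>
      fst \<beta> = j' \<and> p \<le> snd \<beta> \<and> (src j' + (snd \<beta> - p)) mod n = s)" for p
  proof (induction p)
    case 0
    have "(src j' + snd \<beta>) mod n = s" if "\<beta> \<in> B_at s" "fst \<beta> = j'" for \<beta> using that by (simp add: B_at_iff vtx_def)
    then show ?case using s coord_summand[OF s j(2) y] by simp
  next
    case (Suc p)
    let ?t = "(s + p) mod n" and ?x = "path_map s p y"
    have xV: "?x \<in> V ?t" using Suc by blast
    have t: "nx ?t = (s + Suc p) mod n" by (simp add: mod_simps)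
    have st: "fst \<beta> = j' \<and> Suc p \<le> snd \<beta> \<and> (src j' + (snd \<beta> - Suc p)) mod n = s"
      if \<beta>: "\<beta> \<in> B_at (nx ?t)" "coord (nx ?t) \<beta> (f ?t ?x) ~= 0" for \<beta>
    proof (cases "snd \<beta>")
      case 0
      then show ?thesis using coord_f_start[OF lt xV, of "fst \<beta>"] \<beta> by (metis prod.collapse)
    next
      case (Suc q)
      define k where "k = (fst \<beta>, q)"
      have bk: "\<beta> = succ k" using Suc by (simp add: k_def prod_eq_iff)
      have k: "k \<in> B_at ?t" by (rule succ_at_D[OF lt]) (use \<beta>(1) bk in simp)
      have "coord ?t k ?x ~= 0" using coord_f_succ[OF lt xV k] \<beta> bk by (simp add: B_at_iff)
      then have "fst k = j' \<and> p \<le> snd k \<and> (src j' + (snd k - p)) mod n = s" using Suc.IH k by blast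
      moreover have e: "fst \<beta> = fst k" "snd \<beta> = Suc (snd k)" by (simp_all add: bk succ_def)
      ultimately show ?thesis unfolding e diff_Suc_Suc Suc_le_mono by blast
    qed
    show ?case unfolding path_map.simps comp_apply t[symmetric] using f_into[OF lt xV] st by blast
  qed
  let ?t = "(s + m) mod n"
  have "path_map s m y ~= 0"
  proof
    assume "path_map s m y = 0"
    then have z: "\<phi> ?t (bas (j, m)) = 0" using com[OF m(1)] by simp
    have 0: "0 \<in> summand j ?t" using lt by (simp add: summand_def span_zero)
    have "\<phi> ?t 0 = 0" using \<phi>(2)[OF lt 0, of 0] by simp
    then have "bas (j, m) = 0" using bij_betw_imp_inj_on[OF \<phi>(1)[OF lt]] mem[OF m(1)] 0 z by (metis inj_onD)
    moreover have "(j, m) \<in> B_at ?t" using j(1) m(1) by (simp add: basis_at_def s_def)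
    ultimately show False using bas_nonzero[OF lt] by blast
  qed
  then obtain \<beta> where \<beta>: "\<beta> \<in> B_at ?t" "coord ?t \<beta> (path_map s m y) ~= 0"
    using coord_eqI[OF lt, of "path_map s m y" m 0] tr[of m] subspace_0[OF V_subspace[OF lt]] by auto
  then have "fst \<beta> = j'" "m \<le> snd \<beta>" "(src j' + (snd \<beta> - m)) mod n = s" using tr by blast+
  moreover have "snd \<beta> < len j'" using \<beta>(1) calculation(1) by (auto simp: B_at_iff B_def)
  ultimately show ?thesis using m(2) by (intro exI[of _ "snd \<beta> - m"]) (simp add: s_def)
qed

definition mv :: "(nat => nat) => nat \<times> nat => nat \<times> nat" where
  "mv \<sigma> \<beta> = (\<sigma> (fst \<beta>), snd \<beta>)"

lemma succ_mv: "succ (mv \<sigma> \<beta>) = mv \<sigma> (succ \<beta>)"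
  by (simp add: mv_def succ_def)

definition act :: "(nat => nat) => (nat => nat) => ((nat => 'v set) => poly_R) => (nat => 'v set) => poly_R" where
  "act e \<sigma> g = (\<lambda>L\<in>fixed_points e. twist \<sigma> (g (sym_act (inv_into UNIV \<sigma>) L)))"

context
  fixes ks
  assumes num: "numbered_by ks"
begin

lemma sum_ks: "sum_list ks = d"
  using num by (simp add: numbered_by_def)

lemma same_block:
  assumes "r < length ks" "j \<in> block ks r" "j' \<in> block ks r" shows "src j = src j'" "len j = len j'"
proof -
  have j: "j \<in> {1..d}" "j' \<in> {1..d}" using block_subset[of ks r] assms sum_ks by auto
  have iso: "isomorphic_subreps (summand j) (summand j')" "isomorphic_subreps (summand j') (summand j)"
    using num assms j unfolding numbered_by_def by blast+
  obtain q where q: "(src j' + q) mod n = src j" "q + len j \<le> len j'" using iso_strands[OF iso(1) j] by blast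
  obtain q' where q': "q' + len j' \<le> len j" using iso_strands[OF iso(2) j(2,1)] by blast
  show "len j = len j'" using q q' by simp
  then have "q = 0" using q by simp
  then show "src j = src j'" using q src_less[OF j(2)] by simp
qed

lemma young_strand:
  assumes \<sigma>: "\<sigma> \<in> young_subgroup ks" and j: "j \<in> {1..d}"
  shows "\<sigma> j \<in> {1..d}" "src (\<sigma> j) = src j" "len (\<sigma> j) = len j"
proof -
  obtain r where r: "r < length ks" "j \<in> block ks r" using block_cover[of j ks] j sum_ks by auto
  then have sj: "\<sigma> j \<in> block ks r" using \<sigma> by (auto simp: young_subgroup_def)
  then show "\<sigma> j \<in> {1..d}" using block_subset[of ks r] sum_ks by auto
  show "src (\<sigma> j) = src j" "len (\<sigma> j) = len j" using same_block[OF r(1) sj r(2)] by simp_all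
qed

lemma mv_B_at: assumes "\<sigma> \<in> young_subgroup ks" "\<beta> \<in> B_at i" shows "mv \<sigma> \<beta> \<in> B_at i"
proof -
  obtain j p where \<beta>: "\<beta> = (j, p)" by fastforce
  have j: "j \<in> {1..d}" "p < len j" "(src j + p) mod n = i" using assms(2) by (simp_all add: \<beta> basis_at_def)
  show ?thesis using young_strand[OF assms(1) j(1)] j(2,3) by (simp add: \<beta> mv_def basis_at_def)
qed

lemma mv_B: assumes "\<sigma> \<in> young_subgroup ks" "\<beta> \<in> B" shows "mv \<sigma> \<beta> \<in> B"
  using mv_B_at[OF assms(1), of \<beta> "vtx \<beta>"] assms(2) by (simp add: B_at_iff)

lemma mv_inverse:
  assumes "\<sigma> \<in> young_subgroup ks"
  shows "mv (inv_into UNIV \<sigma>) (mv \<sigma> \<beta>) = \<beta>" "mv \<sigma> (mv (inv_into UNIV \<sigma>) \<beta>) = \<beta>"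
proof -
  note b = young_subgroup_bij[OF assms]
  show "mv (inv_into UNIV \<sigma>) (mv \<sigma> \<beta>) = \<beta>" by (simp add: mv_def inv_f_f[OF bij_is_inj[OF b]])
  show "mv \<sigma> (mv (inv_into UNIV \<sigma>) \<beta>) = \<beta>" by (simp add: mv_def surj_f_inv_f[OF bij_is_surj[OF b]])
qed

lemma sym_act_fp:
  assumes \<sigma>: "\<sigma> \<in> young_subgroup ks" shows "sym_act (inv_into UNIV \<sigma>) (fp L) = fp (mv \<sigma> ` L)"
proof (rule extensionalityI[of _ "{..<n}"])
  show "sym_act (inv_into UNIV \<sigma>) (fp L) \<in> extensional {..<n}" by (simp add: sym_act_def)
  show "fp (mv \<sigma> ` L) \<in> extensional {..<n}" by (rule mk_extensional)
  fix i assume "i \<in> {..<n}"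
  then have i: "i < n" by simp
  let ?\<tau> = "inv_into UNIV \<sigma>"
  have \<tau>: "?\<tau> \<in> young_subgroup ks" by (rule young_subgroup_inv[OF \<sigma>])
  \<comment> \<open>\<open>sym_act\<close> itself inverts its argument, so acting by the inverse
    moves the indices by \<sigma>.\<close>
  have ii: "inv_into UNIV ?\<tau> = \<sigma>" using inv_inv_eq[OF young_subgroup_bij[OF \<sigma>]] .
  have m: "(\<Sum>(j, p)\<in>B_at i. scale (coord i (j, p) x) (bas (inv_into UNIV ?\<tau> j, p))) = vec i (\<lambda>\<beta>. coord i (mv ?\<tau> \<beta>) x)" for x
  proof -
    have "(\<Sum>(j, p)\<in>B_at i. scale (coord i (j, p) x) (bas (inv_into UNIV ?\<tau> j, p))) =
        (\<Sum>\<beta>\<in>B_at i. scale (coord i \<beta> x) (bas (mv \<sigma> \<beta>)))"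
      unfolding ii by (intro sum.cong) (auto simp: mv_def)
    also have "\<dots> = (\<Sum>\<beta>\<in>B_at i. scale (coord i (mv ?\<tau> \<beta>) x) (bas \<beta>))"
      by (rule sum.reindex_bij_witness[of _ "mv ?\<tau>" "mv \<sigma>"])
        (simp_all add: mv_inverse[OF \<sigma>] mv_B_at[OF \<sigma>] mv_B_at[OF \<tau>])
    finally show ?thesis by (simp add: vec_def)
  qed
  have fpi: "x \<in> fp L' i \<longleftrightarrow> x \<in> V i \<and> (\<forall>l\<in>B_at i - L'. coord i l x = 0)" for x L' using i by (simp add: mk_iff)
  have "sym_act ?\<tau> (fp L) i = (\<lambda>x. \<Sum>(j, p)\<in>B_at i. scale (coord i (j, p) x) (bas (inv_into UNIV ?\<tau> j, p))) ` fp L i"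
    using i by (simp add: sym_act_def)
  also have "\<dots> = (\<lambda>x. vec i (\<lambda>\<beta>. coord i (mv ?\<tau> \<beta>) x)) ` fp L i" unfolding m by (rule refl)
  also have "\<dots> = fp (mv \<sigma> ` L) i"
  proof (intro equalityI subsetI)
    fix y assume "y \<in> (\<lambda>x. vec i (\<lambda>\<beta>. coord i (mv ?\<tau> \<beta>) x)) ` fp L i"
    then obtain x where x: "x \<in> fp L i" and y: "y = vec i (\<lambda>\<beta>. coord i (mv ?\<tau> \<beta>) x)" by blast
    have "coord i l y = 0" if l: "l \<in> B_at i - mv \<sigma> ` L" for l
    proof -
      have "mv ?\<tau> l \<notin> L" using l mv_inverse(2)[OF \<sigma>, of l] by (metis DiffD2 image_eqI)
      then have "coord i (mv ?\<tau> l) x = 0" using x mv_B_at[OF \<tau>] l unfolding fpi by blast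
      then show ?thesis using y l i by simp
    qed
    then show "y \<in> fp (mv \<sigma> ` L) i" unfolding fpi using y i by simp
  next
    fix y assume y: "y \<in> fp (mv \<sigma> ` L) i"
    define x where "x = vec i (\<lambda>\<beta>. coord i (mv \<sigma> \<beta>) y)"
    have "coord i l x = 0" if l: "l \<in> B_at i - L" for l
    proof -
      have "mv \<sigma> l \<notin> mv \<sigma> ` L" using l mv_inverse(1)[OF \<sigma>] by (metis DiffD2 imageE)
      then have "coord i (mv \<sigma> l) y = 0" using y mv_B_at[OF \<sigma>] l unfolding fpi by blast
      then show ?thesis using l i by (simp add: x_def)
    qed
    then have "x \<in> fp L i" unfolding fpi using i by (simp add: x_def)
    moreover have "vec i (\<lambda>\<beta>. coord i (mv ?\<tau> \<beta>) x) = y"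
    proof (rule coord_eqI[OF i])
      show "y \<in> V i" using y unfolding fpi by blast
      show "coord i \<beta> (vec i (\<lambda>\<beta>. coord i (mv ?\<tau> \<beta>) x)) = coord i \<beta> y" if "\<beta> \<in> B_at i" for \<beta>
        using that i mv_B_at[OF \<tau> that] by (simp add: x_def mv_inverse[OF \<sigma>])
    qed (use i in simp)
    ultimately show "y \<in> (\<lambda>x. vec i (\<lambda>\<beta>. coord i (mv ?\<tau> \<beta>) x)) ` fp L i" by force
  qed
  finally show "sym_act ?\<tau> (fp L) i = fp (mv \<sigma> ` L) i" .
qed

lemma mv_index: assumes \<sigma>: "\<sigma> \<in> young_subgroup ks" and L: "L \<in> fixed_index e" shows "mv \<sigma> ` L \<in> fixed_index e"
proof -
  let ?\<tau> = "inv_into UNIV \<sigma>"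
  have \<tau>: "?\<tau> \<in> young_subgroup ks" by (rule young_subgroup_inv[OF \<sigma>])
  have LB: "L \<subseteq> B" by (rule fixed_index_B[OF L])
  have inj: "inj (mv \<sigma>)" by (rule inj_on_inverseI[of _ "mv ?\<tau>"]) (rule mv_inverse[OF \<sigma>])
  have "mv \<sigma> ` L \<subseteq> B" using LB mv_B[OF \<sigma>] by blast
  moreover have "succ h \<in> mv \<sigma> ` L" if h: "h \<in> mv \<sigma> ` L" "succ h \<in> B" for h
  proof -
    obtain k where k: "k \<in> L" "h = mv \<sigma> k" using h by blast
    have "mv ?\<tau> (succ h) = succ k" unfolding k(2) succ_mv by (rule mv_inverse[OF \<sigma>])
    then have "succ k \<in> B" using mv_B[OF \<tau> h(2)] by simp
    then have "succ k \<in> L" using L k(1) by (simp add: fixed_index_def)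
    then show ?thesis unfolding k(2) succ_mv by blast
  qed
  moreover have "card (B_at i \<inter> mv \<sigma> ` L) = e i" if i: "i < n" for i
  proof -
    have "B_at i \<inter> mv \<sigma> ` L = mv \<sigma> ` (B_at i \<inter> L)"
    proof (intro equalityI subsetI)
      fix \<beta> assume "\<beta> \<in> B_at i \<inter> mv \<sigma> ` L"
      then obtain k where k: "k \<in> L" "\<beta> = mv \<sigma> k" "\<beta> \<in> B_at i" by blast
      then have "k \<in> B_at i" using mv_B_at[OF \<tau> k(3)] mv_inverse(1)[OF \<sigma>] by metis
      then show "\<beta> \<in> mv \<sigma> ` (B_at i \<inter> L)" using k by blast
    qed (use mv_B_at[OF \<sigma>] in auto)
    then show ?thesis using L i card_image[OF inj_on_subset[OF inj subset_UNIV]] by (simp add: fixed_index_def)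
  qed
  ultimately show ?thesis by (simp add: fixed_index_def)
qed

lemma sym_act_fixed:
  assumes "\<sigma> \<in> young_subgroup ks" "M \<in> fixed_points e" shows "sym_act (inv_into UNIV \<sigma>) M \<in> fixed_points e"
  using assms(2) mv_index[OF assms(1)] by (auto simp: fixed_points_eq sym_act_fp[OF assms(1)])

lemma sym_act_comp:
  assumes \<sigma>: "\<sigma> \<in> young_subgroup ks" and \<tau>: "\<tau> \<in> young_subgroup ks" and M: "M \<in> fixed_points e"
  shows "sym_act (inv_into UNIV (\<tau> \<circ> \<sigma>)) M = sym_act (inv_into UNIV \<tau>) (sym_act (inv_into UNIV \<sigma>) M)"
proof -
  obtain L where L: "M = fp L" using M by (auto simp: fixed_points_eq)
  have "mv (\<tau> \<circ> \<sigma>) = mv \<tau> \<circ> mv \<sigma>" by (simp add: mv_def fun_eq_iff)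
  then have "mv (\<tau> \<circ> \<sigma>) ` L = mv \<tau> ` mv \<sigma> ` L" by (simp add: image_comp)
  then show ?thesis unfolding L sym_act_fp[OF \<sigma>] sym_act_fp[OF \<tau>] sym_act_fp[OF young_subgroup_comp[OF \<tau> \<sigma>]] by simp
qed

section \<open>Exchange of two isomorphic summands\<close>

lemma cls_kap: "j \<in> {1..d} ==> cls (kap j) = j"
  by (rule cls_real) (simp add: real_pos_def)

text \<open>Two isomorphic summands start and end at the same levels, so their positions are below,
  inside or above each level simultaneously.\<close>

lemma twin_regimes:
  assumes j: "j \<in> {1..d}" "j' \<in> {1..d}" and eq: "src j = src j'" "len j = len j'"
  shows "inbox z (kap j) ==> inbox z (kap j')" "over z (kap j) ==> over z (kap j')"
proof -
  have tr: "inbox z (kap j')" if b: "inbox z (kap j)" "j \<in> {1..d}" "j' \<in> {1..d}" "src j = src j'" "len j = len j'" for j j'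
  proof -
    obtain p where p: "z = int (src j) + int p" "(j, p) \<in> B" using inbox_kap[OF b(2,1)] by blast
    then have "(j', p) \<in> B" using b by (simp add: B_def)
    then show ?thesis using el_kap[of j' p] p(1) b(4) by simp
  qed
  show "inbox z (kap j) ==> inbox z (kap j')" using tr j eq by blast
  assume o: "over z (kap j)"
  have start: "inbox (int (src j)) (kap j)" "inbox (int (src j)) (kap j')"
    using el_kap[OF start_B[OF j(1)]] el_kap[OF start_B[OF j(2)]] eq by simp_all
  have "\<not> z \<le> int (src j)"
    using over_mono[of z "kap j" "int (src j)"] o over_inbox start(1) unfolding over_def by blast
  then have "1 \<le> kap j' + ctot z" using start(2) ctot_mono[of "int (src j)" z] by (simp add: inbox_def)
  moreover have "\<not> inbox z (kap j')" using tr[of j' j] j eq over_inbox[OF o] by metis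
  ultimately show "over z (kap j')" by (simp add: inbox_def over_def)
qed

context
  fixes r i j
  assumes r: "r < length ks" and ij: "i \<in> block ks r" "j \<in> block ks r" "i ~= j"
begin

abbreviation T where "T \<equiv> Transposition.transpose i j"

lemma T_young: "T \<in> young_subgroup ks"
  by (rule transpose_in_young_subgroup[OF r ij(1,2)])

lemma ij_range: "i \<in> {1..d}" "j \<in> {1..d}"
  using block_subset[of ks r] ij sum_ks by auto

lemma kap_mod: "kap i mod C ~= kap j mod C"
  using ij(3) cls_kap[OF ij_range(1)] cls_kap[OF ij_range(2)] by (simp add: aff.cls_eq_iff[symmetric])

lemma mv_T_iff: "\<beta> \<in> mv T ` L \<longleftrightarrow> mv T \<beta> \<in> L"
proof -
  have "mv T (mv T \<beta>) = \<beta>" for \<beta> by (simp add: mv_def)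
  then show ?thesis by (metis image_iff)
qed

lemma inK_swap:
  "inK (mv T ` L) z (kap i) \<longleftrightarrow> inK L z (kap j)" "inK (mv T ` L) z (kap j) \<longleftrightarrow> inK L z (kap i)"
proof -
  note eq = same_block[OF r ij(1,2)]
  have reg: "inbox z (kap i) \<longleftrightarrow> inbox z (kap j)" "over z (kap i) \<longleftrightarrow> over z (kap j)"
    using twin_regimes[OF ij_range eq] twin_regimes[OF ij_range(2,1) eq[symmetric]] by blast+
  have "el z (kap j) = mv T (el z (kap i)) \<and> el z (kap i) = mv T (el z (kap j))" if b: "inbox z (kap i)"
  proof -
    obtain p where p: "z = int (src i) + int p" "(i, p) \<in> B" using inbox_kap[OF ij_range(1) b] by blast
    then have "(j, p) \<in> B" using ij_range eq by (simp add: B_def)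
    then have "el z (kap i) = (i, p)" "el z (kap j) = (j, p)" using el_kap[of i p] el_kap[of j p] p eq by simp_all
    then show ?thesis by (simp add: mv_def)
  qed
  then show "inK (mv T ` L) z (kap i) \<longleftrightarrow> inK L z (kap j)" "inK (mv T ` L) z (kap j) \<longleftrightarrow> inK L z (kap i)"
    unfolding inK_def mv_T_iff using reg by metis+
qed

text \<open>Exchanging two isomorphic summands exchanges the entering levels of their positions and
  of all translates, which is an affine reflection acting on \<open>nu L\<close>.\<close>

lemma nu_swap: assumes L: "L \<in> fixed_index e" shows "nu (mv T ` L) = nu L \<circ> aff.refl (kap i) (kap j)"
proof
  fix k
  have up: "upclosed L" "upclosed (mv T ` L)" using L mv_index[OF T_young L] by (simp_all add: fixed_index_iff)
  show "nu (mv T ` L) k = (nu L \<circ> aff.refl (kap i) (kap j)) k"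
  proof (rule eq_if_same_upper)
    fix z
    have "inK (mv T ` L) z k \<longleftrightarrow> inK L z (aff.refl (kap i) (kap j) k)"
    proof -
      consider t where "k = kap i + t * C" | t where "k = kap j + t * C" | "k mod C ~= kap i mod C" "k mod C ~= kap j mod C"
        unfolding aff.cong_iff by blast
      then show ?thesis
      proof cases
        case 1
        then show ?thesis using kap_mod by (simp add: aff.refl_shift inK_period[symmetric] inK_swap)
      next
        case 2
        then show ?thesis using kap_mod by (simp add: aff.refl_shift inK_period[symmetric] inK_swap)
      next
        case 3
        then have rk: "aff.refl (kap i) (kap j) k = k" by (simp add: aff.refl_def)
        have "cls k ~= i" "cls k ~= j"
          using 3 cls_kap[OF ij_range(1)] cls_kap[OF ij_range(2)] aff.cls_eq_iff by metis+
        then have "mv T (el z k) = el z k" if "inbox z k"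
          using el_coords(1)[OF that] by (simp add: mv_def transpose_apply_other prod_eq_iff)
        then show ?thesis unfolding rk inK_def mv_T_iff by metis
      qed
    qed
    then show "nu (mv T ` L) k \<le> z \<longleftrightarrow> (nu L \<circ> aff.refl (kap i) (kap j)) k \<le> z"
      by (simp add: nu_le_iff[OF up(1)] nu_le_iff[OF up(2)])
  qed
qed

lemma hat_swap:
  assumes K: "K \<in> hat e"
  shows "K \<circ> aff.refl (kap i) (kap j) \<in> hat e"
    "sym_act (inv_into UNIV T) (pt K) = pt (K \<circ> aff.refl (kap i) (kap j))"
proof -
  note L = setof_hat[OF K]
  have eq: "nu (mv T ` setof K) = K \<circ> aff.refl (kap i) (kap j)" using nu_swap[OF L] nu_setof_hat[OF K] by simp
  then show "K \<circ> aff.refl (kap i) (kap j) \<in> hat e" using hat_nu[OF mv_index[OF T_young L]] by simp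
  show "sym_act (inv_into UNIV T) (pt K) = pt (K \<circ> aff.refl (kap i) (kap j))"
    using sym_act_fp[OF T_young] pt_nu[OF mv_index[OF T_young L]] eq by (simp add: pt_def)
qed

text \<open>The offsets of the two positions agree because the sources do. The loop variable
  therefore drops out, and the affine reflection of weights becomes the plain transposition of two
  variables.\<close>

lemma twist_swap: "twist T g = aff.\<sigma> (kap i) (kap j) g"
proof -
  have "off (kap i) = - int (src i)" "off (kap j) = - int (src j)"
    using off_real[OF ij_range(1), of 0] off_real[OF ij_range(2), of 0] by simp_all
  then have o: "off (kap i) = off (kap j)" using same_block(1)[OF r ij(1,2)] by simp
  have "(\<lambda>m. var (inv_into UNIV T m)) = (\<lambda>m. if m = i then aff.\<omega> (kap j) - of_int (off (kap i)) * var 0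
     else if m = j then aff.\<omega> (kap i) - of_int (off (kap j)) * var 0 else var m)"
    using o cls_kap[OF ij_range(1)] cls_kap[OF ij_range(2)] ij(3)
    by (auto simp: fun_eq_iff aff.\<omega>_def Transposition.transpose_def)
  then show ?thesis
    unfolding twist_eq_psubst aff.\<sigma>_def cls_kap[OF ij_range(1)] cls_kap[OF ij_range(2)] by simp
qed

lemma act_swap_pt:
  assumes "K \<in> hat e"
  shows "act e T g (pt K) = aff.\<sigma> (kap i) (kap j) (g (pt (K \<circ> aff.refl (kap i) (kap j))))"
  unfolding act_def twist_swap using pt_fixed[OF assms] hat_swap(2)[OF assms] by simp

lemma act_swap_closed: assumes g: "g \<in> HT_carrier e" shows "act e T g \<in> HT_carrier e"
proof -
  have G: "\<And>M. M \<in> fixed_points e ==> vars_le d (g M)" "aff.gkm (hat e) (\<lambda>K. g (pt K))"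
    using g by (simp_all add: HT_carrier_iff)
  have "vars_le d (act e T g M)" if "M \<in> fixed_points e" for M
    using twist_vars_le[OF T_young] G(1)[OF sym_act_fixed[OF T_young that]] that by (simp add: act_def sum_ks)
  moreover have "aff.gkm (hat e) (\<lambda>K. act e T g (pt K))"
    by (rule aff.gkm_cong[OF aff.gkm_twist[OF G(2) kap_mod hat_swap(1)]]) (simp_all add: act_swap_pt)
  moreover have "act e T g \<in> extensional (fixed_points e)" by (simp add: act_def)
  ultimately show ?thesis by (simp add: HT_carrier_iff)
qed

text \<open>The set of all fixed points is stable under this particular reflection, so the divided
  difference is defined globally and the linear form is the root of the two positions.\<close>

lemma act_swap_difference:
  assumes x: "x \<in> HT_carrier e"
  shows "\<exists>g\<in>HT_carrier e. \<exists>\<alpha>. vars_le d \<alpha> \<and> homog 1 \<alpha> \<and> \<alpha> ~= 0 \<and>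
    (\<forall>M\<in>fixed_points e. x M - act e T x M = \<alpha> * g M)"
proof -
  let ?a = "kap i" and ?b = "kap j" and ?\<alpha> = "aff.\<omega> (kap i) - aff.\<omega> (kap j)"
  have X: "\<And>M. M \<in> fixed_points e ==> vars_le d (x M)" "aff.gkm (hat e) (\<lambda>K. x (pt K))"
    using x by (simp_all add: HT_carrier_iff)
  obtain h where h: "aff.gkm (hat e) h" "\<forall>K\<in>hat e. ?\<alpha> * h K = x (pt K) - aff.\<sigma> ?a ?b (x (pt (K \<circ> aff.refl ?a ?b)))"
    using aff.divided_difference[OF X(2) kap_mod hat_swap(1)] by blast
  have \<alpha>: "vars_le d ?\<alpha>" "homog 1 ?\<alpha>" "?\<alpha> ~= 0"
  proof -
    show "vars_le d ?\<alpha>" unfolding aff.\<omega>_def cls_kap[OF ij_range(1)] cls_kap[OF ij_range(2)]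
      using ij_range by (intro vars_le_diff vars_le_add vars_le_mult) auto
    show "homog 1 ?\<alpha>" by (rule aff.homog_root)
    show "?\<alpha> ~= 0" using kap_mod by (auto simp: aff.\<omega>_eq_iff)
  qed
  define ix where "ix = inv_into (hat e) pt"
  \<comment> \<open>The divided difference may involve auxiliary variables; as the difference of
    sections and the root do not, truncation keeps the equation valid.\<close>
  define g where "g = (\<lambda>M\<in>fixed_points e. truncate d (h (ix M)))"
  have g_pt: "g (pt K) = truncate d (h K)" if "K \<in> hat e" for K
    using that pt_fixed[OF that] bij_betw_inv_into_left[OF pt_bij that] by (simp add: g_def ix_def)
  have "aff.gkm (hat e) (\<lambda>K. g (pt K))" by (rule aff.gkm_cong[OF gkm_truncate[OF h(1)]]) (rule g_pt)
  then have "g \<in> HT_carrier e" by (simp add: HT_carrier_iff g_def)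
  moreover have "x M - act e T x M = ?\<alpha> * g M" if M: "M \<in> fixed_points e" for M
  proof -
    obtain K where K: "K \<in> hat e" "M = pt K" using M bij_betw_imp_surj_on[OF pt_bij] by blast
    have eq: "x M - act e T x M = ?\<alpha> * h K" using h(2) K by (simp add: act_swap_pt)
    have "vars_le d (act e T x M)" using act_swap_closed[OF x] M by (simp add: HT_carrier_iff)
    then have "x M - act e T x M = truncate d (x M - act e T x M)" using X(1)[OF M] by (simp add: vars_le_diff)
    also have "\<dots> = ?\<alpha> * g M" unfolding eq truncate_mult using \<alpha>(1) K by (simp add: g_pt)
    finally show ?thesis .
  qed
  ultimately show ?thesis using \<alpha> by blast
qed

end

lemma act_id: assumes g: "g \<in> HT_carrier e" shows "act e id g = g"
proof (rule extensionalityI[of _ "fixed_points e"])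
  fix M assume M: "M \<in> fixed_points e"
  then obtain L where "M = fp L" by (auto simp: fixed_points_eq)
  moreover have "mv id = id" by (auto simp: mv_def)
  ultimately have "sym_act (inv_into UNIV id) M = M" using sym_act_fp[OF young_subgroup_id, of L] by simp
  then show "act e id g M = g M" using M by (simp add: act_def)
qed (use g in \<open>simp_all add: act_def HT_carrier_iff\<close>)

lemma act_comp:
  assumes \<sigma>: "\<sigma> \<in> young_subgroup ks" and \<tau>: "\<tau> \<in> young_subgroup ks"
  shows "act e (\<tau> \<circ> \<sigma>) g = act e \<sigma> (act e \<tau> g)"
  unfolding act_def
proof (rule restrict_ext)
  fix M assume M: "M \<in> fixed_points e"
  show "twist (\<tau> \<circ> \<sigma>) (g (sym_act (inv_into UNIV (\<tau> \<circ> \<sigma>)) M)) =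
    twist \<sigma> ((\<lambda>L\<in>fixed_points e. twist \<tau> (g (sym_act (inv_into UNIV \<tau>) L))) (sym_act (inv_into UNIV \<sigma>) M))"
    using sym_act_fixed[OF \<sigma> M] twist_comp[OF young_subgroup_bij[OF \<sigma>] young_subgroup_bij[OF \<tau>]]
    unfolding sym_act_comp[OF \<sigma> \<tau> M] by simp
qed

lemma act_closed:
  assumes "\<sigma> \<in> young_subgroup ks" "g \<in> HT_carrier e" shows "act e \<sigma> g \<in> HT_carrier e"
proof -
  have "\<forall>g\<in>HT_carrier e. act e \<sigma> g \<in> HT_carrier e"
    using assms(1)
  proof (induction rule: young_subgroup_induct)
    case id
    show ?case
    proof
      fix g assume g: "g \<in> HT_carrier e"
      show "act e id g \<in> HT_carrier e" unfolding act_id[OF g] by (rule g)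
    qed
  next
    case (swap a b r \<sigma>)
    show ?case
    proof
      fix g assume g: "g \<in> HT_carrier e"
      show "act e (Transposition.transpose a b \<circ> \<sigma>) g \<in> HT_carrier e"
        unfolding act_comp[OF swap(5) T_young[OF swap(1-4)]] using act_swap_closed[OF swap(1-4) g] swap(6) by blast
    qed
  qed
  then show ?thesis using assms(2) by blast
qed

text \<open>The homogeneous classes indexed by fixed points satisfy the requirements of
  \<open>twisted_class_basis\<close>. Their degree is the number of inversions, which is the number
  of edges starting at the fixed point.\<close>

theorem HT_iso:
  assumes ind: "induces_grading e \<kappa> wt"
  shows "graded_twisted_iso ks (HT e) (direct_sum (fixed_points e) (\<lambda>L. Triv d (card (out_edges e \<kappa> L))))"
proof -
  let ?F = "fixed_points e" and ?A = "HT_carrier e"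
  define ix where "ix = inv_into (hat e) pt"
  have ix: "ix M \<in> hat e" "pt (ix M) = M" if "M \<in> ?F" for M
    using that bij_betw_inv_into_right[OF pt_bij] bij_betw_apply[OF bij_betw_inv_into[OF pt_bij]] by (auto simp: ix_def)
  have ix_pt: "ix (pt K) = K" if "K \<in> hat e" for K
    using bij_betw_inv_into_left[OF pt_bij that] by (simp add: ix_def)
  have ix_inj: "ix M = ix N \<longleftrightarrow> M = N" if "M \<in> ?F" "N \<in> ?F" for M N using ix(2) that by metis
  have deg: "card (out_edges e \<kappa> M) = card (aff.inv_pairs (ix M))" if "M \<in> ?F" for M
    using card_out_edges[OF ind setof_hat[OF ix(1)[OF that]]] ix(2)[OF that] nu_setof_hat[OF ix(1)[OF that]]
    by (simp add: pt_def)
  have "\<forall>K\<in>hat e. \<exists>p. aff.gkm (hat e) p \<and> (\<forall>x. vars_le d (p x) \<and> homog (card (aff.inv_pairs K)) (p x)) \<and>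
    p K = aff.euler K \<and> (\<forall>x\<in>hat e. \<not> aff.below K x \<longrightarrow> p x = 0)"
    using homogeneous_class_exists by blast
  from bchoice[OF this] obtain pc where pc0: "\<forall>K\<in>hat e. aff.gkm (hat e) (pc K) \<and>
      (\<forall>x. vars_le d (pc K x) \<and> homog (card (aff.inv_pairs K)) (pc K x)) \<and> pc K K = aff.euler K \<and>
      (\<forall>x\<in>hat e. \<not> aff.below K x \<longrightarrow> pc K x = 0)" by (rule exE)
  have pc: "aff.gkm (hat e) (pc K)" "vars_le d (pc K x)" "homog (card (aff.inv_pairs K)) (pc K x)"
    "pc K K = aff.euler K" "x \<in> hat e ==> \<not> aff.below K x ==> pc K x = 0" if "K \<in> hat e" for K x
    using pc0 that by blast+
  define p where "p M = (\<lambda>N\<in>?F. pc (ix M) (ix N))" for M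
  \<comment> \<open>The height has to increase strictly along the Bruhat order; the size of the
    lower set does, and it is finite because the lower set stays inside
    \<open>hat e\<close>.\<close>
  define \<mu> where "\<mu> M = card (aff.down (ix M))" for M
  have \<mu>_less: "\<mu> M < \<mu> N" if "M \<in> ?F" "N \<in> ?F" "aff.below (ix M) (ix N)" "M ~= N" for M N
    unfolding \<mu>_def
  proof (rule psubset_card_mono)
    show "finite (aff.down (ix N))" by (rule finite_subset[OF down_hat[OF ix(1)[OF that(2)]] finite_hat])
    have "ix N \<in> aff.down (ix N)" using hat_periodic[OF ix(1)[OF that(2)]] by (simp add: aff.down_def)
    moreover have "ix N \<notin> aff.down (ix M)"
      using aff.below_antisym[OF that(3)] ix_inj that by (auto simp: aff.down_def)
    moreover have "aff.down (ix M) \<subseteq> aff.down (ix N)" using aff.below_trans that(3) by (auto simp: aff.down_def)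
    ultimately show "aff.down (ix M) \<subset> aff.down (ix N)" by blast
  qed
  note A = HT_carrier_iff[of _ e]
  have fd: "pt K \<in> ?F" if "K \<in> hat e" for K using pt_fixed[OF that] .
  interpret basis: twisted_class_basis ks ?F ?A "act e" "\<lambda>L. card (out_edges e \<kappa> L)" \<mu> p
  proof
    show "finite ?F" by (rule finite_fixed_points)
    show "x \<in> extensional ?F" if "x \<in> ?A" for x using that by (simp add: A)
    show "vars_le (sum_list ks) (x L)" if "x \<in> ?A" "L \<in> ?F" for x L using that by (simp add: A sum_ks)
    show "(\<lambda>L\<in>?F. 0) \<in> ?A" unfolding A using fd by (auto simp: aff.gkm_def)
    show "(\<lambda>L\<in>?F. x L + y L) \<in> ?A" if "x \<in> ?A" "y \<in> ?A" for x y
    proof -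
      have "aff.gkm (hat e) (\<lambda>K. (\<lambda>L\<in>?F. x L + y L) (pt K))"
        by (rule aff.gkm_cong[OF aff.gkm_add[of _ "\<lambda>K. x (pt K)" "\<lambda>K. y (pt K)"]]) (use that fd in \<open>simp_all add: A\<close>)
      then show ?thesis using that by (simp add: A vars_le_add)
    qed
    show "(\<lambda>L\<in>?F. a * x L) \<in> ?A" if "vars_le (sum_list ks) a" "x \<in> ?A" for a x
    proof -
      have "aff.gkm (hat e) (\<lambda>K. (\<lambda>L\<in>?F. a * x L) (pt K))"
        by (rule aff.gkm_cong[OF aff.gkm_scale[of _ "\<lambda>K. x (pt K)" a]]) (use that fd in \<open>simp_all add: A\<close>)
      then show ?thesis using that by (simp add: A vars_le_mult sum_ks)
    qed
    show "(\<lambda>L\<in>?F. hcomp k (x L)) \<in> ?A" if "x \<in> ?A" for k x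
    proof -
      have "aff.gkm (hat e) (\<lambda>K. (\<lambda>L\<in>?F. hcomp k (x L)) (pt K))"
        by (rule aff.gkm_cong[OF gkm_hcomp[of _ "\<lambda>K. x (pt K)" k]]) (use that fd in \<open>simp_all add: A\<close>)
      then show ?thesis using that by (simp add: A vars_le_hcomp)
    qed
    show "act e \<sigma> x \<in> ?A" if "\<sigma> \<in> young_subgroup ks" "x \<in> ?A" for \<sigma> x by (rule act_closed[OF that])
    show "act e id x = x" if "x \<in> ?A" for x by (rule act_id[OF that])
    show "act e (\<tau> \<circ> \<sigma>) x = act e \<sigma> (act e \<tau> x)" if "\<sigma> \<in> young_subgroup ks" "\<tau> \<in> young_subgroup ks" "x \<in> ?A" for \<sigma> \<tau> x
      by (rule act_comp[OF that(1,2)])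
    show "act e \<sigma> (\<lambda>L\<in>?F. x L + y L) = (\<lambda>L\<in>?F. act e \<sigma> x L + act e \<sigma> y L)"
      if "\<sigma> \<in> young_subgroup ks" "x \<in> ?A" "y \<in> ?A" for \<sigma> x y
      unfolding act_def by (rule restrict_ext) (simp add: sym_act_fixed[OF that(1)] twist_add)
    show "act e \<sigma> (\<lambda>L\<in>?F. a * x L) = (\<lambda>L\<in>?F. twist \<sigma> a * act e \<sigma> x L)"
      if "\<sigma> \<in> young_subgroup ks" "vars_le (sum_list ks) a" "x \<in> ?A" for \<sigma> a x
      unfolding act_def by (rule restrict_ext) (simp add: sym_act_fixed[OF that(1)] twist_mult)
    show "homog k (act e \<sigma> x L)" if "\<sigma> \<in> young_subgroup ks" "x \<in> ?A" "\<forall>L\<in>?F. homog k (x L)" "L \<in> ?F" for \<sigma> x k L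
      using that sym_act_fixed[OF that(1,4)] by (simp add: act_def twist_homog)
    show "\<exists>g\<in>?A. \<exists>\<alpha>. vars_le (sum_list ks) \<alpha> \<and> homog 1 \<alpha> \<and> \<alpha> ~= 0 \<and>
        (\<forall>L\<in>?F. x L - act e (Transposition.transpose i j) x L = \<alpha> * g L)"
      if "r < length ks" "i \<in> block ks r" "j \<in> block ks r" "i ~= j" "x \<in> ?A" for r i j x
      unfolding sum_ks by (rule act_swap_difference[OF that])
    show "p L \<in> ?A" if L: "L \<in> ?F" for L
    proof -
      have "aff.gkm (hat e) (\<lambda>K. p L (pt K))"
        by (rule aff.gkm_cong[OF pc(1)[OF ix(1)[OF L]]]) (simp add: p_def fd ix_pt)
      then show ?thesis using pc(2)[OF ix(1)[OF L]] by (simp add: A p_def)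
    qed
    show "homog (card (out_edges e \<kappa> L)) (p L K)" if "L \<in> ?F" "K \<in> ?F" for L K
      using that pc(3)[OF ix(1)[OF that(1)]] by (simp add: deg p_def)
    show "p L L ~= 0" if L: "L \<in> ?F" for L
      using L pc(4)[OF ix(1)[OF L]] aff.euler_nonzero[OF hat_periodic[OF ix(1)[OF L]]] by (simp add: p_def)
    show "K = L \<or> \<mu> L < \<mu> K" if "L \<in> ?F" "K \<in> ?F" "p L K ~= 0" for L K
      using \<mu>_less[of L K] pc(5)[OF ix(1)[OF that(1)] ix(1)[OF that(2)]] that by (auto simp: p_def)
    show "p L L dvd x L" if x: "x \<in> ?A" and L: "L \<in> ?F" and zero: "\<forall>K\<in>?F. \<mu> K < \<mu> L \<longrightarrow> x K = 0" for x L
    proof -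
      note K = ix(1)[OF L]
      have "aff.euler (ix L) dvd x (pt (ix L))"
      proof (rule aff.euler_dvd[OF _ K hat_periodic[OF K] down_hat[OF K]])
        show "aff.gkm (hat e) (\<lambda>K. x (pt K))" using x by (simp add: A)
        fix y assume y: "y \<in> hat e" "aff.below y (ix L)" "y ~= ix L"
        have "pt y ~= L" using ix_pt[OF y(1)] y(3) by metis
        then have "\<mu> (pt y) < \<mu> L" using \<mu>_less[OF fd[OF y(1)] L] ix_pt[OF y(1)] y(2) by simp
        then show "x (pt y) = 0" using zero fd[OF y(1)] by blast
      qed
      then show ?thesis using L pc(4)[OF K] ix(2)[OF L] by (simp add: p_def)
    qed
  qed
  have "graded_twisted_iso ks (HT e) (direct_sum ?F (\<lambda>L. Triv (sum_list ks) (card (out_edges e \<kappa> L))))"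
  proof (rule basis.twisted_iso)
    show "carrier (HT e) = ?A" "zero (HT e) = (\<lambda>L\<in>?F. 0)" "add (HT e) = (\<lambda>f g. \<lambda>L\<in>?F. f L + g L)"
      "smult (HT e) = (\<lambda>a f. \<lambda>L\<in>?F. a * f L)" "perm_action (HT e) = act e"
      by (simp_all add: HT_def direct_sum_def Triv_def act_def fun_eq_iff)
    show "grade (HT e) q = {f \<in> ?A. \<forall>L\<in>?F. f L \<in> R_grade (sum_list ks) q}" for q
    proof -
      have "finite {i \<in> ?F. x i ~= 0}" for x :: "(nat => 'v set) => poly_R" using finite_fixed_points[of e] by simp
      then show ?thesis by (auto simp: HT_def direct_sum_def Triv_def sum_ks PiE_iff A)
    qed
  qed
  then show ?thesis by (simp only: sum_ks)
qed

end

end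

theorem theorem5p11:
  fixes scale :: "complex \<Rightarrow> 'v::ab_group_add \<Rightarrow> 'v"
    and n :: nat and V :: "nat \<Rightarrow> 'v set" and f :: "nat \<Rightarrow> 'v \<Rightarrow> 'v"
    and d :: nat and src len :: "nat \<Rightarrow> nat" and bas :: "nat \<times> nat \<Rightarrow> 'v"
    and v :: "nat \<Rightarrow> nat \<Rightarrow> nat \<times> nat" and wt :: "nat \<times> nat \<Rightarrow> int"
    and e :: "nat \<Rightarrow> nat" and \<kappa> :: "nat \<Rightarrow> int" and ks :: "nat list"
  assumes "nilpotent_quiver_rep scale n V f d src len bas"
    and "nilpotent_quiver_rep.numbered_by scale n f d src len bas ks"
    and "nilpotent_quiver_rep.homogeneous scale n V f d src len bas v wt"
    and "cyclic_quiver_rep.Gr scale n V f e \<noteq> {}"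
    and "nilpotent_quiver_rep.generic_cochar scale n V f d src len bas e \<kappa>"
    and "nilpotent_quiver_rep.induces_grading scale n V f d src len bas e \<kappa> wt"
  shows "graded_twisted_iso ks
    (nilpotent_quiver_rep.HT scale n V f d src len bas e)
    (direct_sum (nilpotent_quiver_rep.fixed_points scale n V f d src len bas e)
       (\<lambda>L. Triv d (card (nilpotent_quiver_rep.out_edges scale n V f d src len bas e \<kappa> L))))"
proof -
  interpret homog_rep scale n V f d src len bas v wt
    using assms(1,3) by (simp add: homog_rep_def homog_rep_axioms_def)
  show ?thesis by (rule HT_iso[OF assms(2,6)])
qed

end
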